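(* Let $v$ be a continuous $\mathbb{R}$-action on a compact surface $S$ with $|\mathrm{Sing}(v)|<\infty$. Then $v$ is extended $R$-closed if and only if $v$ is extended pointwise almost periodic.
   Context: $S$ is a compact surface and $v$ is a continuous $\mathbb{R}$-action (flow) on $S$. For $x\in S$, $O(x)$, $O^+(x)$, $O^-(x)$ denote the orbit, positive orbit and negative orbit of $x$, and $\omega(x)$, $\alpha(x)$ its omega and alpha limit sets. $\mathrm{Sing}(v)$ is the set of singularities (fixed points) of $v$. Saddle: a singular point $x$ is a (topological) saddle if it has a neighborhood on which the flow is locally homeomorphic (by a homeomorphism carrying orbits to orbits and preserving their direction) to the flow on a neighborhood of a saddle of a $C^1$ $\mathbb{R}$-action. We say "$\omega(x)$ is a saddle" if $\omega(x)=\{p\}$ with $p$ a saddle, and then write $W^u(\omega(x))=W^u(p)$; similarly for $\alpha$ and $W^s$. Extended orbits: put $W^u(y)=\{z\in S\mid \alpha(z)=\{y\}\}$ and $W^s(y)=\{z\in S\mid \omega(z)=\{y\}\}$. Define $O^+_0(x)=O^+(x)$, $O^+_{i+1}(x)=O^+_i(x)\cup\bigcup\{W^u(\omega(x'))\mid x'\in O^+_i(x),\ \omega(x')\text{ is a saddle}\}$ for every ordinal $i$, and $O^+_\mu(x)=\bigcup_{\nu<\mu}O^+_\nu(x)$ for every limit ordinal $\mu$. The extended positive orbit is $O^+_{\mathrm{ex}}(x)=\bigcup_{\nu\text{ ordinal}}O^+_\nu(x)$. The extended negative orbit $O^-_{\mathrm{ex}}(x)$ is defined symmetrically, starting from $O^-(x)$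 and using $W^s(\alpha(x'))$ when $\alpha(x')$ is a saddle. The extended orbit is $O_{\mathrm{ex}}(x)=O^+_{\mathrm{ex}}(x)\cup O^-_{\mathrm{ex}}(x)$. The action $v$ is extended $R$-closed if $R_{\mathrm{ex}}=\{(x,y)\in S\times S\mid y\in\overline{O_{\mathrm{ex}}(x)}\}$ is closed in $S\times S$. The action $v$ is extended pointwise almost periodic (extended p.a.p.) if the set $\{\overline{O_{\mathrm{ex}}(x)}\mid x\in S\}$ of closures of extended orbits is a decomposition of $S$, i.e. any two of its members are equal or disjoint (they cover $S$). *)

theory Defs
  imports "HOL-Analysis.Analysis" "HOL-Library.Disjoint_Sets"
begin

section \<open>Surfaces and continuous flows\<close>

text \<open>The second coordinate is the one bounded from below. A small open disc of the plane is
  homeomorphic to an open subset of the half plane off its edge, so interior points are covered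
  by the same condition; a surface may have a boundary.\<close>

definition surface :: "'a topology \<Rightarrow> bool" where
  "surface X \<longleftrightarrow> Hausdorff_space X \<and> second_countable X \<and>
     (\<forall>x\<in>topspace X. \<exists>U V. openin X U \<and> x \<in> U \<and>
        openin (top_of_set {z :: real^2. 0 \<le> z $ 2}) V \<and>
        subtopology X U homeomorphic_space top_of_set V)"

definition flow :: "'a topology \<Rightarrow> (real \<Rightarrow> 'a \<Rightarrow> 'a) \<Rightarrow> bool" where
  "flow X v \<longleftrightarrow>
     continuous_map (prod_topology euclideanreal X) X (\<lambda>(t, x). v t x) \<and>
     (\<forall>x\<in>topspace X. v 0 x = x) \<and>
     (\<forall>s t. \<forall>x\<in>topspace X. v (s + t) x = v s (v t x))"

definition Sing :: "'a topology \<Rightarrow> (real \<Rightarrow> 'a \<Rightarrow> 'a) \<Rightarrow> 'a set" where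
  "Sing X v = {x \<in> topspace X. \<forall>t. v t x = x}"

definition pos_orbit :: "(real \<Rightarrow> 'a \<Rightarrow> 'a) \<Rightarrow> 'a \<Rightarrow> 'a set" where
  "pos_orbit v x = (\<lambda>t. v t x) ` {0..}"

definition neg_orbit :: "(real \<Rightarrow> 'a \<Rightarrow> 'a) \<Rightarrow> 'a \<Rightarrow> 'a set" where
  "neg_orbit v x = (\<lambda>t. v t x) ` {..0}"

definition omega_limit :: "'a topology \<Rightarrow> (real \<Rightarrow> 'a \<Rightarrow> 'a) \<Rightarrow> 'a \<Rightarrow> 'a set" where
  "omega_limit X v x = (\<Inter>T. X closure_of ((\<lambda>t. v t x) ` {T..}))"

definition alpha_limit :: "'a topology \<Rightarrow> (real \<Rightarrow> 'a \<Rightarrow> 'a) \<Rightarrow> 'a \<Rightarrow> 'a set" where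
  "alpha_limit X v x = (\<Inter>T. X closure_of ((\<lambda>t. v t x) ` {..T}))"

definition Wu :: "'a topology \<Rightarrow> (real \<Rightarrow> 'a \<Rightarrow> 'a) \<Rightarrow> 'a \<Rightarrow> 'a set" where
  "Wu X v y = {z \<in> topspace X. alpha_limit X v z = {y}}"

definition Ws :: "'a topology \<Rightarrow> (real \<Rightarrow> 'a \<Rightarrow> 'a) \<Rightarrow> 'a \<Rightarrow> 'a set" where
  "Ws X v y = {z \<in> topspace X. omega_limit X v z = {y}}"


section \<open>Saddles of \<open>C\<^sup>1\<close> actions\<close>

definition C1_on :: "'a::real_normed_vector set \<Rightarrow> ('a \<Rightarrow> 'b::real_normed_vector) \<Rightarrow> bool" where
  "C1_on D f \<longleftrightarrow> (\<exists>f' :: 'a \<Rightarrow> 'a \<Rightarrow>\<^sub>L 'b.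
     (\<forall>x\<in>D. (f has_derivative blinfun_apply (f' x)) (at x)) \<and> continuous_on D f')"

definition C1_surface_atlas :: "'a topology \<Rightarrow> ('a set \<times> ('a \<Rightarrow> real^2)) set \<Rightarrow> bool" where
  "C1_surface_atlas M \<A> \<longleftrightarrow> Hausdorff_space M \<and> second_countable M \<and>
     \<Union>(fst ` \<A>) = topspace M \<and>
     (\<forall>(U, \<phi>)\<in>\<A>. openin M U \<and> open (\<phi> ` U) \<and>
        homeomorphic_map (subtopology M U) (top_of_set (\<phi> ` U)) \<phi>) \<and>
     (\<forall>(U, \<phi>)\<in>\<A>. \<forall>(V, \<psi>)\<in>\<A>. C1_on (\<phi> ` (U \<inter> V)) (\<lambda>z. \<psi> (inv_into U \<phi> z)))"

definition C1_flow ::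
  "'a topology \<Rightarrow> ('a set \<times> ('a \<Rightarrow> real^2)) set \<Rightarrow> (real \<Rightarrow> 'a \<Rightarrow> 'a) \<Rightarrow> bool" where
  "C1_flow M \<A> w \<longleftrightarrow> C1_surface_atlas M \<A> \<and> flow M w \<and>
     (\<forall>(U, \<phi>)\<in>\<A>. \<forall>(V, \<psi>)\<in>\<A>.
        C1_on {(t, z). z \<in> \<phi> ` U \<and> w t (inv_into U \<phi> z) \<in> V}
          (\<lambda>(t, z). \<psi> (w t (inv_into U \<phi> z))))"

text \<open>In a chart at the singular point \<open>p\<close>, the derivatives \<open>L t\<close> of the time-\<open>t\<close> maps at \<open>p\<close> form
  a linear flow. The point \<open>p\<close> is a saddle if the generator of this linear flow has real eigenvalues
  \<open>a < 0 < b\<close>, that is, if \<open>L t\<close> has eigenvalues \<open>exp (t * a)\<close> and \<open>exp (t * b)\<close>, with eigenvectors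
  not depending on \<open>t\<close>. The generator itself is avoided because the velocity field of a \<open>C\<^sup>1\<close> action
  need not be differentiable.\<close>

definition C1_saddle ::
  "'a topology \<Rightarrow> ('a set \<times> ('a \<Rightarrow> real^2)) set \<Rightarrow> (real \<Rightarrow> 'a \<Rightarrow> 'a) \<Rightarrow> 'a \<Rightarrow> bool" where
  "C1_saddle M \<A> w p \<longleftrightarrow> C1_flow M \<A> w \<and> p \<in> Sing M w \<and>
     (\<exists>(U, \<phi>)\<in>\<A>. p \<in> U \<and>
       (\<exists>(L :: real \<Rightarrow> real^2 \<Rightarrow> real^2) a b e f.
          (\<forall>t. ((\<lambda>z. \<phi> (w t (inv_into U \<phi> z))) has_derivative L t) (at (\<phi> p))) \<and>
          a < 0 \<and> 0 < b \<and> e \<noteq> 0 \<and> f \<noteq> 0 \<and>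
          (\<forall>t. L t e = exp (t * a) *\<^sub>R e \<and> L t f = exp (t * b) *\<^sub>R f)))"


section \<open>Topological saddles\<close>

text \<open>The map \<open>h\<close> sends every orbit arc of \<open>v\<close> inside \<open>N\<close> to an orbit arc of \<open>w\<close> with the same
  direction, the time parameter being changed by \<open>\<tau>\<close>.\<close>

definition maps_orbits ::
  "(real \<Rightarrow> 'a \<Rightarrow> 'a) \<Rightarrow> 'a set \<Rightarrow> (real \<Rightarrow> 'b \<Rightarrow> 'b) \<Rightarrow> ('a \<Rightarrow> 'b) \<Rightarrow> bool" where
  "maps_orbits v N w h \<longleftrightarrow>
     (\<forall>y T. 0 \<le> T \<longrightarrow> (\<forall>t\<in>{0..T}. v t y \<in> N) \<longrightarrow> y \<in> N \<longrightarrow>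
        (\<exists>\<tau> :: real \<Rightarrow> real. \<tau> 0 = 0 \<and> continuous_on {0..T} \<tau> \<and> strict_mono_on {0..T} \<tau> \<and>
           (\<forall>t\<in>{0..T}. h (v t y) = w (\<tau> t) (h y))))"

definition locally_flow_equivalent ::
  "'a topology \<Rightarrow> (real \<Rightarrow> 'a \<Rightarrow> 'a) \<Rightarrow> 'a \<Rightarrow> 'b topology \<Rightarrow> (real \<Rightarrow> 'b \<Rightarrow> 'b) \<Rightarrow> 'b \<Rightarrow> bool" where
  "locally_flow_equivalent X v x Y w p \<longleftrightarrow>
     (\<exists>N N' h g. openin X N \<and> x \<in> N \<and> openin Y N' \<and> p \<in> N' \<and>
        homeomorphic_maps (subtopology X N) (subtopology Y N') h g \<and> h x = p \<and>
        maps_orbits v N w h \<and> maps_orbits w N' v g)"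

text \<open>The surface \<open>M\<close> carrying the \<open>C\<^sup>1\<close> action is arbitrary. Its points are taken in the type
  \<^typ>\<open>real^2\<close>, but its topology is unrelated to the one of that type. This is no restriction: a
  second countable Hausdorff space has at most continuum many points.\<close>

definition saddle :: "'a topology \<Rightarrow> (real \<Rightarrow> 'a \<Rightarrow> 'a) \<Rightarrow> 'a \<Rightarrow> bool" where
  "saddle X v x \<longleftrightarrow> x \<in> Sing X v \<and>
     (\<exists>(M :: (real^2) topology) \<A> w p.
        C1_saddle M \<A> w p \<and> locally_flow_equivalent X v x M w p)"


section \<open>Transfinite iteration\<close>

text \<open>Ordinals are represented by the elements of the field of a well-order \<open>r\<close>; \<open>i\<close> is the successor
  of \<open>j\<close> iff the strict predecessors of \<open>i\<close> are exactly \<open>j\<close> and its predecessors.\<close>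

definition ord_iter :: "'i rel \<Rightarrow> ('b set \<Rightarrow> 'b set) \<Rightarrow> 'b set \<Rightarrow> 'i \<Rightarrow> 'b set" where
  "ord_iter r F A = wfrec (r - Id) (\<lambda>f i.
     if underS r i = {} then A
     else if \<exists>j\<in>Field r. underS r i = under r j
       then F (f (THE j. j \<in> Field r \<and> underS r i = under r j))
     else (\<Union>j\<in>underS r i. f j))"

lemma under_inj_wo:
  assumes "Well_order r" "j \<in> Field r" "k \<in> Field r" "under r j = under r k"
  shows "j = k"
proof -
  have "Refl r" "antisym r" using assms(1) by (auto simp: order_on_defs)
  then show ?thesis using assms(2-4)
    by (auto simp: under_def refl_on_def dest: antisymD)
qed

lemma ord_iter_unfold:
  assumes r: "Well_order r"
  shows "ord_iter r F A i =
    (if underS r i = {} then A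
     else if \<exists>j\<in>Field r. underS r i = under r j
       then F (ord_iter r F A (THE j. j \<in> Field r \<and> underS r i = under r j))
     else (\<Union>j\<in>underS r i. ord_iter r F A j))"
proof -
  interpret wo_rel r using r by (simp add: wo_rel_def)
  let ?H = "\<lambda>f i. if underS i = {} then A
     else if \<exists>j\<in>Field r. underS i = under j
       then F (f (THE j. j \<in> Field r \<and> underS i = under j))
     else (\<Union>j\<in>underS i. f j)"
  have "adm_wo ?H"
    unfolding adm_wo_def
  proof (intro allI impI)
    fix f g :: "'a \<Rightarrow> 'b set" and x
    assume eq: "\<forall>y\<in>underS x. f y = g y"
    have "f (THE j. j \<in> Field r \<and> underS x = under j) = g (THE j. j \<in> Field r \<and> underS x = under j)"
      if j: "j \<in> Field r" "underS x = under j" for j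
    proof -
      have "(THE j. j \<in> Field r \<and> underS x = under j) = j"
        using j under_inj_wo[OF r] by (intro the_equality) auto
      moreover have "j \<in> underS x"
        using j REFL by (auto simp: under_def refl_on_def)
      ultimately show ?thesis using eq by auto
    qed
    then show "?H f x = ?H g x" using eq by auto
  qed
  from worec_fixpoint[OF this] show ?thesis
    unfolding ord_iter_def worec_def by (rule fun_cong)
qed

lemma ord_iter_zero:
  assumes "Well_order r" "underS r i = {}"
  shows "ord_iter r F A i = A"
  using assms by (subst ord_iter_unfold) auto

lemma ord_iter_succ:
  assumes r: "Well_order r" and j: "j \<in> Field r" "underS r i = under r j"
  shows "ord_iter r F A i = F (ord_iter r F A j)"
proof -
  have "(THE j. j \<in> Field r \<and> underS r i = under r j) = j"
    using j under_inj_wo[OF r] by (intro the_equality) auto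
  moreover have "underS r i \<noteq> {}"
    using r j by (auto simp: order_on_defs under_def refl_on_def)
  ultimately show ?thesis using j by (subst ord_iter_unfold[OF r]) auto
qed

lemma ord_iter_limit:
  assumes "Well_order r" "underS r i \<noteq> {}" "\<not> (\<exists>j\<in>Field r. underS r i = under r j)"
  shows "ord_iter r F A i = (\<Union>j\<in>underS r i. ord_iter r F A j)"
  using assms by (subst ord_iter_unfold) auto


section \<open>Extended orbits\<close>

definition ext_pos_step :: "'a topology \<Rightarrow> (real \<Rightarrow> 'a \<Rightarrow> 'a) \<Rightarrow> 'a set \<Rightarrow> 'a set" where
  "ext_pos_step X v A =
     A \<union> \<Union>{Wu X v p | p x'. x' \<in> A \<and> omega_limit X v x' = {p} \<and> saddle X v p}"

definition ext_neg_step :: "'a topology \<Rightarrow> (real \<Rightarrow> 'a \<Rightarrow> 'a) \<Rightarrow> 'a set \<Rightarrow> 'a set" where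
  "ext_neg_step X v A =
     A \<union> \<Union>{Ws X v p | p x'. x' \<in> A \<and> alpha_limit X v x' = {p} \<and> saddle X v p}"

text \<open>The ordinals that occur are those of the well-orders on subsets of the type \<open>'a set\<close>. They
  include all ordinals that inject into \<open>'a set\<close>, and an increasing transfinite sequence of subsets
  of an infinite type \<open>'a\<close> is stationary before they are exhausted.\<close>

definition ext_pos_orbit :: "'a topology \<Rightarrow> (real \<Rightarrow> 'a \<Rightarrow> 'a) \<Rightarrow> 'a \<Rightarrow> 'a set" where
  "ext_pos_orbit X v x =
     \<Union>{ord_iter r (ext_pos_step X v) (pos_orbit v x) \<nu> | (r :: 'a set rel) \<nu>.
         Well_order r \<and> \<nu> \<in> Field r}"

definition ext_neg_orbit :: "'a topology \<Rightarrow> (real \<Rightarrow> 'a \<Rightarrow> 'a) \<Rightarrow> 'a \<Rightarrow> 'a set" where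
  "ext_neg_orbit X v x =
     \<Union>{ord_iter r (ext_neg_step X v) (neg_orbit v x) \<nu> | (r :: 'a set rel) \<nu>.
         Well_order r \<and> \<nu> \<in> Field r}"

definition ext_orbit :: "'a topology \<Rightarrow> (real \<Rightarrow> 'a \<Rightarrow> 'a) \<Rightarrow> 'a \<Rightarrow> 'a set" where
  "ext_orbit X v x = ext_pos_orbit X v x \<union> ext_neg_orbit X v x"

definition extended_R_closed :: "'a topology \<Rightarrow> (real \<Rightarrow> 'a \<Rightarrow> 'a) \<Rightarrow> bool" where
  "extended_R_closed X v \<longleftrightarrow>
     closedin (prod_topology X X)
       {(x, y). x \<in> topspace X \<and> y \<in> X closure_of ext_orbit X v x}"

definition extended_pap :: "'a topology \<Rightarrow> (real \<Rightarrow> 'a \<Rightarrow> 'a) \<Rightarrow> bool" where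
  "extended_pap X v \<longleftrightarrow>
     partition_on (topspace X) {X closure_of ext_orbit X v x | x. x \<in> topspace X}"

end

(*
  Embed S into a sequence space, so that the flow lives on a compact metric space.

  A closed R_ex is a symmetric relation.  Transitivity follows once every unstable separatrix that
  does not end in a saddle has a limit point on no separatrix at all, whose extended orbit is then its
  orbit.  Otherwise compose the passages through saddle sectors and flow boxes along the separatrix to
  a return map of a half section.  It is contracting, so an interval of the section is covered by
  countably many orbits, whereas it meets uncountably many.

  Conversely, suppose that the closures form a decomposition.  Away from the closures of the singular
  extended orbits, every orbit closure is minimal.  A minimal set is a periodic orbit, near which the
  second iterate of the return map is the identity, or it is open: the gaps which it leaves in a
  section are pairwise disjoint, hence shrink when they are transported along the flow.  In both cases
  the decomposition is upper semicontinuous.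

  The dynamics near a saddle of a differentiable flow is obtained from cone estimates for a time map.
*)

theory Submission
  imports Defs
begin

section \<open>Flows on compact metric spaces\<close>

text \<open>Lying in one extended orbit is a symmetric relation but not a transitive one: from a
  point of a stable separatrix the positive extension reaches both unstable separatrices of the
  saddle, but in general only their negative extension reaches the other stable separatrix.
  Transitivity of the closures is therefore settled at the saddles, in two cases. If the positive
  extended orbit of a saddle consists of connections, a count of separatrices, two stable and two
  unstable ones for each saddle, shows that the negative one is the same set, and this set is
  closed. Otherwise both extensions leave the saddles, and they are compared through limit points on
  no separatrix.

  That a separatrix has such a limit point is proved for a counterexample whose limit set contains
  the fewest orbits. There every limit orbit tends to a saddle, since one that does not would be
  recurrent, against Baire's theorem; this is what lets transit maps be composed. Because a surface
  may have a boundary, a section may be an arc that starts in its base point, and transits are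
  followed on one half of a section at a time.\<close>

definition rv :: "(real => 'm => 'm) => real => 'm => 'm" where
  "rv v t = v (- t)"

definition orb :: "(real => 'm => 'm) => 'm => 'm set" where
  "orb v x = range (%t. v t x)"

definition wst :: "'m::topological_space set => (real => 'm => 'm) => 'm => 'm set" where
  "wst K v p = {z \<in> K. ((%t. v t z) \<longlongrightarrow> p) at_top}"

definition olim :: "(real => 'm::topological_space => 'm) => 'm => 'm set" where
  "olim v x = {y. \<exists>f::nat => real. filterlim f at_top sequentially & (%n. v (f n) x) \<longlonglongrightarrow> y}"

text \<open>The base case takes the whole orbit instead of its positive half. This does not change
  the union \<open>eorb\<close> of the two directions, and it makes the set invariant under the flow
  and closed under further steps. An induction over finitely many steps replaces the ordinals, since
  each step starts from a single point.\<close>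

inductive_set gplus ::
  "'m::topological_space set => (real => 'm => 'm) => 'm set => 'm => 'm set"
  for K v P x where
  base: "v t x \<in> gplus K v P x"
| step: "x' \<in> gplus K v P x ==> p \<in> P ==> x' \<in> wst K v p ==> y \<in> wst K (rv v) p
    ==> y \<in> gplus K v P x"

definition eorb :: "'m::topological_space set => (real => 'm => 'm) => 'm set => 'm => 'm set" where
  "eorb K v P x = gplus K v P x \<union> gplus K (rv v) P x"

definition ecl :: "'m::topological_space set => (real => 'm => 'm) => 'm set => 'm => 'm set" where
  "ecl K v P x = closure (eorb K v P x)"

lemma at_top_seq:
  fixes Q :: "real => bool"
  assumes "\<And>N. \<exists>t\<ge>N. Q t"
  obtains f :: "nat => real" where "\<And>n. f n \<ge> real n" "\<And>n. Q (f n)" "filterlim f at_top sequentially"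
proof -
  define f where "f n = (SOME t. t \<ge> real n & Q t)" for n :: nat
  have f: "f n \<ge> real n & Q (f n)" for n
    unfolding f_def by (rule someI_ex) (rule assms)
  then have "filterlim f at_top sequentially"
    by (intro filterlim_at_top_mono[OF filterlim_real_sequentially]) auto
  with f show thesis by (intro that) auto
qed

lemma olim_seqI:
  "filterlim f at_top sequentially ==> (%n::nat. v (f n) x) \<longlonglongrightarrow> y ==> y \<in> olim v x"
  unfolding olim_def by (rule CollectI) (rule exI, rule conjI)

lemma olim_seqE:
  assumes "y \<in> olim v x"
  obtains f where "filterlim f at_top sequentially" "(%n::nat. v (f n) x) \<longlonglongrightarrow> y"
  using assms unfolding olim_def mem_Collect_eq by (elim exE conjE)

lemma rv_rv [simp]: "rv (rv v) = v"
  by (auto simp: rv_def fun_eq_iff)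

lemma orb_rv [simp]: "orb (rv v) = orb v"
proof (rule ext)
  fix x show "orb (rv v) x = orb v x"
    unfolding orb_def rv_def
    by (auto simp: image_iff) (metis minus_minus)+
qed

lemma eorb_rv: "eorb K (rv v) P x = eorb K v P x"
  by (auto simp: eorb_def)

lemma ecl_rv: "ecl K (rv v) P x = ecl K v P x"
  by (simp add: ecl_def eorb_rv)

locale cflow =
  fixes K :: "'m::metric_space set" and v :: "real => 'm => 'm"
  assumes compactK: "compact K"
    and contv: "continuous_on (UNIV \<times> K) (%(t, x). v t x)"
    and inK: "x \<in> K ==> v t x \<in> K"
    and v0: "x \<in> K ==> v 0 x = x"
    and vadd: "x \<in> K ==> v s (v t x) = v (s + t) x"
begin

lemma cflow_rv: "cflow K (rv v)"
proof
  show "continuous_on (UNIV \<times> K) (%(t, x). rv v t x)"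
  proof -
    have "continuous_on (UNIV \<times> K) ((%(t, x). v t x) \<circ> (%(t, x). (- t, x)))"
      by (intro continuous_on_compose continuous_on_subset[OF contv])
        (auto simp: case_prod_unfold intro!: continuous_intros)
    then show ?thesis by (simp add: rv_def o_def case_prod_unfold)
  qed
qed (use compactK inK v0 vadd in \<open>auto simp: rv_def add.commute\<close>)

lemma closedK: "closed K"
  using compactK compact_imp_closed by blast

lemma tendsto_v:
  assumes "(f \<longlongrightarrow> t) F" "(g \<longlongrightarrow> x) F" "x \<in> K" "eventually (%n. g n \<in> K) F"
  shows "((%n. v (f n) (g n)) \<longlongrightarrow> v t x) F"
proof -
  have "((%n. (f n, g n)) \<longlongrightarrow> (t, x)) F"
    using assms by (intro tendsto_Pair)
  moreover have "((%(t, x). v t x) \<longlongrightarrow> v t x) (at (t, x) within UNIV \<times> K)"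
    using contv assms(3) by (auto simp: continuous_on_def)
  ultimately have "((%n. (%(t, x). v t x) (f n, g n)) \<longlongrightarrow> (%(t, x). v t x) (t, x)) F"
    using assms(4) by (intro continuous_on_tendsto_compose[OF contv]) (auto simp: assms(3))
  then show ?thesis by simp
qed

lemma cont_v:
  assumes "continuous_on S f" "continuous_on S g" "g ` S \<subseteq> K"
  shows "continuous_on S (%s. v (f s) (g s))"
proof -
  have "continuous_on S ((%(t, x). v t x) \<circ> (%s. (f s, g s)))"
    using assms by (intro continuous_on_compose continuous_intros continuous_on_subset[OF contv]) auto
  then show ?thesis by (simp add: o_def)
qed

lemma v_neg [simp]: "x \<in> K ==> v (- t) (v t x) = x" "x \<in> K ==> v t (v (- t) x) = x"
  by (auto simp: vadd v0)

lemma v_eq_iff: "x \<in> K ==> y \<in> K ==> v t x = v s y \<longleftrightarrow> v (t - s) x = y"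
  by (metis (no_types, opaque_lifting) add.commute inK uminus_add_conv_diff v_neg vadd)

lemma orb_subset: "x \<in> K ==> orb v x \<subseteq> K"
  by (auto simp: orb_def inK)

lemma orb_self: "x \<in> K ==> x \<in> orb v x"
  unfolding orb_def by (rule image_eqI[of _ _ 0]) (auto simp: v0)

lemma v_in_orb [simp]: "v t x \<in> orb v x"
  by (auto simp: orb_def)

lemma orb_v: assumes "x \<in> K" shows "orb v (v t x) = orb v x"
proof
  show "orb v (v t x) \<subseteq> orb v x"
    using assms by (auto simp: orb_def vadd)
  have "v s x = v (s - t) (v t x)" for s using assms by (simp add: vadd)
  then show "orb v x \<subseteq> orb v (v t x)"
    unfolding orb_def by (metis image_subsetI rangeI)
qed

lemma orb_eq: "x \<in> K ==> y \<in> orb v x ==> orb v y = orb v x"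
  by (auto simp: orb_def[of v x] orb_v)

section \<open>Limit sets and stable sets of points\<close>

lemma olim_subset: "x \<in> K ==> olim v x \<subseteq> K"
proof
  fix y assume "x \<in> K" "y \<in> olim v x"
  then obtain f where "(%n. v (f n) x) \<longlonglongrightarrow> y" by (blast elim: olim_seqE)
  then show "y \<in> K"
    by (rule closed_sequentially[OF closedK, rotated]) (simp add: inK \<open>x \<in> K\<close>)
qed

lemma olim_subset_closure: "olim v x \<subseteq> closure (orb v x)"
proof
  fix y assume "y \<in> olim v x"
  then obtain f where "(%n. v (f n) x) \<longlonglongrightarrow> y" by (rule olim_seqE)
  then show "y \<in> closure (orb v x)"
    unfolding closure_sequential by (intro exI[of _ "%n. v (f n) x"]) auto
qed

lemma olimI:
  assumes "\<And>N e. e > 0 ==> \<exists>t\<ge>N. dist (v t x) y < e"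
  shows "y \<in> olim v x"
proof -
  have "\<exists>t\<ge>real n. dist (v t x) y < inverse (real (Suc n))" for n
    using assms by simp
  then obtain f where f: "\<And>n. f n \<ge> real n" "\<And>n. dist (v (f n) x) y < inverse (real (Suc n))"
    by metis
  have "filterlim f at_top sequentially"
    using f(1) by (intro filterlim_at_top_mono[OF filterlim_real_sequentially]) auto
  then show ?thesis
  proof (rule olim_seqI)
    show "(%n. v (f n) x) \<longlonglongrightarrow> y"
    using f(2) LIMSEQ_inverse_real_of_nat
    by (intro metric_tendsto_imp_tendsto[OF LIMSEQ_inverse_real_of_nat]) (auto simp: less_imp_le)
  qed
qed

lemma not_olimE:
  assumes "y \<notin> olim v x"
  obtains N e where "e > 0" "\<And>t. t \<ge> N ==> dist (v t x) y \<ge> e"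
  using assms olimI[of x y] that by (meson not_le)

lemma olimD:
  assumes "y \<in> olim v x" "e > 0"
  shows "\<exists>t\<ge>N. dist (v t x) y < e"
proof -
  obtain f where f: "filterlim f at_top sequentially" "(%n. v (f n) x) \<longlonglongrightarrow> y"
    using assms by (blast elim: olim_seqE)
  have "eventually (%n. f n \<ge> N) sequentially"
    using f(1) by (auto simp: filterlim_at_top)
  moreover have "eventually (%n. dist (v (f n) x) y < e) sequentially"
    using f(2) assms(2) by (rule tendstoD)
  ultimately show ?thesis
    using eventually_happens[OF eventually_conj] by fastforce
qed

lemma closed_olim: "closed (olim v x)"
  unfolding closed_sequential_limits
proof (intro allI impI, elim conjE)
  fix f l assume f: "\<forall>n. f n \<in> olim v x" "f \<longlonglongrightarrow> l"
  show "l \<in> olim v x"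
  proof (rule olimI)
    fix N e :: real assume "e > 0"
    then obtain n where n: "dist (f n) l < e/2"
      using f(2) by (metis half_gt_zero lim_sequentially order_refl)
    obtain t where "t \<ge> N" "dist (v t x) (f n) < e/2"
      using olimD[of "f n" x "e/2" N] f(1) \<open>e > 0\<close> by auto
    then show "\<exists>t\<ge>N. dist (v t x) l < e"
      using n dist_triangle[of "v t x" l "f n"] by (intro exI[of _ t]) linarith
  qed
qed

lemma olim_inv: assumes "x \<in> K" "y \<in> olim v x" shows "v s y \<in> olim v x"
proof -
  have yK: "y \<in> K" using assms olim_subset by blast
  obtain f where f: "filterlim f at_top sequentially" "(%n. v (f n) x) \<longlonglongrightarrow> y"
    using assms by (blast elim: olim_seqE)
  have lim: "(%n. v s (v (f n) x)) \<longlonglongrightarrow> v s y"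
    using f yK assms(1) by (intro tendsto_v) (auto simp: inK)
  have "filterlim (%n. s + f n) at_top sequentially"
    by (rule filterlim_tendsto_add_at_top[OF tendsto_const f(1)])
  then show ?thesis using lim assms by (intro olim_seqI) (simp_all add: vadd)
qed

lemma olim_orb: "x \<in> K ==> y \<in> olim v x ==> closure (orb v y) \<subseteq> olim v x"
  by (rule closure_minimal) (auto simp: orb_def olim_inv closed_olim)

lemma olim_v: assumes "x \<in> K" shows "olim v (v s x) = olim v x"
proof -
  have *: "olim v (v s x) \<subseteq> olim v x" if "x \<in> K" for s x
  proof
    fix y assume "y \<in> olim v (v s x)"
    then obtain f where f: "filterlim f at_top sequentially" "(%n. v (f n) (v s x)) \<longlonglongrightarrow> y"
      by (rule olim_seqE)
    have "filterlim (%n. s + f n) at_top sequentially"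
      by (rule filterlim_tendsto_add_at_top[OF tendsto_const f(1)])
    then show "y \<in> olim v x" using f(2) that by (intro olim_seqI) (simp_all add: vadd add.commute)
  qed
  have "olim v x \<subseteq> olim v (v s x)"
    using *[OF inK[OF assms, of s], of "-s"] unfolding v_neg(1)[OF assms] .
  then show ?thesis using *[OF assms, of s] by (rule subset_antisym[rotated])
qed

lemma olim_orb_eq: "x \<in> K ==> y \<in> orb v x ==> olim v y = olim v x"
  by (auto simp: orb_def olim_v)

lemma seq_at_top_subseq:
  assumes "x \<in> K" "filterlim f at_top sequentially"
  shows "\<exists>r l. strict_mono (r::nat=>nat) & l \<in> olim v x & (%n. v (f (r n)) x) \<longlonglongrightarrow> l"
proof -
  obtain l r where lr: "l \<in> K" "strict_mono r" "((%n. v (f n) x) \<circ> r) \<longlonglongrightarrow> l"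
    by (rule seq_compactE[OF compactK[unfolded compact_eq_seq_compact_metric], of "%n. v (f n) x"])
      (use inK[OF assms(1)] in auto)
  have "filterlim (%n. f (r n)) at_top sequentially"
    using assms(2) lr(2) by (simp add: filterlim_compose filterlim_subseq)
  then have "l \<in> olim v x" using lr by (intro olim_seqI) (simp_all add: o_def)
  then show ?thesis using lr by (auto simp: o_def)
qed

lemma olim_nonempty: "x \<in> K ==> olim v x \<noteq> {}"
  using seq_at_top_subseq[OF _ filterlim_real_sequentially] by blast

lemma olim_eventually:
  assumes "x \<in> K" "open U" "olim v x \<subseteq> U"
  shows "eventually (%t. v t x \<in> U) at_top"
proof (rule ccontr)
  assume "\<not> ?thesis"
  then have "\<And>N. \<exists>t\<ge>N. v t x \<notin> U" by (auto simp: eventually_at_top_linorder)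
  then obtain f where f: "filterlim f at_top sequentially" "\<And>n::nat. v (f n) x \<notin> U"
    by (rule at_top_seq) blast
  obtain r l where l: "l \<in> olim v x" "(%n. v (f (r n)) x) \<longlonglongrightarrow> l"
    using seq_at_top_subseq[OF assms(1) f(1)] by blast
  then have "l \<notin> U" using f(2) assms(2)
    by (metis (no_types, lifting) ComplD ComplI closed_Compl closed_sequentially)
  then show False using l assms by blast
qed

lemma wst_olim: "p \<in> wst K v p' \<longleftrightarrow> p \<in> K & olim v p = {p'}"
proof (cases "p \<in> K")
  case True
  show ?thesis
  proof
    assume L: "p \<in> wst K v p'"
    then have l: "((%t. v t p) \<longlongrightarrow> p') at_top" by (simp add: wst_def)
    have "y = p'" if y: "y \<in> olim v p" for y
    proof -
      obtain f where f: "filterlim f at_top sequentially" "(%n. v (f n) p) \<longlonglongrightarrow> y"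
        using y by (rule olim_seqE)
      have "(%n. v (f n) p) \<longlonglongrightarrow> p'" using filterlim_compose[OF l f(1)] .
      then show ?thesis using f(2) LIMSEQ_unique by blast
    qed
    then show "p \<in> K & olim v p = {p'}" using True olim_nonempty[OF True] by blast
  next
    assume R: "p \<in> K & olim v p = {p'}"
    have "((%t. v t p) \<longlongrightarrow> p') at_top"
      unfolding tendsto_def using olim_eventually[OF True] R by auto
    then show "p \<in> wst K v p'" using True by (simp add: wst_def)
  qed
qed (auto simp: wst_def)

lemma wst_subset: "wst K v p \<subseteq> K"
  by (auto simp: wst_def)

lemma wst_fixed: assumes "z \<in> wst K v p" shows "p \<in> K" "v t p = p"
proof -
  have z: "z \<in> K" "olim v z = {p}" using assms by (simp_all add: wst_olim)
  show "p \<in> K" using olim_subset[OF z(1)] z by auto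
  show "v t p = p" using olim_inv[OF z(1), of p t] z(2) by simp
qed

lemma olim_fixed: assumes "p \<in> K" "\<And>t. v t p = p" shows "olim v p = {p}"
proof -
  have "olim v p \<subseteq> {p}" using assms(2) by (auto elim!: olim_seqE dest: LIMSEQ_unique[OF tendsto_const])
  then show ?thesis using olim_nonempty[OF assms(1)] by auto
qed

lemma wst_self: assumes "p \<in> K" "\<And>t. v t p = p" shows "p \<in> wst K v p"
  by (simp add: wst_olim olim_fixed assms)

lemma wst_v: "z \<in> wst K v p ==> v t z \<in> wst K v p"
  by (simp add: wst_olim olim_v inK)

lemma wst_unique: "z \<in> wst K v p ==> z \<in> wst K v q ==> p = q"
  using wst_olim by (metis singleton_inject)

lemma wst_orb: "z \<in> wst K v p ==> orb v z \<subseteq> wst K v p"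
  by (auto simp: orb_def wst_v)

end

text \<open>A point off both limit sets keeps a positive distance from the two ends of the orbit,
  and a point off the orbit keeps one from the compact arc between them.\<close>

lemma (in cflow) closure_orb:
  assumes x: "x \<in> K"
  shows "closure (orb v x) = orb v x \<union> olim v x \<union> olim (rv v) x"
proof
  interpret r: cflow K "rv v" by (rule cflow_rv)
  show "orb v x \<union> olim v x \<union> olim (rv v) x \<subseteq> closure (orb v x)"
    by (intro Un_least closure_subset olim_subset_closure r.olim_subset_closure[unfolded orb_rv])
  show "closure (orb v x) \<subseteq> orb v x \<union> olim v x \<union> olim (rv v) x"
  proof (rule subsetI)
    fix y assume y: "y \<in> closure (orb v x)"
    show "y \<in> orb v x \<union> olim v x \<union> olim (rv v) x"
    proof (rule ccontr)
      assume N: "\<not> ?thesis"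
      obtain N1 e1 where 1: "e1 > 0" "\<And>t. t \<ge> N1 ==> dist (v t x) y \<ge> e1"
        by (rule not_olimE[of y x]) (use N in auto)
      obtain N2 e2 where 2: "e2 > 0" "\<And>t. t \<ge> N2 ==> dist (rv v t x) y \<ge> e2"
        by (rule r.not_olimE[of y x]) (use N in auto)
      let ?A = "(%t. v t x) ` {- \<bar>N2\<bar>..\<bar>N1\<bar>}"
      have "compact ?A"
        by (intro compact_continuous_image cont_v continuous_intros) (use x in auto)
      then have clA: "closed ?A" by (rule compact_imp_closed)
      have "y \<notin> ?A" using N by (auto simp: orb_def)
      obtain e3 where 3: "e3 > 0" "\<And>z. z \<in> ?A ==> dist z y \<ge> e3"
      proof -
        have "open (- ?A)" "y \<in> - ?A" using clA \<open>y \<notin> ?A\<close> by auto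
        then obtain e where e: "e > 0" "ball y e \<subseteq> - ?A" using open_contains_ball by blast
        have "dist z y \<ge> e" if "z \<in> ?A" for z
          using e(2) that by (force simp: dist_commute not_less[symmetric] simp del: atLeastAtMost_iff)
        with e(1) show thesis by (rule that)
      qed
      obtain t where t: "dist (v t x) y < min e1 (min e2 e3)"
      proof -
        have "0 < min e1 (min e2 e3)" using 1(1) 2(1) 3(1) by simp
        then obtain z where "z \<in> orb v x" "dist z y < min e1 (min e2 e3)"
          using y unfolding closure_approachable by blast
        then show thesis using that by (auto simp: orb_def)
      qed
      have "t < N1" using 1(2)[of t] t by fastforce
      moreover have "- t < N2" using 2(2)[of "-t"] t by (fastforce simp: rv_def)
      ultimately have "v t x \<in> ?A" by (intro imageI) auto
      then show False using 3(2) t by fastforce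
    qed
  qed
qed

section \<open>Extended orbits\<close>

text \<open>\<open>P\<close> stands for the set of saddles. Other fixed points are allowed; that
  these are finitely many too is kept as an assumption because \<open>Sp\<close> will unite the
  classes of all fixed points.\<close>

locale pflow = cflow +
  fixes P
  assumes finSing: "finite {p \<in> K. \<forall>t. v t p = p}"
    and PSing: "P \<subseteq> {p \<in> K. \<forall>t. v t p = p}"
begin

lemma pflow_rv: "pflow K (rv v) P"
proof -
  have *: "{p \<in> K. \<forall>t. rv v t p = p} = {p \<in> K. \<forall>t. v t p = p}"
  proof -
    have "(\<forall>t. v (- t) p = p) = (\<forall>t. v t p = p)" for p
      by (rule iffI; intro allI, drule_tac x="- t" in spec, simp)
    then show ?thesis by (simp add: rv_def)
  qed
  interpret r: cflow K "rv v" by (rule cflow_rv)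
  show ?thesis by unfold_locales (use finSing PSing * in auto)
qed

lemma finP: "finite P"
  using finSing PSing finite_subset by blast

lemma PK: "p \<in> P ==> p \<in> K" and Pfix: "p \<in> P ==> v t p = p"
  using PSing by auto

lemma P_wst: "p \<in> P ==> p \<in> wst K v p"
  by (simp add: PK Pfix wst_self)

text \<open>Points on no separatrix. The saddles are excluded as well, since a fixed point lies in
  its own stable set (\<open>P_wst\<close>).\<close>

definition gen :: "'a => bool" where
  "gen z \<longleftrightarrow> z \<in> K & (\<forall>p\<in>P. z \<notin> wst K v p & z \<notin> wst K (rv v) p)"

lemma gplus_subset: "x \<in> K ==> gplus K v P x \<subseteq> K"
proof
  fix y assume "y \<in> gplus K v P x" "x \<in> K"
  then show "y \<in> K" by induction (auto simp: inK wst_def)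
qed

lemma gplus_sub: "gplus K v P x \<subseteq> orb v x \<union> (\<Union>p\<in>P. wst K (rv v) p)"
proof
  fix y assume "y \<in> gplus K v P x"
  then show "y \<in> orb v x \<union> (\<Union>p\<in>P. wst K (rv v) p)" by induction auto
qed

lemma gplus_v: assumes "x \<in> K" "y \<in> gplus K v P x" shows "v t y \<in> gplus K v P x"
  using assms(2,1)
proof induction
  case (base s)
  then show ?case using gplus.base[of v "t + s" x K P] by (simp add: vadd)
next
  case (step x' p y)
  interpret r: cflow K "rv v" by (rule cflow_rv)
  have "rv v (-t) y \<in> wst K (rv v) p" using step.hyps by (intro r.wst_v)
  then show ?case by (intro gplus.step[OF step.hyps(1-3)]) (simp add: rv_def)
qed

lemma gplus_trans:
  assumes "x \<in> K" "y \<in> gplus K v P x" "z \<in> gplus K v P y"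
  shows "z \<in> gplus K v P x"
  using assms(3)
proof induction
  case (base t)
  then show ?case using assms by (intro gplus_v)
next
  case (step x' p y)
  show ?case by (rule gplus.step[OF step.IH step.hyps(2-4)])
qed

lemma gplus_self: "x \<in> K ==> x \<in> gplus K v P x"
  using gplus.base[of v 0 x] v0 by metis

lemma orb_gplus: "orb v x \<subseteq> gplus K v P x"
  unfolding orb_def by (rule image_subsetI) (rule gplus.base)

lemma gplus_orb: assumes "x \<in> K" "y \<in> orb v x" shows "gplus K v P y = gplus K v P x"
proof
  have yK: "y \<in> K" using assms orb_subset by blast
  have xy: "x \<in> orb v y" using orb_eq[OF assms] orb_self[OF assms(1)] by simp
  show "gplus K v P y \<subseteq> gplus K v P x" "gplus K v P x \<subseteq> gplus K v P y"
    using gplus_trans[OF assms(1)] gplus_trans[OF yK] assms(2) xy orb_gplus[of x] orb_gplus[of y]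
    by (meson subsetD subsetI)+
qed

text \<open>A step from \<open>x'\<close> through \<open>p\<close> to \<open>y\<close> is, for the
  reversed flow, a step from \<open>y\<close> through \<open>p\<close> to \<open>x'\<close>; a chain
  is thus read backwards.\<close>

lemma gplus_sym:
  assumes "x \<in> K" "y \<in> gplus K v P x"
  shows "x \<in> gplus K (rv v) P y"
  using assms(2,1)
proof induction
  case (base t)
  then have "rv v t (v t x) = x" by (simp add: rv_def)
  then show ?case using gplus.base[of "rv v" t "v t x" K P] by simp
next
  case (step x' p y)
  interpret r: pflow K "rv v" P by (rule pflow_rv)
  have yK: "y \<in> K" using step by (auto simp: wst_def)
  have "x' \<in> gplus K (rv v) P y"
    by (rule gplus.step[OF r.gplus_self[OF yK] step.hyps(2,4)]) (simp add: step.hyps)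
  then show ?case using r.gplus_trans[OF yK] step.IH step.prems by blast
qed

text \<open>Stable sets are invariant, so a first step off the orbit would put \<open>x\<close>
  itself into one of them.\<close>

lemma gplus_nowst:
  assumes "x \<in> K" "\<And>p. p \<in> P ==> x \<notin> wst K v p"
  shows "gplus K v P x = orb v x"
proof
  show "gplus K v P x \<subseteq> orb v x"
  proof
    fix y assume "y \<in> gplus K v P x"
    then show "y \<in> orb v x"
    proof induction
      case (step x' p y)
      then have "orb v x' \<subseteq> wst K v p" by (intro wst_orb)
      moreover have "x \<in> orb v x'"
        using step.IH orb_eq[OF assms(1) step.IH] orb_self[OF assms(1)] by simp
      ultimately show ?case using assms(2) step.hyps by blast
    qed auto
  qed
qed (rule orb_gplus)

lemma step_point:
  assumes "p \<in> P" "x \<in> wst K v p"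
  shows "p \<in> gplus K v P x"
proof -
  interpret r: pflow K "rv v" P by (rule pflow_rv)
  have xK: "x \<in> K" using assms by (auto simp: wst_def)
  show ?thesis by (rule gplus.step[OF gplus_self[OF xK] assms r.P_wst[OF assms(1)]])
qed

end

context pflow
begin

text \<open>The context is entered anew so that the facts proved above hold for the reversed flow
  under the prefix \<open>r\<close>; the same device recurs below.\<close>

interpretation r: pflow K "rv v" P by (rule pflow_rv)

lemma eorb_subset: "x \<in> K ==> eorb K v P x \<subseteq> K"
  using gplus_subset r.gplus_subset by (auto simp: eorb_def)

lemma eorb_sym: "x \<in> K ==> y \<in> eorb K v P x ==> x \<in> eorb K v P y"
  using gplus_sym r.gplus_sym by (auto simp: eorb_def)

lemma eorb_orb: "x \<in> K ==> y \<in> orb v x ==> eorb K v P y = eorb K v P x"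
  using gplus_orb r.gplus_orb by (auto simp: eorb_def)

lemma orb_eorb: "orb v x \<subseteq> eorb K v P x"
  using orb_gplus by (auto simp: eorb_def)

lemma closed_ecl: "closed (ecl K v P x)"
  by (simp add: ecl_def)

lemma ecl_subset: "x \<in> K ==> ecl K v P x \<subseteq> K"
  unfolding ecl_def using closedK eorb_subset by (simp add: closure_minimal)

lemma ecl_self: "x \<in> K ==> x \<in> ecl K v P x"
  unfolding ecl_def using orb_eorb orb_self closure_subset by blast

lemma ecl_orb: "x \<in> K ==> y \<in> orb v x ==> ecl K v P y = ecl K v P x"
  by (simp add: ecl_def eorb_orb)

lemma closure_orb_ecl: "closure (orb v x) \<subseteq> ecl K v P x"
  unfolding ecl_def by (intro closure_mono orb_eorb)

lemma olim_ecl: "olim v x \<subseteq> ecl K v P x"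
  using olim_subset_closure closure_orb_ecl by blast

lemma gen_rv: "r.gen z \<longleftrightarrow> gen z"
  by (auto simp: gen_def r.gen_def)

lemma gen_eorb: "gen z ==> eorb K v P z = orb v z"
  using gplus_nowst r.gplus_nowst by (auto simp: gen_def eorb_def)

lemma gen_ecl: "gen z ==> ecl K v P z = closure (orb v z)"
  by (simp add: ecl_def gen_eorb)

lemma closure_orb_inv: assumes "x \<in> K" "y \<in> closure (orb v x)" shows "v t y \<in> closure (orb v x)"
proof -
  have yK: "y \<in> K" using assms orb_subset closedK closure_minimal by blast
  obtain f where f: "\<And>n. f n \<in> orb v x" "f \<longlonglongrightarrow> y" using assms(2) closure_sequential by metis
  have "(%n. v t (f n)) \<longlonglongrightarrow> v t y"
    using f yK orb_subset[OF assms(1)] by (intro tendsto_v) (auto intro!: always_eventually)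
  moreover have "v t (f n) \<in> orb v x" for n
    using f(1)[of n] assms(1) by (auto simp: orb_def vadd)
  ultimately show ?thesis unfolding closure_sequential by (intro exI[of _ "%n. v t (f n)"]) auto
qed

lemma closure_orb_mono: assumes "x \<in> K" "y \<in> closure (orb v x)"
  shows "closure (orb v y) \<subseteq> closure (orb v x)"
  by (rule closure_minimal) (auto simp: orb_def[of v y] closure_orb_inv[OF assms])

end

text \<open>Hyperbolicity enters the algebra of extended orbits only through the numbers of stable and
  unstable separatrices of a saddle.\<close>

definition two_orbits :: "'m::topological_space set => (real => 'm => 'm) => 'm => bool" where
  "two_orbits K v p \<longleftrightarrow> (\<exists>x1 x2. wst K v p = {p} \<union> orb v x1 \<union> orb v x2 & x1 \<in> K & x2 \<in> K &
     p \<notin> orb v x1 & p \<notin> orb v x2 & orb v x1 \<inter> orb v x2 = {})"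

section \<open>Counting the separatrices of saddles\<close>

locale sflow = pflow +
  assumes two: "p \<in> P ==> two_orbits K v p" "p \<in> P ==> two_orbits K (rv v) p"
begin

lemma sflow_rv: "sflow K (rv v) P"
proof -
  interpret r: pflow K "rv v" P by (rule pflow_rv)
  show ?thesis by unfold_locales (use two in auto)
qed

definition seps :: "'a => 'a set set" where
  "seps p = orb v ` (wst K v p - {p})"

lemma card_seps: assumes "p \<in> P" shows "card (seps p) = 2" "finite (seps p)"
proof -
  obtain x1 x2 where x: "wst K v p = {p} \<union> orb v x1 \<union> orb v x2" "x1 \<in> K" "x2 \<in> K"
     "p \<notin> orb v x1" "p \<notin> orb v x2" "orb v x1 \<inter> orb v x2 = {}"
    using two(1)[OF assms] unfolding two_orbits_def by blast
  have ne: "orb v x1 \<noteq> orb v x2" using x orb_self by blast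
  have "seps p = {orb v x1, orb v x2}"
  proof
    show "seps p \<subseteq> {orb v x1, orb v x2}"
      unfolding seps_def x(1) using orb_eq x(2,3) by blast
    show "{orb v x1, orb v x2} \<subseteq> seps p"
      unfolding seps_def x(1) using x(2-5) orb_self by blast
  qed
  then show "card (seps p) = 2" "finite (seps p)" using ne by auto
qed

lemma seps_disj: "p \<noteq> q ==> seps p \<inter> seps q = {}"
proof (rule ccontr)
  assume "p \<noteq> q" "seps p \<inter> seps q \<noteq> {}"
  then obtain x y where xy: "x \<in> wst K v p" "y \<in> wst K v q" "orb v x = orb v y"
    unfolding seps_def by blast
  then have "x \<in> wst K v q" using wst_orb[OF xy(2)] orb_self wst_subset by blast
  then show False using wst_unique xy \<open>p \<noteq> q\<close> by blast
qed

lemma card_seps_Union: assumes "Q \<subseteq> P"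
  shows "card (\<Union>(seps ` Q)) = 2 * card Q" "finite (\<Union>(seps ` Q))"
proof -
  have fin: "finite Q" using assms finP finite_subset by blast
  have "card (\<Union>(seps ` Q)) = (\<Sum>p\<in>Q. card (seps p))"
    using fin assms card_seps seps_disj by (intro card_UN_disjoint) auto
  then show "card (\<Union>(seps ` Q)) = 2 * card Q" using assms card_seps by (simp add: subset_iff)
  show "finite (\<Union>(seps ` Q))" using fin assms card_seps by auto
qed

end

context sflow
begin

interpretation r: sflow K "rv v" P by (rule sflow_rv)

text \<open>Every saddle has two stable and two unstable separatrices. If the stable ones of \<open>Q\<close>
  are among the unstable ones of \<open>Q\<close>, then both finite families agree.\<close>

lemma count:
  assumes Q: "Q \<subseteq> P"
    and bk: "\<And>q x. q \<in> Q ==> x \<in> wst K v q ==> x \<noteq> q ==> \<exists>q'\<in>Q. x \<in> wst K (rv v) q'"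
    and q: "q \<in> Q" "y \<in> wst K (rv v) q" "y \<noteq> q"
  shows "\<exists>q'\<in>Q. y \<in> wst K v q'"
proof -
  have fixed: "\<And>q x. q \<in> P ==> x \<in> orb v q ==> x = q" by (auto simp: orb_def Pfix)
  have "\<Union>(seps ` Q) \<subseteq> \<Union>(r.seps ` Q)"
  proof
    fix A assume "A \<in> \<Union>(seps ` Q)"
    then obtain q x where qx: "q \<in> Q" "x \<in> wst K v q" "x \<noteq> q" "A = orb v x"
      by (auto simp: seps_def)
    obtain q' where q': "q' \<in> Q" "x \<in> wst K (rv v) q'" using bk qx by blast
    have "x \<noteq> q'"
    proof
      assume "x = q'"
      then have "x \<in> wst K v q'" using P_wst q' Q by blast
      then show False using wst_unique[OF qx(2)] qx(3) \<open>x = q'\<close> by blast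
    qed
    then show "A \<in> \<Union>(r.seps ` Q)" using q' qx(4) by (auto simp: r.seps_def)
  qed
  then have "\<Union>(seps ` Q) = \<Union>(r.seps ` Q)"
    using card_seps_Union[OF Q] r.card_seps_Union[OF Q] by (intro card_subset_eq) auto
  moreover have "orb v y \<in> \<Union>(r.seps ` Q)" using q by (auto simp: r.seps_def)
  ultimately have "orb v y \<in> \<Union>(seps ` Q)" by simp
  then obtain q' x where q': "q' \<in> Q" "x \<in> wst K v q'" "orb v x = orb v y"
    unfolding seps_def by (force dest!: sym[of "orb v y"])
  then have "y \<in> wst K v q'" using wst_orb[OF q'(2)] orb_self q(2) r.wst_subset by blast
  then show ?thesis using q' by blast
qed

text \<open>\<open>Q\<close> collects the saddles reached backwards from \<open>p\<close>. By
  \<open>H\<close> every stable separatrix of \<open>Q\<close> comes from a saddle, which lies in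
  \<open>Q\<close> again. Then \<open>count\<close> shows that the unstable separatrices of
  \<open>Q\<close> also end in \<open>Q\<close>, so that a forward chain from \<open>p\<close> never
  leaves what is reached backwards.\<close>

lemma gplus_subset_gminus:
  assumes p: "p \<in> P"
    and H: "\<And>q x. q \<in> P ==> x \<in> wst K v q ==> x \<noteq> q ==> x \<in> gplus K (rv v) P p
              ==> \<exists>q'\<in>P. x \<in> wst K (rv v) q'"
    and y: "y \<in> gplus K v P p"
  shows "y \<in> gplus K (rv v) P p" "\<exists>q\<in>P. y \<in> wst K v q"
proof -
  define Q where "Q = P \<inter> gplus K (rv v) P p"
  have pK: "p \<in> K" using p PK by auto
  have stepQ: "x \<in> gplus K (rv v) P p" if "q \<in> Q" "x \<in> wst K v q" for q x
  proof -
    have q: "q \<in> gplus K (rv v) P p" "q \<in> P" using that by (auto simp: Q_def)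
    show ?thesis by (rule gplus.step[OF q r.P_wst[OF q(2)]]) (simp add: that)
  qed
  have stepQ': "q' \<in> Q" if "x \<in> gplus K (rv v) P p" "q' \<in> P" "x \<in> wst K (rv v) q'" for x q'
    using that(2) r.gplus_trans[OF pK that(1) r.step_point[OF that(2,3)]] by (simp add: Q_def)
  have bk: "\<exists>q'\<in>Q. x \<in> wst K (rv v) q'" if "q \<in> Q" "x \<in> wst K v q" "x \<noteq> q" for q x
    using H[OF _ that(2,3)] that stepQ stepQ' by (metis IntD1 Q_def)
  have fwd: "\<exists>q'\<in>Q. y \<in> wst K v q'" if "q \<in> Q" "y \<in> wst K (rv v) q" for q y
    using count[of Q q y] bk that P_wst Q_def by (metis IntD1 Int_lower1)
  have "\<exists>q\<in>Q. y \<in> wst K (rv v) q" using y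
  proof induction
    case (base t)
    have "p \<in> Q" using p r.gplus_self[OF pK] by (simp add: Q_def)
    then show ?case using p r.P_wst[OF p] by (auto simp: Pfix)
  next
    case (step x' q y)
    then obtain q' where "q' \<in> Q" "x' \<in> wst K v q'" using fwd by blast
    then have "q \<in> Q" using step.hyps wst_unique by blast
    then show ?case using step.hyps by blast
  qed
  then obtain q where "q \<in> Q" "y \<in> wst K (rv v) q" by blast
  then show "y \<in> gplus K (rv v) P p" "\<exists>q\<in>P. y \<in> wst K v q"
    using fwd stepQ by (auto simp: Q_def) blast
qed

end

section \<open>Extended orbit closures of extended \<open>R\<close>-closed flows\<close>

locale rflow = sflow +
  assumes Rc: "closed {(x, y). x \<in> K & y \<in> ecl K v P x}"
begin

lemma rflow_rv: "rflow K (rv v) P"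
proof -
  interpret r: sflow K "rv v" P by (rule sflow_rv)
  show ?thesis by unfold_locales (use Rc in \<open>simp add: ecl_rv\<close>)
qed

lemma Rc_seq:
  assumes "\<And>n. a n \<in> K" "\<And>n::nat. b n \<in> ecl K v P (a n)" "a \<longlonglongrightarrow> x" "b \<longlonglongrightarrow> y"
  shows "y \<in> ecl K v P x"
proof -
  have "(%n. (a n, b n)) \<longlonglongrightarrow> (x, y)" using assms by (intro tendsto_Pair)
  then have "(x, y) \<in> {(x, y). x \<in> K & y \<in> ecl K v P x}"
    by (rule closed_sequentially[OF Rc, rotated]) (use assms in auto)
  then show ?thesis by simp
qed

text \<open>The points of an extended orbit see each other by symmetry, and closedness of the
  relation carries this to the limits of such points.\<close>

lemma ecl_sym: assumes "x \<in> K" "y \<in> ecl K v P x" shows "x \<in> ecl K v P y"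
proof -
  obtain f where f: "\<And>n. f n \<in> eorb K v P x" "f \<longlonglongrightarrow> y"
    using assms(2) unfolding ecl_def closure_sequential by blast
  have 1: "f n \<in> K" for n using f(1) eorb_subset[OF assms(1)] by blast
  have 2: "x \<in> ecl K v P (f n)" for n
    unfolding ecl_def by (rule subsetD[OF closure_subset eorb_sym[OF assms(1) f(1)]])
  show ?thesis by (rule Rc_seq[OF 1 2 f(2) tendsto_const])
qed

text \<open>The class is constant along the orbit of \<open>x\<close>, so each of its points is
  related to all orbit points and hence, by closedness, to their limit \<open>k\<close>.\<close>

lemma ecl_limit: assumes "x \<in> K" "k \<in> closure (orb v x)" shows "ecl K v P x \<subseteq> ecl K v P k"
proof
  fix b assume b: "b \<in> ecl K v P x"
  obtain f where f: "\<And>n. f n \<in> orb v x" "f \<longlonglongrightarrow> k"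
    using assms(2) closure_sequential by metis
  have 1: "f n \<in> K" for n using f(1) orb_subset[OF assms(1)] by blast
  have 2: "b \<in> ecl K v P (f n)" for n unfolding ecl_orb[OF assms(1) f(1)] by (rule b)
  show "b \<in> ecl K v P k" by (rule Rc_seq[OF 1 2 f(2) tendsto_const])
qed

end

text \<open>The two assumptions are \<open>separatrix_limit_generic\<close> for the flow and for its
  reverse. Isolating them separates the algebra of classes from the geometry of sections.\<close>

locale rgflow = rflow +
  assumes G: "\<And>p y. p \<in> P ==> y \<in> wst K (rv v) p ==> (\<And>q. q \<in> P ==> y \<notin> wst K v q)
      ==> \<exists>k\<in>olim v y. gen k"
    and G': "\<And>p y. p \<in> P ==> y \<in> wst K v p ==> (\<And>q. q \<in> P ==> y \<notin> wst K (rv v) q)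
      ==> \<exists>k\<in>olim (rv v) y. gen k"
begin

lemma rgflow_rv: "rgflow K (rv v) P"
proof -
  interpret r: rflow K "rv v" P by (rule rflow_rv)
  have eq: "r.gen = gen" by (rule ext) (rule gen_rv)
  show ?thesis
  proof unfold_locales
    fix p y assume "p \<in> P" "y \<in> wst K (rv (rv v)) p" "\<And>q. q \<in> P ==> y \<notin> wst K (rv v) q"
    then show "\<exists>k\<in>olim (rv v) y. r.gen k" unfolding eq rv_rv by (rule G')
  next
    fix p y assume "p \<in> P" "y \<in> wst K (rv v) p" "\<And>q. q \<in> P ==> y \<notin> wst K (rv (rv v)) q"
    then show "\<exists>k\<in>olim (rv (rv v)) y. r.gen k" unfolding eq rv_rv by (rule G)
  qed
qed

text \<open>Closedness puts the class of \<open>y\<close> below that of its generic limit point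
  \<open>k\<close>. The class of \<open>k\<close> is only an orbit closure, which the closed
  invariant limit set of \<open>y\<close> contains.\<close>

lemma nontriv:
  assumes "p \<in> P" "y \<in> wst K (rv v) p" "\<And>q. q \<in> P ==> y \<notin> wst K v q"
  shows "\<exists>k. gen k & ecl K v P y = ecl K v P k & ecl K v P y \<subseteq> closure (orb v y)"
proof -
  have yK: "y \<in> K" using assms by (auto simp: wst_def)
  obtain k where k: "k \<in> olim v y" "gen k" using G[OF assms] by blast
  have 1: "ecl K v P y \<subseteq> ecl K v P k"
    using ecl_limit[OF yK, of k] k olim_subset_closure[of y] by blast
  have 2: "ecl K v P k \<subseteq> olim v y"
    unfolding gen_ecl[OF k(2)] by (rule olim_orb[OF yK k(1)])
  show ?thesis
    using 1 2 olim_ecl[of y] olim_subset_closure[of y] k(2) by (intro exI[of _ k]) blast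
qed

text \<open>Some chain of saddle connections starting in \<open>p\<close> runs out into a separatrix
  that tends to no saddle.\<close>

definition NF :: "'a => bool" where
  "NF p \<longleftrightarrow> (\<exists>y\<in>gplus K v P p. \<forall>q\<in>P. y \<notin> wst K v q)"

end

context rgflow
begin

interpretation r: rgflow K "rv v" P by (rule rgflow_rv)

lemma gplus_wu: assumes "p \<in> P" "y \<in> gplus K v P p" obtains q where "q \<in> P" "y \<in> wst K (rv v) q"
proof -
  have "orb v p = {p}" using Pfix[OF assms(1)] by (auto simp: orb_def)
  then have "y \<in> {p} \<union> (\<Union>p\<in>P. wst K (rv v) p)" using gplus_sub[of p] assms(2) by auto
  then show thesis using that[OF assms(1)] r.P_wst[OF assms(1)] that by blast
qed

text \<open>If all backward chains consisted of connections, the count of separatrices would confine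
  the forward ones to stable sets too.\<close>

lemma NF_imp_rNF: assumes "p \<in> P" "NF p" shows "r.NF p"
proof (rule ccontr)
  assume "\<not> r.NF p"
  then have *: "\<And>x. x \<in> gplus K (rv v) P p ==> \<exists>q'\<in>P. x \<in> wst K (rv v) q'"
    by (auto simp: r.NF_def)
  obtain y where y: "y \<in> gplus K v P p" "\<forall>q\<in>P. y \<notin> wst K v q" using assms(2) NF_def by blast
  have "\<exists>q\<in>P. y \<in> wst K v q"
    by (rule gplus_subset_gminus(2)[OF assms(1) _ y(1)]) (use * in blast)
  with y(2) show False by blast
qed

lemma gplus_eq: assumes "p \<in> P" "\<not> NF p" shows "gplus K v P p \<supseteq> gplus K (rv v) P p"
proof
  fix y assume y: "y \<in> gplus K (rv v) P p"
  have "y \<in> gplus K (rv (rv v)) P p"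
    by (rule r.gplus_subset_gminus(1)[OF assms(1) _ y]) (use assms(2) in \<open>auto simp: NF_def\<close>)
  then show "y \<in> gplus K v P p" by simp
qed

end

context rgflow
begin

interpretation r: rgflow K "rv v" P by (rule rgflow_rv)

lemma NF_iff: "p \<in> P ==> NF p \<longleftrightarrow> r.NF p"
  using NF_imp_rNF[of p] r.NF_imp_rNF[of p, unfolded rv_rv] by blast

lemma gplus_eq': assumes "p \<in> P" "\<not> NF p" shows "gplus K (rv v) P p = gplus K v P p"
  using gplus_eq[OF assms] r.gplus_eq[OF assms(1)] NF_iff[OF assms(1)] assms(2) by auto

text \<open>The class is a finite graph of saddles and connections. Forward and backward extension
  agree on it, so all of its points have the same extended orbit \<open>L\<close>, and
  \<open>L\<close> is closed as a finite union of orbits whose two limit points belong to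
  \<open>L\<close>.\<close>

lemma connection_class:
  assumes p: "p \<in> P" "\<not> NF p" and z: "z \<in> ecl K v P p"
  shows "ecl K v P z = ecl K v P p"
proof -
  define L where "L = gplus K v P p"
  have pK: "p \<in> K" using p PK by blast
  have L': "gplus K (rv v) P p = L" using gplus_eq'[OF p] by (simp add: L_def)
  have L_wst: "\<exists>q\<in>P. y \<in> wst K v q" if "y \<in> L" for y
    using that p(2) by (auto simp: NF_def L_def)
  have L_wu: "\<exists>q\<in>P. y \<in> wst K (rv v) q" if "y \<in> L" for y
    using that gplus_wu[OF p(1)] unfolding L_def by metis
  have LK: "L \<subseteq> K" using gplus_subset[OF pK] by (simp add: L_def)
  have q_L: "q \<in> L" if "q \<in> P" "y \<in> L" "y \<in> wst K v q" for q y
    using gplus_trans[OF pK that(2)[unfolded L_def] step_point[OF that(1,3)]] by (simp add: L_def)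
  have q_L': "q \<in> L" if "q \<in> P" "y \<in> L" "y \<in> wst K (rv v) q" for q y
    using r.gplus_trans[OF pK that(2)[folded L'] r.step_point[OF that(1,3)]] L' by simp
  have eorbL: "eorb K v P y = L" if y: "y \<in> L" for y
  proof
    show "eorb K v P y \<subseteq> L"
      using gplus_trans[OF pK y[unfolded L_def]] r.gplus_trans[OF pK y[folded L']] L'
      by (auto simp: eorb_def L_def)
    obtain q where q: "q \<in> P" "y \<in> wst K v q" using L_wst[OF y] by blast
    have qL: "q \<in> L" by (rule q_L[OF q(1) y q(2)])
    have "gplus K v P q \<subseteq> L" using gplus_trans[OF pK qL[unfolded L_def]] by (auto simp: L_def)
    then have nq: "\<not> NF q" using L_wst unfolding NF_def by blast
    \<comment> \<open>\<open>NF\<close> fails at \<open>q\<close> too, because the extension of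
      \<open>q\<close> stays in \<open>L\<close>. Hence the two extensions of \<open>q\<close>
      agree, and \<open>p\<close>, which is reached backwards from \<open>q\<close>, is also reached
      forwards.\<close>
    have "p \<in> gplus K v P q" using gplus_sym[OF pK qL[unfolded L_def]] gplus_eq'[OF q(1) nq] by simp
    then have "L \<subseteq> gplus K v P q" unfolding L_def using gplus_trans[OF PK[OF q(1)]] by blast
    moreover have "gplus K v P q \<subseteq> gplus K v P y"
      using gplus_trans[OF _ step_point[OF q]] y LK by blast
    ultimately show "L \<subseteq> eorb K v P y" by (auto simp: eorb_def)
  qed
  have "closed L"
  proof -
    have fin: "finite (orb v ` L)"
    proof (rule finite_subset)
      show "orb v ` L \<subseteq> (\<Union>q\<in>P. insert (orb v q) (seps q))"
        using L_wst by (auto simp: seps_def)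
      show "finite (\<Union>q\<in>P. insert (orb v q) (seps q))" using finP card_seps by auto
    qed
    have cl: "closure (orb v y) \<subseteq> L" if y: "y \<in> L" for y
    proof -
      have yK: "y \<in> K" using y LK by blast
      obtain q q' where q: "q \<in> P" "y \<in> wst K v q" "q' \<in> P" "y \<in> wst K (rv v) q'"
        using L_wst[OF y] L_wu[OF y] by blast
      have "olim v y = {q}" "olim (rv v) y = {q'}" using q wst_olim r.wst_olim by auto
      then show ?thesis
        using closure_orb[OF yK] q_L[OF q(1) y q(2)] q_L'[OF q(3) y q(4)]
          orb_eorb[of y] eorbL[OF y] by auto
    qed
    have "L = \<Union>(closure ` (orb v ` L))"
      using cl closure_subset orb_self LK by fast
    moreover have "closed (\<Union>(closure ` (orb v ` L)))"
      using fin by (intro closed_UN) auto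
    ultimately show ?thesis by simp
  qed
  then have eclL: "ecl K v P y = L" if "y \<in> L" for y
    using eorbL[OF that] by (simp add: ecl_def)
  have "p \<in> L" using gplus_self[OF pK] by (simp add: L_def)
  then show ?thesis using eclL z by simp
qed

text \<open>A forward and a backward chain from \<open>p\<close> run out at \<open>y\<close> and
  \<open>x\<close>, which have generic limit points \<open>k1\<close> and \<open>k2\<close>. As
  \<open>y\<close> is reached forwards from \<open>x\<close>, symmetry relates \<open>k1\<close> and
  \<open>k2\<close> in both directions, and between generic points the relation is inclusion of
  orbit closures. So the classes of \<open>x\<close> and \<open>y\<close> coincide, and they enclose
  that of \<open>p\<close> from above while the orbit of \<open>y\<close> bounds it from
  below.\<close>

lemma NF_class:
  assumes p: "p \<in> P" "NF p"
  shows "\<exists>k. gen k & ecl K v P p = ecl K v P k"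
proof -
  have pK: "p \<in> K" using p PK by blast
  obtain y where y: "y \<in> gplus K v P p" "\<And>q. q \<in> P ==> y \<notin> wst K v q"
    using p(2) by (auto simp: NF_def)
  obtain x where x: "x \<in> gplus K (rv v) P p" "\<And>q. q \<in> P ==> x \<notin> wst K (rv v) q"
    using p(2) NF_iff[OF p(1)] by (auto simp: r.NF_def)
  have yK: "y \<in> K" and xK: "x \<in> K" using x y gplus_subset[OF pK] r.gplus_subset[OF pK] by auto
  obtain q where q: "q \<in> P" "y \<in> wst K (rv v) q" by (rule gplus_wu[OF p(1) y(1)])
  obtain q' where q': "q' \<in> P" "x \<in> wst K v q'" using r.gplus_wu[OF p(1) x(1)] by auto
  obtain k1 where k1: "gen k1" "ecl K v P y = ecl K v P k1" "ecl K v P y \<subseteq> closure (orb v y)"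
    using nontriv[OF q y(2)] by blast
  have "x \<in> wst K (rv (rv v)) q'" using q' by simp
  from r.nontriv[OF q'(1) this x(2)]
  obtain k2 where k2: "gen k2" "ecl K v P x = ecl K v P k2"
    by (auto simp: ecl_rv gen_rv)
  have kK: "k1 \<in> K" "k2 \<in> K" using k1 k2 by (auto simp: gen_def)
  have px: "p \<in> gplus K v P x" using r.gplus_sym[OF pK x(1)] by simp
  have py: "p \<in> gplus K (rv v) P y" by (rule gplus_sym[OF pK y(1)])
  have yx: "y \<in> gplus K v P x" by (rule gplus_trans[OF xK px y(1)])
  have xy: "x \<in> gplus K (rv v) P y" by (rule gplus_sym[OF xK yx])
  have sub: "gplus K v P z \<subseteq> ecl K v P z" "gplus K (rv v) P z \<subseteq> ecl K v P z" for z
    using closure_subset[of "eorb K v P z"] by (auto simp: ecl_def eorb_def)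
  have "k2 \<in> ecl K v P y" using yx sub(1) k2(2) ecl_sym[OF kK(2)] by blast
  then have A: "ecl K v P k2 \<subseteq> ecl K v P k1"
    unfolding k1(2) gen_ecl[OF k1(1)] gen_ecl[OF k2(1)] by (rule closure_orb_mono[OF kK(1)])
  have "k1 \<in> ecl K v P x" using xy sub(2) k1(2) ecl_sym[OF kK(1)] by blast
  then have "ecl K v P k1 \<subseteq> ecl K v P k2"
    unfolding k2(2) gen_ecl[OF k1(1)] gen_ecl[OF k2(1)] by (rule closure_orb_mono[OF kK(2)])
  with A have M: "ecl K v P x = ecl K v P k1" "ecl K v P y = ecl K v P k1" using k1 k2 by auto
  have "gplus K v P p \<subseteq> ecl K v P k1"
    using gplus_trans[OF xK px] sub(1)[of x] M by blast
  moreover have "gplus K (rv v) P p \<subseteq> ecl K v P k1"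
    using r.gplus_trans[OF yK py] sub(2)[of y] M by blast
  ultimately have 1: "ecl K v P p \<subseteq> ecl K v P k1"
    unfolding ecl_def[of K v P p] eorb_def[of K v P p] by (intro closure_minimal closed_ecl) auto
  have "orb v y \<subseteq> gplus K v P p" using gplus_v[OF pK y(1)] by (auto simp: orb_def)
  then have "closure (orb v y) \<subseteq> ecl K v P p"
    unfolding ecl_def by (intro closure_mono) (auto simp: eorb_def)
  then have "ecl K v P k1 \<subseteq> ecl K v P p" using k1 by blast
  with 1 k1(1) show ?thesis by blast
qed

text \<open>When \<open>p\<close> has a generic representative \<open>k\<close>, the point at issue
  is a nongeneric \<open>z\<close> in the closure of the orbit of \<open>k\<close>. Its own orbit
  closure contains a saddle \<open>q\<close>, whose class bounds that of \<open>z\<close> and is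
  itself bounded by the class of \<open>k\<close>.\<close>

lemma saddle_class:
  assumes p: "p \<in> P" and z: "z \<in> ecl K v P p"
  shows "ecl K v P z = ecl K v P p"
proof (cases "NF p")
  case False
  then show ?thesis using connection_class p z by blast
next
  case True
  obtain k where k: "gen k" "ecl K v P p = ecl K v P k" using NF_class[OF p True] by blast
  have kK: "k \<in> K" using k by (auto simp: gen_def)
  have zk: "z \<in> closure (orb v k)" if "z \<in> ecl K v P k" for z using that gen_ecl[OF k(1)] by simp
  have sad: "ecl K v P q \<subseteq> ecl K v P k" if q: "q \<in> P" "q \<in> ecl K v P k" for q
  proof -
    have kq: "k \<in> ecl K v P q" by (rule ecl_sym[OF kK q(2)])
    show ?thesis
    proof (cases "NF q")
      case False
      then show ?thesis using connection_class[OF q(1) False kq] by simp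
    next
      case True
      obtain k' where k': "gen k'" "ecl K v P q = ecl K v P k'" using NF_class[OF q(1) True] by blast
      have "k' \<in> ecl K v P k" using kq k' ecl_sym[of k' k] by (auto simp: gen_def)
      then show ?thesis
        unfolding k'(2) gen_ecl[OF k'(1)] gen_ecl[OF k(1)] by (rule closure_orb_mono[OF kK])
    qed
  qed
  have zK: "z \<in> K" using z p PK ecl_subset by blast
  have zk': "z \<in> closure (orb v k)" using z k zk by simp
  have "ecl K v P z \<subseteq> ecl K v P k"
  proof (cases "gen z")
    case True
    then show ?thesis
      unfolding gen_ecl[OF True] gen_ecl[OF k(1)] using closure_orb_mono[OF kK zk'] by blast
  next
    case False
    then obtain q where q: "q \<in> P" "z \<in> wst K v q \<or> z \<in> wst K (rv v) q" using zK by (auto simp: gen_def)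
    then have "q \<in> olim v z \<union> olim (rv v) z" using wst_olim r.wst_olim by auto
    then have qz: "q \<in> closure (orb v z)" using closure_orb[OF zK] by blast
    have "q \<in> ecl K v P k" using closure_orb_mono[OF kK zk'] qz gen_ecl[OF k(1)] by blast
    then have "ecl K v P q \<subseteq> ecl K v P k" by (rule sad[OF q(1)])
    moreover have "ecl K v P z \<subseteq> ecl K v P q" by (rule ecl_limit[OF zK qz])
    ultimately show ?thesis by blast
  qed
  moreover have "ecl K v P k \<subseteq> ecl K v P z" by (rule ecl_limit[OF kK zk'])
  ultimately show ?thesis using k by blast
qed

text \<open>A class with a saddle in it is the class of that saddle. In a class without one all
  points are generic, since a separatrix brings its saddle along as a limit point, and then only
  orbit closures are compared.\<close>

theorem ecl_class:
  assumes z: "z \<in> K" and w: "w \<in> ecl K v P z"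
  shows "ecl K v P w = ecl K v P z"
proof (cases "\<exists>p\<in>P. p \<in> ecl K v P z")
  case True
  then obtain p where p: "p \<in> P" "p \<in> ecl K v P z" by blast
  have "ecl K v P z = ecl K v P p" by (rule saddle_class[OF p(1) ecl_sym[OF z p(2)]])
  then show ?thesis using saddle_class[OF p(1), of w] w by simp
next
  case False
  have nolim: "gen y" if y: "y \<in> K" "closure (orb v y) \<subseteq> ecl K v P z" for y
  proof (rule ccontr)
    assume "\<not> gen y"
    then obtain q where q: "q \<in> P" "y \<in> wst K v q \<or> y \<in> wst K (rv v) q" using y(1) by (auto simp: gen_def)
    then have "q \<in> olim v y \<union> olim (rv v) y" using wst_olim r.wst_olim by auto
    then show False using closure_orb[OF y(1)] y(2) False q(1) by blast
  qed
  have gz: "gen z" by (rule nolim[OF z closure_orb_ecl])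
  have wz: "w \<in> closure (orb v z)" using w gen_ecl[OF gz] by simp
  have wK: "w \<in> K" using w ecl_subset[OF z] by blast
  have cw: "closure (orb v w) \<subseteq> closure (orb v z)" by (rule closure_orb_mono[OF z wz])
  have "gen w" by (rule nolim[OF wK]) (use cw gen_ecl[OF gz] in simp)
  then show ?thesis using cw gen_ecl[OF gz] gen_ecl ecl_limit[OF z wz] by auto
qed

end

section \<open>Flow boxes\<close>

context cflow
begin

lemma tube:
  assumes x: "x \<in> K" and N: "open N" "\<And>t. A \<le> t ==> t \<le> B ==> v t x \<in> N"
  obtains d where "d > 0" "\<And>z t. z \<in> K ==> dist z x < d ==> A \<le> t ==> t \<le> B ==> v t z \<in> N"
proof (rule ccontr)
  assume not: "\<not> thesis"
  have "\<exists>z t. z \<in> K & dist z x < inverse (real (Suc n)) & A \<le> t & t \<le> B & v t z \<notin> N" for n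
  proof (rule ccontr)
    assume "\<not> ?thesis"
    then show False using not that[of "inverse (real (Suc n))"] by auto
  qed
  then obtain z t where zt: "\<And>n. z n \<in> K" "\<And>n. dist (z n) x < inverse (real (Suc n))"
     "\<And>n. A \<le> t n" "\<And>n. t n \<le> B" "\<And>n. v (t n) (z n) \<notin> N"
    by metis
  have "compact {A..B}" by simp
  then obtain l r where lr: "l \<in> {A..B}" "strict_mono r" "(t \<circ> r) \<longlonglongrightarrow> l"
    unfolding compact_eq_seq_compact_metric by (rule seq_compactE[of _ t]) (use zt in auto)
  have "z \<longlonglongrightarrow> x"
    using zt(2) by (intro metric_tendsto_imp_tendsto[OF LIMSEQ_inverse_real_of_nat]) (auto simp: less_imp_le)
  then have zr: "(z \<circ> r) \<longlonglongrightarrow> x" using lr(2) by (rule LIMSEQ_subseq_LIMSEQ)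
  have "(%n. v ((t \<circ> r) n) ((z \<circ> r) n)) \<longlonglongrightarrow> v l x"
    by (rule tendsto_v[OF lr(3) zr x]) (simp add: zt)
  then have "v l x \<in> - N"
    by (rule closed_sequentially[rotated 2]) (use N(1) zt(5) in auto)
  then show False using N(2)[of l] lr(1) by auto
qed

lemma homeo_v: "homeomorphism K K (v t) (v (- t))"
  by (auto simp: homeomorphism_def inK image_iff intro!: cont_v continuous_intros)
     (metis inK v_neg)+

lemma openin_v: "openin (top_of_set K) S ==> openin (top_of_set K) (v t ` S)"
  by (rule homeomorphism_imp_open_map[OF homeo_v])

text \<open>Bebutov's function: the mean distance to \<open>x\<close> over a time interval increases along the
  orbits near \<open>x\<close>.\<close>

lemma bebutov:
  assumes x: "x \<in> K" and nf: "v t0 x \<noteq> x"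
  obtains f :: "'m => real" and e d where "continuous_on K f" "e > 0" "d > 0"
    "\<And>z s t. z \<in> K ==> dist z x < d ==> -e \<le> s ==> s < t ==> t \<le> e ==> f (v s z) < f (v t z)"
proof -
  define q where "q = \<bar>t0\<bar>"
  have q: "v q x \<noteq> x" "q > 0"
  proof -
    show "v q x \<noteq> x"
    proof (cases "t0 \<ge> 0")
      case False
      then have "v q x = v (- t0) x" by (simp add: q_def)
      then show ?thesis using nf x by (metis v_neg(2))
    qed (use nf q_def in auto)
    then show "q > 0" using x v0 unfolding q_def by (cases "t0 = 0") auto
  qed
  define k where "k z s = dist (v s z) x" for z s
  define f where "f z = integral {0..q} (k z)" for z
  have contk: "continuous_on (K \<times> UNIV) (%(z, s). k z s)"
    unfolding k_def case_prod_unfold by (intro continuous_intros cont_v) auto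
  have contk1: "continuous_on S (k z)" if "z \<in> K" for z S
    unfolding k_def using that by (intro continuous_intros cont_v) auto
  have contf: "continuous_on K f"
    unfolding f_def using integral_continuous_on_param[of K 0 q k] contk
    by (auto intro: continuous_on_subset)
  \<comment> \<open>Along the orbit of \<open>z\<close> the function \<open>f\<close> has the
    derivative \<open>h z\<close>. For \<open>z = x\<close> it is positive at time 0, because the
    subtracted distance vanishes there.\<close>
  define h where "h z s = k z (s + q) - k z s" for z s
  have h0: "h x 0 > 0" using q x by (simp add: h_def k_def v0)
  have conth: "continuous_on (K \<times> UNIV) (%p. h (fst p) (snd p))"
    unfolding h_def k_def by (intro continuous_intros cont_v) auto
  define c where "c = h x 0 / 2"
  have "c > 0" using h0 by (simp add: c_def)
  obtain d where d: "d > 0" "\<And>p. p \<in> K \<times> UNIV ==> dist p (x, 0) < d ==> dist (h (fst p) (snd p)) (h x 0) < c"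
    using conth x \<open>c > 0\<close> unfolding continuous_on_iff
    by (metis (no_types, lifting) SigmaI UNIV_I fst_conv snd_conv)
  have hc: "h z s \<ge> c" if "z \<in> K" "dist z x < d/2" "\<bar>s\<bar> < d/2" for z s
  proof -
    have "dist (z, s) (x, 0) \<le> dist z x + dist s 0"
      unfolding dist_Pair_Pair by (rule sqrt_sum_squares_le_sum) auto
    also have "\<dots> < d" using that by simp
    finally have "dist (h z s) (h x 0) < c" using d(2)[of "(z, s)"] that by auto
    then show ?thesis by (simp add: c_def dist_real_def abs_if split: if_splits)
  qed
  have incr: "f (v s z) < f (v t z)"
    if z: "z \<in> K" "dist z x < d/2" and st: "-(d/4) \<le> s" "s < t" "t \<le> d/4" for z s t
  proof -
    have eq: "f (v u z) = integral {u..u+q} (k z)" for u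
    proof -
      have "f (v u z) = integral {u-u..u+q-u} (%r. k z (r + u))"
        unfolding f_def k_def using z by (simp add: vadd)
      then show ?thesis by (simp only: integral_shift_real_ivl)
    qed
    have int: "k z integrable_on {a..b}" for a b
      using contk1[OF z(1)] by (rule integrable_continuous_interval)
    have A: "integral {s..t} (k z) + integral {t..t+q} (k z) = integral {s..t+q} (k z)"
      using st q int by (intro Henstock_Kurzweil_Integration.integral_combine) auto
    have B: "integral {s..s+q} (k z) + integral {s+q..t+q} (k z) = integral {s..t+q} (k z)"
      using st q int by (intro Henstock_Kurzweil_Integration.integral_combine) auto
    have C: "integral {s+q..t+q} (k z) = integral {s..t} (%r. k z (r + q))"
      using integral_shift_real_ivl[of "s+q" q "t+q" "k z"] by simp
    have conts: "continuous_on {s..t} (%r. k z (r + q))"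
      using z unfolding k_def by (intro continuous_intros cont_v) auto
    have "f (v t z) - f (v s z) = integral {s..t} (%r. k z (r + q)) - integral {s..t} (k z)"
      using A B C by (simp add: eq)
    also have "\<dots> = integral {s..t} (h z)"
      unfolding h_def using int conts integrable_continuous_interval
      by (subst Henstock_Kurzweil_Integration.integral_diff) auto
    also have "\<dots> \<ge> integral {s..t} (%_. c)"
    proof (rule integral_le)
      show "h z integrable_on {s..t}"
        unfolding h_def using int conts integrable_continuous_interval by (intro integrable_diff) auto
      show "c \<le> h z r" if "r \<in> {s..t}" for r
        using that st z d(1) by (intro hc) auto
    qed auto
    finally have "f (v t z) - f (v s z) \<ge> c * (t - s)" using st by (simp add: mult.commute)
    moreover have "c * (t - s) > 0" using \<open>c > 0\<close> st by simp
    ultimately show ?thesis by linarith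
  qed
  show thesis
    by (rule that[OF contf, of "d/4" "d/2"]) (use d(1) incr in auto)
qed

end

section \<open>Local cross sections\<close>

context cflow
begin

lemma small_time:
  assumes x: "x \<in> K" and N: "open N" "x \<in> N"
  obtains h where "h > 0" "\<And>t. \<bar>t\<bar> \<le> h ==> v t x \<in> N"
proof -
  have "continuous_on UNIV (%t. v t x)" using x by (intro cont_v continuous_intros) auto
  then have "open ((%t. v t x) -` N)" using N(1) by (simp add: open_vimage)
  moreover have "0 \<in> (%t. v t x) -` N" using N x v0 by simp
  ultimately obtain h where h: "h > 0" "cball 0 h \<subseteq> (%t. v t x) -` N"
    using open_contains_cball by blast
  show thesis by (rule that[OF h(1)]) (use h(2) in \<open>auto simp: dist_real_def subset_iff\<close>)
qed

text \<open>The section is a level set of Bebutov's function. Its strict growth along orbits makes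
  crossings unique, and the intermediate value theorem makes them exist and depend continuously on
  the point. The last property is stated for all \<open>n\<close> and \<open>N\<close> because flow
  boxes need arbitrarily short projections into arbitrarily small parts of the section.\<close>

lemma local_section:
  assumes x: "x \<in> K" and nf: "v t0 x \<noteq> x" and N0: "open N0" "x \<in> N0"
  obtains Sec j where "j > 0" "x \<in> Sec" "Sec \<subseteq> K"
    "\<And>y t. y \<in> Sec ==> \<bar>t\<bar> \<le> j ==> v t y \<in> N0"
    "\<And>y t. y \<in> Sec ==> \<bar>t\<bar> \<le> j ==> v t y \<in> Sec ==> t = 0"
    "\<And>n N. n > 0 ==> open N ==> x \<in> N ==> \<exists>f>0. \<exists>q. continuous_on (ball x f \<inter> K) q &
        (\<forall>z\<in>ball x f \<inter> K. \<bar>q z\<bar> < n & v (q z) z \<in> Sec \<inter> N)"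
proof -
  obtain i :: "'m => real" and e d where i: "continuous_on K i" "e > 0" "d > 0" and
    inc: "\<And>z s t. z \<in> K ==> dist z x < d ==> -e \<le> s ==> s < t ==> t \<le> e ==> i (v s z) < i (v t z)"
    by (rule bebutov[OF x nf]) blast
  obtain h0 where h0: "h0 > 0" "\<And>t. \<bar>t\<bar> \<le> h0 ==> v t x \<in> N0"
    by (rule small_time[OF x N0]) blast
  define j where "j = min e h0"
  have j: "j > 0" "j \<le> e" using i h0 by (auto simp: j_def)
  obtain d1 where d1: "d1 > 0" "\<And>z t. z \<in> K ==> dist z x < d1 ==> -j \<le> t ==> t \<le> j ==> v t z \<in> N0"
    by (rule tube[OF x N0(1), of "-j" j]) (use h0(2) in \<open>auto simp: j_def\<close>)
  define c where "c = i x"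
  define r where "r = min d d1"
  have r: "r > 0" "r \<le> d" "r \<le> d1" using i d1 by (auto simp: r_def)
  define Sec where "Sec = {z \<in> K. dist z x < r & i z = c}"
  have contiv: "continuous_on K (%z. i (v t z))" for t
    by (rule continuous_on_compose2[OF i(1)]) (auto intro!: cont_v continuous_intros simp: inK)
  have near: "\<exists>f>0. \<forall>z\<in>K. dist z y < f --> i (v s z) < c & c < i (v t z)"
    if y: "y \<in> K" "i (v s y) < c" "c < i (v t y)" for y s t
  proof -
    obtain a where a: "a > 0" "\<And>z. z \<in> K ==> dist z y < a ==> dist (i (v s z)) (i (v s y)) < c - i (v s y)"
      using contiv[of s] y unfolding continuous_on_iff by (metis diff_gt_0_iff_gt)
    obtain b where b: "b > 0" "\<And>z. z \<in> K ==> dist z y < b ==> dist (i (v t z)) (i (v t y)) < i (v t y) - c"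
      using contiv[of t] y unfolding continuous_on_iff by (metis diff_gt_0_iff_gt)
    have "i (v s z) < c & c < i (v t z)" if "z \<in> K" "dist z y < min a b" for z
      using a(2)[of z] b(2)[of z] that by (auto simp: dist_real_def)
    then show ?thesis using a(1) b(1) by (intro exI[of _ "min a b"]) auto
  qed
  show thesis
  proof (rule that)
    show "j > 0" by fact
    show "x \<in> Sec" using x r by (simp add: Sec_def c_def)
    show "Sec \<subseteq> K" by (auto simp: Sec_def)
    show "v t y \<in> N0" if "y \<in> Sec" "\<bar>t\<bar> \<le> j" for y t
      using d1(2)[of y t] that r by (auto simp: Sec_def)
    show "t = 0" if "y \<in> Sec" "\<bar>t\<bar> \<le> j" "v t y \<in> Sec" for y t
    proof (rule ccontr)
      assume "t \<noteq> 0"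
      have *: "y \<in> K" "dist y x < d" "i (v t y) = c" "i (v 0 y) = c"
        using that r by (auto simp: Sec_def v0)
      then show False
        using inc[of y 0 t] inc[of y t 0] that j \<open>t \<noteq> 0\<close> by (cases "t > 0") auto
    qed
    show "\<exists>f>0. \<exists>q. continuous_on (ball x f \<inter> K) q &
        (\<forall>z\<in>ball x f \<inter> K. \<bar>q z\<bar> < n & v (q z) z \<in> Sec \<inter> N)"
      if n: "n > 0" and N: "open N" "x \<in> N" for n N
    proof -
      have NN: "open (N \<inter> ball x r)" "x \<in> N \<inter> ball x r" using N r by auto
      obtain h where h: "h > 0" "\<And>t. \<bar>t\<bar> \<le> h ==> v t x \<in> N \<inter> ball x r"
        by (rule small_time[OF x NN]) blast
      define H where "H = min (h/2) (min (n/2) j)"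
      have H: "H > 0" "H < n" "H \<le> j" "H \<le> e" "H \<le> h" using h n j by (auto simp: H_def)
      obtain f1 where f1: "f1 > 0" "\<And>z t. z \<in> K ==> dist z x < f1 ==> -H \<le> t ==> t \<le> H ==> v t z \<in> N \<inter> ball x r"
        by (rule tube[OF x NN(1), of "-H" H]) (use h(2) H in auto)
      have "i (v (-H) x) < c" "c < i (v H x)"
        using inc[OF x, of "-H" 0] inc[OF x, of 0 H] H i x by (auto simp: c_def v0)
      then obtain f2 where f2: "f2 > 0" "\<And>z. z \<in> K ==> dist z x < f2 ==> i (v (-H) z) < c & c < i (v H z)"
        using near[OF x] by blast
      define f where "f = min f1 (min f2 r)"
      have f: "f > 0" using f1 f2 r by (simp add: f_def)
      define q where "q z = (SOME t. -H < t & t < H & i (v t z) = c)" for z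
      have q: "-H < q z & q z < H & i (v (q z) z) = c" if z: "z \<in> ball x f \<inter> K" for z
        unfolding q_def
      proof (rule someI_ex)
        have zz: "z \<in> K" "dist z x < f2" using z by (auto simp: f_def dist_commute)
        have "continuous_on {-H..H} (%t. i (v t z))"
          by (rule continuous_on_compose2[OF i(1)]) (use zz in \<open>auto intro!: cont_v continuous_intros simp: inK\<close>)
        then obtain t where "-H \<le> t" "t \<le> H" "i (v t z) = c"
          using IVT'[of "%t. i (v t z)" "-H" c H] f2(2)[OF zz] H by force
        moreover have "t \<noteq> H" "t \<noteq> -H" using f2(2)[OF zz] \<open>i (v t z) = c\<close> by auto
        ultimately show "\<exists>t. -H < t & t < H & i (v t z) = c" by (intro exI[of _ t]) auto
      qed
      have incz: "i (v s z) < i (v t z)" if "z \<in> ball x f \<inter> K" "-H \<le> s" "s < t" "t \<le> H" for z s t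
        using inc[of z s t] that H r by (auto simp: f_def dist_commute)
      have "continuous_on (ball x f \<inter> K) q"
        unfolding continuous_on_iff
      proof (intro ballI allI impI)
        fix y and e' :: real assume "e' > 0"
        assume y: "y \<in> ball x f \<inter> K"
        define g where "g = min (e'/2) (min (H - q y) (H + q y))"
        have g: "g > 0" "g < e'" "-H \<le> q y - g" "q y + g \<le> H"
          using q[OF y] \<open>e' > 0\<close> by (auto simp: g_def)
        have "i (v (q y - g) y) < c" "c < i (v (q y + g) y)"
          using incz[OF y, of "q y - g" "q y"] incz[OF y, of "q y" "q y + g"] q[OF y] g by auto
        then obtain f3 where f3: "f3 > 0"
          "\<And>z. z \<in> K ==> dist z y < f3 ==> i (v (q y - g) z) < c & c < i (v (q y + g) z)"
          using near[of y] y by blast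
        have "dist (q z) (q y) < e'" if z: "z \<in> ball x f \<inter> K" "dist z y < f3" for z
        proof -
          have "\<not> q z \<le> q y - g"
            using incz[OF z(1), of "q z" "q y - g"] q[OF z(1)] f3(2)[of z] z q[OF y] g
            by (cases "q z = q y - g") auto
          moreover have "\<not> q z \<ge> q y + g"
            using incz[OF z(1), of "q y + g" "q z"] q[OF z(1)] f3(2)[of z] z q[OF y] g
            by (cases "q z = q y + g") auto
          ultimately show ?thesis using g by (auto simp: dist_real_def)
        qed
        then show "\<exists>d>0. \<forall>x'\<in>ball x f \<inter> K. dist x' y < d --> dist (q x') (q y) < e'"
          using f3(1) by blast
      qed
      moreover have "\<bar>q z\<bar> < n & v (q z) z \<in> Sec \<inter> N" if z: "z \<in> ball x f \<inter> K" for z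
        using q[OF z] f1(2)[of z "q z"] z H by (auto simp: Sec_def f_def dist_commute inK)
      ultimately show ?thesis using f by blast
    qed
  qed
qed

end

section \<open>Flow boxes of surfaces, also at boundary points\<close>

locale sfc = cflow +
  assumes chart: "x \<in> K ==> \<exists>U V f g. openin (top_of_set K) U & x \<in> U &
    openin (top_of_set {z :: real^2. 0 \<le> z $ 2}) V & homeomorphism U V f g"
begin

lemma sfc_rv: "sfc K (rv v)"
proof -
  interpret r: cflow K "rv v" by (rule cflow_rv)
  show ?thesis by unfold_locales (rule chart)
qed

definition fcell :: "(real => 'a) => real set => real => 'a set" where
  "fcell j I h = (%(s, t). v t (j s)) ` (I \<times> {-h<..<h})"

text \<open>A cross section through \<open>x\<close> is an arc or, at a boundary point of the surface, an arc
  starting in \<open>x\<close>.\<close>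

definition fbox :: "'a => real => real => real => (real => 'a) => bool" where
  "fbox x a b h j \<longleftrightarrow> a \<le> 0 & 0 < b & 0 < h & continuous_on {a..b} j & j ` {a..b} \<subseteq> K & j 0 = x &
     inj_on (%(s, t). v t (j s)) ({a..b} \<times> {-h..h}) &
     openin (top_of_set K) (fcell j ({a<..<b} \<union> {0}) h)"


text \<open>Invariance of domain makes the box over an open arc open in the surface. If no arc of
  the section passes through \<open>x\<close>, then \<open>x\<close> behaves like a boundary point:
  invariance of dimension still gives an arc starting in \<open>x\<close>, and this arc contains all
  nearby points of the section, since another arc could branch off from it only in \<open>x\<close>
  and would extend it to an arc through \<open>x\<close>.\<close>

theorem flow_box:
  assumes x: "x \<in> K" and nf: "v t0 x \<noteq> x"
  shows "\<exists>a b h j. fbox x a b h j"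
proof -
  define Hp where "Hp = {z :: real^2. 0 \<le> z $ 2}"
  have convH: "convex Hp"
    unfolding Hp_def convex_def by auto
  obtain U V f g where U: "openin (top_of_set K) U" "x \<in> U" and V: "openin (top_of_set Hp) V"
    and hom: "homeomorphism U V f g"
    using chart[OF x] unfolding Hp_def by blast
  have UK: "U \<subseteq> K" using U(1) by (rule openin_imp_subset)
  have VH: "V \<subseteq> Hp" using V by (rule openin_imp_subset)
  have gf: "\<And>y. y \<in> U ==> g (f y) = y" and fg: "\<And>y. y \<in> V ==> f (g y) = y"
    and fV: "\<And>y. y \<in> U ==> f y \<in> V" and gU: "\<And>y. y \<in> V ==> g y \<in> U"
    and contf: "continuous_on U f" and contg: "continuous_on V g"
    using hom by (auto simp: homeomorphism_def)
  obtain N0 where N0: "open N0" "U = K \<inter> N0" using U(1) unfolding openin_open by blast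
  have xN0: "x \<in> N0" using U N0 by auto
  obtain Sec m where m: "m > 0" and xS: "x \<in> Sec" and SK: "Sec \<subseteq> K" and
    SN: "\<And>y t. y \<in> Sec ==> \<bar>t\<bar> \<le> m ==> v t y \<in> N0" and
    Suniq: "\<And>y t. y \<in> Sec ==> \<bar>t\<bar> \<le> m ==> v t y \<in> Sec ==> t = 0" and
    proj: "\<And>n N. n > 0 ==> open N ==> x \<in> N ==> \<exists>\<delta>>0. \<exists>i. continuous_on (ball x \<delta> \<inter> K) i &
        (\<forall>z\<in>ball x \<delta> \<inter> K. \<bar>i z\<bar> < n & v (i z) z \<in> Sec \<inter> N)"
    by (rule local_section[OF x nf N0(1) xN0]) blast
  have SU: "v t y \<in> U" if "y \<in> Sec" "\<bar>t\<bar> \<le> m" for y t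
    using SN[OF that] that SK inK N0 by blast
  have Seq: "t = s & y = z" if "y \<in> Sec" "z \<in> Sec" "\<bar>t\<bar> \<le> m/2" "\<bar>s\<bar> \<le> m/2" "v t y = v s z" for y z s t
  proof -
    have yz: "y \<in> K" "z \<in> K" using that SK by auto
    have "v (t - s) y = z" using that(5) v_eq_iff[OF yz] by simp
    moreover have "\<bar>t - s\<bar> \<le> m" using that by linarith
    ultimately have "t - s = 0" using Suniq[of y "t - s"] that by simp
    then show ?thesis using \<open>v (t - s) y = z\<close> yz v0 by simp
  qed
  have arc_inj: "inj_on (%(s, t). v t (e s)) ({a..b} \<times> {-h..h})"
    if e: "inj_on e {a..b}" "e ` {a..b} \<subseteq> Sec" and h: "h \<le> m/2" for e a b h
  proof (rule inj_onI, clarify)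
    fix s t s' t' assume *: "s \<in> {a..b}" "t \<in> {-h..h}" "s' \<in> {a..b}" "t' \<in> {-h..h}"
       "v t (e s) = v t' (e s')"
    then have "t = t' & e s = e s'" using e(2) h by (intro Seq) auto
    then show "s = s' & t = t'" using e(1) * by (auto dest: inj_onD)
  qed
  \<comment> \<open>Read in the chart, the box is an injective continuous image of an open planar
    set, and it is open in the plane, even when the chart takes its values in the half
    plane.\<close>
  have arc_open: "openin (top_of_set K) (fcell e {a<..<b} h)"
    if e: "continuous_on {a..b} e" "inj_on e {a..b}" "e ` {a..b} \<subseteq> Sec" and h: "h \<le> m/2" for e a b h
  proof -
    define F where "F = (%p. f (v (snd p) (e (fst p))))"
    let ?D = "{a<..<b} \<times> {-h<..<h}"
    have sub: "v (snd p) (e (fst p)) \<in> U" if "p \<in> ?D" for p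
      using that e(3) h m by (intro SU) auto
    have "continuous_on ?D F"
      unfolding F_def
    proof (rule continuous_on_compose2[OF contf])
      have "continuous_on ?D (%p. e (fst p))"
        by (rule continuous_on_compose2[OF e(1)]) (auto intro: continuous_intros)
      then show "continuous_on ?D (%p. v (snd p) (e (fst p)))"
        using e(3) SK by (intro cont_v continuous_intros) (auto simp: image_subset_iff subset_iff)
    qed (use sub in auto)
    moreover have "inj_on F ?D"
    proof (rule inj_onI)
      fix p q assume *: "p \<in> ?D" "q \<in> ?D" "F p = F q"
      then have "v (snd p) (e (fst p)) = v (snd q) (e (fst q))"
        using gf sub unfolding F_def by metis
      then show "p = q"
        using inj_onD[OF arc_inj[OF e(2,3) h], of p q] * by (auto simp: case_prod_unfold)
    qed
    moreover have "open ?D" by (intro open_Times) auto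
    ultimately have "open (F ` ?D)"
      by (intro invariance_of_domain_gen) auto
    then have "openin (top_of_set U) (U \<inter> f -` (F ` ?D))"
      using contf by (simp add: continuous_openin_preimage_gen)
    moreover have "U \<inter> f -` (F ` ?D) = fcell e {a<..<b} h"
    proof
      show "U \<inter> f -` (F ` ?D) \<subseteq> fcell e {a<..<b} h"
      proof
        fix y assume "y \<in> U \<inter> f -` (F ` ?D)"
        then obtain p where p: "p \<in> ?D" "y \<in> U" "f y = f (v (snd p) (e (fst p)))"
          by (auto simp: F_def)
        then have "y = v (snd p) (e (fst p))" using gf sub[OF p(1)] by metis
        then show "y \<in> fcell e {a<..<b} h"
          unfolding fcell_def using p(1) by (intro image_eqI[of _ _ p]) (auto simp: case_prod_unfold)
      qed
      show "fcell e {a<..<b} h \<subseteq> U \<inter> f -` (F ` ?D)"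
      proof
        fix y assume "y \<in> fcell e {a<..<b} h"
        then obtain p where p: "p \<in> ?D" "y = v (snd p) (e (fst p))"
          by (auto simp: fcell_def)
        then show "y \<in> U \<inter> f -` (F ` ?D)" using sub[OF p(1)] by (auto simp: F_def)
      qed
    qed
    ultimately show ?thesis using U(1) openin_trans by metis
  qed
  define PA where "PA N c y \<longleftrightarrow> continuous_on {0..1::real} c & inj_on c {0..1} &
    c ` {0..1} \<subseteq> Sec \<inter> N & c 0 = x & c 1 = y" for N c y
  \<comment> \<open>A neighbourhood \<open>W\<close> of \<open>x\<close> is pushed along the flow
    into the section, in times below \<open>n\<close>, and each of its points lands in
    \<open>x\<close> or can be joined to \<open>x\<close> by an arc of the section inside
    \<open>N\<close>. The nonempty open planar set \<open>Q\<close> is carried along for the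
    dimension argument below.\<close>
  define SW where "SW n N W i Q \<longleftrightarrow> openin (top_of_set K) W & x \<in> W & open Q & Q \<noteq> {} & Q \<subseteq> V &
     g ` Q \<subseteq> W & continuous_on W i &
     (\<forall>z\<in>W. \<bar>i z\<bar> < n & (v (i z) z = x \<or> (\<exists>c. PA N c (v (i z) z))))" for n N W i Q
  have S3: "\<exists>W i Q. SW n N W i Q"
    if n: "n > 0" "n \<le> m" and N: "open N" "x \<in> N" for n N
  proof -
    obtain \<delta> i where \<delta>: "\<delta> > 0" and conti: "continuous_on (ball x \<delta> \<inter> K) i"
      and i: "\<And>z. z \<in> ball x \<delta> \<inter> K ==> \<bar>i z\<bar> < n & v (i z) z \<in> Sec \<inter> N"
      using proj[OF n(1) N] by blast
    have ix: "i x = 0" using i[of x] x xS \<delta> n by (intro Suniq[of x]) auto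
    obtain e1 where e1: "e1 > 0" "\<And>y. y \<in> Hp ==> dist y (f x) < e1 ==> y \<in> V"
      using V fV[OF U(2)] unfolding openin_euclidean_subtopology_iff by blast
    obtain e2 where e2: "e2 > 0" "\<And>y. y \<in> V ==> dist y (f x) < e2 ==> dist (g y) (g (f x)) < \<delta>"
      using contg fV[OF U(2)] \<delta> unfolding continuous_on_iff by blast
    define \<rho> where "\<rho> = min e1 e2"
    define B where "B = ball (f x) \<rho> \<inter> Hp"
    have BV: "B \<subseteq> V" using e1(2) by (auto simp: B_def \<rho>_def dist_commute)
    have Bcx: "convex B" unfolding B_def by (intro convex_Int convex_ball convH)
    have gB: "g ` B \<subseteq> ball x \<delta> \<inter> K"
    proof clarify
      fix y assume y: "y \<in> B"
      then have "y \<in> V" "dist y (f x) < e2" using BV by (auto simp: B_def \<rho>_def dist_commute)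
      then show "g y \<in> ball x \<delta> \<inter> K" using e2(2) gU UK gf[OF U(2)] by (auto simp: dist_commute)
    qed
    have fxB: "f x \<in> B" using e1 e2 fV[OF U(2)] VH by (auto simp: B_def \<rho>_def)
    have homVU: "homeomorphism V U g f" using hom by (rule homeomorphism_symD)
    have "openin (top_of_set V) B"
    proof -
      have "B = V \<inter> ball (f x) \<rho>" using BV VH by (auto simp: B_def)
      then show ?thesis by (simp add: openin_open_Int)
    qed
    then have "openin (top_of_set U) (g ` B)" by (rule homeomorphism_imp_open_map[OF homVU])
    then have opW: "openin (top_of_set K) (g ` B)" using U(1) openin_trans by metis
    have xW: "x \<in> g ` B" using fxB gf[OF U(2)] by (metis imageI)
    define Q where "Q = ball (f x) \<rho> \<inter> {z :: real^2. 0 < z $ 2}"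
    have "open Q" unfolding Q_def
      by (intro open_Int open_ball open_halfspace_component_gt_cart)
    have "Q \<subseteq> B" by (auto simp: Q_def B_def Hp_def)
    have "Q \<noteq> {}"
    proof -
      have \<rho>: "\<rho> > 0" using e1 e2 by (simp add: \<rho>_def)
      define w where "w = f x + (\<rho>/2) *\<^sub>R axis 2 1"
      have "dist w (f x) < \<rho>" using \<rho> by (simp add: w_def dist_norm norm_axis_1)
      moreover have "w $ 2 > 0"
        using fV[OF U(2)] VH \<rho> by (auto simp: w_def Hp_def axis_def)
      ultimately show ?thesis by (auto simp: Q_def dist_commute)
    qed
    \<comment> \<open>The segment from \<open>f x\<close> to \<open>y\<close> lies in the convex set
      \<open>B\<close>. Its projection along the flow is a path in the section, and a path between
      distinct points contains an arc.\<close>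
    have arcs: "v (i z) z = x \<or> (\<exists>c. PA N c (v (i z) z))" if z: "z \<in> g ` B" for z
    proof (cases "v (i z) z = x")
      case False
      obtain y where y: "y \<in> B" "z = g y" using z by blast
      define l where "l = g \<circ> linepath (f x) y"
      define \<sigma> where "\<sigma> u = v (i (l u)) (l u)" for u
      have seg: "linepath (f x) y u \<in> B" if "u \<in> {0..1}" for u
        using linepath_in_convex_hull[of "f x" B y u] fxB y(1) that Bcx hull_same[of convex B] by auto
      then have lB: "l u \<in> ball x \<delta> \<inter> K" if "u \<in> {0..1}" for u
        using gB that unfolding l_def by (metis comp_apply imageI subsetD)
      have contl: "continuous_on {0..1} l"
        unfolding l_def
        by (rule continuous_on_compose) (use seg BV in \<open>auto intro!: continuous_on_subset[OF contg] continuous_on_linepath\<close>)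
      have cont\<sigma>: "continuous_on {0..1} \<sigma>"
        unfolding \<sigma>_def
        by (intro cont_v contl continuous_on_compose2[OF conti contl]) (use lB in auto)
      have \<sigma>S: "\<sigma> u \<in> Sec \<inter> N" if "u \<in> {0..1}" for u
        using i[OF lB[OF that]] by (simp add: \<sigma>_def)
      have SinU: "Sec \<subseteq> U" using SU[of _ 0] SK v0 m by fastforce
      have \<sigma>0: "\<sigma> 0 = x" using gf[OF U(2)] ix x by (simp add: \<sigma>_def l_def linepath_def v0)
      have \<sigma>1: "\<sigma> 1 = v (i z) z" by (simp add: \<sigma>_def l_def linepath_def y)
      have pth: "path (f \<circ> \<sigma>)"
        unfolding path_def using \<sigma>S SinU
        by (intro continuous_on_compose cont\<sigma> continuous_on_subset[OF contf]) auto
      have ne: "f x \<noteq> f (v (i z) z)"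
        using False gf U(2) \<sigma>S[of 1] \<sigma>1 SinU by (metis Int_iff atLeastAtMost_iff order_refl subsetD zero_le_one)
      obtain q where q: "arc q" "path_image q \<subseteq> path_image (f \<circ> \<sigma>)" "pathstart q = f x"
        "pathfinish q = f (v (i z) z)"
        by (rule path_contains_arc[OF pth _ _ ne]) (auto simp: pathstart_def pathfinish_def \<sigma>0 \<sigma>1)
      have qV: "q u \<in> f ` (Sec \<inter> N)" if "u \<in> {0..1}" for u
      proof -
        have "q u \<in> path_image (f \<circ> \<sigma>)" using q(2) that by (auto simp: path_image_def)
        then obtain w where "w \<in> {0..1}" "q u = f (\<sigma> w)" by (auto simp: path_image_def)
        then show ?thesis using \<sigma>S[of w] by blast
      qed
      have qVV: "q ` {0..1} \<subseteq> V"
      proof (rule image_subsetI)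
        fix u :: real assume "u \<in> {0..1}"
        then obtain w where "w \<in> Sec" "q u = f w" using qV by blast
        then show "q u \<in> V" using fV SinU by auto
      qed
      have "continuous_on {0..1} (g \<circ> q)"
        using q(1) qVV by (intro continuous_on_compose continuous_on_subset[OF contg]) (auto simp: arc_def path_def)
      moreover have "inj_on (g \<circ> q) {0..1}"
        using q(1) qVV fg by (intro comp_inj_on) (auto simp: arc_def intro!: inj_on_inverseI[of _ f])
      moreover have "(g \<circ> q) ` {0..1} \<subseteq> Sec \<inter> N"
      proof clarify
        fix u :: real assume "u \<in> {0..1}"
        then obtain w where "w \<in> Sec \<inter> N" "q u = f w" using qV by blast
        then show "(g \<circ> q) u \<in> Sec \<inter> N" using gf SinU by auto
      qed
      moreover have "(g \<circ> q) 0 = x" using q(3) gf[OF U(2)] by (simp add: pathstart_def)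
      moreover have "(g \<circ> q) 1 = v (i z) z"
        using q(4) gf \<sigma>S[of 1] \<sigma>1 SinU by (auto simp: pathfinish_def)
      ultimately have "PA N (g \<circ> q) (v (i z) z)" unfolding PA_def by simp
      then show ?thesis by blast
    qed simp
    have "continuous_on (g ` B) i" using conti gB by (rule continuous_on_subset)
    moreover have "\<forall>z\<in>g ` B. \<bar>i z\<bar> < n" using i gB by blast
    moreover have "Q \<subseteq> V" "g ` Q \<subseteq> g ` B" using \<open>Q \<subseteq> B\<close> BV by auto
    ultimately have "SW n N (g ` B) i Q"
      unfolding SW_def using opW xW \<open>open Q\<close> \<open>Q \<noteq> {}\<close> arcs by simp
    then show ?thesis by blast
  qed
  define AR where "AR a b e \<longleftrightarrow> a < 0 & 0 < b & continuous_on {a..b} e & inj_on e {a..b} &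
    e ` {a..b} \<subseteq> Sec & e 0 = x" for a b :: real and e
  show ?thesis
  proof (cases "\<exists>a b e. AR a b e")
    case True
    then obtain a b e where "AR a b e" by blast
    then have e: "a < 0" "0 < b" "continuous_on {a..b} e" "inj_on e {a..b}" "e ` {a..b} \<subseteq> Sec" "e 0 = x"
      unfolding AR_def by auto
    have "{a<..<b} \<union> {0} = {a<..<b}" using e(1,2) by auto
    moreover have "e ` {a..b} \<subseteq> K" using e(5) SK by (rule subset_trans)
    ultimately have "fbox x a b (m/2) e"
      unfolding fbox_def
      using e(1-3,6) m arc_inj[OF e(4,5) order_refl] arc_open[OF e(3-5) order_refl] by simp
    then show ?thesis by blast
  next
    case no_arc: False
    \<comment> \<open>If all of \<open>W\<close> flowed into \<open>x\<close>, the time needed would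
      be a continuous injection of the open planar set \<open>Q\<close> into the line.\<close>
    have "\<exists>c y. PA UNIV c y"
    proof (rule ccontr)
      assume no: "\<not> ?thesis"
      obtain W i Q where SW: "SW m UNIV W i Q" using S3[OF m order_refl open_UNIV UNIV_I] by blast
      then have W: "W \<subseteq> K" "open Q" "Q \<noteq> {}" "Q \<subseteq> V" "g ` Q \<subseteq> W" "continuous_on W i"
        unfolding SW_def using openin_imp_subset by blast+
      have alt: "v (i z) z = x \<or> (\<exists>c. PA UNIV c (v (i z) z))" if "z \<in> W" for z
        using SW that unfolding SW_def by simp
      have iz: "v (i z) z = x" if "z \<in> W" for z using alt[OF that] no by blast
      have "continuous_on Q (%y. i (g y))"
        by (rule continuous_on_compose2[OF W(6)]) (use W in \<open>auto intro: continuous_on_subset[OF contg]\<close>)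
      moreover have "inj_on (%y. i (g y)) Q"
      proof (rule inj_onI)
        fix y y' assume y: "y \<in> Q" "y' \<in> Q" "i (g y) = i (g y')"
        have gy: "g y \<in> W" "g y' \<in> W" using y W by auto
        have "v (i (g y)) (g y) = v (i (g y)) (g y')" using iz gy y(3) by metis
        then have "g y = g y'" using gy W(1) by (metis subsetD v_neg(1))
        then show "y = y'" using fg y W(4) by (metis subsetD)
      qed
      ultimately have "DIM(real^2) \<le> DIM(real)" using W(2,3) by (intro invariance_of_dimension)
      then show False by simp
    qed
    then obtain c where "\<exists>y. PA UNIV c y" by blast
    then have c: "continuous_on {0..1::real} c" "inj_on c {0..1}" "c ` {0..1} \<subseteq> Sec" "c 0 = x"
      by (auto simp: PA_def)
    have c1: "c 1 \<noteq> x" using c(2,4) by (metis atLeastAtMost_iff inj_onD order_refl zero_le_one zero_neq_one)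
    have nbhd: "\<exists>W. openin (top_of_set K) W & x \<in> W & W \<subseteq> fcell c {0..<1} n"
      if n: "n > 0" "n \<le> m/2" for n
    proof -
      have "open (- {c 1})" "x \<in> - {c 1}" "n \<le> m" using c1 n m by auto
      then obtain W i Q where SW: "SW n (- {c 1}) W i Q" using S3[OF n(1), of "- {c 1}"] by blast
      then have W: "openin (top_of_set K) W" "x \<in> W" unfolding SW_def by simp_all
      have i: "\<bar>i z\<bar> < n" and alt: "v (i z) z = x \<or> (\<exists>c'. PA (- {c 1}) c' (v (i z) z))" if "z \<in> W" for z
        using SW that unfolding SW_def by simp_all
      have "z \<in> fcell c {0..<1} n" if z: "z \<in> W" for z
      proof -
        have "\<exists>s\<in>{0..<1}. v (i z) z = c s"
        proof (cases "v (i z) z = x")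
          case True then show ?thesis using c(4) by (intro bexI[of _ 0]) auto
        next
          case False
          then obtain k where "PA (- {c 1}) k (v (i z) z)" using alt[OF z] by blast
          then have k: "continuous_on {0..1::real} k" "inj_on k {0..1}"
            "k ` {0..1} \<subseteq> Sec \<inter> - {c 1}" "k 0 = x" "k 1 = v (i z) z" unfolding PA_def by blast+
          show ?thesis
          proof (rule ccontr)
            assume nin: "\<not> ?thesis"
            have k1: "k 1 \<notin> c ` {0..1}"
            proof
              assume "k 1 \<in> c ` {0..1}"
              then obtain s where s: "s \<in> {0..1}" "k 1 = c s" by blast
              have "k 1 \<in> - {c 1}" by (rule subsetD[OF k(3), THEN IntD2]) simp
              then have "s \<noteq> 1" using s by auto
              then show False using nin s k(5) by auto
            qed
            define T where "T = {0..1} \<inter> k -` (c ` {0..1})"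
            have "compact (c ` {0..1})" by (intro compact_continuous_image c(1) compact_Icc)
            then have clT: "closed T"
              unfolding T_def by (intro continuous_closed_preimage k(1)) (auto intro: compact_imp_closed)
            have T0: "0 \<in> T" using c(4) k(4) by (force simp: T_def)
            have bdd: "bdd_above T" unfolding T_def by (auto intro: bdd_aboveI[of _ 1])
            \<comment> \<open>The last parameter at which \<open>k\<close> lies on \<open>c\<close>.
              At an inner point of \<open>c\<close> the open box over \<open>c\<close> would keep
              \<open>k\<close> on \<open>c\<close> a little longer, so the two arcs part only in
              \<open>x\<close>.\<close>
            define s where "s = Sup T"
            have sT: "s \<in> T" unfolding s_def by (rule closed_contains_Sup) (use T0 bdd clT in auto)
            then obtain s' where s': "s' \<in> {0..1}" "k s = c s'" "s \<in> {0..1}" by (auto simp: T_def)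
            have s1: "s < 1" using sT k1 by (cases "s = 1") (auto simp: T_def)
            have "k s \<in> - {c 1}" using k(3) s'(3) by blast
            then have "s' \<noteq> 1" using s' by auto
            have "s' = 0"
            proof (rule ccontr)
              assume "s' \<noteq> 0"
              then have s'01: "s' \<in> {0<..<1}" using s' \<open>s' \<noteq> 1\<close> by auto
              let ?B = "fcell c {0<..<1} (m/2)"
              have "openin (top_of_set K) ?B" by (rule arc_open[OF c(1-3)]) simp
              then obtain O' where O': "open O'" "?B = K \<inter> O'" unfolding openin_open by blast
              have "k s \<in> ?B"
                unfolding fcell_def using s'01 s'(2) m c(3) SK
                by (intro image_eqI[of _ _ "(s', 0)"]) (auto simp: v0 subset_iff)
              then have "k s \<in> O'" using O' by auto
              then obtain d where d: "d > 0" "\<And>u. u \<in> {0..1} ==> dist u s < d ==> k u \<in> O'"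
                using k(1) s'(3) O'(1) unfolding continuous_on_topological
                by (metis (no_types, lifting) open_dist)
              define u where "u = min 1 (s + d/2)"
              have u: "u \<in> {0..1}" "s < u" "dist u s < d"
                using s1 d(1) s'(3) by (auto simp: u_def dist_real_def)
              have ku: "k u \<in> Sec" by (rule subsetD[OF k(3), THEN IntD1]) (use u(1) in simp)
              then have kuK: "k u \<in> K" using SK by blast
              then have "k u \<in> ?B" using d(2)[OF u(1,3)] O' by blast
              then obtain r t where rt: "r \<in> {0<..<1}" "t \<in> {-(m/2)<..<m/2}" "k u = v t (c r)"
                unfolding fcell_def by auto
              have cr: "c r \<in> Sec" using c(3) rt(1) by auto
              have "v 0 (k u) = v t (c r)" using rt(3) kuK v0 by simp
              then have "k u = c r" using Seq[OF ku cr, of 0 t] rt(2) m by auto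
              then have "u \<in> T" using u(1) rt(1) by (auto simp: T_def)
              then have "u \<le> s" unfolding s_def by (intro cSup_upper bdd)
              then show False using u by simp
            qed
            then have "k s = k 0" using s' c(4) k(4) by simp
            then have "s = 0" using k(2) s'(3) by (auto dest: inj_onD)
            have meet: "k u \<noteq> c r" if "u \<in> {0<..1}" "r \<in> {0..1}" for u r
            proof
              assume "k u = c r"
              then have "u \<in> T" using that by (auto simp: T_def)
              then have "u \<le> s" unfolding s_def by (intro cSup_upper bdd)
              then show False using \<open>s = 0\<close> that by auto
            qed
            \<comment> \<open>One arm backwards and then the other: an arc through \<open>x\<close>,
              which the case assumption forbids.\<close>
            define e where "e u = (if u \<le> 0 then k (- u) else c u)" for u :: real
            have "continuous_on ({-1..0} \<union> {0..1}) e"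
              unfolding e_def
            proof (rule continuous_on_cases)
              show "continuous_on {-1..0} (%u. k (- u))"
                by (rule continuous_on_compose2[OF k(1)]) (auto intro: continuous_intros)
              show "\<forall>u. u \<in> {-1..0::real} & \<not> u \<le> 0 \<or> u \<in> {0..1} & u \<le> 0 --> k (- u) = c u"
                using c(4) k(4) by auto
            qed (use c(1) in auto)
            moreover have "{-1..0} \<union> {0..1} = {-1..1::real}" by auto
            moreover have "inj_on e {-1..1}"
            proof (rule inj_onI)
              fix u w :: real assume uw: "u \<in> {-1..1}" "w \<in> {-1..1}" "e u = e w"
              consider "u \<le> 0" "w \<le> 0" | "u > 0" "w > 0" | "u \<le> 0" "w > 0" | "u > 0" "w \<le> 0" by linarith
              then show "u = w"
              proof cases
                case 1
                then have "k (-u) = k (-w)" using uw by (simp add: e_def)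
                then have "-u = -w" using 1 uw k(2) by (intro inj_onD[OF k(2)]) auto
                then show ?thesis by simp
              next
                case 2
                then have "c u = c w" using uw by (simp add: e_def)
                then show ?thesis using 2 uw by (intro inj_onD[OF c(2)]) auto
              next
                case 3
                then have eq: "k (-u) = c w" using uw by (simp add: e_def)
                show ?thesis
                proof (cases "u = 0")
                  case True
                  then have "c 0 = c w" using eq c(4) k(4) by simp
                  then have "0 = w" using 3 uw by (intro inj_onD[OF c(2)]) auto
                  then show ?thesis using 3 by simp
                qed (use meet[of "-u" w] eq 3 uw in auto)
              next
                case 4
                then have eq: "k (-w) = c u" using uw by (simp add: e_def)
                show ?thesis
                proof (cases "w = 0")
                  case True
                  then have "c 0 = c u" using eq c(4) k(4) by simp
                  then have "0 = u" using 4 uw by (intro inj_onD[OF c(2)]) auto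
                  then show ?thesis using 4 by simp
                qed (use meet[of "-w" u] eq 4 uw in auto)
              qed
            qed
            moreover have "e ` {-1..1} \<subseteq> Sec"
            proof clarify
              fix u :: real assume "u \<in> {-1..1}"
              then show "e u \<in> Sec"
                using c(3) k(3) unfolding e_def by (cases "u \<le> 0") (auto simp: image_subset_iff)
            qed
            moreover have "e 0 = x" using k(4) by (simp add: e_def)
            ultimately have "AR (-1) 1 e" unfolding AR_def by simp
            then show False using no_arc by blast
          qed
        qed
        then obtain s where s: "s \<in> {0..<1}" "v (i z) z = c s" by blast
        have "z \<in> K" using z W(1) openin_imp_subset by blast
        then have "z = v (- i z) (c s)" using s(2) v_neg(1) by metis
        then show ?thesis
          unfolding fcell_def using s(1) i[OF z] by (intro image_eqI[of _ _ "(s, - i z)"]) auto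
      qed
      then show ?thesis using W by blast
    qed
    have "openin (top_of_set K) (fcell c {0..<1} (m/2))"
    proof (subst openin_subopen, rule ballI)
      fix y assume "y \<in> fcell c {0..<1} (m/2)"
      then obtain s t where st: "s \<in> {0..<1}" "t \<in> {-(m/2)<..<m/2}" "y = v t (c s)"
        by (auto simp: fcell_def)
      show "\<exists>T. openin (top_of_set K) T & y \<in> T & T \<subseteq> fcell c {0..<1} (m/2)"
      proof (cases "s = 0")
        case False
        have "openin (top_of_set K) (fcell c {0<..<1} (m/2))" by (rule arc_open[OF c(1-3)]) simp
        moreover have "y \<in> fcell c {0<..<1} (m/2)"
          using False st by (auto simp: fcell_def intro!: image_eqI[of _ _ "(s, t)"])
        moreover have "fcell c {0<..<1} (m/2) \<subseteq> fcell c {0..<1} (m/2)"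
          unfolding fcell_def by (intro image_mono Sigma_mono) auto
        ultimately show ?thesis by blast
      next
        case True
        \<comment> \<open>The time left between \<open>t\<close> and the end of the box, so that the
          neighbourhood of \<open>x\<close>, shifted by \<open>t\<close>, stays inside.\<close>
        define n where "n = m/2 - \<bar>t\<bar>"
        have n: "n > 0" "n \<le> m/2" using st(2) by (auto simp: n_def)
        obtain W where W: "openin (top_of_set K) W" "x \<in> W" "W \<subseteq> fcell c {0..<1} n" using nbhd[OF n] by blast
        have "y \<in> v t ` W" using W(2) st(3) True c(4) by auto
        moreover have "v t ` W \<subseteq> fcell c {0..<1} (m/2)"
        proof clarify
          fix w assume "w \<in> W"
          then obtain r u where ru: "r \<in> {0..<1}" "u \<in> {-n<..<n}" "w = v u (c r)"
            using W(3) by (auto simp: fcell_def)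
          have "c r \<in> K" using c(3) SK ru(1) by (simp add: image_subset_iff subset_iff)
          then have "v t w = v (t + u) (c r)" using ru(3) vadd by simp
          then show "v t w \<in> fcell c {0..<1} (m/2)"
            unfolding fcell_def using ru(1,2) by (intro image_eqI[of _ _ "(r, t + u)"]) (auto simp: n_def)
        qed
        ultimately show ?thesis using openin_v[OF W(1), of t] by blast
      qed
    qed
    moreover have "{0<..<1} \<union> {0} = {0..<1::real}" by auto
    moreover have "c ` {0..1} \<subseteq> K" using c(3) SK by (rule subset_trans)
    ultimately have "fbox x 0 1 (m/2) c"
      unfolding fbox_def using c(1,4) m arc_inj[OF c(2,3) order_refl] by simp
    then show ?thesis by blast
  qed
qed

end

context cflow
begin

lemma periodic_orb:
  assumes y: "y \<in> K" and T: "T > 0" "v T y = y"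
  shows "orb v y = (%t. v t y) ` {0..T}"
proof
  have per: "v (real n * T) y = y" for n
  proof (induction n)
    case (Suc n)
    have "v (real (Suc n) * T) y = v T (v (real n * T) y)" using y by (simp add: vadd algebra_simps)
    then show ?case using Suc T(2) by simp
  qed (use y v0 in simp)
  have per': "v (of_int n * T) y = y" for n
  proof (cases "n \<ge> 0")
    case True
    then show ?thesis using per[of "nat n"] by simp
  next
    case False
    then have "v (- (of_int n * T)) y = y" using per[of "nat (- n)"] by simp
    then show ?thesis using v_neg(2)[OF y, of "of_int n * T"] by simp
  qed
  show "orb v y \<subseteq> (%t. v t y) ` {0..T}"
  proof
    fix z assume "z \<in> orb v y"
    then obtain t where t: "z = v t y" by (auto simp: orb_def)
    define n where "n = \<lfloor>t / T\<rfloor>"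
    have "of_int n * T \<le> t" "t \<le> of_int n * T + T"
      using T(1) floor_divide_lower[OF T(1), of t] floor_divide_upper[OF T(1), of t]
      by (auto simp: n_def algebra_simps)
    moreover have "v (t - of_int n * T) y = z"
    proof -
      have "v (t - of_int n * T) y = v (t - of_int n * T) (v (of_int n * T) y)" by (simp add: per')
      also have "\<dots> = v t y" using y by (simp add: vadd)
      finally show ?thesis using t by simp
    qed
    ultimately show "z \<in> (%t. v t y) ` {0..T}" by (intro image_eqI[of _ _ "t - of_int n * T"]) auto
  qed
qed (auto simp: orb_def)

lemma compact_arc: "y \<in> K ==> compact ((%t. v t y) ` {A..B})"
  by (intro compact_continuous_image cont_v continuous_intros compact_Icc) auto

end

context sfc
begin

text \<open>Only the difference of the two times has to fit into the box, because the flow moves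
  both points to the level of the section. Orbits can therefore be compared at late times as
  well.\<close>

lemma fbox_uniq:
  assumes f: "fbox x a b h j" and s: "s \<in> {a..b}" "s' \<in> {a..b}" and t: "\<bar>t - t'\<bar> \<le> h"
    and eq: "v t (j s) = v t' (j s')"
  shows "s = s' & t = t'"
proof -
  have jK: "j s \<in> K" "j s' \<in> K" using f s unfolding fbox_def by blast+
  have "v (t - t') (j s) = v 0 (j s')" using eq v_eq_iff[OF jK] jK v0 by simp
  moreover have "inj_on (%(s, t). v t (j s)) ({a..b} \<times> {-h..h})" "h > 0"
    using f unfolding fbox_def by auto
  ultimately have "(s, t - t') = (s', 0)"
    using s t by (intro inj_onD[of "%(s, t). v t (j s)" "{a..b} \<times> {-h..h}"]) auto
  then show ?thesis by simp
qed

lemma boxE: assumes "z \<in> fcell j I h" obtains s t where "s \<in> I" "t \<in> {-h<..<h}" "z = v t (j s)"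
  using assms unfolding fcell_def by force

lemma fbox_K: "fbox x a b h j ==> s \<in> {a..b} ==> j s \<in> K"
  unfolding fbox_def by blast

lemma fbox_coord:
  assumes f: "fbox x a b h j"
  obtains q r where "\<And>s t. s \<in> {a..b} ==> \<bar>t\<bar> \<le> h ==> q (v t (j s)) = s & r (v t (j s)) = t"
    "continuous_on (fcell j ({a<..<b} \<union> {0}) h) q" "continuous_on (fcell j ({a<..<b} \<union> {0}) h) r"
proof -
  let ?D = "{a..b} \<times> {-h..h}"
  define F where "F = (%p. v (snd p) (j (fst p)))"
  have fb: "a \<le> 0" "0 < b" "continuous_on {a..b} j" "inj_on F ?D"
    using f unfolding fbox_def by (auto simp: F_def case_prod_unfold)
  have "continuous_on ?D (%p. j (fst p))"
    by (rule continuous_on_compose2[OF fb(3)]) (auto intro: continuous_intros)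
  then have "continuous_on ?D F"
    unfolding F_def by (intro cont_v continuous_intros) (use fbox_K[OF f] in auto)
  moreover have "compact ?D" by (intro compact_Times compact_Icc)
  ultimately obtain g where g: "homeomorphism ?D (F ` ?D) F g"
    using homeomorphism_compact[of ?D F] fb(4) by blast
  have cg: "continuous_on (F ` ?D) g" using g by (simp add: homeomorphism_def)
  have sub: "fcell j ({a<..<b} \<union> {0}) h \<subseteq> F ` ?D"
    unfolding fcell_def F_def case_prod_unfold by (intro image_mono Sigma_mono) (use fb in auto)
  show thesis
  proof (rule that[of "%z. fst (g z)" "%z. snd (g z)"])
    show "fst (g (v t (j s))) = s & snd (g (v t (j s))) = t" if "s \<in> {a..b}" "\<bar>t\<bar> \<le> h" for s t
    proof -
      have "(s, t) \<in> ?D" using that by auto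
      then have "g (F (s, t)) = (s, t)" using g by (simp add: homeomorphism_def)
      then show ?thesis by (simp add: F_def)
    qed
  qed (use continuous_on_subset[OF cg sub] in \<open>auto intro: continuous_intros\<close>)
qed

lemma fbox_near:
  assumes f: "fbox x a b h j" and s0: "s0 \<in> {a<..<b} \<union> {0}" and S: "open S" "s0 \<in> S" and h': "0 < h'" "h' \<le> h"
  obtains d where "d > 0"
    "\<And>z. z \<in> K ==> dist z (j s0) < d ==> \<exists>s t. s \<in> ({a<..<b} \<union> {0}) \<inter> S & \<bar>t\<bar> < h' & z = v t (j s)"
proof -
  let ?I = "{a<..<b} \<union> {0}"
  obtain q r where co: "\<And>s t. s \<in> {a..b} ==> \<bar>t\<bar> \<le> h ==> q (v t (j s)) = s & r (v t (j s)) = t"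
    "continuous_on (fcell j ?I h) q" "continuous_on (fcell j ?I h) r" by (rule fbox_coord[OF f]) blast
  have fb: "a \<le> 0" "0 < b" "h > 0" and op: "openin (top_of_set K) (fcell j ?I h)"
    using f unfolding fbox_def by auto
  have Iab: "?I \<subseteq> {a..b}" using fb by auto
  define W where "W = (fcell j ?I h \<inter> q -` S) \<inter> (fcell j ?I h \<inter> r -` {-h'<..<h'})"
  have "openin (top_of_set (fcell j ?I h)) W"
    unfolding W_def by (intro openin_Int continuous_openin_preimage_gen co S) auto
  then have W: "openin (top_of_set K) W" using op openin_trans by metis
  have "j s0 = v 0 (j s0)" using v0 fbox_K[OF f] s0 Iab by auto
  then have "j s0 \<in> fcell j ?I h" unfolding fcell_def using s0 fb by (intro image_eqI[of _ _ "(s0, 0)"]) auto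
  moreover have "q (j s0) = s0 & r (j s0) = 0"
    using co(1)[of s0 0] s0 Iab fb \<open>j s0 = v 0 (j s0)\<close> by auto
  ultimately have "j s0 \<in> W" using S h' by (auto simp: W_def)
  then obtain d where d: "d > 0" "\<And>z. z \<in> K ==> dist z (j s0) < d ==> z \<in> W"
    using W unfolding openin_euclidean_subtopology_iff by blast
  show thesis
  proof (rule that[OF d(1)])
    fix z assume "z \<in> K" "dist z (j s0) < d"
    then have zW: "z \<in> W" by (rule d(2))
    then have "z \<in> fcell j ?I h" by (simp add: W_def)
    then obtain s t where st: "s \<in> ?I" "t \<in> {-h<..<h}" "z = v t (j s)" by (rule boxE)
    then have "q z = s" "r z = t" using co(1)[of s t] Iab by auto
    then show "\<exists>s t. s \<in> ?I \<inter> S & \<bar>t\<bar> < h' & z = v t (j s)"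
      using zW st by (intro exI[of _ s] exI[of _ t]) (auto simp: W_def)
  qed
qed

end

text \<open>From \<open>s\<close> on, one iterates \<open>g\<close> if it moves \<open>s\<close>
  down and takes preimages otherwise. Either way the sequence decreases strictly, so its limit is a
  fixed point that it never attains. The final disjunction lets both cases serve as a chain of
  points on one orbit.\<close>

lemma monotone_fixpoint_sequence:
  fixes g :: "real => real"
  assumes cont: "continuous_on {0..r} g" and g0: "g 0 = 0"
    and mono: "\<And>s t. 0 \<le> s ==> s < t ==> t \<le> r ==> g s < g t"
    and s: "0 \<le> s" "s \<le> r" "g s \<noteq> s"
  obtains u l where "u 0 = s" "\<And>n::nat. 0 \<le> u n & u n \<le> r & u n \<noteq> l" "0 \<le> l" "l \<le> r" "u \<longlonglongrightarrow> l" "g l = l"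
    "\<And>n. g (u n) = u (Suc n) \<or> g (u (Suc n)) = u n"
proof -
  have "s > 0" using s g0 by (cases "s = 0") auto
  define c where "c x \<longleftrightarrow> (if g s < s then g x < x else x < g x)" for x
  define Pr where "Pr n x \<longleftrightarrow> 0 < x & x \<le> r & c x & (n = 0 --> x = s)" for n :: nat and x
  define Q where "Q n x y \<longleftrightarrow> y < x & (g x = y \<or> g y = x)" for n :: nat and x y
  have "\<exists>u. \<forall>n. Pr n (u n) & Q n (u n) (u (Suc n))"
  proof (rule dependent_nat_choice)
    show "\<exists>x. Pr 0 x" using s \<open>s > 0\<close> by (intro exI[of _ s]) (auto simp: Pr_def c_def)
    fix x n assume x: "Pr n x"
    show "\<exists>y. Pr (Suc n) y & Q n x y"
    proof (cases "g s < s")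
      case True
      then have gx: "g x < x" using x by (auto simp: Pr_def c_def)
      have "0 < g x" using mono[of 0 x] g0 x by (auto simp: Pr_def)
      moreover have "g (g x) < g x" using mono[of "g x" x] gx \<open>0 < g x\<close> x by (auto simp: Pr_def)
      ultimately show ?thesis using gx x True by (intro exI[of _ "g x"]) (auto simp: Pr_def Q_def c_def)
    next
      case False
      then have gx: "x < g x" and x0: "0 < x" "x \<le> r" using x by (auto simp: Pr_def c_def)
      have "continuous_on {0..x} g" using cont x0 by (auto intro: continuous_on_subset)
      then obtain y where y: "0 \<le> y" "y \<le> x" "g y = x" using IVT'[of g 0 x x] g0 gx x0 by auto
      have "y \<noteq> 0" "y \<noteq> x" using y g0 x0 gx by auto
      then show ?thesis using y x0 False by (intro exI[of _ y]) (auto simp: Pr_def Q_def c_def)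
    qed
  qed
  then obtain u where u: "\<And>n. Pr n (u n)" "\<And>n. Q n (u n) (u (Suc n))" by blast
  have dec: "u (Suc n) < u n" and rel: "g (u n) = u (Suc n) \<or> g (u (Suc n)) = u n"
    and ur: "0 < u n" "u n \<le> r" for n using u[of n] by (auto simp: Pr_def Q_def)
  have "decseq u" using dec by (intro decseq_SucI) (auto simp: less_imp_le)
  then obtain l where l: "u \<longlonglongrightarrow> l" "\<And>n. l \<le> u n"
    using decseq_convergent[of u 0] ur by (auto simp: less_imp_le)
  have l0: "0 \<le> l" using ur l(1) by (intro LIMSEQ_le_const[OF l(1)]) (auto intro!: exI[of _ 0] simp: less_imp_le)
  have lr: "l \<le> r" using l(2)[of 0] ur(2)[of 0] by simp
  have lim: "(%n. g (u n)) \<longlonglongrightarrow> g l"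
    by (rule continuous_on_tendsto_compose[OF cont l(1)]) (use l0 lr ur in \<open>auto simp: less_imp_le\<close>)
  have gl: "g l = l"
  proof (cases "g s < s")
    case True
    have "g (u n) = u (Suc n)" for n
    proof -
      have "g (u n) < u n" "g (u (Suc n)) < u (Suc n)" using u(1)[of n] u(1)[of "Suc n"] True by (auto simp: Pr_def c_def)
      then show ?thesis using rel[of n] dec[of n] by linarith
    qed
    then have "(%n. u (Suc n)) \<longlonglongrightarrow> g l" using lim by simp
    then show ?thesis using LIMSEQ_Suc[OF l(1)] LIMSEQ_unique by blast
  next
    case False
    have "g (u (Suc n)) = u n" for n
    proof -
      have "u n < g (u n)" using u(1)[of n] False by (auto simp: Pr_def c_def)
      then show ?thesis using rel[of n] dec[of n] by linarith
    qed
    then have "u \<longlonglongrightarrow> g l" using LIMSEQ_Suc[OF lim] by simp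
    then show ?thesis using l(1) LIMSEQ_unique by blast
  qed
  have "u n \<noteq> l" for n using dec[of n] l(2)[of "Suc n"] by simp
  then show thesis
    using u(1)[of 0] ur l0 lr l(1) gl rel by (intro that[of u l]) (auto simp: Pr_def less_imp_le)
qed

section \<open>Extended pointwise almost periodic flows\<close>

locale psurf = pflow + sfc

locale ppap = psurf +
  assumes pap: "\<And>x y. x \<in> K ==> y \<in> ecl K v P x ==> ecl K v P y = ecl K v P x"
begin

text \<open>The union of the finitely many classes of fixed points. It is closed, and off it every
  class is a minimal set.\<close>

definition Sp :: "'a set" where
  "Sp = (\<Union>p\<in>{p\<in>K. \<forall>t. v t p = p}. ecl K v P p)"

definition reg :: "'a => bool" where
  "reg x \<longleftrightarrow> x \<in> K & x \<notin> Sp"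

lemma closed_Sp: "closed Sp"
  unfolding Sp_def using finSing closed_ecl by (intro closed_UN) auto

lemma reg_ecl: assumes "reg x" "y \<in> ecl K v P x" shows "reg y" "ecl K v P y = ecl K v P x"
proof -
  have xK: "x \<in> K" using assms by (simp add: reg_def)
  show eq: "ecl K v P y = ecl K v P x" by (rule pap[OF xK assms(2)])
  have "y \<in> K" using assms(2) ecl_subset[OF xK] by blast
  moreover have "y \<notin> Sp"
  proof
    assume "y \<in> Sp"
    then obtain p where p: "p \<in> K" "\<forall>t. v t p = p" "y \<in> ecl K v P p" by (auto simp: Sp_def)
    then have "x \<in> ecl K v P p" using pap[OF p(1,3)] eq ecl_self[OF xK] by simp
    then show False using assms(1) p by (auto simp: reg_def Sp_def)
  qed
  ultimately show "reg y" by (simp add: reg_def)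
qed

lemma reg_not_wst: assumes "reg x" "p \<in> K" "p \<in> ecl K v P x" shows "\<exists>t. v t p \<noteq> p"
  using reg_ecl[OF assms(1,3)] ecl_self[OF assms(2)] assms(2) by (auto simp: reg_def Sp_def)

lemma reg_nonfix: "reg x ==> \<exists>t. v t x \<noteq> x"
  using reg_not_wst[of x x] ecl_self by (auto simp: reg_def)

lemma reg_gen: assumes "reg x" shows "gen x"
proof -
  interpret r: cflow K "rv v" by (rule cflow_rv)
  have xK: "x \<in> K" using assms by (simp add: reg_def)
  have no: "p \<notin> ecl K v P x" if "p \<in> P" for p
    using reg_not_wst[OF assms PK[OF that]] Pfix[OF that] by blast
  have "x \<notin> wst K v p & x \<notin> wst K (rv v) p" if p: "p \<in> P" for p
  proof -
    have "olim v x \<union> olim (rv v) x \<subseteq> ecl K v P x"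
      using closure_orb[OF xK] closure_orb_ecl[of x] by blast
    then show ?thesis using no[OF p] wst_olim[of x p] r.wst_olim[of x p] by auto
  qed
  then show ?thesis using xK by (simp add: gen_def)
qed

lemma reg_closure: "reg x ==> ecl K v P x = closure (orb v x)"
  using reg_gen gen_ecl by blast

text \<open>Minimality: a limit point has the same class, which is the closure of its own orbit and
  hence part of the limit set.\<close>

lemma reg_olim: assumes "reg x" shows "ecl K v P x \<subseteq> olim v x"
proof -
  have xK: "x \<in> K" using assms by (simp add: reg_def)
  obtain z where z: "z \<in> olim v x" using olim_nonempty[OF xK] by blast
  then have "z \<in> ecl K v P x" using olim_ecl by blast
  then have "ecl K v P x = closure (orb v z)" using reg_ecl[OF assms] reg_closure by metis
  then show ?thesis using olim_orb[OF xK z] by simp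
qed

text \<open>The return map of a section through a periodic point, iterated twice to make it increasing,
  is the identity: monotone orbits would converge to a periodic orbit.\<close>

lemma periodic_usc:
  assumes x: "reg x" and T: "T > 0" "v T x = x"
    and seq: "\<And>n::nat. xs n \<in> K" "\<And>n. ys n \<in> ecl K v P (xs n)" "xs \<longlonglongrightarrow> x" "ys \<longlonglongrightarrow> y"
  shows "y \<in> ecl K v P x"
proof -
  have xK: "x \<in> K" using x by (simp add: reg_def)
  obtain a b h j where fb: "fbox x a b h j" using reg_nonfix[OF x] flow_box[OF xK] by blast
  let ?I = "{a<..<b} \<union> {0}"
  have ab: "a \<le> 0" "0 < b" "h > 0" "continuous_on {a..b} j" "j 0 = x" using fb unfolding fbox_def by auto
  have jK: "j s \<in> K" if "s \<in> {a..b}" for s using fbox_K[OF fb that] .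
  have Th: "T > h"
  proof (rule ccontr)
    assume "\<not> T > h"
    moreover have "v T (j 0) = v 0 (j 0)" using T ab xK v0 by simp
    ultimately show False using fbox_uniq[OF fb, of 0 0 T 0] T ab by auto
  qed
  obtain k \<tau> where co: "\<And>s t. s \<in> {a..b} ==> \<bar>t\<bar> \<le> h ==> k (v t (j s)) = s & \<tau> (v t (j s)) = t"
    "continuous_on (fcell j ?I h) k" "continuous_on (fcell j ?I h) \<tau>" by (rule fbox_coord[OF fb]) blast
  obtain d where d: "d > 0" "\<And>z. z \<in> K ==> dist z (j 0) < d ==> \<exists>s t. s \<in> ?I \<inter> UNIV & \<bar>t\<bar> < h/3 & z = v t (j s)"
    by (rule fbox_near[OF fb, of 0 UNIV "h/3"]) (use ab in auto)
  have contvT: "continuous_on {a..b} (%s. v T (j s))"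
    by (intro cont_v continuous_intros ab) (use jK in auto)
  have "v T (j 0) = j 0" using T ab by simp
  obtain r1 where r1: "r1 > 0" "\<And>s. s \<in> {a..b} ==> dist s 0 < r1 ==> dist (v T (j s)) (j 0) < d"
    using contvT d(1) ab(1,2) \<open>v T (j 0) = j 0\<close> unfolding continuous_on_iff
    by (metis atLeastAtMost_iff less_imp_le)
  have "open (- Sp)" "j 0 \<in> - Sp" using closed_Sp x ab by (auto simp: reg_def)
  then obtain r0 where r0: "r0 > 0" "\<And>s. s \<in> {a..b} ==> dist s 0 < r0 ==> j s \<in> - Sp"
    using ab(4) ab(1,2) unfolding continuous_on_topological
    by (metis (no_types, lifting) atLeastAtMost_iff less_imp_le open_dist)
  define r where "r = min (min r0 r1) b / 2"
  have r: "r > 0" "r < r0" "r < r1" "r < b" using r0 r1 ab by (auto simp: r_def)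
  \<comment> \<open>Cut off at \<open>a\<close>: when the section is one-sided, that is
    \<open>a = 0\<close>, so is the domain of the return map.\<close>
  define D where "D i = {max a (-i)..i}" for i :: real
  have D: "D i \<subseteq> {a..b}" "s \<in> D i ==> \<bar>s\<bar> \<le> i" "0 \<le> i ==> 0 \<in> D i" if "i \<le> r" for i s
    using that r ab by (auto simp: D_def)
  define f where "f s = k (v T (j s))" for s
  define c where "c s = \<tau> (v T (j s))" for s
  have f: "f s \<in> ?I & \<bar>c s\<bar> < h/3 & v T (j s) = v (c s) (j (f s)) & v T (j s) \<in> fcell j ?I h" if s: "s \<in> D r" for s
  proof -
    have sab: "s \<in> {a..b}" using D(1)[OF order_refl] s by blast
    have sr: "dist s 0 < r1" using D(2)[OF order_refl s] r by (simp add: dist_real_def)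
    obtain s' t where st: "s' \<in> ?I" "\<bar>t\<bar> < h/3" "v T (j s) = v t (j s')"
      using d(2)[OF inK[OF jK[OF sab]] r1(2)[OF sab sr]] by blast
    have "s' \<in> {a..b}" using st ab by auto
    then have "k (v T (j s)) = s'" "\<tau> (v T (j s)) = t" using co(1)[of s' t] st ab by auto
    then show ?thesis using st ab
      by (auto simp: f_def c_def fcell_def intro!: image_eqI[of _ _ "(s', t)"])
  qed
  have Iab: "?I \<subseteq> {a..b}" using ab by auto
  have jf: "j (f s) = v (T - c s) (j s)" if "s \<in> D r" for s
  proof -
    have "f s \<in> {a..b}" using f[OF that] Iab by blast
    moreover have "s \<in> {a..b}" using D(1)[OF order_refl] that by blast
    ultimately have "v (T - c s) (j s) = j (f s)"
      using f[OF that] v_eq_iff[of "j s" "j (f s)" T "c s"] jK by blast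
    then show ?thesis by simp
  qed
  have contf: "continuous_on (D r) f"
    unfolding f_def
    by (rule continuous_on_compose2[OF co(2) continuous_on_subset[OF contvT D(1)[OF order_refl]]])
      (use f in blast)
  have injf: "inj_on f (D r)"
  proof (rule inj_onI)
    fix s s' assume s: "s \<in> D r" "s' \<in> D r" "f s = f s'"
    then have "v (T - c s) (j s) = v (T - c s') (j s')" using jf by metis
    moreover have "\<bar>(T - c s) - (T - c s')\<bar> \<le> h" using f[OF s(1)] f[OF s(2)] by linarith
    moreover have "s \<in> {a..b}" "s' \<in> {a..b}" using D(1)[OF order_refl] s by auto
    ultimately show "s = s'" using fbox_uniq[OF fb, of s s' "T - c s" "T - c s'"] by blast
  qed
  have f0: "f 0 = 0"
  proof -
    have "v T (j 0) = v 0 (j 0)" using \<open>v T (j 0) = j 0\<close> v0 xK ab by simp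
    then show ?thesis using co(1)[of 0 0] ab by (simp add: f_def)
  qed
  have monof: "strict_mono_on (D r) f \<or> strict_antimono_on (D r) f"
    using injective_eq_monotone_map[OF _ contf] injf by (simp add: D_def is_interval_cc)
  obtain r2 where r2: "r2 > 0" "r2 \<le> r" "\<And>s. s \<in> D r2 ==> f s \<in> D r"
  proof -
    have "0 \<in> D r" using D(3)[OF order_refl] r by simp
    then obtain e where e: "e > 0" "\<And>s. s \<in> D r ==> dist s 0 < e ==> dist (f s) (f 0) < r"
      using contf r(1) unfolding continuous_on_iff by metis
    show thesis
    proof (rule that[of "min r (e/2)"])
      fix s assume s: "s \<in> D (min r (e/2))"
      then have "s \<in> D r" "dist s 0 < e" using e(1) by (auto simp: D_def dist_real_def)
      then have "\<bar>f s\<bar> < r" "f s \<in> {a..b}" using e(2)[of s] f0 f[of s] Iab by (auto simp: dist_real_def)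
      then show "f s \<in> D r" by (auto simp: D_def)
    qed (use r e in auto)
  qed
  have D2r: "s \<in> D r2 ==> s \<in> D r" for s using r2(2) by (auto simp: D_def)
  define g where "g s = f (f s)" for s
  have contg: "continuous_on (D r2) g"
    unfolding g_def by (rule continuous_on_compose2[OF contf continuous_on_subset[OF contf]]) (use D2r r2(3) in auto)
  have g0: "g 0 = 0" using f0 by (simp add: g_def)
  have monog: "g s < g t" if "s \<in> D r2" "t \<in> D r2" "s < t" for s t
    using monof that D2r r2(3) unfolding g_def monotone_on_def by (metis (no_types, lifting))
  \<comment> \<open>The time of two successive returns. The corrections are below
    \<open>h / 3\<close> and \<open>h < T\<close>, so it lies between \<open>T\<close> and
    \<open>3 * T\<close>; the upper bound gives the compactness used at the end.\<close>
  define u where "u s = (T - c (f s)) + (T - c s)" for s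
  have jg: "j (g s) = v (u s) (j s)" and us: "T \<le> u s" "u s \<le> 3 * T" and gab: "g s \<in> {a..b}" if s: "s \<in> D r2" for s
  proof -
    have "j (g s) = v (T - c (f s)) (v (T - c s) (j s))"
      using jf[OF r2(3)[OF s]] jf[OF D2r[OF s]] by (simp add: g_def)
    then show "j (g s) = v (u s) (j s)" using jK D(1)[OF order_refl] D2r[OF s] by (auto simp: u_def vadd)
    show "T \<le> u s" "u s \<le> 3 * T" using f[OF r2(3)[OF s]] f[OF D2r[OF s]] Th by (auto simp: u_def)
    show "g s \<in> {a..b}" using f[OF r2(3)[OF s]] Iab by (auto simp: g_def)
  qed
  have sab: "s \<in> {a..b}" if "s \<in> D r2" for s using D(1)[OF order_refl] D2r[OF that] by blast
  have regj: "reg (j s)" if "s \<in> D r2" for s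
    using r0(2)[OF sab[OF that]] D(2)[OF order_refl D2r[OF that]] r jK[OF sab[OF that]]
    by (simp add: reg_def dist_real_def)
  have no_seq: False
    if w: "\<And>n::nat. w n \<in> D r2" "\<And>n. w n \<noteq> l" "w \<longlonglongrightarrow> l" and l: "l \<in> D r2" "g l = l"
      and rel: "\<And>n. g (w n) = w (Suc n) \<or> g (w (Suc n)) = w n" for w l
  proof -
    have orbw: "orb v (j (w n)) = orb v (j (w 0))" for n
    proof (induction n)
      case (Suc n)
      have "orb v (j (w (Suc n))) = orb v (j (w n))"
        using rel[of n] jg[OF w(1)] orb_v jK sab[OF w(1)] by metis
      then show ?case using Suc by simp
    qed simp
    have lK: "j l \<in> K" using jK sab[OF l(1)] .
    have per: "v (u l) (j l) = j l" using jg[OF l(1)] l(2) by simp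
    have ul: "u l > 0" using us[OF l(1)] T by simp
    have jw: "(%n. j (w n)) \<longlonglongrightarrow> j l"
      by (rule continuous_on_tendsto_compose[OF ab(4) w(3)]) (use sab w l in auto)
    have w0: "j (w 0) \<in> K" "reg (j (w 0))" using jK sab w(1) regj by auto
    have "j l \<in> closure (orb v (j (w 0)))"
      unfolding closure_sequential using jw orbw orb_self jK sab w(1)
      by (intro exI[of _ "%n. j (w n)"]) (metis (no_types, lifting))
    then have "ecl K v P (j l) = ecl K v P (j (w 0))"
      using reg_closure[OF w0(2)] pap[OF w0(1)] by simp
    then have "j (w n) \<in> closure (orb v (j l))" for n
      using reg_closure[OF regj[OF l(1)]] reg_closure[OF w0(2)] orbw[of n] orb_self[OF jK[OF sab[OF w(1)[of n]]]]
        closure_subset[of "orb v (j (w 0))"] by auto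
    moreover have "closure (orb v (j l)) = (%t. v t (j l)) ` {0..u l}"
      using periodic_orb[OF lK ul per] compact_arc[OF lK, of 0 "u l"] by (simp add: compact_imp_closed)
    ultimately have "\<exists>t. t \<in> {0..u l} & j (w n) = v t (j l)" for n by blast
    then obtain t where t: "\<And>n. t n \<in> {0..u l}" "\<And>n. j (w n) = v (t n) (j l)" by metis
    have "compact {0..u l}" by simp
    then obtain t' q where q: "t' \<in> {0..u l}" "strict_mono q" "(t \<circ> q) \<longlonglongrightarrow> t'"
      unfolding compact_eq_seq_compact_metric by (rule seq_compactE[of _ t]) (use t in auto)
    have "(%n. v ((t \<circ> q) n) (j l)) \<longlonglongrightarrow> v t' (j l)"
      by (rule tendsto_v[OF q(3) tendsto_const lK]) (simp add: lK)
    moreover have "(%n. v ((t \<circ> q) n) (j l)) \<longlonglongrightarrow> j l"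
      using LIMSEQ_subseq_LIMSEQ[OF jw q(2)] t(2) by (simp add: o_def)
    ultimately have t': "v t' (j l) = j l" by (rule LIMSEQ_unique)
    obtain n where n: "\<bar>(t \<circ> q) n - t'\<bar> < h"
      using q(3) ab(3) unfolding lim_sequentially by (metis dist_real_def order_refl)
    have "v 0 (j (w (q n))) = v (t (q n)) (j l)" using t(2) v0 jK sab w(1) by metis
    also have "\<dots> = v (t (q n) - t') (v t' (j l))" using lK by (simp add: vadd)
    finally have "v 0 (j (w (q n))) = v (t (q n) - t') (j l)" using t' by simp
    then have "w (q n) = l"
      using fbox_uniq[OF fb, of "w (q n)" l 0 "t (q n) - t'"] sab w(1) l(1) n by (auto simp: o_def)
    then show False using w(2) by blast
  qed
  have gid: "g s = s" if s: "s \<in> D r2" for s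
  proof (rule ccontr)
    assume ne: "g s \<noteq> s"
    show False
    proof (cases "s \<ge> 0")
      case True
      have sub: "{0..r2} \<subseteq> D r2" using ab(1) r2(1) by (auto simp: D_def)
      obtain w l where w: "w 0 = s" "\<And>n::nat. 0 \<le> w n & w n \<le> r2 & w n \<noteq> l" "0 \<le> l" "l \<le> r2" "w \<longlonglongrightarrow> l" "g l = l"
        "\<And>n. g (w n) = w (Suc n) \<or> g (w (Suc n)) = w n"
        by (rule monotone_fixpoint_sequence[of r2 g s])
          (use True s ne g0 monog sub continuous_on_subset[OF contg sub] in \<open>auto simp: D_def\<close>)
      show False by (rule no_seq[of w l]) (use w sub in \<open>auto simp: subset_iff\<close>)
    next
      case False
      define m where "m = - max a (- r2)"
      have sub: "- t \<in> D r2" if "0 \<le> t" "t \<le> m" for t using that r2(1) by (auto simp: D_def m_def)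
      have sub': "{-m..0} \<subseteq> D r2"
      proof
        fix t assume "t \<in> {-m..0}"
        then show "t \<in> D r2" using sub[of "- t"] by simp
      qed
      have cg: "continuous_on {0..m} (%t. - g (- t))"
        by (intro continuous_on_minus continuous_on_compose2[OF contg] continuous_intros) (use sub' in auto)
      obtain w l where w: "w 0 = - s" "\<And>n::nat. 0 \<le> w n & w n \<le> m & w n \<noteq> l" "0 \<le> l" "l \<le> m" "w \<longlonglongrightarrow> l" "- g (- l) = l"
        "\<And>n. - g (- w n) = w (Suc n) \<or> - g (- w (Suc n)) = w n"
      proof (rule monotone_fixpoint_sequence[OF cg, of "- s"])
        show "- g (- t') < - g (- t)" if "0 \<le> t'" "t' < t" "t \<le> m" for t' t
          using monog[of "-t" "-t'"] sub that by auto
      qed (use False s ne g0 in \<open>auto simp: D_def m_def\<close>)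
      show False
      proof (rule no_seq[of "%n. - w n" "- l"])
        show "(%n. - w n) \<longlonglongrightarrow> - l" using w(5) by (rule tendsto_minus)
        show "g (- l) = - l" using w(6) by simp
        show "g (- w n) = - w (Suc n) \<or> g (- w (Suc n)) = - w n" for n using w(7)[of n] by linarith
        show "- w n \<in> D r2" "- l \<in> D r2" for n using w sub by auto
        show "- w n \<noteq> - l" for n using w(2)[of n] by simp
      qed
    qed
  qed
  obtain d2 where d2: "d2 > 0" "\<And>z. z \<in> K ==> dist z (j 0) < d2 ==>
      \<exists>s t. s \<in> ?I \<inter> {-r2<..<r2} & \<bar>t\<bar> < h & z = v t (j s)"
    by (rule fbox_near[OF fb, of 0 "{- r2<..<r2}" h]) (use ab r2 in auto)
  obtain N where N: "\<And>n. n \<ge> N ==> dist (xs n) x < d2"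
    using seq(3) d2(1) unfolding lim_sequentially by blast
  define xs' where "xs' n = xs (n + N)" for n
  have lim': "xs' \<longlonglongrightarrow> x" "(%n. ys (n + N)) \<longlonglongrightarrow> y"
    unfolding xs'_def using seq(3,4) by (auto intro: LIMSEQ_ignore_initial_segment)
  have "\<exists>s t. s \<in> ?I \<inter> {-r2<..<r2} & \<bar>t\<bar> < h & xs' n = v t (j s)" for n
    using d2(2)[of "xs' n"] N[of "n + N"] seq(1) ab by (simp add: xs'_def)
  then obtain S Tm where ST: "\<And>n. S n \<in> ?I \<inter> {-r2<..<r2}" "\<And>n. \<bar>Tm n\<bar> < h" "\<And>n. xs' n = v (Tm n) (j (S n))"
    by metis
  have SD: "S n \<in> D r2" for n using ST(1)[of n] ab by (auto simp: D_def)
  have "\<exists>t. t \<in> {0..3*T} & ys (n + N) = v t (j (S n))" for n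
  proof -
    have jSK: "j (S n) \<in> K" using jK sab SD by blast
    have "ecl K v P (xs' n) = ecl K v P (j (S n))"
      by (rule ecl_orb[OF jSK]) (simp add: ST(3))
    then have "ys (n + N) \<in> closure (orb v (j (S n)))"
      using seq(2)[of "n + N"] reg_closure[OF regj[OF SD]] by (simp add: xs'_def)
    moreover have per: "v (u (S n)) (j (S n)) = j (S n)" using jg[OF SD] gid[OF SD] by metis
    moreover have "u (S n) > 0" using us[OF SD[of n]] T by simp
    ultimately have "ys (n + N) \<in> (%t. v t (j (S n))) ` {0..u (S n)}"
      using periodic_orb[OF jSK, of "u (S n)"] compact_arc[OF jSK, of 0 "u (S n)"]
      by (simp add: compact_imp_closed)
    then show ?thesis using us[OF SD[of n]] by auto
  qed
  then obtain t where t: "\<And>n. t n \<in> {0..3*T}" "\<And>n. ys (n + N) = v (t n) (j (S n))" by metis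
  have "compact {0..3*T}" by simp
  then obtain t' q where q: "t' \<in> {0..3*T}" "strict_mono q" "(t \<circ> q) \<longlonglongrightarrow> t'"
    unfolding compact_eq_seq_compact_metric by (rule seq_compactE[of _ t]) (use t in auto)
  have "S \<longlonglongrightarrow> 0"
  proof -
    have inb: "xs' n \<in> fcell j ?I h" for n
      using ST[of n] unfolding fcell_def by (intro image_eqI[of _ _ "(S n, Tm n)"]) auto
    have xb: "x \<in> fcell j ?I h" unfolding fcell_def using ab v0 xK by (intro image_eqI[of _ _ "(0, 0)"]) auto
    have "(%n. k (xs' n)) \<longlonglongrightarrow> k x"
      by (rule continuous_on_tendsto_compose[OF co(2) lim'(1) xb always_eventually]) (use inb in blast)
    moreover have "k (xs' n) = S n" for n using co(1)[of "S n" "Tm n"] ST[of n] sab[OF SD] by auto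
    moreover have "k x = 0" using co(1)[of 0 0] ab v0 xK by auto
    ultimately show ?thesis by simp
  qed
  then have jS: "(%n. j (S n)) \<longlonglongrightarrow> x"
    using continuous_on_tendsto_compose[OF ab(4), of S 0 sequentially] ab(1,2,5) sab[OF SD] by simp
  have "(%n. v ((t \<circ> q) n) (j (S (q n)))) \<longlonglongrightarrow> v t' x"
    using LIMSEQ_subseq_LIMSEQ[OF jS q(2)] jK sab SD
    by (intro tendsto_v[OF q(3) _ xK]) (auto simp: o_def)
  moreover have "(%n. v ((t \<circ> q) n) (j (S (q n)))) \<longlonglongrightarrow> y"
    using LIMSEQ_subseq_LIMSEQ[OF lim'(2) q(2)] t(2) by (simp add: o_def)
  ultimately have "y = v t' x" using LIMSEQ_unique by blast
  then show ?thesis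
    using orb_eorb[of x] closure_subset[of "eorb K v P x"] v_in_orb[of t' x] unfolding ecl_def by blast
qed

end

section \<open>Nonperiodic minimal sets\<close>

context ppap
begin

text \<open>A minimal set that is not open would leave gaps in a section. Transported along the flow,
  pairwise distinct gaps shrink, so the orbits through a gap would accumulate on the minimal set.\<close>

lemma minimal_open:
  assumes x: "reg x" and np: "\<And>t. t > 0 ==> v t x \<noteq> x"
  shows "\<exists>e>0. \<forall>z\<in>K. dist z x < e --> z \<in> ecl K v P x"
proof (rule ccontr)
  assume not_int: "\<not> ?thesis"
  have xK: "x \<in> K" using x by (simp add: reg_def)
  define M where "M = ecl K v P x"
  have clM: "closed M" and MK: "M \<subseteq> K" and xM: "x \<in> M"
    unfolding M_def using closed_ecl ecl_subset[OF xK] ecl_self[OF xK] by auto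
  have Mreg: "reg y" "ecl K v P y = M" if "y \<in> M" for y
    using reg_ecl[OF x] that by (auto simp: M_def)
  have Minv: "v t y \<in> M" if "y \<in> M" for y t
  proof -
    have "v t y \<in> ecl K v P y"
      using orb_eorb[of y] closure_subset[of "eorb K v P y"] v_in_orb[of t y] unfolding ecl_def by blast
    then show ?thesis using Mreg[OF that] by simp
  qed
  have Minv': "v t y \<in> M \<longleftrightarrow> y \<in> M" if "y \<in> K" for y t
    using Minv[of y t] Minv[of "v t y" "- t"] v_neg(1)[OF that] by auto
  have Mrec: "z \<in> olim v y" if "y \<in> M" "z \<in> M" for y z
    using reg_olim[OF Mreg(1)[OF that(1)]] Mreg(2)[OF that(1)] that(2) by blast
  have nper: "v t y \<noteq> y" if y: "y \<in> M" and t: "t > 0" for t y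
  proof
    assume eq: "v t y = y"
    have yK: "y \<in> K" using y MK by blast
    have "closure (orb v y) = orb v y"
      using periodic_orb[OF yK t eq] compact_arc[OF yK, of 0 t] by (simp add: compact_imp_closed)
    then have "M = orb v y" using reg_closure[OF Mreg(1)[OF y]] Mreg(2)[OF y] by simp
    then obtain s where s: "x = v s y" using xM by (auto simp: orb_def)
    have "v t x = v s (v t y)" using s yK by (simp add: vadd add.commute)
    then show False using np[OF t] eq s by simp
  qed
  \<comment> \<open>An interior point anywhere in \<open>M\<close> is enough: the orbit of
    \<open>x\<close> comes near it, and the flow moves a neighbourhood back to
    \<open>x\<close>.\<close>
  have noball: False if y: "y \<in> M" and e: "e > 0" "\<And>z. z \<in> K ==> dist z y < e ==> z \<in> M" for y e
  proof -
    obtain t where t: "dist (v t x) y < e" using olimD[OF Mrec[OF xM y] e(1)] by blast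
    obtain d where d: "d > 0" "\<And>z s. z \<in> K ==> dist z x < d ==> t \<le> s ==> s \<le> t ==> v s z \<in> ball y e"
    proof (rule tube[OF xK open_ball[of y e], of t t])
      show "v s x \<in> ball y e" if "t \<le> s" "s \<le> t" for s
        using t that by (simp add: dist_commute antisym[OF that(2,1)])
    qed (use that in blast)
    have "z \<in> M" if "z \<in> K" "dist z x < d" for z
    proof -
      have "v t z \<in> M" using d(2)[OF that, of t] e(2)[OF inK[OF that(1)]] by (simp add: dist_commute)
      then show ?thesis using Minv'[OF that(1)] by blast
    qed
    then show False using not_int d(1) unfolding M_def by blast
  qed
  obtain a b h j where fb: "fbox x a b h j" using reg_nonfix[OF x] flow_box[OF xK] by blast
  let ?I = "{a<..<b} \<union> {0}"
  have ab: "a \<le> 0" "0 < b" "h > 0" "continuous_on {a..b} j" "j 0 = x" using fb unfolding fbox_def by auto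
  have jK: "j s \<in> K" if "s \<in> {a..b}" for s using fbox_K[OF fb that] .
  have Iab: "?I \<subseteq> {a..b}" using ab by auto
  obtain \<sigma> \<tau> where co: "\<And>s t. s \<in> {a..b} ==> \<bar>t\<bar> \<le> h ==> \<sigma> (v t (j s)) = s & \<tau> (v t (j s)) = t"
    "continuous_on (fcell j ?I h) \<sigma>" "continuous_on (fcell j ?I h) \<tau>" by (rule fbox_coord[OF fb]) blast
  define A where "A = {s \<in> {a..b}. j s \<in> M}"
  have "closed ({a..b} \<inter> j -` M)" by (intro continuous_closed_preimage ab clM) auto
  moreover have "A = {a..b} \<inter> j -` M" by (auto simp: A_def)
  ultimately have clA: "closed A" by simp
  have A0: "0 \<in> A" using ab xM by (simp add: A_def)
  have noint: "\<exists>s. u < s & s < w & s \<notin> A" if uw: "u < w" "a \<le> u" "w \<le> b" for u w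
  proof (rule ccontr)
    assume "\<not> ?thesis"
    then have all: "\<And>s. u < s ==> s < w ==> s \<in> A" by blast
    define s0 where "s0 = (u + w) / 2"
    have s0: "u < s0" "s0 < w" using uw by (auto simp: s0_def)
    obtain d where d: "d > 0" "\<And>z. z \<in> K ==> dist z (j s0) < d ==>
        \<exists>s t. s \<in> ?I \<inter> {u<..<w} & \<bar>t\<bar> < h & z = v t (j s)"
      by (rule fbox_near[OF fb, of s0 "{u<..<w}" h]) (use s0 uw ab in auto)
    have "j s0 \<in> M" using all[OF s0] by (simp add: A_def)
    then show False
    proof (rule noball[OF _ d(1)])
      fix z assume "z \<in> K" "dist z (j s0) < d"
      then obtain s t where st: "s \<in> {u<..<w}" "z = v t (j s)" using d(2) by blast
      then have "j s \<in> M" using all by (auto simp: A_def)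
      then show "z \<in> M" using Minv st by blast
    qed
  qed
  obtain d where d: "0 < d" "d < b" "d \<notin> A" using noint[of 0 b] ab by auto
  \<comment> \<open>The section is cut at points off \<open>M\<close>, so that the part of
    \<open>M\<close> on it is compact and stays away from the cuts. A one-sided section keeps its
    end 0, which a flow box treats like an inner point.\<close>
  obtain c where c: "a \<le> c" "c \<le> 0" "c < 0 ==> c \<notin> A" "c < 0 ==> a < c" "c = 0 ==> a = 0"
  proof (cases "a < 0")
    case True
    then obtain c where "a < c" "c < 0" "c \<notin> A" using noint[of a 0] ab by auto
    then show thesis by (intro that[of c]) auto
  qed (use ab in \<open>auto intro: that[of 0]\<close>)
  have cd: "{c..d} \<subseteq> {a..b}" using c d by auto
  define A' where "A' = A \<inter> {c..d}"
  define S where "S = (if c < 0 then {c<..<d} else {-1<..<d})"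
  have openS: "open S" by (simp add: S_def)
  have IS: "?I \<inter> S \<subseteq> {c..d}" using c by (auto simp: S_def split: if_splits)
  have A'S: "s \<in> ?I \<inter> S" if "s \<in> A'" for s
  proof -
    have s: "s \<in> A" "c \<le> s" "s \<le> d" using that by (auto simp: A'_def)
    then have "s \<noteq> d" using d by auto
    moreover have "s \<noteq> c \<or> c = 0" using c s by force
    ultimately show ?thesis using s c d by (auto simp: S_def)
  qed
  have cptA': "compact A'" unfolding A'_def using clA by (metis closed_Int_compact compact_Icc)
  have A'M: "s \<in> A' \<longleftrightarrow> s \<in> {c..d} & j s \<in> M" for s using cd by (auto simp: A'_def A_def)
  \<comment> \<open>A return to the section along positive times, on a piece \<open>U\<close> only:
    different pieces may use different returns. No orientation is prescribed.\<close>
  define RP where "RP U f \<longleftrightarrow> continuous_on (U \<inter> {c..d}) f & inj_on f (U \<inter> {c..d}) & f ` (U \<inter> {c..d}) \<subseteq> {c..d} &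
     (\<forall>s\<in>U \<inter> {c..d}. \<exists>t>0. j (f s) = v t (j s))" for U f
  have RP_mono: "RP W f" if "RP U f" "W \<subseteq> U" for U W f
  proof -
    have sub: "W \<inter> {c..d} \<subseteq> U \<inter> {c..d}" using that(2) by blast
    have U: "continuous_on (U \<inter> {c..d}) f" "inj_on f (U \<inter> {c..d})" "f ` (U \<inter> {c..d}) \<subseteq> {c..d}"
       "\<And>s. s \<in> U \<inter> {c..d} ==> \<exists>t>0. j (f s) = v t (j s)" using that(1) by (simp_all add: RP_def)
    have "f ` (W \<inter> {c..d}) \<subseteq> {c..d}" using image_mono[OF sub] U(3) by (rule subset_trans)
    moreover have "\<forall>s\<in>W \<inter> {c..d}. \<exists>t>0. j (f s) = v t (j s)" using U(4) sub by blast
    ultimately show ?thesis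
      unfolding RP_def using continuous_on_subset[OF U(1) sub] inj_on_subset[OF U(2) sub] by simp
  qed
  have loc: "\<exists>e>0. \<exists>f. RP (ball m e) f" if m: "m \<in> A'" for m
  proof -
    have mI: "m \<in> ?I" "m \<in> S" and mab: "m \<in> {a..b}" and jm: "j m \<in> M"
      using A'S[OF m] m Iab A'M by blast+
    obtain d1 where d1: "d1 > 0" "\<And>z. z \<in> K ==> dist z (j m) < d1 ==>
        \<exists>s t. s \<in> ?I \<inter> S & \<bar>t\<bar> < h/2 & z = v t (j s)"
      by (rule fbox_near[OF fb mI(1) openS mI(2), of "h/2"]) (use ab in auto)
    obtain t where t: "t \<ge> h" "dist (v t (j m)) (j m) < d1/2"
      using olimD[OF Mrec[OF jm jm], of "d1/2" h] d1(1) by auto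
    have cvt: "continuous_on {a..b} (%s. v t (j s))"
      by (intro cont_v continuous_intros ab) (use jK in auto)
    then obtain e where e: "e > 0" "\<And>s. s \<in> {a..b} ==> dist s m < e ==> dist (v t (j s)) (v t (j m)) < d1/2"
      using mab d1(1) unfolding continuous_on_iff by (metis half_gt_zero)
    define f where "f s = \<sigma> (v t (j s))" for s
    define \<theta> where "\<theta> s = \<tau> (v t (j s))" for s
    have f: "f s \<in> ?I \<inter> S & \<bar>\<theta> s\<bar> < h/2 & v t (j s) = v (\<theta> s) (j (f s)) & v t (j s) \<in> fcell j ?I h"
      if s: "s \<in> ball m e \<inter> {c..d}" for s
    proof -
      have sab: "s \<in> {a..b}" using s cd by blast
      have "dist (v t (j s)) (j m) < d1"
        using e(2)[OF sab] s t(2) dist_triangle[of "v t (j s)" "j m" "v t (j m)"]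
        by (auto simp: dist_commute)
      then obtain s' t' where st: "s' \<in> ?I \<inter> S" "\<bar>t'\<bar> < h/2" "v t (j s) = v t' (j s')"
        using d1(2)[OF inK[OF jK[OF sab]]] by blast
      have "s' \<in> {a..b}" using st(1) Iab by blast
      then have "\<sigma> (v t (j s)) = s'" "\<tau> (v t (j s)) = t'" using co(1)[of s' t'] st ab by auto
      then show ?thesis using st ab
        by (auto simp: f_def \<theta>_def fcell_def intro!: image_eqI[of _ _ "(s', t')"])
    qed
    have jf: "j (f s) = v (t - \<theta> s) (j s)" if "s \<in> ball m e \<inter> {c..d}" for s
    proof -
      have "f s \<in> {a..b}" using f[OF that] Iab by blast
      moreover have "s \<in> {a..b}" using cd that by blast
      ultimately have "v (t - \<theta> s) (j s) = j (f s)"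
        using f[OF that] v_eq_iff[of "j s" "j (f s)" t "\<theta> s"] jK by blast
      then show ?thesis by simp
    qed
    have "RP (ball m e) f"
      unfolding RP_def
    proof (intro conjI ballI)
      show "continuous_on (ball m e \<inter> {c..d}) f"
        unfolding f_def
        by (rule continuous_on_compose2[OF co(2) continuous_on_subset[OF cvt]]) (use f cd in blast)+
      show "inj_on f (ball m e \<inter> {c..d})"
      proof (rule inj_onI)
        fix s s' assume s: "s \<in> ball m e \<inter> {c..d}" "s' \<in> ball m e \<inter> {c..d}" "f s = f s'"
        then have "v (t - \<theta> s) (j s) = v (t - \<theta> s') (j s')" using jf by metis
        moreover have "\<bar>(t - \<theta> s) - (t - \<theta> s')\<bar> \<le> h" using f[OF s(1)] f[OF s(2)] by linarith
        moreover have "s \<in> {a..b}" "s' \<in> {a..b}" using cd s by auto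
        ultimately show "s = s'" using fbox_uniq[OF fb, of s s' "t - \<theta> s" "t - \<theta> s'"] by blast
      qed
      show "f ` (ball m e \<inter> {c..d}) \<subseteq> {c..d}" using f IS by blast
      fix s assume s: "s \<in> ball m e \<inter> {c..d}"
      have "t - \<theta> s > 0" using f[OF s] t ab by linarith
      then show "\<exists>t>0. j (f s) = v t (j s)" using jf[OF s] by blast
    qed
    then show ?thesis using e(1) by blast
  qed
  then obtain E where E: "\<And>m. m \<in> A' ==> E m > 0 & (\<exists>f. RP (ball m (E m)) f)" by metis
  \<comment> \<open>A Lebesgue number of the pieces: a gap shorter than \<delta> lies within one of
    them and can be transported as a whole.\<close>
  obtain \<delta> where \<delta>: "\<delta> > 0" "\<And>m. m \<in> A' ==> \<exists>G\<in>(%m. ball m (E m)) ` A'. ball m \<delta> \<subseteq> G"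
    by (rule Heine_Borel_lemma[OF cptA', of "(%m. ball m (E m)) ` A'"]) (use E in auto)
  have unif: "\<exists>f. RP (ball m \<delta>) f" if m: "m \<in> A'" for m
  proof -
    obtain m' where m': "m' \<in> A'" "ball m \<delta> \<subseteq> ball m' (E m')" using \<delta>(2)[OF m] by blast
    then obtain f where "RP (ball m' (E m')) f" using E by blast
    then show ?thesis using RP_mono m'(2) by blast
  qed
  define gapp where "gapp G \<longleftrightarrow> fst G \<in> A' & snd G \<in> A' & fst G < snd G & {fst G<..<snd G} \<inter> A' = {}" for G
  have gap_not: False if "gapp G" "z \<in> A'" "fst G < z" "z < snd G" for G z
    using that unfolding gapp_def disjoint_iff by simp
  \<comment> \<open>Endpoints go to endpoints in positive time, in either order since a return may
    reverse the gap. Inner points correspond to each other along orbits, without regard to time,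
    which is all that the accumulation argument needs.\<close>
  define Tr where "Tr G H \<longleftrightarrow> (\<exists>t>0. v t (j (fst G)) \<in> {j (fst H), j (snd H)}) &
      (\<exists>t>0. v t (j (snd G)) \<in> {j (fst H), j (snd H)}) &
      (\<forall>z\<in>{fst G<..<snd G}. \<exists>z'\<in>{fst H<..<snd H}. j z' \<in> orb v (j z)) &
      (\<forall>z'\<in>{fst H<..<snd H}. \<exists>z\<in>{fst G<..<snd G}. j z' \<in> orb v (j z))" for G H :: "real \<times> real"
  have Tr1: "\<exists>t>0. v t (j (fst G)) \<in> {j (fst H), j (snd H)}" and Tr2: "\<exists>t>0. v t (j (snd G)) \<in> {j (fst H), j (snd H)}"
    and Tr3: "\<And>z. z \<in> {fst G<..<snd G} ==> \<exists>z'\<in>{fst H<..<snd H}. j z' \<in> orb v (j z)"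
    and Tr4: "\<And>z'. z' \<in> {fst H<..<snd H} ==> \<exists>z\<in>{fst G<..<snd G}. j z' \<in> orb v (j z)"
    if "Tr G H" for G H
    using that by (simp_all add: Tr_def)
  have gap_ab: "z \<in> {c..d} & z \<in> {a..b}" if "gapp G" "fst G \<le> z" "z \<le> snd G" for G z
    using that cd by (auto simp: gapp_def A'_def)
  have succ: "\<exists>H. gapp H & Tr G H" if G: "gapp G" "snd G - fst G < \<delta>" for G
  proof -
    obtain p q where pq: "G = (p, q)" by (cases G)
    have g: "p \<in> A'" "q \<in> A'" "p < q" "{p<..<q} \<inter> A' = {}" using G(1) by (auto simp: gapp_def pq)
    obtain f where "RP (ball p \<delta>) f" using unif[OF g(1)] by blast
    moreover have "{p..q} \<subseteq> ball p \<delta>" using G(2) by (auto simp: pq dist_real_def)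
    ultimately have "RP {p..q} f" by (rule RP_mono)
    moreover have pqcd: "{p..q} \<subseteq> {c..d}" using g(1,2) by (auto simp: A'_def)
    moreover have "{p..q} \<inter> {c..d} = {p..q}" using pqcd by blast
    ultimately have f: "continuous_on {p..q} f" "inj_on f {p..q}" "f ` {p..q} \<subseteq> {c..d}"
      and ft: "\<And>s. s \<in> {p..q} ==> \<exists>t>0. j (f s) = v t (j s)"
      unfolding RP_def by auto
    have jK': "j s \<in> K" if "s \<in> {p..q}" for s using jK cd pqcd that by blast
    have fA: "f s \<in> A' \<longleftrightarrow> s \<in> A'" if s: "s \<in> {p..q}" for s
    proof -
      obtain t where "j (f s) = v t (j s)" using ft[OF s] by blast
      moreover have "f s \<in> {c..d}" by (rule subsetD[OF f(3)]) (use s in simp)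
      moreover have "s \<in> {c..d}" using s pqcd by blast
      ultimately show ?thesis using Minv'[OF jK'[OF s], of t] A'M by simp
    qed
    define p' q' where "p' = min (f p) (f q)" and "q' = max (f p) (f q)"
    have btw: "p' < f z & f z < q'" if "z \<in> {p<..<q}" for z
      using continuous_inj_imp_mono[OF _ _ f(1,2), of z] that by (auto simp: p'_def q'_def)
    have onto: "\<exists>z\<in>{p<..<q}. f z = z'" if z': "z' \<in> {p'<..<q'}" for z'
    proof -
      have "\<exists>z. p \<le> z & z \<le> q & f z = z'"
        using IVT'[of f p z' q] IVT2'[of f q z' p] f(1) g(3) z' by (auto simp: p'_def q'_def min_def max_def split: if_splits)
      then obtain z where z: "p \<le> z" "z \<le> q" "f z = z'" by blast
      then have "z \<noteq> p" "z \<noteq> q" using z' by (auto simp: p'_def q'_def)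
      then show ?thesis using z by (intro bexI[of _ z]) auto
    qed
    have "f ((p + q)/2) \<in> {p'<..<q'}" using btw[of "(p+q)/2"] g(3) by auto
    then have "p' < q'" by auto
    have "gapp (p', q')"
      unfolding gapp_def fst_conv snd_conv
    proof (intro conjI)
      show "p' \<in> A'" "q' \<in> A'" using fA[of p] fA[of q] g by (auto simp: p'_def q'_def min_def max_def)
      show "{p'<..<q'} \<inter> A' = {}"
      proof (rule ccontr)
        assume "{p'<..<q'} \<inter> A' \<noteq> {}"
        then obtain z' where "z' \<in> {p'<..<q'}" "z' \<in> A'" by blast
        then obtain z where "z \<in> {p<..<q}" "f z \<in> A'" using onto by blast
        then show False using fA[of z] g(4) by auto
      qed
    qed fact
    moreover have "Tr (p, q) (p', q')"
      unfolding Tr_def fst_conv snd_conv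
    proof (intro conjI ballI)
      have *: "{j p', j q'} = {j (f p), j (f q)}" by (auto simp: p'_def q'_def min_def max_def)
      show "\<exists>t>0. v t (j p) \<in> {j p', j q'}" "\<exists>t>0. v t (j q) \<in> {j p', j q'}"
        unfolding * using ft[of p] ft[of q] g(3) by auto
      show "\<exists>z'\<in>{p'<..<q'}. j z' \<in> orb v (j z)" if z: "z \<in> {p<..<q}" for z
        using btw[OF z] ft[of z] z by (intro bexI[of _ "f z"]) auto
      show "\<exists>z\<in>{p<..<q}. j z' \<in> orb v (j z)" if z': "z' \<in> {p'<..<q'}" for z'
      proof -
        obtain z where z: "z \<in> {p<..<q}" "f z = z'" using onto[OF z'] by blast
        then show ?thesis using ft[of z] by (intro bexI[of _ z]) auto
      qed
    qed
    ultimately show ?thesis by (auto simp: pq)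
  qed
  have Tr_trans: "Tr F H" if F: "gapp F" "gapp G" "Tr F G" "Tr G H" for F G H
  proof -
    have jFK: "j (fst F) \<in> K" "j (snd F) \<in> K" using jK gap_ab[OF F(1)] F(1) unfolding gapp_def by auto
    have ends: "\<exists>t>0. v t w \<in> {j (fst H), j (snd H)}"
      if w: "w \<in> K" "\<exists>t>0. v t w \<in> {j (fst G), j (snd G)}" for w
    proof -
      obtain t where t: "t > 0" "v t w = j (fst G) \<or> v t w = j (snd G)" using w(2) by auto
      obtain t' where t': "t' > 0" "v t' (v t w) \<in> {j (fst H), j (snd H)}"
        using t(2) Tr1[OF F(4)] Tr2[OF F(4)] by metis
      then show ?thesis using t(1) vadd[OF w(1)] by (intro exI[of _ "t' + t"]) auto
    qed
    have o: "j z'' \<in> orb v (j z)" if "z \<in> {fst F<..<snd F}" "j z' \<in> orb v (j z)" "j z'' \<in> orb v (j z')" for z z' z''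
      using that orb_eq[OF jK] gap_ab[OF F(1), of z] by auto
    show ?thesis
      unfolding Tr_def
    proof (intro conjI ballI)
      show "\<exists>t>0. v t (j (fst F)) \<in> {j (fst H), j (snd H)}" "\<exists>t>0. v t (j (snd F)) \<in> {j (fst H), j (snd H)}"
        by (rule ends[OF jFK(1) Tr1[OF F(3)]], rule ends[OF jFK(2) Tr2[OF F(3)]])
      show "\<exists>z'\<in>{fst H<..<snd H}. j z' \<in> orb v (j z)" if z: "z \<in> {fst F<..<snd F}" for z
      proof -
        obtain z1 where z1: "z1 \<in> {fst G<..<snd G}" "j z1 \<in> orb v (j z)" using Tr3[OF F(3) z] by blast
        obtain z2 where "z2 \<in> {fst H<..<snd H}" "j z2 \<in> orb v (j z1)" using Tr3[OF F(4) z1(1)] by blast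
        then show ?thesis using o[OF z z1(2)] by blast
      qed
      show "\<exists>z\<in>{fst F<..<snd F}. j z' \<in> orb v (j z)" if z': "z' \<in> {fst H<..<snd H}" for z'
      proof -
        obtain z1 where z1: "z1 \<in> {fst G<..<snd G}" "j z' \<in> orb v (j z1)" using Tr4[OF F(4) z'] by blast
        obtain z2 where "z2 \<in> {fst F<..<snd F}" "j z1 \<in> orb v (j z2)" using Tr4[OF F(3) z1(1)] by blast
        then show ?thesis using o z1(2) by blast
      qed
    qed
  qed
  \<comment> \<open>A gap transported to itself would exchange its endpoints or fix one of them, and
    thus make an endpoint periodic after at most two rounds.\<close>
  have no_self: "\<not> Tr G G" if G: "gapp G" for G
  proof
    assume T: "Tr G G"
    have M: "j (fst G) \<in> M" "j (snd G) \<in> M" using G A'M by (auto simp: gapp_def)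
    obtain t where t: "t > 0" "v t (j (fst G)) \<in> {j (fst G), j (snd G)}" using Tr1[OF T] by blast
    obtain s where s: "s > 0" "v s (j (snd G)) \<in> {j (fst G), j (snd G)}" using Tr2[OF T] by blast
    have 1: "v t (j (fst G)) = j (snd G)" using t nper[OF M(1) t(1)] by auto
    have "v s (j (snd G)) = j (fst G)" using s nper[OF M(2) s(1)] by auto
    then have "v (s + t) (j (fst G)) = j (fst G)" using 1 M MK vadd[of "j (fst G)" s t] by auto
    then show False using nper[OF M(1), of "s + t"] s t by simp
  qed
  \<comment> \<open>Every point of \<open>A'\<close> returns to \<open>A'\<close> in positive time.
    In a finite set the successive returns of 0 would repeat and give a period.\<close>
  have infA': "infinite A'"
  proof
    assume fin: "finite A'"
    have "\<exists>m'\<in>A'. \<exists>t>0. j m' = v t (j m)" if m: "m \<in> A'" for m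
    proof -
      obtain f where f: "RP (ball m \<delta>) f" using unif[OF m] by blast
      have mm: "m \<in> ball m \<delta> \<inter> {c..d}" using m \<delta>(1) by (auto simp: A'_def)
      then obtain t where t: "t > 0" "j (f m) = v t (j m)" using f unfolding RP_def by blast
      moreover have "f m \<in> {c..d}" using f mm unfolding RP_def by blast
      moreover have "v t (j m) \<in> M" using Minv m A'M by blast
      ultimately show ?thesis using A'M by auto
    qed
    then obtain g where g: "\<And>m. m \<in> A' ==> g m \<in> A' & (\<exists>t>0. j (g m) = v t (j m))" by metis
    have "0 \<in> A'" using A0 c d by (auto simp: A'_def)
    then have gn: "(g ^^ n) 0 \<in> A'" for n by (induction n) (use g in auto)
    have fwd: "\<exists>t>0. j ((g ^^ (n + Suc k)) 0) = v t (j ((g ^^ n) 0))" for n k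
    proof (induction k)
      case 0
      then show ?case using g[OF gn[of n]] by simp
    next
      case (Suc k)
      then obtain t where t: "t > 0" "j ((g ^^ (n + Suc k)) 0) = v t (j ((g ^^ n) 0))" by blast
      obtain s where s: "s > 0" "j (g ((g ^^ (n + Suc k)) 0)) = v s (j ((g ^^ (n + Suc k)) 0))" using g[OF gn] by blast
      have "j ((g ^^ n) 0) \<in> K" using gn A'M MK by blast
      then have "j (g ((g ^^ (n + Suc k)) 0)) = v (s + t) (j ((g ^^ n) 0))" using s t by (simp add: vadd)
      then show ?case using s(1) t(1) by (intro exI[of _ "s + t"]) simp
    qed
    have "\<not> inj (%n. (g ^^ n) 0)"
      using fin gn finite_subset[of "range (%n. (g ^^ n) 0)" A'] range_inj_infinite by blast
    then obtain n k where nk: "n < k" "(g ^^ n) 0 = (g ^^ k) 0"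
      unfolding inj_def by (metis linorder_neqE_nat)
    then have "n + Suc (k - Suc n) = k" by simp
    then obtain t where "t > 0" "j ((g ^^ k) 0) = v t (j ((g ^^ n) 0))" using fwd by metis
    then show False using nk(2) nper gn A'M by metis
  qed
  have gap_between: "\<exists>G. gapp G & p \<le> fst G & snd G \<le> q" if pq: "p \<in> A'" "q \<in> A'" "p < q" for p q
  proof -
    have "a \<le> p" "q \<le> b" using pq cd by (auto simp: A'_def)
    then obtain r where r: "p < r" "r < q" "r \<notin> A" using noint[OF pq(3)] by blast
    define L where "L = A' \<inter> {p..r}"
    define R where "R = A' \<inter> {r..q}"
    have cl: "closed L" "closed R" unfolding L_def R_def using cptA' by (auto intro: compact_imp_closed closed_Int)
    have ne: "L \<noteq> {}" "R \<noteq> {}" using pq r by (auto simp: L_def R_def)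
    have bd: "bdd_above L" "bdd_below R" unfolding L_def R_def by (auto intro: bdd_aboveI[of _ r] bdd_belowI[of _ r])
    have SL: "Sup L \<in> L" and IR: "Inf R \<in> R" using closed_contains_Sup closed_contains_Inf cl ne bd by auto
    have ner: "Sup L \<noteq> r" "Inf R \<noteq> r" using SL IR r(3) by (auto simp: L_def R_def A'_def)
    have "z \<notin> A'" if z: "z \<in> {Sup L<..<Inf R}" for z
    proof
      assume zA: "z \<in> A'"
      have zpq: "p \<le> z" "z \<le> q" using SL IR z by (auto simp: L_def R_def)
      show False
      proof (cases "z \<le> r")
        case True
        then have "z \<in> L" using zA zpq by (simp add: L_def)
        then show False using cSup_upper[OF _ bd(1)] z by force
      next
        case False
        then have "z \<in> R" using zA zpq by (simp add: R_def)
        then show False using cInf_lower[OF _ bd(2)] z by force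
      qed
    qed
    then have "gapp (Sup L, Inf R)"
      using SL IR ner by (auto simp: gapp_def L_def R_def)
    then show ?thesis using SL IR by (intro exI[of _ "(Sup L, Inf R)"]) (auto simp: L_def R_def)
  qed
  have inf_gaps: "infinite {G. gapp G}"
  proof
    assume fin: "finite {G. gapp G}"
    \<comment> \<open>The points of \<open>A'\<close> are told apart by the gaps on their left, so
      finitely many gaps would leave only finitely many points.\<close>
    have "inj_on (%m. {G. gapp G & snd G \<le> m}) A'"
    proof (rule linorder_inj_onI)
      fix p q assume pq: "p < q" "p \<in> A'" "q \<in> A'"
      obtain G where G: "gapp G" "p \<le> fst G" "snd G \<le> q" using gap_between[OF pq(2,3,1)] by blast
      then have "\<not> snd G \<le> p" by (auto simp: gapp_def)
      then show "{G. gapp G & snd G \<le> p} \<noteq> {G. gapp G & snd G \<le> q}" using G by blast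
    qed (rule linear)
    moreover have "finite ((%m. {G. gapp G & snd G \<le> m}) ` A')"
      by (rule finite_subset[of _ "Pow {G. gapp G}"]) (use fin in auto)
    ultimately show False using infA' finite_imageD by blast
  qed
  \<comment> \<open>Gaps do not overlap, so the left ends of those with length at least
    \<open>e\<close> fall into different cells of width \<open>e\<close>.\<close>
  have fin_big: "finite {G. gapp G & snd G - fst G \<ge> e}" if e: "e > 0" for e
  proof (rule inj_on_finite[of "%G. \<lfloor>fst G / e\<rfloor>" _ "{\<lfloor>c / e\<rfloor>..\<lfloor>d / e\<rfloor>}"])
    have lt: "\<lfloor>fst G / e\<rfloor> < \<lfloor>fst H / e\<rfloor>"
      if G: "gapp G" "snd G - fst G \<ge> e" "gapp H" "fst G < fst H" for G H
    proof -
      have "snd G \<le> fst H"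
      proof (rule ccontr)
        assume "\<not> ?thesis"
        then show False using gap_not[OF G(1), of "fst H"] G(3,4) by (simp add: gapp_def)
      qed
      then have "(fst G + e) / e \<le> fst H / e" using G(2) e by (intro divide_right_mono) auto
      then have "fst G / e + 1 \<le> fst H / e" using e by (simp add: add_divide_distrib)
      then have "\<lfloor>fst G / e + 1\<rfloor> \<le> \<lfloor>fst H / e\<rfloor>" by (rule floor_mono)
      then show ?thesis by simp
    qed
    have snd_eq: "snd G = snd H" if G: "gapp G" "gapp H" "fst G = fst H" for G H
    proof (rule ccontr)
      assume "snd G \<noteq> snd H"
      then consider "snd G < snd H" | "snd H < snd G" by linarith
      then show False
        using gap_not[OF G(2), of "snd G"] gap_not[OF G(1), of "snd H"] G by cases (simp_all add: gapp_def)
    qed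
    show "inj_on (%G. \<lfloor>fst G / e\<rfloor>) {G. gapp G & snd G - fst G \<ge> e}"
    proof (rule inj_onI, clarify)
      fix p q p' q' assume *: "gapp (p, q)" "snd (p, q) - fst (p, q) \<ge> e" "gapp (p', q')"
        "snd (p', q') - fst (p', q') \<ge> e" "\<lfloor>fst (p, q) / e\<rfloor> = \<lfloor>fst (p', q') / e\<rfloor>"
      have "p = p'" using lt[OF *(1,2,3)] lt[OF *(3,4,1)] *(5) by (cases p p' rule: linorder_cases) auto
      then show "p = p' & q = q'" using snd_eq[OF *(1,3)] by simp
    qed
    show "(%G. \<lfloor>fst G / e\<rfloor>) ` {G. gapp G & e \<le> snd G - fst G} \<subseteq> {\<lfloor>c / e\<rfloor>..\<lfloor>d / e\<rfloor>}"
      using e by (auto simp: gapp_def A'_def intro!: floor_mono divide_right_mono)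
  qed simp
  \<comment> \<open>The gaps entered by the orbit of \<open>z0\<close> become arbitrarily short, so
    the orbit accumulates at one of their endpoints in the limit, that is, on \<open>M\<close>. The
    decomposition property then puts \<open>z0\<close> itself into \<open>M\<close>.\<close>
  have acc: False if inf: "infinite \<H>" and gaps: "\<And>G. G \<in> \<H> ==> gapp G"
    and z0: "z0 \<in> K" "z0 \<notin> M" "\<And>G. G \<in> \<H> ==> \<exists>z\<in>{fst G<..<snd G}. j z \<in> orb v z0" for \<H> z0
  proof -
    have "\<exists>G\<in>\<H>. snd G - fst G < inverse (real (Suc n))" for n
    proof (rule ccontr)
      assume "\<not> ?thesis"
      then have "\<H> \<subseteq> {G. gapp G & snd G - fst G \<ge> inverse (real (Suc n))}" using gaps by (auto simp: not_less)
      then show False using fin_big[of "inverse (real (Suc n))"] inf finite_subset by auto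
    qed
    then obtain G where G: "\<And>n. G n \<in> \<H>" "\<And>n. snd (G n) - fst (G n) < inverse (real (Suc n))" by metis
    have "\<exists>z. z \<in> {fst (G n)<..<snd (G n)} & j z \<in> orb v z0" for n using z0(3)[OF G(1)] by blast
    then obtain z where z: "\<And>n. z n \<in> {fst (G n)<..<snd (G n)}" "\<And>n. j (z n) \<in> orb v z0" by metis
    have pA: "fst (G n) \<in> A'" for n using gaps[OF G(1)] by (simp add: gapp_def)
    obtain l r where l: "l \<in> A'" "strict_mono r" "((%n. fst (G n)) \<circ> r) \<longlonglongrightarrow> l"
      by (rule seq_compactE[OF cptA'[unfolded compact_eq_seq_compact_metric], of "%n. fst (G n)"]) (use pA in auto)
    have "(%n. z n - fst (G n)) \<longlonglongrightarrow> 0"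
    proof (rule real_tendsto_sandwich[OF _ _ tendsto_const LIMSEQ_inverse_real_of_nat])
      show "\<forall>\<^sub>F n in sequentially. 0 \<le> z n - fst (G n)" using z(1) by (auto simp: less_imp_le)
      show "\<forall>\<^sub>F n in sequentially. z n - fst (G n) \<le> inverse (real (Suc n))"
      proof (intro always_eventually allI)
        fix n show "z n - fst (G n) \<le> inverse (real (Suc n))" using z(1)[of n] G(2)[of n] by auto
      qed
    qed
    then have "(%n. z (r n) - fst (G (r n))) \<longlonglongrightarrow> 0" using LIMSEQ_subseq_LIMSEQ[OF _ l(2)] by (fastforce simp: o_def)
    from tendsto_add[OF this l(3)] have zl: "(%n. z (r n)) \<longlonglongrightarrow> l" by (simp add: o_def)
    have zab: "z n \<in> {a..b}" for n using gap_ab[OF gaps[OF G(1)], of n "z n"] z(1)[of n] by auto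
    have lab: "l \<in> {a..b}" and jl: "j l \<in> M" using l(1) cd A'M by auto
    have "(%n. j (z (r n))) \<longlonglongrightarrow> j l"
      by (rule continuous_on_tendsto_compose[OF ab(4) zl lab]) (use zab in auto)
    then have "j l \<in> closure (orb v z0)" unfolding closure_sequential using z(2) by (intro exI[of _ "%n. j (z (r n))"]) auto
    then have "j l \<in> ecl K v P z0" using closure_orb_ecl by blast
    then have "ecl K v P z0 = M" using pap[OF z0(1)] Mreg(2)[OF jl] by simp
    then show False using z0(2) ecl_self[OF z0(1)] by simp
  qed
  have mid: "j ((fst G + snd G)/2) \<in> K" "j ((fst G + snd G)/2) \<notin> M" "(fst G + snd G)/2 \<in> {fst G<..<snd G}" if G: "gapp G" for G
  proof -
    show m: "(fst G + snd G)/2 \<in> {fst G<..<snd G}" using G by (auto simp: gapp_def)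
    then have cdm: "(fst G + snd G)/2 \<in> {c..d} & (fst G + snd G)/2 \<in> {a..b}" by (intro gap_ab[OF G]) auto
    then show "j ((fst G + snd G)/2) \<in> K" using jK by blast
    show "j ((fst G + snd G)/2) \<notin> M"
    proof
      assume "j ((fst G + snd G)/2) \<in> M"
      then have "(fst G + snd G)/2 \<in> A'" using A'M cdm by blast
      then show False using gap_not[OF G, of "(fst G + snd G)/2"] m
        unfolding greaterThanLessThan_iff by blast
    qed
  qed
  define big where "big = {G. gapp G & snd G - fst G \<ge> \<delta>}"
  have fin_b: "finite big" unfolding big_def using fin_big[OF \<delta>(1)] .
  show False
  \<comment> \<open>Either some short gap is only ever transported to short gaps, and its successors
    form an infinite chain without repetition; or every short gap reaches one of the finitely many
    long ones, and infinitely many reach the same. In both cases one orbit off \<open>M\<close>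
    enters infinitely many gaps.\<close>
  proof (cases "\<exists>G0. gapp G0 & G0 \<notin> big & (\<forall>H. gapp H & Tr G0 H --> H \<notin> big)")
    case True
    then obtain G0 where G0: "gapp G0" "G0 \<notin> big" "\<And>H. gapp H ==> Tr G0 H ==> H \<notin> big" by blast
    have small: "snd G - fst G < \<delta>" if "gapp G" "G \<notin> big" for G using that by (auto simp: big_def)
    have "\<exists>H. \<forall>n. (gapp (H n) & Tr G0 (H n)) & Tr (H n) (H (Suc n))"
    proof (rule dependent_nat_choice)
      show "\<exists>H. gapp H & Tr G0 H" by (rule succ[OF G0(1) small[OF G0(1,2)]])
      fix H and n :: nat assume H: "gapp H & Tr G0 H"
      then obtain H' where "gapp H'" "Tr H H'" using succ[of H] small G0(3) by blast
      then show "\<exists>H'. (gapp H' & Tr G0 H') & Tr H H'" using Tr_trans[OF G0(1), of H H'] H by blast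
    qed
    then obtain H where H: "\<And>n. gapp (H n)" "\<And>n. Tr G0 (H n)" "\<And>n. Tr (H n) (H (Suc n))" by blast
    have chain: "Tr (H n) (H (n + Suc k))" for n k
      by (induction k) (use H Tr_trans in \<open>auto, blast\<close>)
    have "inj H"
    proof (rule linorder_injI)
      fix n k :: nat assume "n < k"
      then have "Tr (H n) (H k)" using chain[of n "k - Suc n"] by simp
      then show "H n \<noteq> H k" using no_self[OF H(1)] by metis
    qed
    then have "infinite (range H)" by (rule range_inj_infinite)
    then show False
    proof (rule acc[OF _ _ mid(1,2)[OF G0(1)]])
      show "gapp G" if "G \<in> range H" for G using that H(1) by blast
      show "\<exists>z\<in>{fst G<..<snd G}. j z \<in> orb v (j ((fst G0 + snd G0)/2))" if "G \<in> range H" for G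
        using that Tr3[OF H(2) mid(3)[OF G0(1)]] by blast
    qed
  next
    case False
    have "\<exists>B\<in>big. Tr G B" if "gapp G" "G \<notin> big" for G using False that by blast
    then obtain i where i: "\<And>G. gapp G ==> G \<notin> big ==> i G \<in> big & Tr G (i G)" by metis
    have "infinite ({G. gapp G} - big)" using inf_gaps fin_b by (rule Diff_infinite_finite[rotated])
    moreover have "finite (i ` ({G. gapp G} - big))"
      using i by (intro finite_subset[OF _ fin_b]) auto
    ultimately obtain G1 where G1: "G1 \<in> {G. gapp G} - big"
      "infinite {G \<in> {G. gapp G} - big. i G = i G1}" using pigeonhole_infinite by blast
    have B: "gapp (i G1)" using i G1(1) by (auto simp: big_def)
    let ?m = "(fst (i G1) + snd (i G1))/2"
    show False
    proof (rule acc[OF G1(2) _ mid(1,2)[OF B]])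
      fix G assume G: "G \<in> {G \<in> {G. gapp G} - big. i G = i G1}"
      show gG: "gapp G" using G by blast
      have "i G = i G1" "G \<notin> big" using G by simp_all
      then have TG: "Tr G (i G1)" using i[OF gG] by simp
      obtain z where z: "z \<in> {fst G<..<snd G}" "j ?m \<in> orb v (j z)"
        using Tr4[OF TG mid(3)[OF B]] by blast
      have "j z \<in> K" using jK gap_ab[OF gG, of z] z(1) by auto
      then have "j z \<in> orb v (j ?m)" using orb_eq z(2) orb_self by blast
      then show "\<exists>z\<in>{fst G<..<snd G}. j z \<in> orb v (j ?m)" using z(1) by blast
    qed
  qed
qed

section \<open>Closedness of the relation from upper semicontinuity\<close>

lemma regular_usc:
  assumes x: "reg x"
    and seq: "\<And>n::nat. xs n \<in> K" "\<And>n. ys n \<in> ecl K v P (xs n)" "xs \<longlonglongrightarrow> x" "ys \<longlonglongrightarrow> y"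
  shows "y \<in> ecl K v P x"
proof (cases "\<exists>T>0. v T x = x")
  case True
  then show ?thesis using periodic_usc[OF x] seq by blast
next
  case False
  have xK: "x \<in> K" using x by (simp add: reg_def)
  obtain e where e: "e > 0" "\<And>z. z \<in> K ==> dist z x < e ==> z \<in> ecl K v P x"
    using minimal_open[OF x] False by blast
  have "\<forall>\<^sub>F n in sequentially. dist (xs n) x < e" using seq(3) e(1) by (rule tendstoD)
  then have "\<forall>\<^sub>F n in sequentially. ys n \<in> ecl K v P x"
  proof eventually_elim
    case (elim n)
    then have "ecl K v P (xs n) = ecl K v P x" using pap[OF xK] e(2)[OF seq(1)] by blast
    then show ?case using seq(2) by blast
  qed
  then show ?thesis by (rule Lim_in_closed_set[OF closed_ecl _ sequentially_bot seq(4)])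
qed

text \<open>Upper semicontinuity is known at regular points only. Suppose \<open>y\<close> is not in
  the class \<open>A\<close> of a point \<open>x\<close> of \<open>Sp\<close>. All but finitely many
  approximating classes are regular, hence connected orbit closures, and they join points near
  \<open>A\<close> to points near \<open>B\<close>, which consists of \<open>y\<close> and the other
  singular classes. They cross a level set between \<open>A\<close> and \<open>B\<close>; a limit of
  the crossings is a regular point, and semicontinuity there makes \<open>x\<close> regular, a
  contradiction.\<close>

theorem pap_imp_closed: "closed {(x, y). x \<in> K & y \<in> ecl K v P x}"
  unfolding closed_sequential_limits
proof (intro allI impI, elim conjE)
  fix w l assume w: "\<forall>n::nat. w n \<in> {(x, y). x \<in> K & y \<in> ecl K v P x}" "w \<longlonglongrightarrow> l"
  define xs ys x y where "xs n = fst (w n)" and "ys n = snd (w n)" and "x = fst l" and "y = snd l" for n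
  have seq: "\<And>n. xs n \<in> K" "\<And>n. ys n \<in> ecl K v P (xs n)" "xs \<longlonglongrightarrow> x" "ys \<longlonglongrightarrow> y"
    using w tendsto_fst[OF w(2)] tendsto_snd[OF w(2)]
    by (auto simp: xs_def[abs_def] ys_def[abs_def] x_def y_def case_prod_unfold)
  have xK: "x \<in> K" using closed_sequentially[OF closedK _ seq(3)] seq(1) by blast
  have ysK: "ys n \<in> K" for n using ecl_subset[OF seq(1)] seq(2) by blast
  have yK: "y \<in> K" using closed_sequentially[OF closedK _ seq(4)] ysK by blast
  have "y \<in> ecl K v P x"
  proof (rule ccontr)
    assume ny: "y \<notin> ecl K v P x"
    have nreg: "\<not> reg x" using regular_usc seq ny by blast
    let ?F = "{p \<in> K. \<forall>t. v t p = p}"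
    \<comment> \<open>Infinitely many \<open>xs n\<close> in one class would put both limits
      \<open>x\<close> and \<open>y\<close> into it, since classes are closed.\<close>
    have finp: "finite {n. xs n \<in> ecl K v P p}" if p: "p \<in> K" for p
    proof (rule ccontr)
      assume "infinite {n. xs n \<in> ecl K v P p}"
      then obtain r :: "nat => nat" where r: "strict_mono r" "\<And>n. r n \<in> {n. xs n \<in> ecl K v P p}"
        using infinite_enumerate by blast
      have "(xs \<circ> r) \<longlonglongrightarrow> x" "(ys \<circ> r) \<longlonglongrightarrow> y" using LIMSEQ_subseq_LIMSEQ seq r(1) by auto
      moreover have "(xs \<circ> r) n \<in> ecl K v P p" "(ys \<circ> r) n \<in> ecl K v P p" for n
        using r(2)[of n] pap[OF p, of "xs (r n)"] seq(2)[of "r n"] by auto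
      ultimately have "x \<in> ecl K v P p" "y \<in> ecl K v P p"
        using closed_sequentially[OF closed_ecl] by blast+
      then show False using ny pap[OF p] by simp
    qed
    have "finite {n. xs n \<in> Sp}"
    proof -
      have "{n. xs n \<in> Sp} = (\<Union>p\<in>?F. {n. xs n \<in> ecl K v P p})" by (auto simp: Sp_def)
      then show ?thesis using finSing finp by auto
    qed
    then obtain N where N: "\<And>n. n \<ge> N ==> xs n \<notin> Sp"
      unfolding finite_nat_set_iff_bounded by (metis mem_Collect_eq not_le)
    define A where "A = ecl K v P x"
    define B where "B = insert y (\<Union>p\<in>{p\<in>?F. ecl K v P p \<noteq> A}. ecl K v P p)"
    have "finite {p\<in>?F. ecl K v P p \<noteq> A}" by (rule finite_subset[OF _ finSing]) auto
    then have "closed B" unfolding B_def by (intro closed_insert closed_UN) (simp_all add: closed_ecl)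
    have "closed A" unfolding A_def by (rule closed_ecl)
    have AB: "A \<inter> B = {}"
    proof -
      have "ecl K v P p = A" if "p \<in> K" "z \<in> ecl K v P p" "z \<in> A" for p z
        using pap[OF that(1,2)] pap[OF xK, of z] that(3) by (simp add: A_def)
      then show ?thesis using ny by (auto simp: B_def A_def)
    qed
    have xA: "x \<in> A" and yB: "y \<in> B" using ecl_self[OF xK] by (auto simp: A_def B_def)
    define f where "f z = infdist z A - infdist z B" for z
    have contf: "continuous_on UNIV f" unfolding f_def by (intro continuous_intros)
    have in0: "infdist z C = 0 \<longleftrightarrow> z \<in> C" if "closed C" "C \<noteq> {}" for z :: 'a and C
      using in_closed_iff_infdist_zero[OF that] by simp
    have "f x < 0"
      using in0[OF \<open>closed A\<close>, of x] in0[OF \<open>closed B\<close>, of x] xA yB AB infdist_nonneg[of x B] by (auto simp: f_def less_le)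
    have "f y > 0"
      using in0[OF \<open>closed A\<close>, of y] in0[OF \<open>closed B\<close>, of y] xA yB AB infdist_nonneg[of y A] by (auto simp: f_def less_le)
    have lim: "(%n. f (xs n)) \<longlonglongrightarrow> f x" "(%n. f (ys n)) \<longlonglongrightarrow> f y"
      using continuous_on_tendsto_compose[OF contf seq(3)] continuous_on_tendsto_compose[OF contf seq(4)] by auto
    obtain N1 where N1: "\<And>n. n \<ge> N1 ==> f (xs n) < 0"
      using order_tendstoD(2)[OF lim(1) \<open>f x < 0\<close>] by (auto simp: eventually_sequentially)
    obtain N2 where N2: "\<And>n. n \<ge> N2 ==> f (ys n) > 0"
      using order_tendstoD(1)[OF lim(2) \<open>f y > 0\<close>] by (auto simp: eventually_sequentially)
    define m where "m n = n + N + N1 + N2" for n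
    have regm: "reg (xs (m n))" for n using N[of "m n"] seq(1) by (auto simp: reg_def m_def)
    have "\<exists>z. z \<in> ecl K v P (xs (m n)) & f z = 0" for n
    proof -
      have con: "connected (ecl K v P (xs (m n)))"
        unfolding reg_closure[OF regm] orb_def
        by (intro connected_imp_connected_closure connected_continuous_image cont_v continuous_intros) (use seq(1) in auto)
      have "connected (f ` ecl K v P (xs (m n)))"
        by (rule connected_continuous_image[OF continuous_on_subset[OF contf] con]) simp
      moreover have "f (xs (m n)) < 0" "f (ys (m n)) > 0" using N1[of "m n"] N2[of "m n"] by (auto simp: m_def)
      moreover have "xs (m n) \<in> ecl K v P (xs (m n))" "ys (m n) \<in> ecl K v P (xs (m n))" using ecl_self seq by auto
      ultimately have "0 \<in> f ` ecl K v P (xs (m n))"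
        using connectedD_interval[of "f ` ecl K v P (xs (m n))" "f (xs (m n))" "f (ys (m n))" 0] by auto
      then show ?thesis by auto
    qed
    then obtain z where z: "\<And>n. z n \<in> ecl K v P (xs (m n))" "\<And>n. f (z n) = 0" by metis
    have zK: "z n \<in> K" for n using z(1) ecl_subset[OF seq(1)] by blast
    obtain k r where kr: "k \<in> K" "strict_mono r" "(z \<circ> r) \<longlonglongrightarrow> k"
      by (rule seq_compactE[OF compactK[unfolded compact_eq_seq_compact_metric], of z]) (use zK in auto)
    have "(%n. f ((z \<circ> r) n)) \<longlonglongrightarrow> f k" using continuous_on_tendsto_compose[OF contf kr(3)] by auto
    then have "f k = 0" using z(2) LIMSEQ_unique[OF _ tendsto_const] by (auto simp: o_def)
    have kAB: "k \<notin> A" "k \<notin> B"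
      using \<open>f k = 0\<close> in0[OF \<open>closed A\<close>, of k] in0[OF \<open>closed B\<close>, of k] xA yB AB by (auto simp: f_def)
    have "k \<notin> Sp"
    proof
      assume "k \<in> Sp"
      then obtain p where "p \<in> ?F" "k \<in> ecl K v P p" unfolding Sp_def by blast
      then show False using kAB by (cases "ecl K v P p = A") (auto simp: B_def)
    qed
    then have rk: "reg k" using kr(1) by (simp add: reg_def)
    have sm: "strict_mono m" by (auto simp: m_def strict_mono_def)
    have xsr: "(xs \<circ> (m \<circ> r)) \<longlonglongrightarrow> x"
      by (rule LIMSEQ_subseq_LIMSEQ[OF seq(3)]) (use sm kr(2) in \<open>auto simp: strict_mono_def\<close>)
    have "x \<in> ecl K v P k"
    proof (rule regular_usc[OF rk _ _ kr(3) xsr])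
      show "(z \<circ> r) n \<in> K" for n using zK by simp
      show "(xs \<circ> (m \<circ> r)) n \<in> ecl K v P ((z \<circ> r) n)" for n
        using pap[OF seq(1) z(1)] ecl_self[OF seq(1)] by simp
    qed
    then have "reg x" by (rule reg_ecl(1)[OF rk])
    then show False using nreg by blast
  qed
  then show "l \<in> {(x, y). x \<in> K & y \<in> ecl K v P x}" using xK by (simp add: x_def y_def case_prod_unfold)
qed

end

section \<open>Passage through the sectors of a saddle\<close>

definition sector :: "(real => 'm::metric_space => 'm) => 'm => 'm => 'm set => bool" where
  "sector v p y0 U \<longleftrightarrow> (\<forall>y\<in>orb v y0. \<forall>V W. open V & open W & y \<in> W & p \<in> V & (\<forall>t\<le>0. v t y \<in> V) -->
     (\<exists>W'. open W' & p \<in> W' &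
        (\<forall>z\<in>W' \<inter> U. \<exists>t\<ge>0. v t z \<in> W & (\<forall>r. 0 \<le> r & r \<le> t --> v r z \<in> V))))"

definition sector_data where
  "sector_data K v p N x1 x2 y1 y2 U1 U2 \<longleftrightarrow> open N & p \<in> N &
     x1 \<in> K & x2 \<in> K & wst K v p = {p} \<union> orb v x1 \<union> orb v x2 &
     p \<notin> orb v x1 & p \<notin> orb v x2 & orb v x1 \<inter> orb v x2 = {} &
     y1 \<in> wst K (rv v) p & y2 \<in> wst K (rv v) p & y1 \<noteq> p & y2 \<noteq> p &
     openin (top_of_set K) U1 & openin (top_of_set K) U2 & U1 \<inter> U2 = {} &
     N \<inter> K \<subseteq> insert p ((%t. v t x1) ` {0..}) \<union> insert p ((%t. v t x2) ` {0..}) \<union> (U1 \<union> U2) &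
     sector v p y1 U1 & sector v p y2 U2"

text \<open>The last parameters \<open>U1\<close> and \<open>U2\<close> are the two components of a neighbourhood of the saddle cut
  along its local stable set; what enters in \<open>Ui\<close> leaves along the unstable separatrix of \<open>yi\<close>.\<close>

definition sectors :: "'m::metric_space set => (real => 'm => 'm) => 'm => bool" where
  "sectors K v p \<longleftrightarrow> (\<exists>N x1 x2 y1 y2 U1 U2. sector_data K v p N x1 x2 y1 y2 U1 U2)"

lemma sectors_two_orbits: "sectors K v p ==> two_orbits K v p"
proof -
  assume "sectors K v p"
  then obtain N x1 x2 y1 y2 U1 U2 where "sector_data K v p N x1 x2 y1 y2 U1 U2"
    unfolding sectors_def by blast
  then show ?thesis unfolding sector_data_def two_orbits_def by (intro exI[of _ x1] exI[of _ x2]) simp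
qed

section \<open>Orbits that tend to a fixed point\<close>

context cflow
begin

text \<open>A periodic point is its own limit point, whereas the only limit point of
  \<open>x\<close> is \<open>p\<close>.\<close>

lemma wst_nonper:
  assumes x: "x \<in> wst K v p" "x \<noteq> p" and eq: "v t x = v s x"
  shows "t = s"
proof (rule ccontr)
  assume "t \<noteq> s"
  have xK: "x \<in> K" using x by (simp add: wst_def)
  have *: False if eq: "v t x = v s x" and ts: "t < s" for t s
  proof -
    have per: "v (s - t) x = x" using v_eq_iff[OF xK xK, of s t] eq by simp
    have "x \<in> olim v x"
    proof (rule olimI)
      fix N e :: real assume "e > 0"
      have "x \<in> (%u. v u (v N x)) ` {0..s - t}"
        using periodic_orb[OF inK[OF xK], of "s - t" N] per ts orb_v[OF xK, of N] orb_self[OF xK] xK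
        by (simp add: vadd) (metis add.commute vadd xK)
      then obtain u where "u \<ge> 0" "v (u + N) x = x" using xK by (auto simp: vadd)
      then show "\<exists>t\<ge>N. dist (v t x) x < e" using \<open>e > 0\<close> by (intro exI[of _ "u + N"]) auto
    qed
    then show False using x wst_olim[of x p] by auto
  qed
  show False using *[OF eq] *[OF eq[symmetric]] \<open>t \<noteq> s\<close> by linarith
qed

lemma wst_v_ne: assumes "x \<in> wst K v p" "x \<noteq> p" shows "v t x \<noteq> p"
proof
  assume "v t x = p"
  then have "v (t + 1) x = v t x"
    using wst_fixed(2)[OF assms(1), of 1] vadd[of x 1 t] assms(1) by (simp add: wst_def add.commute)
  then show False using wst_nonper[OF assms] by fastforce
qed

text \<open>At late times the orbit is near \<open>p\<close> and away from \<open>x\<close>. On the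
  remaining compact set of times outside \<open>{-h<..<h}\<close> the distance to \<open>x\<close>
  has a positive minimum, because the orbit is not periodic.\<close>

lemma wst_return:
  assumes x: "x \<in> wst K v p" "x \<noteq> p" and h: "h > 0"
  obtains e where "e > 0" "\<And>t. R \<le> t ==> dist (v t x) x < e ==> \<bar>t\<bar> < h"
proof -
  have xK: "x \<in> K" and lim: "((%t. v t x) \<longlongrightarrow> p) at_top" using x by (simp_all add: wst_def)
  define d where "d = dist x p / 2"
  have d: "d > 0" using x by (simp add: d_def)
  obtain T where T: "\<And>t. t \<ge> T ==> dist (v t x) p < d"
    using tendstoD[OF lim d] by (auto simp: eventually_at_top_linorder)
  define S where "S = {R..max R T} - {-h<..<h}"
  have "compact S" unfolding S_def by (intro compact_diff compact_Icc open_greaterThanLessThan)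
  have cont: "continuous_on S (%t. dist (v t x) x)"
    by (intro continuous_intros cont_v) (use xK in auto)
  obtain e where e: "e > 0" "\<And>t. t \<in> S ==> e \<le> dist (v t x) x"
  proof (cases "S = {}")
    case True then show thesis using that[of 1] by simp
  next
    case False
    obtain t0 where t0: "t0 \<in> S" "\<And>t. t \<in> S ==> dist (v t0 x) x \<le> dist (v t x) x"
      using continuous_attains_inf[OF \<open>compact S\<close> False cont] by blast
    have "v t0 x \<noteq> x"
    proof
      assume "v t0 x = x"
      then have "v t0 x = v 0 x" using v0 xK by simp
      then show False using wst_nonper[OF x, of t0 0] t0(1) h by (simp add: S_def)
    qed
    then show thesis using that[of "dist (v t0 x) x"] t0(2) by simp
  qed
  show thesis
  proof (rule that[of "min e d"])
    fix t assume t: "R \<le> t" "dist (v t x) x < min e d"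
    have "t < T"
    proof (rule ccontr)
      assume "\<not> t < T"
      then have "dist (v t x) p < d" using T by simp
      then have "dist x p < d + d" using t dist_triangle3[of x p "v t x"] by (simp add: dist_commute)
      then show False by (simp add: d_def)
    qed
    then show "\<bar>t\<bar> < h" using e(2)[of t] t by (force simp: S_def)
  qed (use e d in auto)
qed

lemma closed_tail: assumes x: "x \<in> wst K v p" shows "closed (insert p ((%t. v t x) ` {R..}))"
  unfolding closed_sequential_limits
proof (intro allI impI, elim conjE)
  fix f l assume f: "\<forall>n::nat. f n \<in> insert p ((%t. v t x) ` {R..})" "f \<longlonglongrightarrow> l"
  have xK: "x \<in> K" and lim: "((%t. v t x) \<longlongrightarrow> p) at_top" using x by (simp_all add: wst_def)
  show "l \<in> insert p ((%t. v t x) ` {R..})"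
  proof (cases "l = p")
    case False
    then have d: "dist l p / 2 > 0" by simp
    obtain T where T: "\<And>t. t \<ge> T ==> dist (v t x) p < dist l p / 2"
      using tendstoD[OF lim d] by (auto simp: eventually_at_top_linorder)
    obtain M where M: "\<And>n. n \<ge> M ==> dist (f n) l < dist l p / 2"
      using f(2) d unfolding lim_sequentially by blast
    have "f (n + M) \<in> (%t. v t x) ` {R..T}" for n
    proof -
      have "\<not> dist (f (n + M)) p < dist l p / 2"
      proof
        assume "dist (f (n + M)) p < dist l p / 2"
        then have "dist l p < dist l p / 2 + dist l p / 2"
          using M[of "n + M"] dist_triangle3[of l p "f (n + M)"] by (simp add: dist_commute)
        then show False by simp
      qed
      moreover then have "f (n + M) \<noteq> p" using d by auto
      ultimately obtain t where t: "t \<ge> R" "f (n + M) = v t x" using f(1) by auto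
      then have "t \<le> T" using T[of t] \<open>\<not> dist (f (n + M)) p < dist l p / 2\<close> by force
      then show ?thesis using t by auto
    qed
    moreover have "(%n. f (n + M)) \<longlonglongrightarrow> l" using f(2) by (rule LIMSEQ_ignore_initial_segment)
    ultimately have "l \<in> (%t. v t x) ` {R..T}"
      by (rule closed_sequentially[OF compact_imp_closed[OF compact_arc[OF xK]]])
    then show ?thesis by auto
  qed simp
qed

text \<open>A curve ending in a stable separatrix, but not running along it, follows the flow through the
  saddle and leaves along one and the same unstable separatrix.\<close>

lemma passage:
  assumes sd: "sector_data K v p N x1 x2 y1 y2 U1 U2"
    and w: "w \<in> wst K v p" "w \<noteq> p"
    and b: "(b::real) > 0" and q: "continuous_on {0..b} q" "q ` {0..b} \<subseteq> K" "q 0 = w"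
    and h: "h > 0" and np: "\<And>s t. 0 < s ==> s \<le> b ==> \<bar>t\<bar> \<le> h ==> q s \<noteq> v t w"
  shows "\<exists>y. y \<in> wst K (rv v) p & y \<noteq> p & (\<forall>y'\<in>orb v y. \<forall>V W T0. open V --> open W --> y' \<in> W --> p \<in> V -->
     (\<forall>t\<le>0. v t y' \<in> V) --> (\<exists>T\<ge>T0. \<exists>n>0. n \<le> b & (\<forall>s. 0 < s & s < n -->
        (\<exists>t\<ge>T. v t (q s) \<in> W & (\<forall>r. T \<le> r & r \<le> t --> v r (q s) \<in> V)))))"
proof -
  have N: "open N" "p \<in> N" and xK: "x1 \<in> K" "x2 \<in> K" and ws: "wst K v p = {p} \<union> orb v x1 \<union> orb v x2"
    and disj: "p \<notin> orb v x1" "p \<notin> orb v x2" "orb v x1 \<inter> orb v x2 = {}"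
    and y: "y1 \<in> wst K (rv v) p" "y2 \<in> wst K (rv v) p" "y1 \<noteq> p" "y2 \<noteq> p"
    and U: "openin (top_of_set K) U1" "openin (top_of_set K) U2" "U1 \<inter> U2 = {}"
    and cover: "N \<inter> K \<subseteq> insert p ((%t. v t x1) ` {0..}) \<union> insert p ((%t. v t x2) ` {0..}) \<union> (U1 \<union> U2)"
    and sec: "sector v p y1 U1" "sector v p y2 U2"
    using sd unfolding sector_data_def by simp_all
  have wK: "w \<in> K" and limw: "((%t. v t w) \<longlongrightarrow> p) at_top" using w by (simp_all add: wst_def)
  have pfix: "v t p = p" for t using wst_fixed(2)[OF w(1)] .
  define L where "L = insert p ((%t. v t x1) ` {0..}) \<union> insert p ((%t. v t x2) ` {0..})"
  have x12: "x1 \<in> wst K v p" "x2 \<in> wst K v p" "x1 \<noteq> p" "x2 \<noteq> p" using ws disj orb_self xK by auto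
  have Lfwd: "v t z \<in> L" if "z \<in> L" "t \<ge> 0" for z t
    using that pfix xK by (auto simp: L_def vadd)
  have qK: "q s \<in> K" if "0 \<le> s" "s \<le> b" for s using q(2) that by auto
  \<comment> \<open>Near each point of the orbit of \<open>w\<close>, the local stable set
    \<open>L\<close> is nothing but a short arc of this orbit.\<close>
  have local: "\<exists>e>0. \<forall>z\<in>L. dist z (v T w) < e --> (\<exists>r. \<bar>r\<bar> \<le> h & z = v r (v T w))" for T
  proof -
    define u where "u = v T w"
    have u: "u \<in> wst K v p" "u \<noteq> p" unfolding u_def using wst_v w wst_v_ne by auto
    have one: "\<exists>e>0. \<forall>z\<in>insert p ((%t. v t x) ` {0..}). dist z u < e --> (\<exists>r. \<bar>r\<bar> \<le> h & z = v r u)"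
      if x: "x \<in> wst K v p" "x \<noteq> p" for x
    proof (cases "u \<in> orb v x")
      case True
      then obtain c where c: "u = v c x" by (auto simp: orb_def)
      have xK': "x \<in> K" using x by (simp add: wst_def)
      obtain e where e: "e > 0" "\<And>t. - c \<le> t ==> dist (v t u) u < e ==> \<bar>t\<bar> < h"
        by (rule wst_return[OF u h, where R = "- c"]) blast
      have "\<exists>r. \<bar>r\<bar> \<le> h & z = v r u"
        if z: "z \<in> insert p ((%t. v t x) ` {0..})" "dist z u < min e (dist p u)" for z
      proof -
        obtain t where t: "t \<ge> 0" "z = v t x" using z by auto
        have "z = v (t - c) u" using t c xK' by (simp add: vadd)
        then show ?thesis using e(2)[of "t - c"] t z(2) by (intro exI[of _ "t - c"]) auto
      qed
      then show ?thesis using e(1) u(2) by (intro exI[of _ "min e (dist p u)"]) auto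
    next
      case False
      have "u \<notin> insert p ((%t. v t x) ` {0..})" using False u(2) by (auto simp: orb_def)
      then obtain e where "e > 0" "ball u e \<subseteq> - insert p ((%t. v t x) ` {0..})"
        using open_Compl[OF closed_tail[OF x(1), of 0]] unfolding open_contains_ball by blast
      then show ?thesis by (intro exI[of _ e]) (force simp: dist_commute)
    qed
    obtain e1 where e1: "e1 > 0" "\<forall>z\<in>insert p ((%t. v t x1) ` {0..}). dist z u < e1 --> (\<exists>r. \<bar>r\<bar> \<le> h & z = v r u)"
      using one[OF x12(1,3)] by blast
    obtain e2 where e2: "e2 > 0" "\<forall>z\<in>insert p ((%t. v t x2) ` {0..}). dist z u < e2 --> (\<exists>r. \<bar>r\<bar> \<le> h & z = v r u)"
      using one[OF x12(2,4)] by blast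
    show ?thesis
      unfolding u_def[symmetric] L_def using e1 e2 by (intro exI[of _ "min e1 e2"]) auto
  qed
  have qnear: "\<exists>n>0. n \<le> b & (\<forall>s. 0 \<le> s & s < n --> dist (q s) w < e)" if e: "e > 0" for e
  proof -
    obtain d where d: "d > 0" "\<And>s. s \<in> {0..b} ==> dist s 0 < d ==> dist (q s) (q 0) < e"
      using q(1) b e unfolding continuous_on_iff by (metis atLeastAtMost_iff less_imp_le order_refl)
    show ?thesis
      using d(1) b d(2) q(3) by (intro exI[of _ "min d b"]) (auto simp: dist_real_def)
  qed
  have qtube: "\<exists>n>0. n \<le> b & (\<forall>s t. 0 \<le> s & s < n & A \<le> t & t \<le> B --> v t (q s) \<in> G)"
    if G: "open G" "\<And>t. A \<le> t ==> t \<le> B ==> v t w \<in> G" for A B G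
  proof -
    obtain d where d: "d > 0" "\<And>z t. z \<in> K ==> dist z w < d ==> A \<le> t ==> t \<le> B ==> v t z \<in> G"
      by (rule tube[OF wK G]) auto
    obtain n where "n > 0" "n \<le> b" "\<forall>s. 0 \<le> s & s < n --> dist (q s) w < d" using qnear[OF d(1)] by blast
    then show ?thesis using d(2) qK by (intro exI[of _ n]) auto
  qed
  have qpt: "\<exists>n>0. n \<le> b & (\<forall>s. 0 \<le> s & s < n --> v T (q s) \<in> G)"
    if G: "open G" "v T w \<in> G" for T G
  proof -
    have "\<And>t. T \<le> t ==> t \<le> T ==> v t w \<in> G" using G(2) antisym by blast
    then obtain n where "n > 0" "n \<le> b" "\<forall>s t. 0 \<le> s & s < n & T \<le> t & t \<le> T --> v t (q s) \<in> G"
      using qtube[OF G(1), of T T] by blast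
    then show ?thesis by (intro exI[of _ n]) auto
  qed
  \<comment> \<open>If the curve met \<open>L\<close> at time \<open>T\<close>, it would meet the
    short arc of the orbit of \<open>w\<close> there; moved back by time \<open>T\<close> this
    contradicts \<open>np\<close>.\<close>
  have avoid: "\<exists>n>0. n \<le> b & (\<forall>s. 0 < s & s < n --> v T (q s) \<notin> L)" for T
  proof -
    obtain e where e: "e > 0" "\<forall>z\<in>L. dist z (v T w) < e --> (\<exists>r. \<bar>r\<bar> \<le> h & z = v r (v T w))" using local by blast
    have "open (ball (v T w) e)" "v T w \<in> ball (v T w) e" using e(1) by auto
    from qpt[OF this] obtain n where n: "n > 0" "n \<le> b"
      "\<And>s. 0 \<le> s ==> s < n ==> v T (q s) \<in> ball (v T w) e" by blast
    have "v T (q s) \<notin> L" if s: "0 < s" "s < n" for s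
    proof
      assume "v T (q s) \<in> L"
      then obtain r where r: "\<bar>r\<bar> \<le> h" "v T (q s) = v r (v T w)"
        using e(2) n(3)[of s] s by (auto simp: dist_commute)
      then have "v T (q s) = v T (v r w)" using wK by (simp add: vadd add.commute)
      moreover have "q s \<in> K" using qK[of s] s n(2) by simp
      ultimately have "q s = v r w"
        using v_neg(1)[of "q s" T] v_neg(1)[OF inK[OF wK, of r], of T] by metis
      then show False using np[of s r] s n(2) r(1) by simp
    qed
    then show ?thesis using n(1,2) by blast
  qed
  obtain T1 where T1: "\<And>t. t \<ge> T1 ==> v t w \<in> N"
    using topological_tendstoD[OF limw N] by (auto simp: eventually_at_top_linorder)
  have inUU: "\<exists>n>0. n \<le> b & (\<forall>s t. 0 < s & s < n & T1 \<le> t & t \<le> T --> v t (q s) \<in> U1 \<union> U2)" for T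
  proof -
    obtain n1 where 1: "n1 > 0" "n1 \<le> b" "\<forall>s t. 0 \<le> s & s < n1 & T1 \<le> t & t \<le> T --> v t (q s) \<in> N"
      using qtube[OF N(1), of T1 T] T1 by blast
    obtain n2 where 2: "n2 > 0" "n2 \<le> b" "\<forall>s. 0 < s & s < n2 --> v T (q s) \<notin> L" using avoid by blast
    have "v t (q s) \<in> U1 \<union> U2" if s: "0 < s" "s < min n1 n2" "T1 \<le> t" "t \<le> T" for s t
    proof -
      have sK: "q s \<in> K" using qK[of s] s 1(2) by simp
      have "v t (q s) \<notin> L"
        using Lfwd[of "v t (q s)" "T - t"] 2(3) s sK by (auto simp: vadd)
      moreover have "v t (q s) \<in> N \<inter> K" using 1(3) s inK[OF sK] by simp
      ultimately show ?thesis using cover unfolding L_def by blast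
    qed
    then show ?thesis using 1 2 by (intro exI[of _ "min n1 n2"]) auto
  qed
  have conn: "C \<subseteq> U1 \<or> C \<subseteq> U2" if C: "connected C" "C \<subseteq> U1 \<union> U2" for C
  proof -
    have CK: "C \<subseteq> K" using C(2) U(1,2)[THEN openin_imp_subset] by blast
    obtain G1 G2 where G: "open G1" "U1 = K \<inter> G1" "open G2" "U2 = K \<inter> G2"
      using U(1,2) unfolding openin_open by blast
    have "C \<subseteq> G1 \<union> G2" "G1 \<inter> G2 \<inter> C = {}" using C(2) G U(3) CK by blast+
    then have "G1 \<inter> C = {} \<or> G2 \<inter> C = {}" using connectedD[OF C(1) G(1,3)] by blast
    then show ?thesis using C(2) G by blast
  qed
  obtain n0 where n0: "n0 > 0" "n0 \<le> b" "\<And>s. 0 < s ==> s < n0 ==> v T1 (q s) \<in> U1 \<union> U2"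
    using inUU[of T1] by auto
  \<comment> \<open>At the fixed time \<open>T1\<close> the transported curve without its end is
    connected and lies in the disjoint open sides, hence in a single one. The separatrix along which
    it leaves is thus the same for all small \<open>s\<close> and for all targets.\<close>
  have "connected ((%s. v T1 (q s)) ` {0<..<n0})"
  proof (rule connected_continuous_image)
    have "continuous_on {0<..<n0} q" by (rule continuous_on_subset[OF q(1)]) (use n0 in auto)
    then show "continuous_on {0<..<n0} (%s. v T1 (q s))"
      by (intro cont_v continuous_intros) (use qK n0 in auto)
  qed simp
  then have "(%s. v T1 (q s)) ` {0<..<n0} \<subseteq> U1 \<or> (%s. v T1 (q s)) ` {0<..<n0} \<subseteq> U2"
    by (rule conn, intro image_subsetI n0(3)) simp_all
  then obtain Uk yk where k: "(%s. v T1 (q s)) ` {0<..<n0} \<subseteq> Uk" "(Uk = U1 & yk = y1) \<or> (Uk = U2 & yk = y2)"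
    by blast
  have yk: "yk \<in> wst K (rv v) p" "yk \<noteq> p" and seck: "sector v p yk Uk" using k(2) y sec by auto
  have "\<exists>T\<ge>T0. \<exists>n>0. n \<le> b & (\<forall>s. 0 < s & s < n -->
        (\<exists>t\<ge>T. v t (q s) \<in> W & (\<forall>r. T \<le> r & r \<le> t --> v r (q s) \<in> V)))"
    if y': "y' \<in> orb v yk" and VW: "open V" "open W" "y' \<in> W" "p \<in> V" "\<forall>t\<le>0. v t y' \<in> V" for y' V W T0
  proof -
    have "\<exists>W'. open W' & p \<in> W' &
        (\<forall>z\<in>W' \<inter> Uk. \<exists>t\<ge>0. v t z \<in> W & (\<forall>r. 0 \<le> r & r \<le> t --> v r z \<in> V))"
      using seck y' VW unfolding sector_def by simp
    then obtain W' where W': "open W'" "p \<in> W'"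
      "\<forall>z\<in>W' \<inter> Uk. \<exists>t\<ge>0. v t z \<in> W & (\<forall>r. 0 \<le> r & r \<le> t --> v r z \<in> V)"
      by (elim exE conjE)
    obtain T2 where T2: "\<And>t. t \<ge> T2 ==> v t w \<in> W'"
      using topological_tendstoD[OF limw W'(1,2)] by (auto simp: eventually_at_top_linorder)
    define T where "T = max T0 (max T1 T2)"
    obtain n1 where 1: "n1 > 0" "n1 \<le> b" "\<forall>s t. 0 < s & s < n1 & T1 \<le> t & t \<le> T --> v t (q s) \<in> U1 \<union> U2"
      using inUU by blast
    have "v T w \<in> W'" using T2 by (auto simp: T_def)
    from qpt[OF W'(1) this] obtain n2 where 2: "n2 > 0" "n2 \<le> b"
      "\<And>s. 0 \<le> s ==> s < n2 ==> v T (q s) \<in> W'" by blast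
    define n where "n = min n0 (min n1 n2)"
    have "\<exists>t\<ge>T. v t (q s) \<in> W & (\<forall>r. T \<le> r & r \<le> t --> v r (q s) \<in> V)" if s: "0 < s" "s < n" for s
    proof -
      have sK: "q s \<in> K" using qK[of s] s n0(2) by (simp add: n_def)
      \<comment> \<open>The side chosen at time \<open>T1\<close> is kept up to time
        \<open>T\<close>, because the orbit arc in between is connected and stays in the two open
        sides.\<close>
      let ?C = "(%t. v t (q s)) ` {T1..T}"
      have T1T: "T1 \<le> T" by (simp add: T_def)
      have "connected ?C" by (intro connected_continuous_image cont_v continuous_intros) (use sK in auto)
      moreover have "?C \<subseteq> U1 \<union> U2"
      proof (rule image_subsetI)
        fix t assume "t \<in> {T1..T}"
        then show "v t (q s) \<in> U1 \<union> U2" using 1(3)[rule_format, of s t] s by (simp add: n_def)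
      qed
      ultimately have "?C \<subseteq> U1 \<or> ?C \<subseteq> U2" by (rule conn)
      moreover have "v T1 (q s) \<in> ?C" "v T (q s) \<in> ?C" using T1T by auto
      moreover have "v T1 (q s) \<in> Uk" using k(1) s by (auto simp: n_def)
      ultimately have "v T (q s) \<in> Uk" using k(2) U(3) by blast
      moreover have "v T (q s) \<in> W'" using 2(3)[of s] s by (simp add: n_def)
      ultimately obtain t where t: "t \<ge> 0" "v t (v T (q s)) \<in> W" "\<forall>r. 0 \<le> r & r \<le> t --> v r (v T (q s)) \<in> V"
        using bspec[OF W'(3), of "v T (q s)"] by (auto elim!: exE conjE)
      have "v r (q s) \<in> V" if "T \<le> r" "r \<le> t + T" for r
        using t(3)[rule_format, of "r - T"] that sK by (simp add: vadd)
      then show ?thesis using t sK by (intro exI[of _ "t + T"]) (simp add: vadd)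
    qed
    moreover have "n > 0" "n \<le> b" using n0 1 2 by (auto simp: n_def)
    moreover have "T \<ge> T0" by (simp add: T_def)
    ultimately show ?thesis by blast
  qed
  then show ?thesis using yk by blast
qed

end

section \<open>Recurrent orbits and Baire category\<close>

context cflow
begin

text \<open>By Baire's theorem a nonperiodic recurrent orbit is not locally closed.\<close>

lemma recurrent_orbits_infinite:
  assumes w: "w \<in> K" "w \<in> olim v w" and np: "\<And>t s. v t w = v s w ==> t = s"
    and F: "finite F" "F \<subseteq> K" "olim v w \<subseteq> (\<Union>y\<in>F. orb v y)"
  shows False
proof -
  define C where "C = olim v w"
  define X where "X = top_of_set C"
  have clC: "closed C" unfolding C_def by (rule closed_olim)
  have "compact C"
    using compactK clC olim_subset[OF w(1)] unfolding C_def by (metis compact_Int_closed inf.absorb2)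
  then have "compact_space X" unfolding X_def by (simp add: compact_space_subtopology)
  moreover have "metrizable_space X"
    unfolding X_def by (intro metrizable_space_subtopology metrizable_space_euclidean)
  ultimately have X: "locally_compact_space X" "regular_space X"
    using compact_imp_locally_compact_space metrizable_imp_regular_space by auto
  define arc where "arc y n = C \<inter> (%t. v t y) ` {of_int n..of_int n + 1}" for y and n :: int
  define \<G> where "\<G> = (%(y, n). arc y n) ` (F \<times> UNIV)"
  have cnt: "countable \<G>" unfolding \<G>_def using F(1) by (intro countable_image countable_SIGMA) (auto simp: countable_finite)
  have "\<Union>\<G> = C"
  proof
    show "\<Union>\<G> \<subseteq> C" by (auto simp: \<G>_def arc_def)
    show "C \<subseteq> \<Union>\<G>"
    proof
      fix z assume z: "z \<in> C"
      then obtain y where y: "y \<in> F" "z \<in> orb v y" using F(3) C_def by auto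
      then obtain t where t: "z = v t y" by (auto simp: orb_def)
      have "t \<in> {of_int \<lfloor>t\<rfloor>..of_int \<lfloor>t\<rfloor> + 1}" by (simp add: less_imp_le)
      then have "z \<in> arc y \<lfloor>t\<rfloor>" using z t by (auto simp: arc_def)
      then show "z \<in> \<Union>\<G>" unfolding \<G>_def using y by (intro UnionI[of "arc y \<lfloor>t\<rfloor>"]) auto
    qed
  qed
  moreover have "X interior_of C \<noteq> {}"
    using w(2) by (metis C_def X_def empty_iff interior_of_topspace topspace_euclidean_subtopology)
  ultimately have "X interior_of \<Union>\<G> \<noteq> {}" by simp
  then obtain T where T: "T \<in> \<G>" "\<not> (closedin X T & X interior_of T = {})"
    using Baire_category_alt[OF disjI2[OF conjI[OF X]] cnt] by blast
  obtain y n where yn: "y \<in> F" "T = arc y n" using T(1) by (auto simp: \<G>_def)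
  have yK: "y \<in> K" using F yn by blast
  have "closed T" unfolding yn arc_def using clC compact_arc[OF yK] by (intro closed_Int compact_imp_closed) auto
  then have "closedin X T" unfolding X_def using yn by (intro closed_subset) (auto simp: arc_def)
  then obtain u where "u \<in> X interior_of T" using T(2) by blast
  then obtain U where U: "openin X U" "u \<in> U" "U \<subseteq> T" unfolding interior_of_def by blast
  then obtain G where G: "open G" "U = C \<inter> G" unfolding X_def openin_open by blast
  have hit: "\<exists>t\<ge>R. \<exists>r\<in>{of_int n..of_int n + 1}. v t w = v r y" for R
  proof -
    have uG: "u \<in> G" "u \<in> olim v w" using U G by (auto simp: C_def)
    obtain d where d: "d > 0" "ball u d \<subseteq> G" using G(1) uG(1) open_contains_ball by blast
    obtain t where t: "t \<ge> R" "dist (v t w) u < d" using olimD[OF uG(2) d(1)] by blast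
    have "v t w \<in> C" unfolding C_def by (rule olim_inv[OF w])
    moreover have "v t w \<in> G" using d(2) t(2) by (auto simp: dist_commute)
    ultimately have "v t w \<in> arc y n" using G U(3) yn by blast
    then show ?thesis using t(1) unfolding arc_def by blast
  qed
  obtain t1 r1 where 1: "r1 \<in> {of_int n..of_int n + 1}" "v t1 w = v r1 y" using hit by blast
  \<comment> \<open>Two visits at least 2 apart in time, to an arc of length 1, cannot be the same
    passage, so they give a period.\<close>
  obtain t2 r2 where 2: "t2 \<ge> t1 + 2" "r2 \<in> {of_int n..of_int n + 1}" "v t2 w = v r2 y" using hit by blast
  have "v (t1 - r1) w = y" using v_eq_iff[OF w(1) yK] 1(2) by simp
  moreover have "v (t2 - r2) w = y" using v_eq_iff[OF w(1) yK] 2(3) by simp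
  ultimately have "t1 - r1 = t2 - r2" using np by metis
  then show False using 1(1) 2(1,2) by auto
qed

lemma tube_point:
  assumes "x \<in> K" "open N" "v t x \<in> N"
  obtains d where "d > 0" "\<And>z. z \<in> K ==> dist z x < d ==> v t z \<in> N"
proof -
  have "\<And>s. t \<le> s ==> s \<le> t ==> v s x \<in> N" using assms(3) antisym by blast
  then obtain d where "d > 0" "\<And>z s. z \<in> K ==> dist z x < d ==> t \<le> s ==> s \<le> t ==> v s z \<in> N"
    using tube[OF assms(1,2), of t t] by blast
  then show thesis using that by blast
qed

end

section \<open>Transit maps through a saddle\<close>

context sfc
begin

text \<open>The times are at least 1 so that repeated transits exhaust the time axis. The last
  clause keeps a transit near the closures of the two orbits it connects; it will bound the limit
  sets of orbits that make infinitely many transits.\<close>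

definition transit_map where
  "transit_map c m A w w' \<eta> \<tau> f \<longleftrightarrow> \<eta> > 0 & continuous_on {0<..<\<eta>} f &
     (\<forall>s. 0 < s & s < \<eta> --> \<tau> s \<ge> 1 & f s \<in> A & v (\<tau> s) (c s) = m (f s)) &
     (\<forall>k>0. \<exists>e>0. \<forall>s. 0 < s & s < e --> \<bar>f s\<bar> < k) &
     (\<forall>V. open V & closure (orb v w) \<subseteq> V & closure (orb v w') \<subseteq> V -->
        (\<exists>e>0. \<forall>s r. 0 < s & s < e & 0 \<le> r & r \<le> \<tau> s --> v r (c s) \<in> V))"
  for c m :: "real => 'a" and A :: "real set" and \<tau> f :: "real => real"

text \<open>The separatrix of \<open>y\<close> is supplied by \<open>passage\<close> before any
  section on it is chosen. The transit ends with the first hit, after a fixed time, of a compact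
  piece of the new section; a first hit is unique, and the flow boxes make it continuous.\<close>

lemma transit:
  assumes fb: "fbox w a b h j" and m: "m \<noteq> 0" and i: "i > 0" "\<And>s. 0 \<le> s ==> s \<le> i ==> m * s \<in> {a..b}"
    and w: "w \<in> wst K v q" "w \<noteq> q" and sec: "sectors K v q"
  shows "\<exists>y. y \<in> wst K (rv v) q & y \<noteq> q &
    (\<forall>W T0. open W --> y \<in> W --> (\<exists>e>0. \<forall>s. 0 < s & s < e --> (\<exists>t\<ge>T0. v t (j (m * s)) \<in> W))) &
    (\<forall>w' a' b' h' j'. w' \<in> orb v y --> fbox w' a' b' h' j' -->
      (\<exists>n g f. n \<le> i & transit_map (%s. j (m * s)) j' {a'..b'} w w' n g f))"
proof -
  interpret r: cflow K "rv v" by (rule cflow_rv)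
  obtain N x1 x2 y1 y2 U1 U2 where sd: "sector_data K v q N x1 x2 y1 y2 U1 U2"
    using sec unfolding sectors_def by blast
  have ab: "a \<le> 0" "0 < b" "h > 0" "continuous_on {a..b} j" "j 0 = w" using fb unfolding fbox_def by auto
  define c where "c s = j (m * s)" for s
  have cc: "continuous_on {0..i} c"
    unfolding c_def
    by (rule continuous_on_compose2[OF ab(4)]) (use i(2) in \<open>auto intro!: continuous_intros\<close>)
  have cK: "c s \<in> K" if "0 \<le> s" "s \<le> i" for s unfolding c_def by (rule fbox_K[OF fb i(2)[OF that]])
  have cKK: "c ` {0..i} \<subseteq> K" using cK by auto
  have c0: "c 0 = w" by (simp add: c_def ab)
  have wK: "w \<in> K" and limw: "((%t. v t w) \<longlongrightarrow> q) at_top" using w by (simp_all add: wst_def)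
  have np: "c s \<noteq> v t w" if s: "0 < s" "s \<le> i" and t: "\<bar>t\<bar> \<le> h" for s t
  proof
    assume "c s = v t w"
    then have "v 0 (j (m * s)) = v t (j 0)" using v0 cK[of s] s ab(5) by (simp add: c_def)
    then have "m * s = 0" using fbox_uniq[OF fb i(2)[of s], of 0 0 t] s t ab by auto
    then show False using m s by simp
  qed
  obtain y where y: "y \<in> wst K (rv v) q" "y \<noteq> q" and pass:
    "\<forall>y'\<in>orb v y. \<forall>V W T0. open V --> open W --> y' \<in> W --> q \<in> V --> (\<forall>t\<le>0. v t y' \<in> V) -->
       (\<exists>T\<ge>T0. \<exists>n>0. n \<le> i & (\<forall>s. 0 < s & s < n -->
        (\<exists>t\<ge>T. v t (c s) \<in> W & (\<forall>r. T \<le> r & r \<le> t --> v r (c s) \<in> V))))"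
    using passage[OF sd w i(1) cc cKK c0 ab(3) np] by blast
  have yK: "y \<in> K" using y(1) by (simp add: wst_def)
  have near: "\<exists>e>0. \<forall>s. 0 < s & s < e --> (\<exists>t\<ge>T0. v t (j (m * s)) \<in> W)" if W: "open W" "y \<in> W" for W T0
  proof -
    obtain T n where "T \<ge> T0" "n > 0" "\<forall>s. 0 < s & s < n -->
        (\<exists>t\<ge>T. v t (c s) \<in> W & (\<forall>r. T \<le> r & r \<le> t --> v r (c s) \<in> UNIV))"
      using pass[rule_format, OF orb_self[OF yK] open_UNIV W UNIV_I, of T0] by auto
    then show ?thesis unfolding c_def by (intro exI[of _ n]) (meson order_trans)
  qed
  have main: "\<exists>n g f. n \<le> i & transit_map c j' {a'..b'} w w' n g f"
    if w'y: "w' \<in> orb v y" and fb': "fbox w' a' b' h' j'" for w' a' b' h' j'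
  proof -
    have w'K: "w' \<in> K" using w'y orb_subset[OF yK] by blast
    have w': "w' \<in> wst K (rv v) q" "w' \<noteq> q"
    proof -
      show "w' \<in> wst K (rv v) q" using r.wst_orb[OF y(1)] w'y by auto
      obtain t where "w' = rv v (-t) y" using w'y by (auto simp: orb_def rv_def)
      then show "w' \<noteq> q" using r.wst_v_ne[OF y] by simp
    qed
    have ab': "a' \<le> 0" "0 < b'" "h' > 0" "continuous_on {a'..b'} j'" "j' 0 = w'"
      using fb' unfolding fbox_def by auto
    let ?I = "{a'<..<b'} \<union> {0}"
    have j'K: "j' s \<in> K" if "s \<in> {a'..b'}" for s by (rule fbox_K[OF fb' that])
    have j'near: "\<exists>k>0. \<forall>s\<in>{a'..b'}. \<bar>s\<bar> \<le> k --> dist (j' s) w' < e" if e: "e > 0" for e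
    proof -
      obtain d where d: "d > 0" "\<And>s. s \<in> {a'..b'} ==> dist s 0 < d ==> dist (j' s) (j' 0) < e"
        using ab'(1,2) ab'(4)[unfolded continuous_on_iff, rule_format, of 0 e] e by auto
      then show ?thesis using ab'(5) by (intro exI[of _ "d/2"]) (auto simp: dist_real_def)
    qed
    \<comment> \<open>A point half a box before \<open>w'\<close>: whatever passes close to it
      crosses the new section at a time between 0 and \<open>h'\<close> later.\<close>
    define y' where "y' = v (- (h'/2)) w'"
    have y'y: "y' \<in> orb v y" using orb_eq[OF yK w'y] by (metis v_in_orb y'_def)
    have y'K: "y' \<in> K" using y'y orb_subset[OF yK] by blast
    obtain e where e: "e > 0" "\<And>t. 0 \<le> t ==> dist (rv v t w') w' < e ==> \<bar>t\<bar> < h'/2"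
      by (rule r.wst_return[OF w', where R = 0 and h = "h'/2"]) (use ab' in auto)
    obtain k0 where k0: "k0 > 0" "\<forall>s\<in>{a'..b'}. \<bar>s\<bar> \<le> k0 --> dist (j' s) w' < min e (dist q w')"
      using j'near[of "min e (dist q w')"] e(1) w'(2) by auto
    define l where "l = min k0 (min (b'/2) (if a' < 0 then - a'/2 else b'/2))"
    have l: "l > 0" "l \<le> k0" using k0 ab' by (auto simp: l_def)
    have lI: "s \<in> ?I" if "s \<in> {a'..b'}" "\<bar>s\<bar> \<le> l" for s
      using that ab' by (auto simp: l_def split: if_splits)
    define J where "J = j' ` ({a'..b'} \<inter> {-l..l})"
    have "compact J"
      unfolding J_def by (intro compact_continuous_image continuous_on_subset[OF ab'(4)]) auto
    then have opJ: "open (- J)" by (simp add: open_Compl compact_imp_closed)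
    have Jd: "dist z w' < min e (dist q w')" if "z \<in> J" for z using that k0(2) l(2) unfolding J_def by auto
    have qJ: "q \<in> - J" using Jd by force
    \<comment> \<open>The separatrix up to \<open>y'\<close> misses \<open>J\<close>, because
      backwards from \<open>w'\<close> it returns close to \<open>w'\<close> only at times below
      \<open>h' / 2\<close>.\<close>
    have backJ: "v t y' \<in> - J" if "t \<le> 0" for t
    proof
      assume "v t y' \<in> J"
      moreover have "v t y' = rv v (h'/2 - t) w'" unfolding y'_def rv_def using w'K by (simp add: vadd)
      ultimately have "\<bar>h'/2 - t\<bar> < h'/2" using Jd e(2)[of "h'/2 - t"] that ab' by auto
      then show False using that ab' by auto
    qed
    obtain T1' where T1': "\<And>t. t \<ge> T1' ==> v t w \<in> - J"
      using topological_tendstoD[OF limw opJ qJ] by (auto simp: eventually_at_top_linorder)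
    define T1 where "T1 = max 1 T1'"
    have T1: "T1 \<ge> 1" "\<And>t. t \<ge> T1 ==> v t w \<in> - J" using T1' by (auto simp: T1_def)
    \<comment> \<open>The first hit of \<open>J\<close> after time \<open>T1\<close>, at time
      \<open>t\<close> and with parameter \<open>s'\<close>. The orbit of \<open>w\<close> itself
      misses \<open>J\<close> from \<open>T1\<close> on, which keeps nearby orbits off
      \<open>J\<close> until they have passed the saddle.\<close>
    define HT where "HT s t s' \<longleftrightarrow> t > T1 & \<bar>s'\<bar> < l & s' \<in> {a'..b'} & v t (c s) = j' s' &
        (\<forall>r. T1 \<le> r & r < t --> v r (c s) \<notin> J)" for s t s'
    have ctube: "\<exists>e>0. e \<le> i & (\<forall>s t. 0 \<le> s & s < e & A \<le> t & t \<le> B --> v t (c s) \<in> G)"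
      if G: "open G" "\<And>t. A \<le> t ==> t \<le> B ==> v t w \<in> G" for A B G
    proof -
      obtain d where d: "d > 0" "\<And>z t. z \<in> K ==> dist z w < d ==> A \<le> t ==> t \<le> B ==> v t z \<in> G"
        by (rule tube[OF wK G]) auto
      obtain d' where d': "d' > 0" "\<And>s. s \<in> {0..i} ==> dist s 0 < d' ==> dist (c s) (c 0) < d"
        using cc i(1) d(1) unfolding continuous_on_iff by (metis atLeastAtMost_iff less_imp_le order_refl)
      have "v t (c s) \<in> G" if "0 \<le> s" "s < min d' i" "A \<le> t" "t \<le> B" for s t
        using d(2)[of "c s" t] d'(2)[of s] cK[of s] c0 that by (simp add: dist_real_def)
      then show ?thesis using d'(1) i(1) by (intro exI[of _ "min d' i"]) auto
    qed
    have FH: "\<exists>e>0. e \<le> i & (\<forall>s. 0 < s & s < e --> (\<exists>t s'. HT s t s' & \<bar>s'\<bar> < k & (\<forall>r. 0 \<le> r & r \<le> t --> v r (c s) \<in> V)))"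
      if k: "k > 0" and V: "open V" "closure (orb v w) \<subseteq> V" "closure (orb v w') \<subseteq> V" for k V
    proof -
      have wV: "v t w \<in> V" and w'V: "v t w' \<in> V" for t using V(2,3) closure_subset v_in_orb by blast+
      have qV: "q \<in> V" using olim_subset_closure[of w] wst_olim[of w q] w(1) V(2) by auto
      obtain d1 where d1: "d1 > 0" "\<And>z t. z \<in> K ==> dist z w' < d1 ==> - h' \<le> t ==> t \<le> h' ==> v t z \<in> V"
        by (rule tube[OF w'K V(1), of "-h'" h']) (use w'V in auto)
      obtain k1 where k1: "k1 > 0" "\<forall>s\<in>{a'..b'}. \<bar>s\<bar> \<le> k1 --> dist (j' s) w' < d1" using j'near[OF d1(1)] by blast
      define k2 where "k2 = min k (min k1 l)"
      have k2: "k2 > 0" "k2 \<le> k" "k2 \<le> k1" "k2 \<le> l" using k k1 l by (auto simp: k2_def)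
      obtain d2 where d2: "d2 > 0" "\<And>z. z \<in> K ==> dist z (j' 0) < d2 ==>
          \<exists>s t. s \<in> ?I \<inter> {-k2<..<k2} & \<bar>t\<bar> < h'/2 & z = v t (j' s)"
        by (rule fbox_near[OF fb', of 0 "{-k2<..<k2}" "h'/2"]) (use k2 ab' in auto)
      have "v (h'/2) y' = w'" unfolding y'_def using w'K v_neg(2)[of w' "h'/2"] by simp
      then have "v (h'/2) y' \<in> ball w' d2" using d2(1) by simp
      then obtain d3 where d3: "d3 > 0" "\<And>z. z \<in> K ==> dist z y' < d3 ==> v (h'/2) z \<in> ball w' d2"
        using tube_point[OF y'K open_ball, of "h'/2" w' d2] by blast
      define V1 where "V1 = V \<inter> - J"
      have "open V1" "q \<in> V1" unfolding V1_def using V(1) opJ qV qJ by auto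
      moreover have "\<forall>t\<le>0. v t y' \<in> V1"
      proof (intro allI impI)
        fix t :: real assume t: "t \<le> 0"
        have "v t y' = v (t + - (h'/2)) w'" unfolding y'_def using w'K by (simp only: vadd)
        then have "v t y' \<in> V" using w'V by simp
        then show "v t y' \<in> V1" using backJ[OF t] by (simp only: V1_def Int_iff)
      qed
      moreover have "y' \<in> ball y' d3" using d3(1) by simp
      ultimately have "\<exists>T\<ge>T1. \<exists>n>0. n \<le> i & (\<forall>s. 0 < s & s < n -->
        (\<exists>t\<ge>T. v t (c s) \<in> ball y' d3 & (\<forall>r. T \<le> r & r \<le> t --> v r (c s) \<in> V1)))"
        using pass[rule_format, OF y'y, of V1 "ball y' d3" T1] open_ball by simp
      then obtain T n1 where T: "T \<ge> T1" and n1: "n1 > 0" "n1 \<le> i" "\<And>s. 0 < s ==> s < n1 ==>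
        \<exists>t\<ge>T. v t (c s) \<in> ball y' d3 & (\<forall>r. T \<le> r & r \<le> t --> v r (c s) \<in> V1)" by auto
      obtain n2 where n2: "n2 > 0" "\<forall>s t. 0 \<le> s & s < n2 & 0 \<le> t & t \<le> T --> v t (c s) \<in> V"
        using ctube[OF V(1), of 0 T] wV by blast
      obtain n3 where n3: "n3 > 0" "\<forall>s t. 0 \<le> s & s < n3 & T1 \<le> t & t \<le> T --> v t (c s) \<in> - J"
        using ctube[OF opJ, of T1 T] T1(2) by blast
      have "\<exists>t s'. HT s t s' & \<bar>s'\<bar> < k & (\<forall>r. 0 \<le> r & r \<le> t --> v r (c s) \<in> V)"
        if s: "0 < s" "s < min n1 (min n2 n3)" for s
      proof -
        have sK: "c s \<in> K" using cK[of s] s n1(2) by simp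
        obtain t where t: "t \<ge> T" "v t (c s) \<in> ball y' d3" "\<forall>r. T \<le> r & r \<le> t --> v r (c s) \<in> V1"
          using n1(3)[of s] s by auto
        have "v (h'/2) (v t (c s)) \<in> ball w' d2" using d3(2)[OF inK[OF sK]] t(2) by (simp add: dist_commute)
        then have "dist (v (h'/2) (v t (c s))) (j' 0) < d2" using ab' by (simp add: dist_commute)
        then obtain s' t' where st: "s' \<in> ?I \<inter> {-k2<..<k2}" "\<bar>t'\<bar> < h'/2" "v (h'/2) (v t (c s)) = v t' (j' s')"
          using d2(2)[OF inK[OF inK[OF sK]]] by blast
        have s'ab: "s' \<in> {a'..b'}" using st(1) ab' by auto
        have s'K: "j' s' \<in> K" by (rule j'K[OF s'ab])
        define t1 where "t1 = h'/2 + t - t'"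
        have t1t: "t1 > t" "t1 - t < h'" using st(2) by (auto simp: t1_def)
        have hit: "v t1 (c s) = j' s'"
          unfolding t1_def using st(3) v_eq_iff[OF sK s'K, of "h'/2 + t" t'] sK by (simp add: vadd)
        have after: "v r (c s) = v (r - t1) (j' s')" for r
          using hit sK by (simp flip: hit add: vadd)
        have "v r (c s) \<notin> J" if r: "T1 \<le> r" "r < t1" for r
        proof (cases "r \<le> t")
          case True
          then show ?thesis using t(3) n3(2) s r(1) by (cases "r \<le> T") (auto simp: V1_def)
        next
          case False
          show ?thesis
          proof
            assume "v r (c s) \<in> J"
            then obtain s'' where s'': "s'' \<in> {a'..b'}" "v r (c s) = j' s''" by (auto simp: J_def)
            then have "v (r - t1) (j' s') = v 0 (j' s'')" using after v0 j'K by simp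
            then have "r - t1 = 0" using fbox_uniq[OF fb' s'ab s''(1), of "r - t1" 0] False r t1t by auto
            then show False using r by simp
          qed
        qed
        then have "HT s t1 s'" unfolding HT_def using st(1) s'ab hit k2 t(1) t1t T by auto
        moreover have "v r (c s) \<in> V" if r: "0 \<le> r" "r \<le> t1" for r
        proof -
          consider "r \<le> T" | "T \<le> r" "r \<le> t" | "t < r" by linarith
          then show ?thesis
          proof cases
            case 1 then show ?thesis using n2(2) s r by auto
          next
            case 2 then show ?thesis using t(3) by (auto simp: V1_def)
          next
            case 3
            have "dist (j' s') w' < d1" using k1(2) s'ab st(1) k2 by auto
            then have "v (r - t1) (j' s') \<in> V" using d1(2)[OF s'K] 3 r t1t by auto
            then show ?thesis using after by simp
          qed
        qed
        ultimately show ?thesis using st(1) k2 by (intro exI[of _ t1] exI[of _ s']) auto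
      qed
      then show ?thesis using n1 n2 n3 by (intro exI[of _ "min n1 (min n2 n3)"]) auto
    qed
    have HT_J: "v t (c s) \<in> J" if "HT s t s'" for s t s'
    proof -
      have "v t (c s) = j' s'" "s' \<in> {a'..b'} \<inter> {-l..l}" using that by (auto simp: HT_def)
      then show ?thesis unfolding J_def by (rule image_eqI)
    qed
    have HT_uniq: "t = t2 & s' = s2" if H: "HT s t s'" "HT s t2 s2" for s t s' t2 s2
    proof -
      have J': "v t (c s) \<in> J" "v t2 (c s) \<in> J" using H HT_J by blast+
      have "\<not> t < t2" "\<not> t2 < t" using H J' unfolding HT_def by (metis less_imp_le)+
      then have t: "t = t2" by simp
      then have "v 0 (j' s') = v 0 (j' s2)" using H unfolding HT_def by simp
      then show ?thesis using fbox_uniq[OF fb', of s' s2 0 0] H t ab' by (auto simp: HT_def)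
    qed
    obtain n where n: "n > 0" "n \<le> i" "\<And>s. 0 < s ==> s < n ==> \<exists>t s'. HT s t s'"
    proof -
      obtain e where "e > 0 & e \<le> i & (\<forall>s. 0 < s & s < e --> (\<exists>t s'. HT s t s' & \<bar>s'\<bar> < 1 &
          (\<forall>r. 0 \<le> r & r \<le> t --> v r (c s) \<in> UNIV)))"
        using FH[OF zero_less_one open_UNIV subset_UNIV subset_UNIV] by (elim exE)
      then show thesis by (intro that[of e]) meson+
    qed
    define g where "g s = (SOME t. \<exists>s'. HT s t s')" for s
    define f where "f s = (SOME s'. HT s (g s) s')" for s
    have HT: "HT s (g s) (f s)" if "0 < s" "s < n" for s
      unfolding f_def by (rule someI_ex) (use someI_ex[OF n(3)[OF that]] in \<open>simp add: g_def\<close>)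
    have contc: "\<exists>d>0. \<forall>s'. 0 < s' & s' < n & \<bar>s' - s\<bar> < d --> dist (c s') (c s) < e" if s: "0 < s" "s < n" and e: "e > 0" for s e
    proof -
      obtain d where d: "d > 0" "\<And>s'. s' \<in> {0..i} ==> dist s' s < d ==> dist (c s') (c s) < e"
        using cc[unfolded continuous_on_iff, rule_format, of s e] e s n(2) by auto
      then show ?thesis using n(2) by (intro exI[of _ d]) (auto simp: dist_real_def)
    qed
    have contg: "continuous_on {0<..<n} g"
      unfolding continuous_on_iff
    proof (intro ballI allI impI)
      fix s e0 :: real assume s: "s \<in> {0<..<n}" and e0: "e0 > 0"
      have H: "HT s (g s) (f s)" using HT s by auto
      have sK: "c s \<in> K" using cK[of s] s n(2) by simp
      \<comment> \<open>Up to time \<open>g s - e1\<close> nearby orbits still miss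
        \<open>J\<close>, and around time \<open>g s\<close> they hit it with an error below
        \<open>e1\<close>. The two bounds together are the continuity of the hitting time.\<close>
      define e1 where "e1 = min (min e0 h') (g s - T1)"
      have e1: "e1 > 0" "e1 \<le> e0" "e1 \<le> h'" "e1 \<le> g s - T1" using e0 ab' H by (auto simp: e1_def HT_def)
      obtain d1 where d1: "d1 > 0" "\<And>z t. z \<in> K ==> dist z (c s) < d1 ==> T1 \<le> t ==> t \<le> g s - e1 ==> v t z \<in> - J"
        by (rule tube[OF sK opJ, of T1 "g s - e1"]) (use H e1 in \<open>auto simp: HT_def\<close>)
      have fI: "f s \<in> ?I" using lI[of "f s"] H by (simp add: HT_def)
      obtain d2 where d2: "d2 > 0" "\<And>z. z \<in> K ==> dist z (j' (f s)) < d2 ==>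
          \<exists>s' t. s' \<in> ?I \<inter> {-l<..<l} & \<bar>t\<bar> < e1 & z = v t (j' s')"
        by (rule fbox_near[OF fb' fI, of "{-l<..<l}" e1]) (use H e1 in \<open>auto simp: HT_def\<close>)
      have "v (g s) (c s) \<in> ball (j' (f s)) d2" using H d2(1) by (simp add: HT_def)
      then obtain d3 where d3: "d3 > 0" "\<And>z. z \<in> K ==> dist z (c s) < d3 ==> v (g s) z \<in> ball (j' (f s)) d2"
        using tube_point[OF sK open_ball] by blast
      obtain d where d: "d > 0" "\<forall>s'. 0 < s' & s' < n & \<bar>s' - s\<bar> < d --> dist (c s') (c s) < min d1 d3"
        using contc[of s "min d1 d3"] s d1(1) d3(1) by auto
      have "dist (g s') (g s) < e0" if s': "s' \<in> {0<..<n}" "dist s' s < d" for s'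
      proof -
        have s'K: "c s' \<in> K" using cK[of s'] s' n(2) by simp
        have ds: "dist (c s') (c s) < d1" "dist (c s') (c s) < d3" using d(2) s' by (auto simp: dist_real_def)
        have H': "HT s' (g s') (f s')" using HT s' by auto
        have "v (g s') (c s') \<in> J" by (rule HT_J[OF H'])
        then have low: "g s' > g s - e1" using d1(2)[OF s'K ds(1), of "g s'"] H' by (force simp: HT_def)
        have "dist (v (g s) (c s')) (j' (f s)) < d2" using d3(2)[OF s'K ds(2)] by (simp add: dist_commute)
        then obtain q' t where qt: "q' \<in> ?I \<inter> {-l<..<l}" "\<bar>t\<bar> < e1" "v (g s) (c s') = v t (j' q')"
          using d2(2)[OF inK[OF s'K]] by blast
        have q'ab: "q' \<in> {a'..b'}" using qt(1) ab' by auto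
        have "v (g s - t) (c s') = j' q'" using v_eq_iff[OF s'K j'K[OF q'ab], of "g s" t] qt(3) by simp
        then have "v (g s - t) (c s') \<in> J" unfolding J_def by (rule image_eqI) (use qt(1) q'ab in auto)
        then have "g s' \<le> g s - t" using H' e1(4) qt(2) unfolding HT_def
            by (cases "g s - t < g s'") auto
        then show ?thesis using low e1 qt(2) by (auto simp: dist_real_def)
      qed
      then show "\<exists>d>0. \<forall>x'\<in>{0<..<n}. dist x' s < d --> dist (g x') (g s) < e0" using d(1) by blast
    qed
    obtain m' g' where co: "\<And>s t. s \<in> {a'..b'} ==> \<bar>t\<bar> \<le> h' ==> m' (v t (j' s)) = s & g' (v t (j' s)) = t"
      "continuous_on (fcell j' ?I h') m'" "continuous_on (fcell j' ?I h') g'" by (rule fbox_coord[OF fb']) blast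
    have f_co: "f s = m' (v (g s) (c s)) & v (g s) (c s) \<in> fcell j' ?I h'" if s: "0 < s" "s < n" for s
    proof -
      have H: "HT s (g s) (f s)" by (rule HT[OF s])
      then have fs: "f s \<in> {a'..b'}" "f s \<in> ?I" using lI[of "f s"] by (auto simp: HT_def)
      have "v (g s) (c s) = v 0 (j' (f s))" using H v0 j'K[OF fs(1)] by (simp add: HT_def)
      then show ?thesis
        using co(1)[OF fs(1), of 0] fs ab' by (auto simp: fcell_def intro!: image_eqI[of _ _ "(f s, 0)"])
    qed
    have "continuous_on {0<..<n} (%s. m' (v (g s) (c s)))"
    proof (rule continuous_on_compose2[OF co(2)])
      have "continuous_on {0<..<n} c" by (rule continuous_on_subset[OF cc]) (use n(2) in auto)
      then show "continuous_on {0<..<n} (%s. v (g s) (c s))"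
        by (intro cont_v contg) (use cK n(2) in auto)
      show "(%s. v (g s) (c s)) ` {0<..<n} \<subseteq> fcell j' ?I h'"
        by (rule image_subsetI) (use f_co in auto)
    qed
    then have contf: "continuous_on {0<..<n} f"
      by (rule continuous_on_eq) (use f_co in auto)
    have "transit_map c j' {a'..b'} w w' n g f"
      unfolding transit_map_def
    proof (intro conjI allI impI)
      show "n > 0" by fact
      show "continuous_on {0<..<n} f" by fact
      show "g s \<ge> 1" "f s \<in> {a'..b'}" "v (g s) (c s) = j' (f s)" if "0 < s & s < n" for s
        using HT[of s] that T1(1) by (auto simp: HT_def)
      show "\<exists>e>0. \<forall>s. 0 < s & s < e --> \<bar>f s\<bar> < k" if k: "k > 0" for k
      proof -
        obtain e where e: "e > 0" "\<forall>s. 0 < s & s < e --> (\<exists>t s'. HT s t s' & \<bar>s'\<bar> < k &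
            (\<forall>r. 0 \<le> r & r \<le> t --> v r (c s) \<in> UNIV))"
          using FH[OF k open_UNIV subset_UNIV subset_UNIV] by (elim exE conjE) (rule that)
        have "\<bar>f s\<bar> < k" if s: "0 < s" "s < min e n" for s
        proof -
          obtain t s' where "HT s t s'" "\<bar>s'\<bar> < k" using e(2) s by auto
          then show ?thesis using HT_uniq[OF HT[of s]] s by auto
        qed
        then show ?thesis using e(1) n(1) by (intro exI[of _ "min e n"]) auto
      qed
      show "\<exists>e>0. \<forall>s r. 0 < s & s < e & 0 \<le> r & r \<le> g s --> v r (c s) \<in> V"
        if V: "open V & closure (orb v w) \<subseteq> V & closure (orb v w') \<subseteq> V" for V
      proof -
        obtain e where e: "e > 0" "\<forall>s. 0 < s & s < e --> (\<exists>t s'. HT s t s' & \<bar>s'\<bar> < 1 &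
            (\<forall>r. 0 \<le> r & r \<le> t --> v r (c s) \<in> V))"
          using FH[OF zero_less_one conjunct1[OF V] conjunct1[OF conjunct2[OF V]] conjunct2[OF conjunct2[OF V]]]
          by (elim exE conjE) (rule that)
        have "v r (c s) \<in> V" if s: "0 < s" "s < min e n" "0 \<le> r" "r \<le> g s" for s r
        proof -
          obtain t s' where t: "HT s t s'" "\<forall>r. 0 \<le> r & r \<le> t --> v r (c s) \<in> V" using e(2) s by auto
          then have "t = g s" using HT_uniq[OF HT[of s]] s by auto
          then show ?thesis using t(2) s by blast
        qed
        then show ?thesis using e(1) n(1) by (intro exI[of _ "min e n"]) auto
      qed
    qed
    then show ?thesis using n(2) by blast
  qed
  have eq: "(%s. j (m * s)) = c" by (simp add: c_def fun_eq_iff)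
  show ?thesis
    unfolding eq
  proof (intro exI[of _ y] conjI allI impI)
    show "\<exists>e>0. \<forall>s. 0 < s & s < e --> (\<exists>t\<ge>T0. v t (j (m * s)) \<in> W)" if "open W" "y \<in> W" for W T0
      by (rule near[OF that])
    show "\<exists>n g f. n \<le> i & transit_map c j' {a'..b'} w w' n g f"
      if "w' \<in> orb v y" "fbox w' a' b' h' j'" for w' a' b' h' j'
      by (rule main[OF that])
  qed (use y in auto)
qed

end

section \<open>Limit sets of unstable separatrices\<close>

context cflow
begin

text \<open>A first return or transit along the flow between the germs at \<open>0\<close> of two half sections.\<close>

definition germ_map where
  "germ_map D c c' \<eta> \<tau> g \<longleftrightarrow> \<eta> > 0 & continuous_on {0<..<\<eta>} g &
     (\<forall>s. 0 < s & s < \<eta> --> c s \<in> K & \<tau> s \<ge> 1 & g s > 0 & v (\<tau> s) (c s) = c' (g s)) &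
     (\<forall>k>0. \<exists>e>0. \<forall>s. 0 < s & s < e --> g s < k) &
     (\<forall>V. open V & D \<subseteq> V -->
        (\<exists>e>0. \<forall>s r. 0 < s & s < e & 0 \<le> r & r \<le> \<tau> s --> v r (c s) \<in> V))"
  for c c' :: "real => _" and \<tau> g :: "real => real"

definition acc where
  "acc e c \<longleftrightarrow> (\<forall>T \<delta>. \<delta> > 0 --> (\<exists>t\<ge>T. \<exists>s. 0 < s & s < \<delta> & v t e = c s))"
  for c :: "real => _"

lemma germ_mapD:
  assumes "germ_map D c c' h t g"
  shows "h > 0" "continuous_on {0<..<h} g"
    "\<And>s. 0 < s ==> s < h ==> c s \<in> K & t s \<ge> 1 & g s > 0 & v (t s) (c s) = c' (g s)"
    "\<And>k. k > 0 ==> \<exists>e>0. \<forall>s. 0 < s & s < e --> g s < k"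
    "\<And>V. open V ==> D \<subseteq> V ==>
        \<exists>e>0. \<forall>s r. 0 < s & s < e & 0 \<le> r & r \<le> t s --> v r (c s) \<in> V"
  using assms unfolding germ_map_def by simp_all

lemma germ_map_shrink:
  assumes "germ_map D c c' h t g" "0 < h'" "h' \<le> h"
  shows "germ_map D c c' h' t g"
proof -
  note d = germ_mapD[OF assms(1)]
  have "continuous_on {0<..<h'} g" by (rule continuous_on_subset[OF d(2)]) (use assms in auto)
  then show ?thesis unfolding germ_map_def using d(3-5) assms(2,3) by simp
qed

lemma germ_map_trans:
  assumes "germ_map D c c' h t g" "germ_map D c' c'' h' t' g'"
  shows "\<exists>h t g. germ_map D c c'' h t g"
proof -
  note d = germ_mapD[OF assms(1)] and d' = germ_mapD[OF assms(2)]
  obtain e where e: "e > 0" "\<forall>s. 0 < s & s < e --> g s < h'" using d(4)[OF d'(1)] by blast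
  define q where "q = min e h"
  have q: "q > 0" using e d by (simp add: q_def)
  have gd: "0 < g s" "g s < h'" "s < h" if "0 < s" "s < q" for s using d(3)[of s] e(2) that by (auto simp: q_def)
  have "germ_map D c c'' q (%s. t' (g s) + t s) (%s. g' (g s))"
    unfolding germ_map_def
  proof (intro conjI allI impI)
    show "continuous_on {0<..<q} (%s. g' (g s))"
    proof (rule continuous_on_compose2[OF d'(2)])
      show "continuous_on {0<..<q} g" by (rule continuous_on_subset[OF d(2)]) (auto simp: q_def)
    qed (use gd in auto)
    fix s assume s: "0 < s & s < q"
    have 1: "c s \<in> K" "t s \<ge> 1" "v (t s) (c s) = c' (g s)" using d(3)[of s] gd s by auto
    have 2: "t' (g s) \<ge> 1" "g' (g s) > 0" "v (t' (g s)) (c' (g s)) = c'' (g' (g s))"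
      using d'(3)[of "g s"] gd s by auto
    show "c s \<in> K" "1 \<le> t' (g s) + t s" "0 < g' (g s)" using 1 2 by auto
    show "v (t' (g s) + t s) (c s) = c'' (g' (g s))" using 1 2 vadd[OF 1(1)] by metis
  next
    fix k :: real assume "k > 0"
    then obtain k' where k': "k' > 0" "\<forall>s. 0 < s & s < k' --> g' s < k" using d'(4) by blast
    obtain e' where e': "e' > 0" "\<forall>s. 0 < s & s < e' --> g s < k'" using d(4)[OF k'(1)] by blast
    show "\<exists>e>0. \<forall>s. 0 < s & s < e --> g' (g s) < k"
      using k' e' q gd by (intro exI[of _ "min e' q"]) auto
  next
    fix V assume V: "open V & D \<subseteq> V"
    obtain k' where k': "k' > 0" "\<forall>s r. 0 < s & s < k' & 0 \<le> r & r \<le> t' s --> v r (c' s) \<in> V"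
      using d'(5) V by blast
    obtain e1 where e1: "e1 > 0" "\<forall>s r. 0 < s & s < e1 & 0 \<le> r & r \<le> t s --> v r (c s) \<in> V"
      using d(5) V by blast
    obtain e' where e': "e' > 0" "\<forall>s. 0 < s & s < e' --> g s < k'" using d(4)[OF k'(1)] by blast
    have "v r (c s) \<in> V"
      if s: "0 < s" "s < min e1 (min e' q)" "0 \<le> r" "r \<le> t' (g s) + t s" for s r
    proof (cases "r \<le> t s")
      case True then show ?thesis using e1(2) s by auto
    next
      case False
      have 1: "c s \<in> K" "v (t s) (c s) = c' (g s)" using d(3)[of s] gd s by auto
      have "v r (c s) = v (r - t s) (c' (g s))" using vadd[OF 1(1), of "r - t s" "t s"] 1(2) by simp
      then show ?thesis using k'(2)[rule_format, of "g s" "r - t s"] e'(2) gd[of s] s False by auto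
    qed
    then show "\<exists>e>0. \<forall>s r. 0 < s & s < e & 0 \<le> r & r \<le> t' (g s) + t s --> v r (c s) \<in> V"
      using e1(1) e'(1) q by (intro exI[of _ "min e1 (min e' q)"]) auto
  qed (rule q)
  then show ?thesis by (intro exI)
qed

lemma acc_germ_map:
  assumes "germ_map D c c' h q g" "acc e c" "e \<in> K"
  shows "acc e c'"
  unfolding acc_def
proof (intro allI impI)
  note d = germ_mapD[OF assms(1)]
  fix T b :: real assume "b > 0"
  then obtain k where k: "k > 0" "\<forall>s. 0 < s & s < k --> g s < b" using d(4) by blast
  obtain t s where ts: "t \<ge> T" "0 < s" "s < min k h" "v t e = c s"
    using assms(2)[unfolded acc_def, rule_format, of "min k h" T] k d(1) by auto
  have s: "q s \<ge> 1" "g s > 0" "v (q s) (c s) = c' (g s)" using d(3)[of s] ts by auto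
  have "v (q s + t) e = c' (g s)" using s ts vadd[OF assms(3), of "q s" t] by simp
  then show "\<exists>t\<ge>T. \<exists>s. 0 < s & s < b & v t e = c' s"
    using s ts k by (intro exI[of _ "q s + t"] conjI exI[of _ "g s"]) auto
qed

text \<open>The iterates of \<open>g\<close> decrease to a fixed point, which can only be 0, and
  each takes time at least 1, so the orbit comes back to the half section ever closer to
  \<open>w\<close>. From some iterate on all further passages run in a given neighbourhood of
  \<open>D\<close>, which confines the limit set to \<open>D\<close>.\<close>

lemma contracting_germ_map:
  assumes gm: "germ_map D c c a q g" and less: "\<And>s. 0 < s ==> s < a ==> g s < s"
    and c: "\<And>h. h > 0 ==> \<exists>k>0. \<forall>s. 0 < s & s < k --> dist (c s) w < h"
    and D: "closed D" and s0: "0 < s0" "s0 < a"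
  shows "w \<in> olim v (c s0)" "olim v (c s0) \<subseteq> D"
proof -
  note d = germ_mapD[OF gm]
  have zK: "c s0 \<in> K" using d(3)[of s0] s0 by blast
  define x where "x n = (g ^^ n) s0" for n
  have xI: "0 < x n & x n < a" for n
  proof (induction n)
    case (Suc n)
    then show ?case using d(3)[of "x n"] less[of "x n"] by (auto simp: x_def)
  qed (use s0 in \<open>simp add: x_def\<close>)
  have xS: "x (Suc n) = g (x n)" for n by (simp add: x_def)
  have "decseq x" unfolding decseq_Suc_iff xS using xI less by (simp add: less_imp_le)
  then obtain l where l: "x \<longlonglongrightarrow> l" "\<And>i. l \<le> x i"
    using decseq_convergent[of x 0] xI by (metis less_imp_le)
  have l0: "0 \<le> l" by (rule LIMSEQ_le_const[OF l(1)]) (use xI in \<open>auto intro: less_imp_le\<close>)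
  have "l = 0"
  proof (rule ccontr)
    assume "l \<noteq> 0"
    then have lI: "0 < l" "l < a" using l0 l(2)[of 0] xI[of 0] by auto
    have "isCont g l"
      using d(2) lI by (simp add: continuous_on_eq_continuous_at)
    then have "(%n. g (x n)) \<longlonglongrightarrow> g l" using l(1) isCont_tendsto_compose by blast
    moreover have "(%n. g (x n)) \<longlonglongrightarrow> l" using LIMSEQ_Suc[OF l(1)] by (simp add: xS)
    ultimately have "g l = l" using LIMSEQ_unique by blast
    then show False using less[of l] lI by simp
  qed
  have time: "\<exists>t\<ge>real n. v t (c s0) = c (x n)" for n
  proof (induction n)
    case 0 then show ?case using v0[OF zK] by (intro exI[of _ 0]) (simp add: x_def)
  next
    case (Suc n)
    then obtain t where t: "t \<ge> real n" "v t (c s0) = c (x n)" by blast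
    have "v (q (x n) + t) (c s0) = c (x (Suc n))"
      using d(3)[of "x n"] xI[of n] t(2) vadd[OF zK, of "q (x n)" t] by (simp add: xS)
    then show ?case using t(1) d(3)[of "x n"] xI[of n] by (intro exI[of _ "q (x n) + t"]) auto
  qed
  have reach: "\<exists>t\<ge>N. \<exists>s. 0 < s & s < k & v t (c s0) = c s" if k: "k > 0" for N k
  proof -
    obtain M where M: "\<And>n. n \<ge> M ==> x n < k"
      using LIMSEQ_D[OF l(1)[unfolded \<open>l = 0\<close>] k] xI by (auto simp: abs_less_iff)
    obtain n where n: "n \<ge> M" "real n \<ge> N"
      using real_arch_simple[of N] by (meson le_max_iff_disj max.cobounded1 of_nat_le_iff order_trans nle_le)
    obtain t where "t \<ge> real n" "v t (c s0) = c (x n)" using time by blast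
    then show ?thesis using n M[OF n(1)] xI[of n] by (intro exI[of _ t] conjI exI[of _ "x n"]) auto
  qed
  show "w \<in> olim v (c s0)"
  proof (rule olimI)
    fix N h :: real assume "h > 0"
    then obtain k where k: "k > 0" "\<forall>s. 0 < s & s < k --> dist (c s) w < h" using c by blast
    then show "\<exists>t\<ge>N. dist (v t (c s0)) w < h" using reach[OF k(1), of N] by metis
  qed
  show "olim v (c s0) \<subseteq> D"
  proof (rule subsetI, rule ccontr)
    fix y assume y: "y \<in> olim v (c s0)" "y \<notin> D"
    then obtain h where h: "h > 0" "ball y h \<subseteq> - D"
      using D open_contains_ball[of "- D"] by (auto simp: open_Compl)
    define V where "V = - cball y (h/2)"
    have "D \<subseteq> V" using h by (force simp: V_def)
    moreover have "open V" by (simp add: V_def open_Compl)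
    ultimately obtain e where e: "e > 0" "\<forall>s r. 0 < s & s < e & 0 \<le> r & r \<le> q s --> v r (c s) \<in> V"
      using d(5) by blast
    \<comment> \<open>Each passage takes time at least 1, so \<open>n\<close> of them cover all
      times up to \<open>n\<close>.\<close>
    have stay: "v r (c s) \<in> V" if "0 < s" "s < min e a" "0 \<le> r" "r \<le> real n" for n s r
      using that
    proof (induction n arbitrary: s r)
      case 0
      then have "0 \<le> q s" using d(3)[of s] by auto
      then show ?case using e(2) 0 by auto
    next
      case (Suc n)
      have s: "c s \<in> K" "q s \<ge> 1" "g s > 0" "v (q s) (c s) = c (g s)" "g s < s" using d(3)[of s] less[of s] Suc.prems by auto
      show ?case
      proof (cases "r \<le> q s")
        case True then show ?thesis using e(2) Suc.prems by auto
      next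
        case False
        have "v (r - q s) (c (g s)) \<in> V" using Suc.IH[of "g s" "r - q s"] s Suc.prems False by auto
        then show ?thesis using vadd[OF s(1), of "r - q s" "q s"] s(4) by simp
      qed
    qed
    have "min e a > 0" using e(1) d(1) by simp
    then obtain t s where ts: "0 < s" "s < min e a" "v t (c s0) = c s" using reach by metis
    obtain t' where t': "t' \<ge> t" "dist (v t' (c s0)) y < h/2" using olimD[OF y(1), of "h/2" t] h(1) by auto
    obtain n where n: "t' - t \<le> real n" using real_arch_simple by blast
    have "v (t' - t) (c s) \<in> V" by (rule stay[OF ts(1,2) _ n]) (use t' in simp)
    then have "v t' (c s0) \<in> V" using vadd[OF zK, of "t' - t" t] ts(3) by simp
    then show False using t'(2) by (auto simp: V_def dist_commute)
  qed
qed

end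

section \<open>Half sections and their return maps\<close>

context sfc
begin

lemma half_section:
  assumes fb: "fbox w a b h j" and r: "\<And>s. 0 \<le> s ==> s \<le> r ==> q * s \<in> {a..b}"
  shows "continuous_on {0..r} (%s. j (q * s))" "\<And>s. 0 \<le> s ==> s \<le> r ==> j (q * s) \<in> K"
proof -
  show "continuous_on {0..r} (%s. j (q * s))"
    by (rule continuous_on_compose2[of "{a..b}" j])
      (use r fb in \<open>auto intro!: continuous_intros simp: fbox_def\<close>)
  show "j (q * s) \<in> K" if "0 \<le> s" "s \<le> r" for s by (rule fbox_K[OF fb r[OF that]])
qed

lemma fbox_not_fixed: assumes "fbox w a b h j" "s \<in> {a..b}" "\<And>t. v t (j s) = j s" shows False
proof -
  have "h > 0" using assms(1) by (simp add: fbox_def)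
  moreover have "v h (j s) = v 0 (j s)" using assms(3) by metis
  ultimately show False using fbox_uniq[OF assms(1,2,2), of h 0] by simp
qed

text \<open>An orbit accumulating in forward time on the half section and converging in backward time to
  a fixed point cannot be expanded by the return map: its backward iterates would stay on a compact
  part of the section.\<close>

lemma return_contracting:
  assumes fb: "fbox w a b h j" and q: "m \<le> q" "\<And>s. 0 \<le> s ==> s \<le> q ==> i * s \<in> {a..b}"
    and gm: "germ_map D (%s. j (i * s)) (%s. j (i * s)) m l g"
    and ac: "acc e (%s. j (i * s))" and e: "e \<in> wst K (rv v) p0" and s: "0 < s" "s < m"
  shows "g s < s"
proof (rule ccontr)
  interpret r: cflow K "rv v" by (rule cflow_rv)
  assume "\<not> g s < s"
  then have gs: "s \<le> g s" by simp
  note d = germ_mapD[OF gm] and hs = half_section[OF fb q(2)]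
  define c where "c s = j (i * s)" for s
  have eK: "e \<in> K" using e by (simp add: wst_def)
  \<comment> \<open>As \<open>g\<close> tends to 0 and \<open>g s\<close> is at least
    \<open>s\<close>, the intermediate value theorem gives every point of \<open>{0<..s}\<close> a
    preimage in the same interval.\<close>
  have bwd: "\<exists>s1. 0 < s1 & s1 \<le> s & g s1 = u" if u: "0 < u" "u \<le> s" for u
  proof -
    obtain k where k: "k > 0" "\<forall>s. 0 < s & s < k --> g s < u" using d(4)[OF u(1)] by blast
    define f where "f = min k s / 2"
    have f: "0 < f" "f < k" "f \<le> s" using k s by (auto simp: f_def)
    have "\<exists>x\<ge>f. x \<le> s & g x = u"
    proof (rule IVT')
      show "continuous_on {f..s} g" by (rule continuous_on_subset[OF d(2)]) (use s f in auto)
    qed (use k f gs u in auto)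
    then obtain x where "x \<ge> f" "x \<le> s" "g x = u" by blast
    then show ?thesis using f(1) by (intro exI[of _ x]) auto
  qed
  have iter: "\<exists>s'. 0 < s' & s' \<le> s & (\<exists>t\<ge>real n. v t (c s') = c u)" if "0 < u" "u \<le> s" for n u
    using that
  proof (induction n arbitrary: u)
    case 0
    have "v 0 (c u) = c u" unfolding c_def using v0 hs(2)[of u] 0 s q(1) by simp
    then show ?case using 0 by (intro exI[of _ u] conjI exI[of _ 0]) auto
  next
    case (Suc n)
    obtain s1 where s1: "0 < s1" "s1 \<le> s" "g s1 = u" using bwd[OF Suc.prems] by blast
    obtain s' t where s': "0 < s'" "s' \<le> s" "t \<ge> real n" "v t (c s') = c s1" using Suc.IH[OF s1(1,2)] by blast
    have s'K: "c s' \<in> K" unfolding c_def using hs(2)[of s'] s' s q(1) by simp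
    have "v (l s1 + t) (c s') = c u" "l s1 \<ge> 1"
      using d(3)[of s1] s1 s s'(4) vadd[OF s'K, of "l s1" t] by (auto simp: c_def)
    then show ?case using s' by (intro exI[of _ s'] conjI exI[of _ "l s1 + t"]) auto
  qed
  obtain t0 u where u: "0 < u" "u < s" "v t0 e = c u"
    using ac[unfolded acc_def, rule_format, OF s(1), of 0] by (auto simp: c_def)
  define C where "C = c ` {0..s}"
  have "continuous_on {0..s} c" unfolding c_def by (rule continuous_on_subset[OF hs(1)]) (use s q(1) in auto)
  then have "compact C" unfolding C_def by (intro compact_continuous_image) auto
  then have op: "open (- C)" by (simp add: open_Compl compact_imp_closed)
  \<comment> \<open>Backward iterates of a crossing of the orbit of \<open>e\<close> lie in
    \<open>C\<close>, at arbitrarily early times of that orbit. Since the orbit tends to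
    \<open>p0\<close> backwards and \<open>C\<close> is compact, \<open>p0\<close> lies on the
    section, where no fixed point can be.\<close>
  have "p0 \<in> C"
  proof (rule ccontr)
    assume "p0 \<notin> C"
    moreover have "((%t. rv v t e) \<longlongrightarrow> p0) at_top" using e by (simp add: wst_def)
    ultimately obtain T where T: "\<And>t. t \<ge> T ==> rv v t e \<notin> C"
      using topological_tendstoD[OF _ op] by (fastforce simp: eventually_at_top_linorder)
    obtain n where n: "T + t0 \<le> real n" using real_arch_simple by blast
    obtain s' t where s': "0 < s'" "s' \<le> s" "t \<ge> real n" "v t (c s') = c u" using iter[of u n] u by auto
    have s'K: "c s' \<in> K" unfolding c_def using hs(2)[of s'] s' s q(1) by simp
    have "c s' = v (- t) (v t0 e)" using v_neg(1)[OF s'K, of t] s'(4) u(3) by simp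
    then have "c s' = rv v (t - t0) e" using eK by (simp add: rv_def vadd)
    moreover have "c s' \<in> C" using s' by (auto simp: C_def)
    ultimately show False using T[of "t - t0"] n s'(3) by auto
  qed
  then obtain x where x: "x \<in> {0..s}" "p0 = j (i * x)" by (auto simp: C_def c_def)
  have "v t p0 = p0" for t using r.wst_fixed(2)[OF e, of "-t"] by (simp add: rv_def)
  then show False using fbox_not_fixed[OF fb q(2)[of x]] x s q(1) by auto
qed

text \<open>The orbit of a connection becomes closed by adding its two end points. If
  \<open>w\<close> is off it, the section near \<open>w\<close> is off it too. If \<open>w\<close>
  is on it, only a short arc around \<open>w\<close> comes near, and this arc meets the section in
  \<open>w\<close> alone.\<close>

lemma section_avoids_orbit:
  assumes fb: "fbox w a b h j" and nf: "v t0 w \<noteq> w"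
    and w': "w' \<in> wst K v q" "w' \<in> wst K (rv v) q'"
  shows "\<exists>c>0. \<forall>s\<in>{a..b}. s \<noteq> 0 & \<bar>s\<bar> < c --> j s \<notin> orb v w'"
proof -
  interpret r: cflow K "rv v" by (rule cflow_rv)
  have ab: "a \<le> 0" "0 < b" "h > 0" "continuous_on {a..b} j" "j 0 = w" using fb unfolding fbox_def by auto
  have wK: "w \<in> K" using fbox_K[OF fb, of 0] ab by auto
  have w'K: "w' \<in> K" using w' by (simp add: wst_def)
  have near: "\<exists>c>0. \<forall>s\<in>{a..b}. \<bar>s\<bar> < c --> j s \<notin> C" if C: "closed C" "w \<notin> C" for C
  proof -
    obtain d where d: "d > 0" "ball w d \<subseteq> - C" using C open_contains_ball[of "- C"] by (auto simp: open_Compl)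
    obtain e where "e > 0" "\<And>s. s \<in> {a..b} ==> dist s 0 < e ==> dist (j s) (j 0) < d"
      using ab(1,2) ab(4)[unfolded continuous_on_iff, rule_format, of 0 d] d(1) by auto
    then show ?thesis using d(2) ab(5) by (intro exI[of _ e]) (force simp: dist_commute)
  qed
  have qf: "v t q = q" "v t q' = q'" for t
    using wst_fixed(2)[OF w'(1)] r.wst_fixed(2)[OF w'(2), of "-t"] by (auto simp: rv_def)
  have wq: "w \<noteq> q" "w \<noteq> q'" using qf nf by auto
  show ?thesis
  proof (cases "w \<in> orb v w'")
    case False
    let ?C = "insert q ((%t. v t w') ` {0..}) \<union> insert q' ((%t. rv v t w') ` {0..})"
    have "closed ?C" by (intro closed_Un closed_tail[OF w'(1)] r.closed_tail[OF w'(2)])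
    moreover have "w \<notin> ?C" using False wq by (auto simp: orb_def rv_def)
    moreover have "orb v w' \<subseteq> ?C"
    proof
      fix z assume "z \<in> orb v w'"
      then obtain t where t: "z = v t w'" by (auto simp: orb_def)
      show "z \<in> ?C"
      proof (cases "t \<ge> 0")
        case False then show ?thesis using t by (intro UnI2 insertI2 image_eqI[of _ _ "-t"]) (auto simp: rv_def)
      qed (use t in auto)
    qed
    ultimately show ?thesis using near[of ?C] by blast
  next
    case True
    have ow: "orb v w' = orb v w" using orb_eq[OF w'K True] by simp
    have w1: "w \<in> wst K v q" "w \<in> wst K (rv v) q'"
      using wst_orb[OF w'(1)] r.wst_orb[OF w'(2)] True by auto
    define C where "C = insert q ((%t. v t w) ` {h..}) \<union> insert q' ((%t. rv v t w) ` {h..})"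
    have cC: "closed C" unfolding C_def by (intro closed_Un closed_tail[OF w1(1)] r.closed_tail[OF w1(2)])
    have wC: "w \<notin> C"
    proof
      assume "w \<in> C"
      then obtain t where "t \<ge> h" "v 0 w = v t w \<or> v 0 w = v (- t) w" using wq v0[OF wK] unfolding C_def by (elim UnE insertE imageE) (simp_all add: rv_def)
      then show False using wst_nonper[OF w1(1) wq(1)] ab(3) by fastforce
    qed
    obtain c where c: "c > 0" "\<forall>s\<in>{a..b}. \<bar>s\<bar> < c --> j s \<notin> C" using near[OF cC wC] by blast
    have "j s \<notin> orb v w'" if s: "s \<in> {a..b}" "s \<noteq> 0" "\<bar>s\<bar> < c" for s
    proof
      assume "j s \<in> orb v w'"
      then obtain t where t: "j s = v t w" unfolding ow by (auto simp: orb_def)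
      have nC: "j s \<notin> C" using c s by blast
      show False
      proof (cases "\<bar>t\<bar> < h")
        case True
        have "v 0 (j s) = v t (j 0)" using t ab(5) v0 fbox_K[OF fb s(1)] by simp
        then show False using fbox_uniq[OF fb s(1), of 0 0 t] True ab s(2) by auto
      next
        case False
        then have "t \<ge> h \<or> - t \<ge> h" by auto
        then show False using nC t by (auto simp: C_def rv_def image_iff dest: bspec[of _ _ "- t"])
      qed
    qed
    then show ?thesis using c(1) by blast
  qed
qed

end

text \<open>Otherwise \<open>R\<close> would be a strict order on a finite set without a maximal
  element.\<close>

lemma finite_transitive_loop:
  assumes "finite X" "X \<noteq> {}" "\<And>x. x \<in> X ==> \<exists>y\<in>X. R x y"
    "\<And>x y z. R x y ==> R y z ==> R x z"
  shows "\<exists>x\<in>X. R x x"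
proof (rule ccontr)
  assume N: "\<not> ?thesis"
  have "asymp_on X R" using N assms(4) by (blast intro: asymp_onI)
  moreover have "transp_on X R" using assms(4) by (blast intro: transp_onI)
  ultimately have "\<exists>m\<in>X. \<forall>x\<in>X. x \<noteq> m --> \<not> R m x"
    using Finite_Set.bex_max_element[OF assms(1)] assms(2) by metis
  then obtain m where "m \<in> X" "\<And>x. x \<in> X ==> x \<noteq> m ==> \<not> R m x" by blast
  then show False using N assms(3)[of m] by metis
qed

context cflow
begin

text \<open>The orbit of \<open>e\<close> comes close to \<open>q\<close> again and again without
  lying in its stable set. It is then on one of the two sides, and is carried close to
  \<open>y1\<close> or \<open>y2\<close> each time.\<close>

lemma limit_leaves_saddle:
  assumes sec: "sectors K v q" and e: "e \<in> K" "q \<in> olim v e" "e \<notin> wst K v q"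
  shows "\<exists>y\<in>olim v e. y \<in> wst K (rv v) q & y \<noteq> q"
proof (rule ccontr)
  assume N: "\<not> ?thesis"
  obtain N0 x1 x2 y1 y2 U1 U2 where sd: "sector_data K v q N0 x1 x2 y1 y2 U1 U2"
    using sec unfolding sectors_def by blast
  have y: "y1 \<in> wst K (rv v) q" "y2 \<in> wst K (rv v) q" "y1 \<noteq> q" "y2 \<noteq> q" "open N0" "q \<in> N0"
    and wq: "wst K v q = {q} \<union> orb v x1 \<union> orb v x2"
    and NK: "N0 \<inter> K \<subseteq> insert q ((%t. v t x1) ` {0..}) \<union> insert q ((%t. v t x2) ` {0..}) \<union> (U1 \<union> U2)"
    and s1: "sector v q y1 U1" and s2: "sector v q y2 U2"
    using sd unfolding sector_data_def by auto
  have yK: "y1 \<in> K" "y2 \<in> K" using y by (auto simp: wst_def)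
  have miss: "\<exists>T W'. open W' & q \<in> W' & (\<forall>t\<ge>T. v t e \<notin> W' \<inter> U)"
    if y: "y \<notin> olim v e" "y \<in> K" and s: "sector v q y U" for y U
  proof -
    obtain d T where d: "d > 0" "\<And>t. t \<ge> T ==> dist (v t e) y \<ge> d" by (rule not_olimE[OF y(1)]) blast
    have "\<exists>W'. open W' & q \<in> W' &
        (\<forall>z\<in>W' \<inter> U. \<exists>t\<ge>0. v t z \<in> ball y d & (\<forall>r. 0 \<le> r & r \<le> t --> v r z \<in> UNIV))"
      using s[unfolded sector_def, rule_format, OF orb_self[OF y(2)], of UNIV "ball y d"] d(1) by simp
    then obtain W' where W': "open W'" "q \<in> W'" "\<And>z. z \<in> W' \<inter> U ==> \<exists>t\<ge>0. v t z \<in> ball y d" by auto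
    have "v t e \<notin> W' \<inter> U" if t: "t \<ge> T" for t
    proof
      assume "v t e \<in> W' \<inter> U"
      then obtain r where "r \<ge> 0" "v r (v t e) \<in> ball y d" using W'(3) by blast
      then show False using d(2)[of "r + t"] vadd[OF e(1), of r t] t by (simp add: dist_commute)
    qed
    then show ?thesis using W'(1,2) by blast
  qed
  obtain T1 W1 where 1: "open W1" "q \<in> W1" "\<forall>t\<ge>T1. v t e \<notin> W1 \<inter> U1"
    using miss[OF _ yK(1) s1] N y by blast
  obtain T2 W2 where 2: "open W2" "q \<in> W2" "\<forall>t\<ge>T2. v t e \<notin> W2 \<inter> U2"
    using miss[OF _ yK(2) s2] N y by blast
  have "open (N0 \<inter> W1 \<inter> W2)" "q \<in> N0 \<inter> W1 \<inter> W2" using 1 2 y by auto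
  then obtain d where d: "d > 0" "ball q d \<subseteq> N0 \<inter> W1 \<inter> W2" using open_contains_ball by blast
  obtain t where t: "t \<ge> max T1 T2" "dist (v t e) q < d" using olimD[OF e(2) d(1)] by blast
  have "v t e \<in> N0 \<inter> W1 \<inter> W2" using d(2) t(2) by (auto simp: dist_commute)
  moreover have "v t e \<notin> W1 \<inter> U1" "v t e \<notin> W2 \<inter> U2" using 1(3) 2(3) t(1) by auto
  ultimately have "v t e \<in> wst K v q" using NK inK[OF e(1), of t] unfolding wq by (auto simp: orb_def)
  then show False using e wst_olim[of e q] wst_olim[of "v t e" q] olim_v[OF e(1)] by simp
qed

end

section \<open>Limit sets made of separatrices\<close>

locale gflow = rflow + sfc +
  assumes sec: "p \<in> P ==> sectors K v p"
begin

lemma nongen_orbits: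
  obtains F where "finite F" "F \<subseteq> K" "\<And>x. x \<in> F ==> \<exists>p\<in>P. x \<in> wst K v p \<or> x \<in> wst K (rv v) p"
    "\<And>z. z \<in> K ==> \<not> gen z ==> \<exists>x\<in>F. z \<in> orb v x"
proof -
  have rep: "\<exists>F. finite F & F \<subseteq> wst K u p & wst K u p \<subseteq> (\<Union>x\<in>F. orb u x)"
    if u: "cflow K u" and t: "two_orbits K u p" for u p
  proof -
    interpret u: cflow K u by (rule u)
    obtain x1 x2 where x: "wst K u p = {p} \<union> orb u x1 \<union> orb u x2" "x1 \<in> K" "x2 \<in> K"
      using t unfolding two_orbits_def by blast
    have "p \<in> K" using x(1) by (auto simp: wst_def)
    then show ?thesis using x u.orb_self by (intro exI[of _ "{p, x1, x2}"]) auto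
  qed
  obtain F1 where F1: "\<And>p. p \<in> P ==> finite (F1 p) & F1 p \<subseteq> wst K v p & wst K v p \<subseteq> (\<Union>x\<in>F1 p. orb v x)"
    using rep[OF cflow_axioms two(1)] by metis
  obtain F2 where F2: "\<And>p. p \<in> P ==> finite (F2 p) & F2 p \<subseteq> wst K (rv v) p & wst K (rv v) p \<subseteq> (\<Union>x\<in>F2 p. orb v x)"
    using rep[OF cflow_rv two(2)] unfolding orb_rv by metis
  show thesis
  proof (rule that[of "\<Union>p\<in>P. F1 p \<union> F2 p"])
    show "finite (\<Union>p\<in>P. F1 p \<union> F2 p)" using finP F1 F2 by auto
    show "(\<Union>p\<in>P. F1 p \<union> F2 p) \<subseteq> K" using F1 F2 by (fastforce simp: wst_def)
    show "\<exists>p\<in>P. x \<in> wst K v p \<or> x \<in> wst K (rv v) p" if "x \<in> (\<Union>p\<in>P. F1 p \<union> F2 p)" for x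
      using that F1 F2 by blast
    show "\<exists>x\<in>\<Union>p\<in>P. F1 p \<union> F2 p. z \<in> orb v x" if z: "z \<in> K" "\<not> gen z" for z
    proof -
      obtain p where p: "p \<in> P" "z \<in> wst K v p \<or> z \<in> wst K (rv v) p" using z unfolding gen_def by blast
      then obtain x where "x \<in> F1 p \<union> F2 p" "z \<in> orb v x" using F1[OF p(1)] F2[OF p(1)] by blast
      then show ?thesis using p(1) by blast
    qed
  qed
qed

text \<open>The orbit of \<open>w\<close> ends in a saddle \<open>q\<close>, and
  \<open>transit\<close> leads past it to a section at a representative \<open>w'\<close> of an
  unstable separatrix, which lies in the limit set because the orbit of \<open>e\<close> is carried
  along. Near \<open>w\<close> the half section avoids the orbit of \<open>w'\<close>, so the
  transit map has no zero. By continuity it has a constant sign, and \<open>c'\<close> names the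
  half section in which it lands.\<close>

lemma transit_germ:
  assumes fb: "fbox w a b h j" and c: "c = 1 \<or> c = -1"
    and d: "d > 0" "\<And>s. 0 \<le> s ==> s \<le> d ==> c * s \<in> {a..b}"
    and e: "e \<in> K" and ac: "acc e (%s. j (c * s))"
    and w: "w \<in> olim v e" "w \<notin> P" and D: "\<And>w. w \<in> olim v e ==> \<exists>q\<in>P. w \<in> wst K v q"
    and F: "\<And>y. y \<in> olim v e ==> y \<notin> P ==> \<exists>w'\<in>F. w' \<in> orb v y"
    and boxes: "\<And>w'. w' \<in> F ==> fbox w' (A w') (B w') (H w') (J w')"
  shows "\<exists>w'\<in>F. \<exists>c'. (c' = 1 \<or> c' = -1) &
    (\<exists>d>0. \<forall>s. 0 \<le> s & s \<le> d --> c' * s \<in> {A w'..B w'}) &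
    (\<exists>n l g. germ_map (olim v e) (%s. j (c * s)) (%s. J w' (c' * s)) n l g)"
proof -
  interpret r: cflow K "rv v" by (rule cflow_rv)
  obtain q where q: "q \<in> P" "w \<in> wst K v q" using D w(1) by blast
  have wq: "w \<noteq> q" using q w by blast
  have wK: "w \<in> K" using q by (simp add: wst_def)
  have nf: "v 1 w \<noteq> w" using wst_nonper[OF q(2) wq, of 1 0] v0[OF wK] by auto
  have c0: "c \<noteq> 0" using c by auto
  obtain y where y: "y \<in> wst K (rv v) q" "y \<noteq> q"
    and near: "\<forall>W T0. open W --> y \<in> W --> (\<exists>e>0. \<forall>s. 0 < s & s < e --> (\<exists>t\<ge>T0. v t (j (c * s)) \<in> W))"
    and tr: "\<forall>w' a' b' h' j'. w' \<in> orb v y --> fbox w' a' b' h' j' -->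
      (\<exists>n l f. n \<le> d & transit_map (%s. j (c * s)) j' {a'..b'} w w' n l f)"
    by (rule exE[OF transit[OF fb c0 d(1) _ q(2) wq sec[OF q(1)]]], rule d(2), assumption, assumption,
      elim conjE, rule that, assumption+)
  have yK: "y \<in> K" using y by (simp add: wst_def)
  have yD: "y \<in> olim v e"
  proof (rule olimI)
    fix N i :: real assume i: "i > 0"
    obtain k where k: "k > 0" "\<forall>s. 0 < s & s < k --> (\<exists>t\<ge>0. v t (j (c * s)) \<in> ball y i)"
      using near[rule_format, of "ball y i" 0] i by auto
    obtain t s where ts: "t \<ge> N" "0 < s" "s < k" "v t e = j (c * s)"
      using ac[unfolded acc_def, rule_format, OF k(1), of N] by auto
    obtain t' where "t' \<ge> 0" "v t' (j (c * s)) \<in> ball y i" using k(2) ts by blast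
    then show "\<exists>t\<ge>N. dist (v t e) y < i"
      using ts vadd[OF e, of t' t] by (intro exI[of _ "t' + t"]) (simp add: dist_commute)
  qed
  have yP: "y \<notin> P"
  proof
    assume "y \<in> P"
    then have "olim (rv v) y = {y}" by (intro r.olim_fixed yK) (simp add: rv_def Pfix)
    then show False using y r.wst_olim[of y q] by simp
  qed
  obtain w' where w': "w' \<in> F" "w' \<in> orb v y" using F[OF yD yP] by blast
  have w'D: "w' \<in> olim v e" using w'(2) olim_inv[OF e yD] by (auto simp: orb_def)
  obtain q' where q': "q' \<in> P" "w' \<in> wst K v q'" using D[OF w'D] by blast
  have w'r: "w' \<in> wst K (rv v) q" using r.wst_orb[OF y(1)] w'(2) by auto
  note fb' = boxes[OF w'(1)]
  have AB: "A w' \<le> 0" "0 < B w'" using fb' by (auto simp: fbox_def)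
  obtain i where i: "i > 0" "\<forall>s\<in>{a..b}. s \<noteq> 0 & \<bar>s\<bar> < i --> j s \<notin> orb v w'"
    using section_avoids_orbit[OF fb nf q'(2) w'r] by blast
  obtain n0 l f where n0: "n0 \<le> d" and tm: "transit_map (%s. j (c * s)) (J w') {A w'..B w'} w w' n0 l f"
    using tr[rule_format, OF w'(2) fb'] by (elim exE conjE)
  have t: "n0 > 0" "continuous_on {0<..<n0} f"
    "\<And>s. 0 < s ==> s < n0 ==> l s \<ge> 1 & f s \<in> {A w'..B w'} & v (l s) (j (c * s)) = J w' (f s)"
    "\<And>k. k > 0 ==> \<exists>e>0. \<forall>s. 0 < s & s < e --> \<bar>f s\<bar> < k"
    "\<And>V. open V ==> closure (orb v w) \<subseteq> V ==> closure (orb v w') \<subseteq> V ==>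
        \<exists>e>0. \<forall>s r. 0 < s & s < e & 0 \<le> r & r \<le> l s --> v r (j (c * s)) \<in> V"
    using tm unfolding transit_map_def by simp_all
  define n where "n = min n0 i"
  have n: "n > 0" "n \<le> n0" "n \<le> i" using t(1) i(1) by (auto simp: n_def)
  have cK: "j (c * s) \<in> K" if "0 < s" "s < n" for s
    by (rule half_section(2)[OF fb d(2)]) (use that n n0 in auto)
  have f0: "f s \<noteq> 0" if s: "0 < s" "s < n" for s
  proof
    assume "f s = 0"
    then have "v (l s) (j (c * s)) = w'" using t(3)[of s] s n fb' by (auto simp: fbox_def)
    then have "j (c * s) = v (- l s) w'" using v_neg(1)[OF cK[OF s]] by metis
    then have "j (c * s) \<in> orb v w'" by simp
    moreover have "c * s \<in> {a..b}" using d(2)[of s] s n n0 by simp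
    ultimately show False using i(2)[rule_format, of "c * s"] c s n by auto
  qed
  have contf: "continuous_on {0<..<n} f" by (rule continuous_on_subset[OF t(2)]) (use n in auto)
  have sgn: "(\<forall>s. 0 < s & s < n --> f s > 0) \<or> (\<forall>s. 0 < s & s < n --> f s < 0)"
  proof -
    have "connected (f ` {0<..<n})" by (intro connected_continuous_image contf) simp
    then have iv: "\<And>a b x. a \<in> f ` {0<..<n} ==> b \<in> f ` {0<..<n} ==> a \<le> x ==> x \<le> b ==> x \<in> f ` {0<..<n}"
      unfolding is_interval_connected_1[symmetric] is_interval_1 by blast
    have no: False if s: "0 < s1" "s1 < n" "f s1 \<le> 0" "0 < s2" "s2 < n" "0 \<le> f s2" for s1 s2
    proof -
      have "0 \<in> f ` {0<..<n}" by (rule iv[of "f s1" "f s2"]) (use s in auto)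
      then show False using f0 by force
    qed
    show ?thesis using no by (meson less_imp_le not_le)
  qed
  then obtain c' :: real where c': "c' = 1 \<or> c' = -1" "\<And>s. 0 < s ==> s < n ==> \<bar>f s\<bar> > 0 & c' * \<bar>f s\<bar> = f s"
  proof (elim disjE)
    assume "\<forall>s. 0 < s & s < n --> f s > 0"
    then show thesis by (intro that[of 1]) auto
  next
    assume "\<forall>s. 0 < s & s < n --> f s < 0"
    then show thesis by (intro that[of "-1"]) auto
  qed
  have gm: "germ_map (olim v e) (%s. j (c * s)) (%s. J w' (c' * s)) n l (%s. \<bar>f s\<bar>)"
    unfolding germ_map_def
  proof (intro conjI allI impI)
    show "continuous_on {0<..<n} (%s. \<bar>f s\<bar>)" by (intro continuous_intros contf)
    fix s assume s: "0 < s & s < n"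
    show "j (c * s) \<in> K" "1 \<le> l s" "0 < \<bar>f s\<bar>" "v (l s) (j (c * s)) = J w' (c' * \<bar>f s\<bar>)"
      using cK[of s] t(3)[of s] c'(2)[of s] s n by auto
  next
    fix V assume V: "open V & olim v e \<subseteq> V"
    have "closure (orb v w) \<subseteq> V" "closure (orb v w') \<subseteq> V"
      using olim_orb[OF e w(1)] olim_orb[OF e w'D] V by auto
    then show "\<exists>ea>0. \<forall>s r. 0 < s & s < ea & 0 \<le> r & r \<le> l s --> v r (j (c * s)) \<in> V"
      using t(5) V by blast
  qed (use n t(4) in auto)
  have "\<exists>d>0. \<forall>s. 0 \<le> s & s \<le> d --> c' * s \<in> {A w'..B w'}"
  proof -
    define d' where "d' = \<bar>f (n/2)\<bar>"
    have "d' > 0" "c' * d' = f (n/2)" using c'(2)[of "n/2"] n by (auto simp: d'_def)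
    moreover have "f (n/2) \<in> {A w'..B w'}" using t(3)[of "n/2"] n by auto
    ultimately show ?thesis using c'(1) AB by (intro exI[of _ d']) auto
  qed
  then show ?thesis using w'(1) c'(1) gm by blast
qed

end

context gflow
begin

interpretation r: cflow K "rv v" by (rule cflow_rv)

lemma eorb_nongen: assumes w: "w \<in> K" "\<not> gen w" and z: "z \<in> eorb K v P w" shows "z \<in> K" "\<not> gen z"
proof -
  obtain p where p: "p \<in> P" "w \<in> wst K v p \<or> w \<in> wst K (rv v) p" using w unfolding gen_def by blast
  have o: "orb v w \<subseteq> wst K v p \<or> orb v w \<subseteq> wst K (rv v) p"
    using p(2) wst_orb[of w p] r.wst_orb[of w p] by auto
  interpret rp: pflow K "rv v" P by (rule pflow_rv)
  have "z \<in> orb v w \<or> (\<exists>p\<in>P. z \<in> wst K (rv v) p) \<or> (\<exists>p\<in>P. z \<in> wst K v p)"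
    using z gplus_sub[of w] rp.gplus_sub[of w] unfolding eorb_def by (auto dest!: subsetD)
  then show "\<not> gen z" using o p(1) unfolding gen_def by blast
  show "z \<in> K" using eorb_subset[OF w(1)] z by blast
qed

text \<open>By symmetry \<open>z\<close> lies in the class of \<open>w\<close>, which is contained
  in the closures of finitely many separatrices, so \<open>z\<close> is in the closure of some orbit
  of \<open>x\<close>. This orbit crosses the half section near \<open>z\<close>, hence its forward
  limit set lies in \<open>D\<close>, and its backward limit is a saddle. As \<open>z\<close> is
  neither in \<open>D\<close> nor fixed, it lies on the orbit itself.\<close>

lemma section_in_orbit:
  assumes fb: "fbox w a b h j" and c: "c = 1 \<or> c = -1"
    and e: "\<And>s. 0 \<le> s ==> s \<le> n ==> c * s \<in> {a..b}"
    and w: "w \<in> K" "w \<notin> P" "\<not> gen w"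
    and D: "\<And>y. y \<in> D ==> \<exists>q\<in>P. y \<in> wst K v q"
    and ol: "\<And>s. 0 < s ==> s < n ==> w \<in> olim v (j (c * s)) & olim v (j (c * s)) \<subseteq> D"
    and F: "finite F" "F \<subseteq> K" "\<And>x. x \<in> F ==> \<exists>p\<in>P. x \<in> wst K v p \<or> x \<in> wst K (rv v) p"
    "\<And>z. z \<in> K ==> \<not> gen z ==> \<exists>x\<in>F. z \<in> orb v x"
    and s: "0 < s" "s < n"
  shows "\<exists>x\<in>F. j (c * s) \<in> orb v x"
proof -
  define z where "z = j (c * s)"
  have cs: "c * s \<in> {a..b}" using e[of s] s by simp
  have zK: "z \<in> K" unfolding z_def by (rule fbox_K[OF fb cs])
  have wz: "w \<in> olim v z" "olim v z \<subseteq> D" using ol[OF s] by (auto simp: z_def)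
  have zD: "z \<notin> D"
  proof
    assume "z \<in> D"
    then obtain q where "q \<in> P" "z \<in> wst K v q" using D by blast
    then show False using wz(1) w(2) by (auto simp: wst_olim)
  qed
  have "z \<in> ecl K v P w" by (rule ecl_sym[OF zK]) (use olim_ecl wz(1) in blast)
  moreover have "ecl K v P w \<subseteq> closure (\<Union>x\<in>F. orb v x)"
    unfolding ecl_def by (intro closure_mono subsetI) (use eorb_nongen[OF w(1,3)] F(4) in blast)
  moreover have "closure (\<Union>x\<in>F. orb v x) = (\<Union>x\<in>F. closure (orb v x))"
    using F(1) by induction auto
  ultimately obtain x where x: "x \<in> F" "z \<in> closure (orb v x)" by blast
  have xK: "x \<in> K" using x F(2) by blast
  have ab: "a \<le> 0" "0 < b" "h > 0" using fb by (auto simp: fbox_def)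
  define S where "S = {min 0 (c * n)<..<max 0 (c * n)}"
  have SS: "0 < c * u & c * u < n" if "u \<in> S" for u using c that s by (auto simp: S_def)
  have I: "c * s \<in> {a<..<b} \<union> {0}" and mS: "c * s \<in> S" using c s e[of n] ab by (auto simp: S_def)
  have oS: "open S" by (simp add: S_def)
  obtain d where d: "d > 0" "\<And>z. z \<in> K ==> dist z (j (c * s)) < d ==>
      \<exists>u t. u \<in> ({a<..<b} \<union> {0}) \<inter> S & \<bar>t\<bar> < h & z = v t (j u)"
    by (rule fbox_near[OF fb I oS mS ab(3) order_refl]) blast
  obtain x' where x': "x' \<in> orb v x" "dist x' z < d" using x(2) d(1) unfolding closure_approachable by blast
  obtain u t where u: "u \<in> S" "x' = v t (j u)"
    using d(2)[of x'] x' orb_subset[OF xK] unfolding z_def by blast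
  have eq: "c * (c * u) = u" using c by auto
  have uK: "j u \<in> K" using fbox_K[OF fb e[of "c * u"]] SS[OF u(1)] unfolding eq by simp
  have "olim v x = olim v x'" using olim_orb_eq[OF xK x'(1)] by simp
  also have "\<dots> = olim v (j u)" using olim_v[OF uK] u(2) by simp
  finally have ox: "w \<in> olim v x" "olim v x \<subseteq> D" using ol[of "c * u"] SS[OF u(1)] unfolding eq by auto
  obtain p where p: "p \<in> P" "x \<in> wst K v p \<or> x \<in> wst K (rv v) p" using F(3)[OF x(1)] by blast
  have "x \<notin> wst K v p" using ox(1) w(2) p(1) by (auto simp: wst_olim)
  then have xp: "olim (rv v) x = {p}" using p(2) by (simp add: r.wst_olim)
  have "z \<noteq> p" using fbox_not_fixed[OF fb cs] Pfix[OF p(1)] unfolding z_def by metis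
  then show ?thesis using x closure_orb[OF xK] xp ox(2) zD unfolding z_def by blast
qed

text \<open>A flow box separates the crossings of one orbit: each time cell of width
  \<open>h\<close> contains at most one. So an orbit meets the section in countably many
  points.\<close>

lemma section_uncountable_orbits:
  assumes fb: "fbox w a b h j" and q: "q = 1 \<or> q = -1" and n: "n > 0"
    and r: "\<And>s. 0 \<le> s ==> s \<le> n ==> q * s \<in> {a..b}"
    and F: "finite F" "F \<subseteq> K" "\<And>s. 0 < s ==> s < n ==> \<exists>x\<in>F. j (q * s) \<in> orb v x"
  shows False
proof -
  have h: "h > 0" using fb by (simp add: fbox_def)
  define S where "S x = {s. 0 < s & s < n & j (q * s) \<in> orb v x}" for x
  have "countable (S x)" if x: "x \<in> F" for x
  proof -
    have xK: "x \<in> K" using x F(2) by blast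
    define T where "T s = (SOME t. j (q * s) = v t x)" for s
    have T: "j (q * s) = v (T s) x" if s: "s \<in> S x" for s
    proof -
      have "\<exists>t. j (q * s) = v t x" using s by (auto simp: S_def orb_def)
      then show ?thesis unfolding T_def by (rule someI_ex)
    qed
    have "inj_on (%s. \<lfloor>T s / h\<rfloor>) (S x)"
    proof (rule inj_onI)
      fix s u assume su: "s \<in> S x" "u \<in> S x" "\<lfloor>T s / h\<rfloor> = \<lfloor>T u / h\<rfloor>"
      have "\<bar>T s / h - T u / h\<bar> < 1" using su(3) by linarith
      then have "\<bar>T s - T u\<bar> / h < 1" using h by (simp add: diff_divide_distrib[symmetric])
      then have lt: "\<bar>- T s - - T u\<bar> \<le> h" using h by simp
      have I: "q * s \<in> {a..b}" "q * u \<in> {a..b}" using r su by (auto simp: S_def)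
      have "v (- T s) (j (q * s)) = v (- T u) (j (q * u))"
        using T[OF su(1)] T[OF su(2)] xK by simp
      then have "q * s = q * u" using fbox_uniq[OF fb I lt] by simp
      then show "s = u" using q by auto
    qed
    then show ?thesis by (rule countableI')
  qed
  then have "countable (\<Union>x\<in>F. S x)" using F(1) by (simp add: countable_finite)
  moreover have "{0<..<n} \<subseteq> (\<Union>x\<in>F. S x)" using F(3) by (auto simp: S_def)
  ultimately have "countable {0<..<n}" using countable_subset by blast
  then show False using uncountable_open_interval[of 0 n] n by simp
qed

text \<open>Half sections at representatives of the limit orbits are the vertices of a finite graph
  whose edges are transit maps. A half section on which \<open>e\<close> accumulates has a successor
  of the same kind, so the graph has a loop, and composing along it gives a return map to one half
  section.\<close>

lemma limit_not_all_stable: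
  assumes p0: "p0 \<in> P" and e: "e \<in> wst K (rv v) p0" "\<And>q. q \<in> P ==> e \<notin> wst K v q"
    and D: "\<And>w. w \<in> olim v e ==> \<exists>q\<in>P. w \<in> wst K v q"
  shows False
proof -
  have eK: "e \<in> K" using e by (simp add: wst_def)
  have DK: "olim v e \<subseteq> K" by (rule olim_subset[OF eK])
  have eD: "v t e \<notin> olim v e" for t
  proof
    assume "v t e \<in> olim v e"
    then have "e \<in> olim v e" using olim_inv[OF eK, of "v t e" "-t"] eK by simp
    then show False using D e(2) by blast
  qed
  obtain F where F: "finite F" "F \<subseteq> K" "\<And>x. x \<in> F ==> \<exists>p\<in>P. x \<in> wst K v p \<or> x \<in> wst K (rv v) p"
    "\<And>z. z \<in> K ==> \<not> gen z ==> \<exists>x\<in>F. z \<in> orb v x" using nongen_orbits by metis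
  have ng: "\<not> gen w" if "w \<in> olim v e" for w using D[OF that] by (auto simp: gen_def)
  have "orb v ` (olim v e - P) \<subseteq> orb v ` F"
  proof
    fix Q assume "Q \<in> orb v ` (olim v e - P)"
    then obtain y where y: "y \<in> olim v e" "Q = orb v y" by blast
    then obtain x where "x \<in> F" "y \<in> orb v x" using F(4)[OF _ ng[OF y(1)]] DK by blast
    then show "Q \<in> orb v ` F" using orb_eq[of x y] F(2) y(2) by blast
  qed
  then have "finite (orb v ` (olim v e - P))" using F(1) finite_surj by blast
  then obtain F0 where F0: "F0 \<subseteq> olim v e - P" "finite F0" "orb v ` (olim v e - P) = orb v ` F0"
    using finite_subset_image[OF _ order_refl] by metis
  have rep: "\<exists>w'\<in>F0. w' \<in> orb v y" if y: "y \<in> olim v e" "y \<notin> P" for y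
  proof -
    have "orb v y \<in> orb v ` F0" using F0(3) y by blast
    then obtain w' where w': "w' \<in> F0" "orb v y = orb v w'" by blast
    then have "w' \<in> orb v y" using orb_self[of w'] F0(1) DK by blast
    then show ?thesis using w'(1) by blast
  qed
  have nf: "v 1 w \<noteq> w" if w: "w \<in> F0" for w
  proof -
    obtain q where q: "q \<in> P" "w \<in> wst K v q" using D w F0(1) by blast
    have "w \<noteq> q" "w \<in> K" using q w F0(1) DK by auto
    then show ?thesis using wst_nonper[OF q(2), of 1 0] v0 by auto
  qed
  have "\<forall>w. \<exists>a b h j. w \<in> F0 --> fbox w a b h j"
    using flow_box[OF _ nf] F0(1) DK by blast
  then obtain A B H J where boxes: "\<And>w. w \<in> F0 ==> fbox w (A w) (B w) (H w) (J w)" by metis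
  define c where "c x = (%s. J (fst x) (snd x * s))" for x :: "'a \<times> real"
  define X where "X = {x. fst x \<in> F0 & (snd x = 1 \<or> snd x = -1) &
     (\<exists>i>0. \<forall>s. 0 \<le> s & s \<le> i --> snd x * s \<in> {A (fst x)..B (fst x)}) & acc e (c x)}"
  have "X \<subseteq> F0 \<times> {1, -1}" unfolding X_def by auto
  then have finX: "finite X" using F0(2) finite_subset by blast
  have neX: "X \<noteq> {}"
  proof -
    obtain q where q: "q \<in> olim v e" using olim_nonempty[OF eK] by blast
    obtain w0 where "w0 \<in> olim v e" "w0 \<notin> P"
    proof (cases "q \<in> P")
      case True
      obtain y where y: "y \<in> olim v e" "y \<in> wst K (rv v) q" "y \<noteq> q"
        using limit_leaves_saddle[OF sec[OF True] eK q e(2)[OF True]] by blast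
      have "y \<notin> P"
      proof
        assume yP: "y \<in> P"
        have "olim (rv v) y = {y}" by (rule r.olim_fixed) (use yP PK Pfix in \<open>auto simp: rv_def\<close>)
        then show False using y by (simp add: r.wst_olim)
      qed
      then show thesis using that y by blast
    qed (use that q in blast)
    then obtain w where w: "w \<in> F0" using rep by blast
    note fb = boxes[OF w]
    have wD: "w \<in> olim v e" using w F0(1) by blast
    have ab: "A w \<le> 0" "0 < B w" "H w > 0" "J w 0 = w" using fb by (auto simp: fbox_def)
    \<comment> \<open>The section at \<open>w\<close> is hit at arbitrarily late times and
      arbitrarily close to \<open>w\<close>, yet never in \<open>w\<close>, because the orbit of
      \<open>e\<close> is disjoint from its own limit set. Hence at least one of the two sides is
      hit again and again.\<close>
    have both: "\<exists>t\<ge>T. \<exists>s. s \<noteq> 0 & \<bar>s\<bar> < l & s \<in> {A w..B w} & v t e = J w s" if l: "l > 0" for T l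
    proof -
      obtain d where d: "d > 0" "\<And>z. z \<in> K ==> dist z (J w 0) < d ==>
          \<exists>s t. s \<in> ({A w<..<B w} \<union> {0}) \<inter> {-l<..<l} & \<bar>t\<bar> < H w & z = v t (J w s)"
        by (rule fbox_near[OF fb, of 0 "{-l<..<l}" "H w"]) (use ab l in auto)
      obtain t where t: "t \<ge> T + H w" "dist (v t e) w < d" using olimD[OF wD d(1)] by blast
      then obtain s t' where st: "s \<in> ({A w<..<B w} \<union> {0}) \<inter> {-l<..<l}" "\<bar>t'\<bar> < H w" "v t e = v t' (J w s)"
        using d(2)[of "v t e"] inK[OF eK] ab(4) by auto
      have sab: "s \<in> {A w..B w}" using st(1) ab by auto
      have "v (t - t') e = J w s" using v_eq_iff[OF eK fbox_K[OF fb sab]] st(3) by simp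
      moreover have "s \<noteq> 0" using eD[of "t - t'"] calculation ab(4) wD by auto
      ultimately show ?thesis using st t sab by (intro exI[of _ "t - t'"] conjI exI[of _ s]) auto
    qed
    have "\<exists>f. (f = 1 \<or> f = -1) & (\<forall>T l. l > 0 -->
        (\<exists>t\<ge>T. \<exists>s. 0 < s & s < l & f * s \<in> {A w..B w} & v t e = J w (f * s)))"
    proof (rule ccontr)
      assume N: "\<not> ?thesis"
      obtain T1 l1 where 1: "l1 > 0" "\<And>t s. t \<ge> T1 ==> 0 < s ==> s < l1 ==> s \<in> {A w..B w} ==> v t e \<noteq> J w s"
        using N[simplified, rule_format, of 1] by auto
      obtain T2 l2 where 2: "l2 > 0" "\<And>t s. t \<ge> T2 ==> 0 < s ==> s < l2 ==> - s \<in> {A w..B w} ==> v t e \<noteq> J w (- s)"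
        using N[simplified, rule_format, of "-1"] by auto
      obtain t s where ts: "t \<ge> max T1 T2" "s \<noteq> 0" "\<bar>s\<bar> < min l1 l2" "s \<in> {A w..B w}" "v t e = J w s"
        using both[of "min l1 l2" "max T1 T2"] 1(1) 2(1) by auto
      show False using 1(2)[of t s] 2(2)[of t "-s"] ts by (cases "s > 0") auto
    qed
    then obtain f where f: "f = 1 \<or> f = -1" and hit: "\<And>T l. l > 0 ==>
        \<exists>t\<ge>T. \<exists>s. 0 < s & s < l & f * s \<in> {A w..B w} & v t e = J w (f * s)" by metis
    obtain s where "0 < s" "f * s \<in> {A w..B w}" using hit[OF zero_less_one] by blast
    then have "\<exists>i>0. \<forall>s. 0 \<le> s & s \<le> i --> f * s \<in> {A w..B w}"
      using f ab by (intro exI[of _ s]) auto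
    moreover have "acc e (%s. J w (f * s))" unfolding acc_def using hit by metis
    ultimately have "(w, f) \<in> X" using w f by (simp add: X_def c_def)
    then show ?thesis by blast
  qed
  define R where "R x y \<longleftrightarrow> (\<exists>n u g. germ_map (olim v e) (c x) (c y) n u g)" for x y
  have Rt: "R x z" if "R x y" "R y z" for x y z
    using that germ_map_trans unfolding R_def by (elim exE) (rule germ_map_trans)
  have succ: "\<exists>y\<in>X. R x y" if x: "x \<in> X" for x
  proof -
    have xF: "fst x \<in> F0" and xf: "snd x = 1 \<or> snd x = -1" and ax: "acc e (c x)" using x by (auto simp: X_def)
    obtain i where i: "i > 0" "\<And>s. 0 \<le> s ==> s \<le> i ==> snd x * s \<in> {A (fst x)..B (fst x)}"
      using x unfolding X_def by blast
    have wD: "fst x \<in> olim v e" "fst x \<notin> P" using xF F0(1) by auto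
    obtain w' f' where w': "w' \<in> F0" "f' = 1 \<or> f' = -1"
      "\<exists>i>0. \<forall>s. 0 \<le> s & s \<le> i --> f' * s \<in> {A w'..B w'}"
      "\<exists>n u g. germ_map (olim v e) (c x) (c (w', f')) n u g"
      using transit_germ[OF boxes[OF xF] xf i(1) _ eK ax[unfolded c_def] wD D rep boxes] i(2)
      unfolding c_def fst_conv snd_conv by (metis (no_types, lifting))
    have "acc e (c (w', f'))" using w'(4) acc_germ_map[OF _ ax eK] by blast
    then have "(w', f') \<in> X" using w' by (simp add: X_def)
    moreover have "R x (w', f')" using w'(4) by (simp add: R_def)
    ultimately show ?thesis by blast
  qed
  have "\<exists>x\<in>X. R x x" by (rule finite_transitive_loop[OF finX neX]) (erule succ, erule Rt, assumption)
  then obtain x where x: "x \<in> X" "R x x" by blast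
  define w where "w = fst x"
  define f where "f = snd x"
  have w: "w \<in> F0" and f: "f = 1 \<or> f = -1" and ax: "acc e (%s. J w (f * s))"
    using x by (auto simp: X_def w_def f_def c_def)
  have wD: "w \<in> olim v e" "w \<notin> P" using w F0(1) by auto
  have wK: "w \<in> K" using wD DK by blast
  obtain i where i: "i > 0" "\<And>s. 0 \<le> s ==> s \<le> i ==> f * s \<in> {A w..B w}"
    using x unfolding X_def w_def f_def by blast
  obtain n0 u g where gm0: "germ_map (olim v e) (%s. J w (f * s)) (%s. J w (f * s)) n0 u g"
    using x(2) unfolding R_def c_def w_def f_def by blast
  define n where "n = min n0 i"
  have n: "0 < n" "n \<le> n0" "n \<le> i" using germ_mapD(1)[OF gm0] i(1) by (auto simp: n_def)
  note gm = germ_map_shrink[OF gm0 n(1,2)] and fb = boxes[OF w]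
  note hs = half_section[OF fb, of i f, OF i(2)]
  have "J w 0 = w" using fb by (simp add: fbox_def)
  then have near: "\<exists>k>0. \<forall>s. 0 < s & s < k --> dist (J w (f * s)) w < m" if m: "m > 0" for m
  proof -
    obtain k where "k > 0" "\<forall>s\<in>{0..i}. dist s 0 < k --> dist (J w (f * s)) (J w (f * 0)) < m"
      using hs(1) m i(1) unfolding continuous_on_iff by (metis atLeastAtMost_iff less_imp_le order_refl)
    then show ?thesis using \<open>J w 0 = w\<close> i(1) by (intro exI[of _ "min k i"]) (auto simp: dist_real_def)
  qed
  have less: "g s < s" if "0 < s" "s < n" for s
    by (rule return_contracting[OF fb n(3) _ gm ax e(1) that]) (rule i(2))
  have ol: "w \<in> olim v (J w (f * s)) & olim v (J w (f * s)) \<subseteq> olim v e" if s: "0 < s" "s < n" for s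
  proof
    show "w \<in> olim v (J w (f * s))"
      by (rule contracting_germ_map(1)[OF gm _ _ closed_olim s]) (simp_all add: less near)
    show "olim v (J w (f * s)) \<subseteq> olim v e"
      by (rule contracting_germ_map(2)[OF gm _ _ closed_olim s, of w]) (simp_all add: less near)
  qed
  have i': "f * s \<in> {A w..B w}" if "0 \<le> s" "s \<le> n" for s using i(2) that n(3) by auto
  show False
  proof (rule section_uncountable_orbits[OF fb f n(1) _ F(1,2)])
    show "\<exists>x\<in>F. J w (f * s) \<in> orb v x" if "0 < s" "s < n" for s
      by (rule section_in_orbit[where D = "olim v e", OF fb f _ wK wD(2) ng[OF wD(1)] _ _ F(1,2) _ _ that])
        (rule i' D ol F(3,4), assumption+)+
  qed (rule i')
qed

theorem separatrix_limit_generic: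
  assumes "p0 \<in> P" "e0 \<in> wst K (rv v) p0" "\<And>q. q \<in> P ==> e0 \<notin> wst K v q"
  shows "\<exists>k\<in>olim v e0. gen k"
proof (rule ccontr)
  define bad where "bad e \<longleftrightarrow> (\<exists>p\<in>P. e \<in> wst K (rv v) p) & (\<forall>q\<in>P. e \<notin> wst K v q) & (\<forall>k\<in>olim v e. \<not> gen k)" for e
  assume "\<not> ?thesis"
  then have "bad e0" using assms by (auto simp: bad_def)
  then obtain e where e: "bad e" "\<And>e'. bad e' ==> card (orb v ` olim v e) \<le> card (orb v ` olim v e')"
    using ex_has_least_nat[of bad e0 "%e. card (orb v ` olim v e)"] by blast
  obtain p where p: "p \<in> P" "e \<in> wst K (rv v) p" using e(1) bad_def by blast
  have eK: "e \<in> K" using p by (simp add: wst_def)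
  obtain F where F: "finite F" "F \<subseteq> K" "\<And>x. x \<in> F ==> \<exists>p\<in>P. x \<in> wst K v p \<or> x \<in> wst K (rv v) p"
    "\<And>z. z \<in> K ==> \<not> gen z ==> \<exists>x\<in>F. z \<in> orb v x" using nongen_orbits by metis
  have cover: "olim v e \<subseteq> (\<Union>x\<in>F. orb v x)"
    using F(4) e(1) olim_subset[OF eK] unfolding bad_def by blast
  have "orb v ` olim v e \<subseteq> orb v ` F"
  proof
    fix Q assume "Q \<in> orb v ` olim v e"
    then obtain y where y: "y \<in> olim v e" "Q = orb v y" by blast
    then obtain x where "x \<in> F" "y \<in> orb v x" using cover by blast
    then show "Q \<in> orb v ` F" using orb_eq[of x y] F(2) y(2) by blast
  qed
  then have fin: "finite (orb v ` olim v e)" using F(1) finite_surj by blast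
  have "\<exists>q\<in>P. w \<in> wst K v q" if w: "w \<in> olim v e" for w
  proof (rule ccontr)
    assume N: "\<not> ?thesis"
    have wK: "w \<in> K" using w olim_subset[OF eK] by blast
    have sub: "olim v w \<subseteq> olim v e" using olim_orb[OF eK w] olim_subset_closure[of w] by blast
    have "\<not> gen w" using e(1) w by (auto simp: bad_def)
    then obtain p' where p': "p' \<in> P" "w \<in> wst K (rv v) p'" using N wK by (auto simp: gen_def)
    then have "bad w" using N sub e(1) unfolding bad_def by blast
    \<comment> \<open>The point \<open>w\<close> is a counterexample too, with its limit set inside
      that of \<open>e\<close>. By minimality the two contain the same orbits, so \<open>w\<close>
      is recurrent.\<close>
    then have "orb v ` olim v w = orb v ` olim v e"
      using e(2) sub fin by (intro card_seteq image_mono) auto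
    then obtain w1 where w1: "w1 \<in> olim v w" "orb v w = orb v w1" using w by blast
    then have "w \<in> orb v w1" using orb_self[OF wK] by simp
    then have "w \<in> olim v w" using olim_inv[OF wK w1(1)] by (auto simp: orb_def)
    moreover have "t = s" if ts: "v t w = v s w" for t s
    proof -
      have "w \<noteq> p'" using N P_wst[OF p'(1)] p'(1) by blast
      moreover have "rv v (-t) w = rv v (-s) w" using ts by (simp add: rv_def)
      ultimately show "t = s" using r.wst_nonper[OF p'(2)] by fastforce
    qed
    moreover have "olim v w \<subseteq> (\<Union>x\<in>F. orb v x)" using sub cover by blast
    ultimately show False using recurrent_orbits_infinite[OF wK _ _ F(1,2)] by blast
  qed
  then show False using limit_not_all_stable[OF p(1,2)] e(1) unfolding bad_def by blast
qed

end

theorem ecl_class_sectors: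
  assumes "rflow K v P" "sfc K v" and sec: "\<And>p. p \<in> P ==> sectors K v p" "\<And>p. p \<in> P ==> sectors K (rv v) p"
  shows "rgflow K v P"
proof -
  interpret rflow K v P by fact
  interpret sfc K v by fact
  interpret g: gflow K v P by unfold_locales (rule sec)
  interpret r: rflow K "rv v" P by (rule rflow_rv)
  interpret rs: sfc K "rv v" by (rule sfc_rv)
  interpret rg: gflow K "rv v" P by unfold_locales (rule sec)
  show ?thesis
  proof unfold_locales
    show "\<exists>k\<in>olim v y. gen k" if "p \<in> P" "y \<in> wst K (rv v) p" "\<And>q. q \<in> P ==> y \<notin> wst K v q" for p y
      by (rule g.separatrix_limit_generic[OF that])
    show "\<exists>k\<in>olim (rv v) y. gen k" if "p \<in> P" "y \<in> wst K v p" "\<And>q. q \<in> P ==> y \<notin> wst K (rv v) q" for p y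
      using rg.separatrix_limit_generic[of p y] that gen_rv by simp
  qed
qed

section \<open>Hyperbolic charts\<close>

definition bx :: "real => (real \<times> real) set" where
  "bx r = {-r..r} \<times> {-r..r}"

definition ibx :: "real => (real \<times> real) set" where
  "ibx r = {-r<..<r} \<times> {-r<..<r}"

lemma mem_bx: "z \<in> bx r \<longleftrightarrow> \<bar>fst z\<bar> \<le> r & \<bar>snd z\<bar> \<le> r"
  by (cases z) (auto simp: bx_def abs_le_iff)

lemma mem_ibx: "z \<in> ibx r \<longleftrightarrow> \<bar>fst z\<bar> < r & \<bar>snd z\<bar> < r"
  by (cases z) (auto simp: ibx_def abs_less_iff)

lemma open_ibx: "open (ibx r)" and closed_bx: "closed (bx r)" and compact_bx: "compact (bx r)"
  and ibx_bx: "r \<le> s ==> ibx r \<subseteq> bx s" and bx_mono: "r \<le> s ==> bx r \<subseteq> bx s"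
  and ibx_mono: "r \<le> s ==> ibx r \<subseteq> ibx s" and bx_ibx: "r < s ==> bx r \<subseteq> ibx s"
  unfolding bx_def ibx_def by (auto intro!: open_Times closed_Times compact_Times)

lemma ibx_ball: assumes "open T" "(0, 0) \<in> T" obtains r where "r > 0" "bx r \<subseteq> T"
proof -
  obtain e where e: "e > 0" "ball (0, 0) e \<subseteq> T" using assms open_contains_ball by blast
  have "bx (e/3) \<subseteq> ball (0, 0) e"
  proof
    fix z assume z: "z \<in> bx (e/3)"
    have "dist (0, 0) z \<le> \<bar>fst z\<bar> + \<bar>snd z\<bar>"
      using norm_Pair_le[of "fst z" "snd z"] by (simp add: dist_norm norm_minus_commute zero_prod_def[symmetric])
    also have "\<dots> < e" using z e(1) by (auto simp: mem_bx)
    finally show "z \<in> ball (0, 0) e" by simp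
  qed
  then show thesis using e by (intro that[of "e/3"]) auto
qed

text \<open>Vertical differences grow by \<kappa> and remain vertical, horizontal ones shrink by
  \<nu> in the first coordinate. The conditions concern differences so that two orbits can be
  compared, as in \<open>St_lip\<close>. Being about absolute values, they do not tell up from down,
  hence the last clause.\<close>

definition cones :: "real => real => real => (real \<times> real => real \<times> real) => bool" where
  "cones R \<kappa> \<nu> G \<longleftrightarrow>
    (\<forall>z\<in>bx R. \<forall>z'\<in>bx R.
      (\<bar>fst z - fst z'\<bar> \<le> \<bar>snd z - snd z'\<bar> -->
        \<kappa> * \<bar>snd z - snd z'\<bar> \<le> \<bar>snd (G z) - snd (G z')\<bar> &
        \<bar>fst (G z) - fst (G z')\<bar> \<le> \<nu> * \<bar>snd z - snd z'\<bar>) &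
      (\<bar>snd z - snd z'\<bar> \<le> \<bar>fst z - fst z'\<bar> -->
        \<bar>fst (G z) - fst (G z')\<bar> \<le> \<nu> * \<bar>fst z - fst z'\<bar>)) &
    (\<forall>z\<in>bx R. \<bar>fst z\<bar> \<le> \<bar>snd z\<bar> & snd z \<noteq> 0 --> snd z * snd (G z) > 0)"

text \<open>In the chart \<open>k\<close> the first coordinate is contracted and the second one expanded by \<open>G\<close>, which
  moves points forward along the flow.\<close>

locale hyp = cflow +
  fixes p :: 'a and k :: "real \<times> real => 'a" and B :: "(real \<times> real) set" and R \<kappa> \<nu> :: real
    and G :: "real \<times> real => real \<times> real"
  assumes pK: "p \<in> K" and pfix: "v t p = p"
    and Rpos: "R > 0" and \<kappa>: "\<kappa> > 1" and \<nu>: "0 < \<nu>" "\<nu> < 1"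
    and B: "open B" "bx R \<subseteq> B"
    and k: "inj_on k B" "continuous_on B k" "k ` B \<subseteq> K" "k (0, 0) = p"
    and kopen: "\<And>T. open T ==> T \<subseteq> B ==> openin (top_of_set K) (k ` T)"
    and G: "continuous_on (bx R) G" "G ` bx R \<subseteq> B" "G (0, 0) = (0, 0)"
    and cone: "cones R \<kappa> \<nu> G"
    and time: "z \<in> bx R ==> \<exists>\<theta>>0. v \<theta> (k z) = k (G z)"
    and seg: "open V ==> p \<in> V ==> \<exists>r>0. r \<le> R &
      (\<forall>z\<in>bx r. \<exists>\<theta>>0. v \<theta> (k z) = k (G z) & (\<forall>t. 0 \<le> t & t \<le> \<theta> --> v t (k z) \<in> V))"
begin

section \<open>Exit sets and the local stable set\<close>

definition Wc :: "real => (real \<times> real) set" where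
  "Wc s = {z. \<bar>fst z\<bar> < s * snd z}"

text \<open>Points driven out upwards for \<open>s = 1\<close> and downwards for
  \<open>s = -1\<close>: some iterate enters the cone \<open>Wc s\<close>, and all earlier ones lie
  in the box. The inductive form turns openness and disjointness into inductions over the exit time.
  What remains of the box is the local stable set \<open>St\<close>.\<close>

inductive_set E :: "real => (real \<times> real) set" for s where
  base: "z \<in> ibx R ==> G z \<in> Wc s ==> z \<in> E s"
| step: "z \<in> ibx R ==> G z \<in> E s ==> z \<in> E s"

definition St :: "(real \<times> real) set" where
  "St = ibx R - E 1 - E (-1)"

lemma cone1:
  assumes "z \<in> bx R" "z' \<in> bx R" "\<bar>fst z - fst z'\<bar> \<le> \<bar>snd z - snd z'\<bar>"
  shows "\<kappa> * \<bar>snd z - snd z'\<bar> \<le> \<bar>snd (G z) - snd (G z')\<bar>"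
    "\<bar>fst (G z) - fst (G z')\<bar> \<le> \<nu> * \<bar>snd z - snd z'\<bar>"
  using cone assms unfolding cones_def by blast+

lemma cone2:
  assumes "z \<in> bx R" "z' \<in> bx R" "\<bar>snd z - snd z'\<bar> \<le> \<bar>fst z - fst z'\<bar>"
  shows "\<bar>fst (G z) - fst (G z')\<bar> \<le> \<nu> * \<bar>fst z - fst z'\<bar>"
  using cone assms unfolding cones_def by blast

lemma cone_sgn: "z \<in> bx R ==> \<bar>fst z\<bar> \<le> \<bar>snd z\<bar> ==> snd z \<noteq> 0 ==> snd z * snd (G z) > 0"
  using cone unfolding cones_def by blast

lemma zero_bx: "(0, 0) \<in> bx R" and ibxR: "ibx R \<subseteq> bx R"
  using Rpos by (auto simp: mem_bx mem_ibx)

lemma kK: "z \<in> B ==> k z \<in> K" using k by blast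

lemma cone0:
  assumes "z \<in> bx R" "\<bar>fst z\<bar> \<le> \<bar>snd z\<bar>" "snd z \<noteq> 0"
  shows "\<kappa> * \<bar>snd z\<bar> \<le> \<bar>snd (G z)\<bar>" "\<bar>fst (G z)\<bar> < \<bar>snd (G z)\<bar>"
proof -
  have *: "\<kappa> * \<bar>snd z\<bar> \<le> \<bar>snd (G z)\<bar>" "\<bar>fst (G z)\<bar> \<le> \<nu> * \<bar>snd z\<bar>"
    using cone1[OF assms(1) zero_bx] assms(2) G(3) by auto
  have "\<nu> * \<bar>snd z\<bar> < \<kappa> * \<bar>snd z\<bar>" using \<kappa> \<nu> assms(3) by (intro mult_strict_right_mono) auto
  then show "\<kappa> * \<bar>snd z\<bar> \<le> \<bar>snd (G z)\<bar>" "\<bar>fst (G z)\<bar> < \<bar>snd (G z)\<bar>" using * by auto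
qed

lemma Wc_G:
  assumes "z \<in> bx R" "\<bar>fst z\<bar> \<le> s * snd z" "snd z \<noteq> 0" "s = 1 \<or> s = -1"
  shows "G z \<in> Wc s"
proof -
  have c: "\<bar>fst z\<bar> \<le> \<bar>snd z\<bar>" using assms(2,4) by auto
  have "\<bar>fst (G z)\<bar> < \<bar>snd (G z)\<bar>" "snd z * snd (G z) > 0" using cone0[OF assms(1) c assms(3)] cone_sgn[OF assms(1) c assms(3)] by auto
  then show ?thesis using assms(2-4) by (auto simp: Wc_def zero_less_mult_iff)
qed

lemma Wc_G': assumes "z \<in> bx R" "z \<in> Wc s" "s = 1 \<or> s = -1" shows "G z \<in> Wc s"
  by (rule Wc_G) (use assms in \<open>auto simp: Wc_def\<close>)

lemma E_Wc_disj: assumes "z \<in> E s" "z \<in> Wc (-s)" "s = 1 \<or> s = -1" shows False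
  using assms
proof induction
  case (base z)
  have "G z \<in> Wc (-s)" by (rule Wc_G') (use base ibxR in auto)
  then show ?case using base by (auto simp: Wc_def)
next
  case (step z)
  have "G z \<in> Wc (-s)" by (rule Wc_G') (use step ibxR in auto)
  then show ?case using step by blast
qed

lemma E_disj: assumes "z \<in> E s" "z \<in> E (-s)" "s = 1 \<or> s = -1" shows False
  using assms
proof induction
  case (base z)
  from base(3) show ?case
  proof cases
    case base1: base then show ?thesis using base(2) by (auto simp: Wc_def)
  next
    case step then show ?thesis using E_Wc_disj[of "G z" "-s"] base(2,4) by auto
  qed
next
  case (step z)
  from step(4) show ?case
  proof cases
    case base then show ?thesis using E_Wc_disj[of "G z" s] step(2,5) by auto
  next
    case step1: step then show ?thesis using step by blast
  qed
qed

lemma E_G: "z \<in> E s ==> G z \<in> E s \<union> Wc s"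
  by (auto elim: E.cases)

lemma E_iterates:
  assumes "z \<in> E s" "s = 1 \<or> s = -1" "\<And>i. i < n ==> (G ^^ i) z \<in> bx R"
  shows "(G ^^ n) z \<in> E s \<union> Wc s"
  using assms(3)
proof (induction n)
  case (Suc n)
  then have "(G ^^ n) z \<in> E s \<union> Wc s" "(G ^^ n) z \<in> bx R" by auto
  then show ?case using E_G[of "(G ^^ n) z" s] Wc_G'[of "(G ^^ n) z" s] assms(2) by auto
qed (use assms in simp)

lemma Wc_escape: assumes "z \<in> Wc s" "s = 1 \<or> s = -1" "\<And>n. (G ^^ n) z \<in> bx R" shows False
proof -
  have "(G ^^ n) z \<in> Wc s & \<kappa> ^ n * \<bar>snd z\<bar> \<le> \<bar>snd ((G ^^ n) z)\<bar>" for n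
  proof (induction n)
    case (Suc n)
    let ?y = "(G ^^ n) z"
    have y: "?y \<in> bx R" "\<bar>fst ?y\<bar> \<le> \<bar>snd ?y\<bar>" "snd ?y \<noteq> 0" using assms(2,3) Suc by (auto simp: Wc_def)
    have "\<kappa> ^ Suc n * \<bar>snd z\<bar> = \<kappa> * (\<kappa> ^ n * \<bar>snd z\<bar>)" by simp
    also have "\<dots> \<le> \<kappa> * \<bar>snd ?y\<bar>" using \<kappa> Suc by (intro mult_left_mono) auto
    also have "\<dots> \<le> \<bar>snd (G ?y)\<bar>" by (rule cone0(1)[OF y])
    finally show ?case using Wc_G'[OF y(1) _ assms(2)] Suc by simp
  qed (use assms in simp)
  moreover have "\<bar>snd ((G ^^ n) z)\<bar> \<le> R" for n using assms(3) by (simp add: mem_bx)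
  ultimately have b: "\<kappa> ^ n * \<bar>snd z\<bar> \<le> R" for n by (meson order_trans)
  have z0: "\<bar>snd z\<bar> > 0" using assms(1,2) by (auto simp: Wc_def)
  obtain n where "R / \<bar>snd z\<bar> < \<kappa> ^ n" using real_arch_pow[OF \<kappa>] by blast
  then have "R < \<kappa> ^ n * \<bar>snd z\<bar>" using z0 by (simp add: field_simps)
  then show False using b[of n] by simp
qed

lemma E_escape: assumes "z \<in> E s" "s = 1 \<or> s = -1" "\<And>n. (G ^^ n) z \<in> bx R" shows False
  using assms
proof induction
  case (base z)
  show ?case
    by (rule Wc_escape[OF base(2,3)]) (use base(4)[of "Suc n" for n] in \<open>simp add: funpow_swap1\<close>)
next
  case (step z)
  show ?case by (rule step.IH[OF step(4)]) (use step(5)[of "Suc n" for n] in \<open>simp add: funpow_swap1\<close>)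
qed

lemma open_Wc: "open (Wc s)"
  unfolding Wc_def by (intro open_Collect_less continuous_intros)

lemma open_E: "open (E s)"
proof -
  have pre: "open (ibx R \<inter> G -` T)" if "open T" for T
    using continuous_open_preimage[OF continuous_on_subset[OF G(1) ibxR] open_ibx that] .
  have "\<exists>T. open T & z \<in> T & T \<subseteq> E s" if "z \<in> E s" for z
    using that
  proof induction
    case (base z)
    then show ?case
      by (intro exI[of _ "ibx R \<inter> G -` Wc s"]) (auto simp: pre open_Wc intro: E.base)
  next
    case (step z)
    then obtain T where "open T" "G z \<in> T" "T \<subseteq> E s" by blast
    moreover from this have "ibx R \<inter> G -` T \<subseteq> E s" using E.step by blast
    ultimately show ?case using step(1)
      by (intro exI[of _ "ibx R \<inter> G -` T"]) (simp add: pre)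
  qed
  then show ?thesis using openI by (metis (no_types, lifting) open_subopen)
qed

lemma E_ibx: "E s \<subseteq> ibx R" by (auto elim: E.cases)

text \<open>A point of the open vertical cone is mapped into that cone and thereby exits. So
  \<open>St\<close> lies in the horizontal cone, where the first coordinate contracts, and this
  keeps the image in the box.\<close>

lemma St_cone: assumes "z \<in> St"
  shows "z \<in> ibx R" "\<bar>snd z\<bar> \<le> \<bar>fst z\<bar>" "G z \<in> St" "\<bar>fst (G z)\<bar> \<le> \<nu> * \<bar>fst z\<bar>"
proof -
  show z: "z \<in> ibx R" using assms by (simp add: St_def)
  have n: "G z \<notin> Wc 1" "G z \<notin> Wc (-1)" "G z \<notin> E 1" "G z \<notin> E (-1)"
    using assms z E.base E.step unfolding St_def by blast+
  show c: "\<bar>snd z\<bar> \<le> \<bar>fst z\<bar>"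
  proof (rule ccontr)
    assume "\<not> ?thesis"
    then have "z \<in> Wc 1 \<or> z \<in> Wc (-1)" by (auto simp: Wc_def)
    then show False using Wc_G'[of z] z ibxR n by auto
  qed
  show x: "\<bar>fst (G z)\<bar> \<le> \<nu> * \<bar>fst z\<bar>" using cone2[of z "(0, 0)"] z ibxR zero_bx c G(3) by auto
  have "\<nu> * \<bar>fst z\<bar> \<le> 1 * \<bar>fst z\<bar>" using \<nu> by (intro mult_right_mono) auto
  moreover have "\<bar>snd (G z)\<bar> \<le> \<bar>fst (G z)\<bar>" using n(1,2) by (auto simp: Wc_def)
  ultimately have "G z \<in> ibx R" using x z by (auto simp: mem_ibx)
  then show "G z \<in> St" using n by (simp add: St_def)
qed

lemma St_iter: assumes "z \<in> St" shows "(G ^^ n) z \<in> St" "\<bar>fst ((G ^^ n) z)\<bar> \<le> \<nu> ^ n * \<bar>fst z\<bar>"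
proof -
  have "(G ^^ n) z \<in> St & \<bar>fst ((G ^^ n) z)\<bar> \<le> \<nu> ^ n * \<bar>fst z\<bar>"
  proof (induction n)
    case (Suc n)
    then have "\<bar>fst (G ((G ^^ n) z))\<bar> \<le> \<nu> * \<bar>fst ((G ^^ n) z)\<bar>" by (intro St_cone(4)) simp
    also have "\<dots> \<le> \<nu> * (\<nu> ^ n * \<bar>fst z\<bar>)" using Suc \<nu> by (intro mult_left_mono) auto
    finally show ?case using St_cone(3)[of "(G ^^ n) z"] Suc by simp
  qed (use assms in simp)
  then show "(G ^^ n) z \<in> St" "\<bar>fst ((G ^^ n) z)\<bar> \<le> \<nu> ^ n * \<bar>fst z\<bar>" by auto
qed

lemma St_shrinks: assumes "z \<in> St" "r > 0" shows "\<exists>n. (G ^^ n) z \<in> bx r"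
proof -
  have "(%n. \<nu> ^ n * \<bar>fst z\<bar>) \<longlonglongrightarrow> 0 * \<bar>fst z\<bar>"
    using \<nu> by (intro tendsto_mult tendsto_const LIMSEQ_realpow_zero) auto
  then have "eventually (%n. \<nu> ^ n * \<bar>fst z\<bar> < r) sequentially"
    using assms(2) order_tendstoD(2) by fastforce
  then obtain n where "\<nu> ^ n * \<bar>fst z\<bar> < r" using eventually_happens by force
  then have "(G ^^ n) z \<in> bx r"
    using St_iter[OF assms(1), of n] St_cone(2)[of "(G ^^ n) z"] by (auto simp: mem_bx)
  then show ?thesis ..
qed

text \<open>Two points in vertical position would separate by the factor \<kappa> at each step,
  although all their iterates stay in the box. Hence \<open>St\<close> is a Lipschitz graph over the
  first coordinate.\<close>

lemma St_lip: assumes "z \<in> St" "z' \<in> St" shows "\<bar>snd z - snd z'\<bar> \<le> \<bar>fst z - fst z'\<bar>"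
proof (rule ccontr)
  assume N: "\<not> ?thesis"
  let ?g = "%n. (G ^^ n) z" and ?g' = "%n. (G ^^ n) z'"
  have bx: "?g n \<in> bx R" "?g' n \<in> bx R" for n
    using St_iter(1)[of _ n] St_cone(1) ibxR assms by blast+
  have "\<bar>fst (?g n) - fst (?g' n)\<bar> \<le> \<bar>snd (?g n) - snd (?g' n)\<bar> &
      \<kappa> ^ n * \<bar>snd z - snd z'\<bar> \<le> \<bar>snd (?g n) - snd (?g' n)\<bar>" for n
  proof (induction n)
    case (Suc n)
    let ?d = "\<bar>snd (?g n) - snd (?g' n)\<bar>"
    have c: "\<kappa> * ?d \<le> \<bar>snd (?g (Suc n)) - snd (?g' (Suc n))\<bar>"
      "\<bar>fst (?g (Suc n)) - fst (?g' (Suc n))\<bar> \<le> \<nu> * ?d"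
      using cone1[OF bx(1)[of n] bx(2)[of n]] Suc by simp_all
    have "\<nu> * ?d \<le> \<kappa> * ?d" using \<nu> \<kappa> by (intro mult_right_mono) auto
    moreover have "\<kappa> ^ Suc n * \<bar>snd z - snd z'\<bar> \<le> \<kappa> * ?d"
      using mult_left_mono[of "\<kappa> ^ n * \<bar>snd z - snd z'\<bar>" ?d \<kappa>] Suc \<kappa> by (simp add: mult.assoc)
    ultimately show ?case using c by linarith
  qed (use N in simp)
  moreover have "\<bar>snd (?g n) - snd (?g' n)\<bar> \<le> 2 * R" for n using bx[of n] by (auto simp: mem_bx)
  ultimately have b: "\<kappa> ^ n * \<bar>snd z - snd z'\<bar> \<le> 2 * R" for n by (meson order_trans)
  have z0: "\<bar>snd z - snd z'\<bar> > 0" using N by auto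
  obtain n where "2 * R / \<bar>snd z - snd z'\<bar> < \<kappa> ^ n" using real_arch_pow[OF \<kappa>] by blast
  then have "2 * R < \<kappa> ^ n * \<bar>snd z - snd z'\<bar>" using z0 by (simp add: field_simps)
  then show False using b[of n] by simp
qed

text \<open>A vertical segment meets both exit sets, which are open and disjoint.\<close>

lemma St_exists: assumes "\<bar>x\<bar> < R" shows "\<exists>y. (x, y) \<in> St"
proof (rule ccontr)
  assume N: "\<not> ?thesis"
  define J where "J = {-R<..<R}"
  define A where "A s = {y. (x, y) \<in> E s}" for s
  have op: "open (A s)" for s
  proof -
    have "A s = (%y. (x, y)) -` E s" by (auto simp: A_def)
    then show ?thesis using open_E by (simp add: open_vimage continuous_intros)
  qed
  have "J \<subseteq> A 1 \<union> A (-1)"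
  proof
    fix y assume "y \<in> J"
    then have "(x, y) \<in> ibx R" using assms by (auto simp: J_def mem_ibx)
    then show "y \<in> A 1 \<union> A (-1)" using N by (auto simp: A_def St_def)
  qed
  moreover have "A 1 \<inter> A (-1) \<inter> J = {}" using E_disj[of _ 1] by (auto simp: A_def)
  moreover have "connected J" by (simp add: J_def)
  ultimately have "A 1 \<inter> J = {} \<or> A (-1) \<inter> J = {}"
    using op[of 1] op[of "-1"] connectedD by blast
  moreover have "s * ((\<bar>x\<bar> + R) / 2) \<in> A s \<inter> J" if s: "s = 1 \<or> s = -1" for s
  proof -
    let ?y = "s * ((\<bar>x\<bar> + R) / 2)"
    have y: "\<bar>?y\<bar> < R" "\<bar>x\<bar> \<le> s * ?y" "?y \<noteq> 0" using s assms Rpos by auto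
    have I: "(x, ?y) \<in> ibx R" using y(1) assms by (simp add: mem_ibx)
    have "G (x, ?y) \<in> Wc s" by (rule Wc_G) (use y I ibxR s in auto)
    then show ?thesis using E.base[OF I] y(1) unfolding A_def J_def by (auto simp: abs_less_iff)
  qed
  ultimately show False by (metis empty_iff)
qed

lemma ki: obtains ki where "continuous_on (k ` ibx R) ki" "\<And>z. z \<in> ibx R ==> ki (k z) = z"
proof -
  have sub: "bx R \<subseteq> B" by (rule B)
  obtain g where g: "homeomorphism (bx R) (k ` bx R) k g"
    using homeomorphism_compact[OF compact_bx continuous_on_subset[OF k(2) sub] refl inj_on_subset[OF k(1) sub]] by blast
  show thesis
  proof (rule that[of g])
    show "continuous_on (k ` ibx R) g"
      by (rule continuous_on_subset[OF homeomorphism_cont2[OF g] image_mono[OF ibxR]])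
    show "g (k z) = z" if "z \<in> ibx R" for z by (rule homeomorphism_apply1[OF g subsetD[OF ibxR that]])
  qed
qed

lemma kopen_nbhd: assumes "0 < r" "r \<le> R" obtains N where "open N" "p \<in> N" "N \<inter> K = k ` ibx r"
proof -
  have "ibx r \<subseteq> B" using ibx_bx[OF assms(2)] B(2) by blast
  then have "openin (top_of_set K) (k ` ibx r)" by (intro kopen open_ibx)
  then obtain N where N: "open N" "k ` ibx r = K \<inter> N" unfolding openin_open by blast
  have "p \<in> k ` ibx r" using assms(1) k(4) by (intro image_eqI[of _ _ "(0, 0)"]) (auto simp: mem_ibx)
  then show thesis using N by (intro that[of N]) auto
qed

text \<open>\<open>G\<close> moves a point by a positive time of the flow, so an orbit that stays in
  the box keeps all iterates there, which neither exit set permits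
  (\<open>E_escape\<close>).\<close>

lemma St_of_stay:
  assumes z: "z \<in> ibx R" and st: "\<And>t. t \<ge> 0 ==> v t (k z) \<in> k ` ibx R"
  shows "z \<in> St"
proof -
  have zK: "k z \<in> K" using z ibxR B(2) kK by blast
  have it: "(G ^^ n) z \<in> ibx R & (\<exists>t\<ge>0. k ((G ^^ n) z) = v t (k z))" for n
  proof (induction n)
    case 0 then show ?case using z v0[OF zK] by (auto intro!: exI[of _ 0])
  next
    case (Suc n)
    let ?y = "(G ^^ n) z"
    obtain t where t: "t \<ge> 0" "k ?y = v t (k z)" and y: "?y \<in> ibx R" using Suc by blast
    obtain q where q: "q > 0" "v q (k ?y) = k (G ?y)" using time[of ?y] y ibxR by blast
    have eq: "k (G ?y) = v (q + t) (k z)" using q(2) t(2) zK by (simp add: vadd)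
    then have "k (G ?y) \<in> k ` ibx R" using st[of "q + t"] t(1) q(1) by simp
    moreover have "G ?y \<in> B" using y ibxR G(2) by blast
    ultimately have "G ?y \<in> ibx R" using inj_onD[OF k(1)] ibxR B(2) by blast
    then show ?case using eq t(1) q(1) by (intro conjI exI[of _ "q + t"]) auto
  qed
  have "(G ^^ n) z \<in> bx R" for n using it ibxR by blast
  then have "z \<notin> E 1" "z \<notin> E (-1)" using E_escape[of z 1] E_escape[of z "-1"] by auto
  then show ?thesis using z by (simp add: St_def)
qed

text \<open>If the transit times along the iterates of \<open>z\<close> are summable, then \<open>z\<close> reaches the fixed point
  in finite time and hence is the fixed point.\<close>

lemma St_stay:
  assumes V: "open V" "p \<in> V"
  shows "\<exists>r>0. r \<le> R & (\<forall>z\<in>St. z \<in> bx r --> (\<forall>t\<ge>0. v t (k z) \<in> V))"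
proof -
  obtain r where r: "r > 0" "r \<le> R"
    "\<And>z. z \<in> bx r ==> \<exists>q>0. v q (k z) = k (G z) & (\<forall>t. 0 \<le> t & t \<le> q --> v t (k z) \<in> V)"
    using seg[OF V] by auto
  have "v t (k z) \<in> V" if z: "z \<in> St" "z \<in> bx r" and t: "t \<ge> 0" for z t
  proof -
    define x where "x n = (G ^^ n) z" for n
    have xr: "x n \<in> bx r" for n
    proof -
      have "\<nu> ^ n * \<bar>fst z\<bar> \<le> 1 * \<bar>fst z\<bar>" using \<nu> by (intro mult_right_mono power_le_one) auto
      then show ?thesis using St_iter[OF z(1), of n] St_cone(2)[of "x n"] z(2) by (auto simp: x_def mem_bx)
    qed
    obtain q where q: "\<And>n. q n > 0" "\<And>n. v (q n) (k (x n)) = k (x (Suc n))"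
      "\<And>n t. 0 \<le> t ==> t \<le> q n ==> v t (k (x n)) \<in> V"
      using r(3)[OF xr] unfolding x_def funpow.simps o_def by metis
    define T where "T n = (\<Sum>i<n. q i)" for n
    have zK: "k z \<in> K" using z(2) bx_mono[OF r(2)] B(2) kK by blast
    have vT: "v (T n) (k z) = k (x n)" for n
    proof (induction n)
      case (Suc n)
      have "v (q n + T n) (k z) = v (q n) (v (T n) (k z))" using vadd[OF zK] by simp
      then show ?case using Suc q(2) by (simp add: T_def add.commute)
    qed (use v0[OF zK] in \<open>simp add: T_def x_def\<close>)
    have inc: "incseq T" unfolding T_def using q(1) by (intro incseq_SucI) (simp add: less_imp_le)
    have T0: "T 0 = 0" by (simp add: T_def)
    show ?thesis
    proof (cases "\<exists>n. t < T n")
      case True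
      define n where "n = (LEAST n. t < T n)"
      have n: "t < T n" unfolding n_def by (rule LeastI_ex[OF True])
      then have "n \<noteq> 0" using T0 t by (cases n) auto
      then obtain m where m: "n = Suc m" using not0_implies_Suc by blast
      have "\<not> t < T m" using not_less_Least[of m "%n. t < T n"] m by (simp add: n_def)
      then have tm: "0 \<le> t - T m" "t - T m \<le> q m" using n m by (auto simp: T_def)
      have "v t (k z) = v (t - T m) (v (T m) (k z))" using vadd[OF zK] by simp
      then show ?thesis using q(3)[OF tm] vT by simp
    next
      case False
      then have "\<And>n. T n \<le> t" by (simp add: not_less)
      then obtain L where L: "T \<longlonglongrightarrow> L" using incseq_convergent[OF inc] by blast
      have "(%n. v (T n) (k z)) \<longlonglongrightarrow> v L (k z)" by (rule tendsto_v[OF L tendsto_const zK]) (simp add: zK)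
      moreover have "(%n. k (x n)) \<longlonglongrightarrow> p"
      proof -
        have lim: "(%n. \<nu> ^ n * \<bar>fst z\<bar>) \<longlonglongrightarrow> 0"
          using tendsto_mult[OF LIMSEQ_realpow_zero tendsto_const, of \<nu> "\<bar>fst z\<bar>"] \<nu> by simp
        have "(%n. fst (x n)) \<longlonglongrightarrow> 0"
          by (rule Lim_null_comparison[OF _ lim]) (use St_iter[OF z(1)] in \<open>auto simp: x_def\<close>)
        moreover have "(%n. snd (x n)) \<longlonglongrightarrow> 0"
        proof (rule Lim_null_comparison[OF _ lim])
          have "\<bar>snd (x n)\<bar> \<le> \<nu> ^ n * \<bar>fst z\<bar>" for n
            using St_iter[OF z(1), of n] St_cone(2)[of "x n"] by (auto simp: x_def)
          then show "eventually (%n. norm (snd (x n)) \<le> \<nu> ^ n * \<bar>fst z\<bar>) sequentially" by simp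
        qed
        ultimately have "(%n. (fst (x n), snd (x n))) \<longlonglongrightarrow> (0, 0)" by (rule tendsto_Pair)
        then have "x \<longlonglongrightarrow> (0, 0)" by simp
        then have "(%n. k (x n)) \<longlonglongrightarrow> k (0, 0)"
        proof (rule continuous_on_tendsto_compose[OF k(2)])
          have "x n \<in> B" for n using xr bx_mono[OF r(2)] B(2) by blast
          then show "eventually (%n. x n \<in> B) sequentially" by simp
        qed (use B(2) zero_bx in auto)
        then show ?thesis using k(4) by simp
      qed
      ultimately have "v L (k z) = p" using vT LIMSEQ_unique by simp
      then have "k z = p" using v_neg(1)[OF zK, of L] pfix by metis
      then show ?thesis using pfix V(2) by simp
    qed
  qed
  then show ?thesis using r(1,2) by blast
qed

lemma St_reach: assumes "z \<in> St" shows "\<exists>t\<ge>0. v t (k z) = k ((G ^^ n) z)"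
proof (induction n)
  case 0
  have "k z \<in> K" using St_cone(1)[OF assms] ibxR B(2) kK by blast
  then show ?case using v0 by (intro exI[of _ 0]) simp
next
  case (Suc n)
  have zK: "k z \<in> K" using St_cone(1)[OF assms] ibxR B(2) kK by blast
  obtain t where t: "t \<ge> 0" "v t (k z) = k ((G ^^ n) z)" using Suc by blast
  obtain q where q: "q > 0" "v q (k ((G ^^ n) z)) = k (G ((G ^^ n) z))"
    using time[of "(G ^^ n) z"] St_cone(1)[OF St_iter(1)[OF assms]] ibxR by blast
  have "v (q + t) (k z) = k ((G ^^ Suc n) z)" using t(2) q(2) vadd[OF zK, of q t] by simp
  then show ?case using t(1) q(1) by (intro exI[of _ "q + t"]) auto
qed

lemma St_wst: assumes "z \<in> St" shows "k z \<in> wst K v p"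
proof -
  have zK: "k z \<in> K" using St_cone(1)[OF assms] ibxR B(2) kK by blast
  have "((%t. v t (k z)) \<longlongrightarrow> p) at_top"
    unfolding tendsto_def
  proof (intro allI impI)
    fix V assume V: "open V" "p \<in> V"
    obtain r where r: "r > 0" "\<And>z t. z \<in> St ==> z \<in> bx r ==> t \<ge> 0 ==> v t (k z) \<in> V"
      using St_stay[OF V] by blast
    obtain n where n: "(G ^^ n) z \<in> bx r" using St_shrinks[OF assms r(1)] by blast
    obtain T where T: "v T (k z) = k ((G ^^ n) z)" using St_reach[OF assms] by blast
    have "v t (k z) \<in> V" if "t \<ge> T" for t
    proof -
      have "v (t - T) (k ((G ^^ n) z)) \<in> V" using r(2)[OF St_iter(1)[OF assms] n] that by simp
      then show ?thesis using vadd[OF zK, of "t - T" T] T by simp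
    qed
    then show "eventually (%t. v t (k z) \<in> V) at_top" by (auto simp: eventually_at_top_linorder)
  qed
  then show ?thesis using zK by (simp add: wst_def)
qed

lemma St_nonzero: assumes "z \<in> St" shows "k z = p \<longleftrightarrow> fst z = 0"
proof
  assume "k z = p"
  then have "z = (0, 0)" using inj_onD[OF k(1), of z "(0, 0)"] k(4) St_cone(1)[OF assms] ibxR B(2) zero_bx by auto
  then show "fst z = 0" by simp
next
  assume "fst z = 0"
  then have "z = (0, 0)" using St_cone(2)[OF assms] by (intro prod_eqI) auto
  then show "k z = p" using k(4) by simp
qed

text \<open>The flow carries a point of \<open>St\<close> along \<open>St\<close> and never through
  the fixed point, so the first coordinate keeps its sign. It also tends to 0, and as
  \<open>St\<close> is a graph, the intermediate value theorem puts every point of \<open>St\<close>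
  further in on the same forward orbit.\<close>

lemma St_curve:
  obtains r where "r > 0" "r < R"
    "\<And>z t. z \<in> St ==> z \<in> bx r ==> fst z \<noteq> 0 ==> t \<ge> 0 ==> \<exists>z'\<in>St. v t (k z) = k z' & fst z * fst z' > 0"
    "\<And>z z'. z \<in> St ==> z \<in> bx r ==> z' \<in> St ==> fst z * fst z' > 0 ==> \<bar>fst z'\<bar> \<le> \<bar>fst z\<bar> ==> \<exists>t\<ge>0. k z' = v t (k z)"
proof -
  obtain N where N: "open N" "p \<in> N" "N \<inter> K = k ` ibx R" using kopen_nbhd[OF Rpos order_refl] by blast
  obtain r0 where r0: "r0 > 0" "r0 \<le> R" "\<And>z t. z \<in> St ==> z \<in> bx r0 ==> t \<ge> 0 ==> v t (k z) \<in> N"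
    using St_stay[OF N(1,2)] by blast
  obtain ki where ki: "continuous_on (k ` ibx R) ki" "\<And>z. z \<in> ibx R ==> ki (k z) = z" using ki by blast
  define r where "r = r0 / 2"
  have r: "r > 0" "r < R" "bx r \<subseteq> bx r0" using r0 bx_mono[of r r0] by (auto simp: r_def)
  have stay: "v t (k z) \<in> k ` ibx R" if "z \<in> St" "z \<in> bx r" "t \<ge> 0" for z t
  proof -
    have "bx r \<subseteq> B" using r bx_mono[of r R] B(2) by simp
    then have "k z \<in> K" using that(2) kK by blast
    then show ?thesis using r0(3)[of z t] that r(3) inK[of "k z" t] N(3) by blast
  qed
  have curve: "\<exists>c. continuous_on {0..} c & c 0 = z & (\<forall>t\<ge>0. c t \<in> St & k (c t) = v t (k z) & fst z * fst (c t) > 0)"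
    if z: "z \<in> St" "z \<in> bx r" "fst z \<noteq> 0" for z
  proof -
    have zI: "z \<in> ibx R" by (rule St_cone(1)[OF z(1)])
    have zK: "k z \<in> K" using zI ibxR B(2) kK by blast
    define c where "c t = ki (v t (k z))" for t
    have kc: "k (c t) = v t (k z) & c t \<in> ibx R" if "t \<ge> 0" for t
      using stay[OF z(1,2) that] ki(2) unfolding c_def by auto
    have cS: "c t \<in> St" if t: "t \<ge> 0" for t
    proof (rule St_of_stay)
      show "c t \<in> ibx R" using kc[OF t] by blast
      show "v s (k (c t)) \<in> k ` ibx R" if "s \<ge> 0" for s
        using kc[OF t] vadd[OF zK, of s t] stay[OF z(1,2), of "s + t"] that t by simp
    qed
    have cont: "continuous_on {0..} c"
      unfolding c_def
      by (rule continuous_on_compose2[OF ki(1)]) (use stay[OF z(1,2)] zK in \<open>auto intro!: cont_v continuous_intros\<close>)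
    have c0: "c 0 = z" using v0[OF zK] ki(2)[OF zI] by (simp add: c_def)
    have ne: "fst (c t) \<noteq> 0" if t: "t \<ge> 0" for t
    proof
      assume "fst (c t) = 0"
      then have "v t (k z) = p" using St_nonzero[OF cS[OF t]] kc[OF t] by simp
      then have "k z = p" using v_neg(1)[OF zK, of t] pfix by metis
      then show False using St_nonzero[OF z(1)] z(3) by simp
    qed
    have "fst z * fst (c t) > 0" if t: "t \<ge> 0" for t
    proof (rule ccontr)
      assume "\<not> ?thesis"
      then have le: "fst z * fst (c t) \<le> 0" by simp
      have "continuous_on {0..t} (%s. fst z * fst (c s))"
        by (intro continuous_intros continuous_on_subset[OF cont]) auto
      moreover have "fst z * fst (c 0) \<ge> 0" by (simp add: c0)
      ultimately obtain s where "0 \<le> s" "fst z * fst (c s) = 0"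
        using IVT2'[of "%s. fst z * fst (c s)" t 0 0] le t by blast
      then show False using ne[of s] z(3) by simp
    qed
    then show ?thesis using cont c0 kc cS by (intro exI[of _ c]) blast
  qed
  show thesis
  proof (rule that[OF r(1,2)])
    show "\<exists>z'\<in>St. v t (k z) = k z' & fst z * fst z' > 0" if "z \<in> St" "z \<in> bx r" "fst z \<noteq> 0" "t \<ge> 0" for z t
      using curve[OF that(1-3)] that(4) by metis
    show "\<exists>t\<ge>0. k z' = v t (k z)"
      if z: "z \<in> St" "z \<in> bx r" "z' \<in> St" "fst z * fst z' > 0" "\<bar>fst z'\<bar> \<le> \<bar>fst z\<bar>" for z z'
    proof -
      have zne: "fst z \<noteq> 0" using z(4) by auto
      obtain c where c: "continuous_on {0..} c" "c 0 = z"
        "\<And>t. t \<ge> 0 ==> c t \<in> St & k (c t) = v t (k z) & fst z * fst (c t) > 0"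
        using curve[OF z(1,2) zne] by blast
      have "z' \<noteq> (0, 0)" using z(4) by auto
      define d where "d = \<bar>fst z'\<bar> / 2"
      have d: "d > 0" "d < \<bar>fst z'\<bar>" using z(4) by (auto simp: d_def)
      have dR: "d \<le> R" using St_cone(1)[OF z(3)] by (auto simp: d_def mem_ibx)
      obtain M where M: "open M" "p \<in> M" "M \<inter> K = k ` ibx d" using kopen_nbhd[OF d(1) dR] by blast
      have "((%t. v t (k z)) \<longlongrightarrow> p) at_top" using St_wst[OF z(1)] by (simp add: wst_def)
      then have "eventually (%t. v t (k z) \<in> M & t \<ge> 0) at_top"
        using topological_tendstoD[OF _ M(1,2)] eventually_ge_at_top[of 0] by (intro eventually_conj) auto
      then obtain t1 where t1: "v t1 (k z) \<in> M" "t1 \<ge> 0" using eventually_happens by force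
      have ct1: "c t1 \<in> ibx R" using c(3)[OF t1(2)] St_cone(1) by blast
      have "k (c t1) \<in> k ` ibx d" using t1 c(3)[OF t1(2)] M(3) ct1 ibxR B(2) kK by (metis IntI subsetD)
      then have "c t1 \<in> ibx d" using inj_onD[OF k(1)] ct1 ibxR B(2) ibx_mono[OF dR] by blast
      then have lt: "\<bar>fst (c t1)\<bar> < \<bar>fst z'\<bar>" using d by (auto simp: mem_ibx)
      have cont: "continuous_on {0..t1} (%s. \<bar>fst (c s)\<bar>)"
        by (intro continuous_intros continuous_on_subset[OF c(1)]) auto
      obtain t where t: "0 \<le> t" "\<bar>fst (c t)\<bar> = \<bar>fst z'\<bar>"
        using IVT2'[OF _ _ t1(2) cont, of "\<bar>fst z'\<bar>"] lt z(5) c(2) by auto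
      have "fst (c t) = fst z'" using t z(4) c(3)[OF t(1)] by (auto simp: abs_if zero_less_mult_iff split: if_splits)
      moreover then have "snd (c t) = snd z'" using St_lip[of "c t" z'] c(3)[OF t(1)] z(3) by auto
      ultimately have "z' = c t" by (simp add: prod_eqI)
      then show ?thesis using c(3)[OF t(1)] t(1) by auto
    qed
  qed
qed

end

section \<open>Passage from the stable to the unstable side\<close>

context hyp
begin

lemma G_small: assumes "e > 0" shows "\<exists>d>0. d \<le> e & G ` bx d \<subseteq> ibx e"
proof -
  have "open (ibx R \<inter> G -` ibx e)"
    by (rule continuous_open_preimage[OF continuous_on_subset[OF G(1) ibxR] open_ibx open_ibx])
  moreover have "(0, 0) \<in> ibx R \<inter> G -` ibx e" using Rpos assms G(3) by (simp add: mem_ibx)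
  ultimately obtain d where d: "d > 0" "bx d \<subseteq> ibx R \<inter> G -` ibx e" by (rule ibx_ball)
  have "bx (min d e) \<subseteq> bx d" by (rule bx_mono) simp
  then show ?thesis using d assms by (intro exI[of _ "min d e"]) auto
qed

lemma iterates_small: assumes "e > 0" shows "\<exists>d>0. \<forall>z\<in>bx d. \<forall>i\<le>n. (G ^^ i) z \<in> ibx e"
  using assms
proof (induction n arbitrary: e)
  case 0
  then show ?case using bx_ibx[of "e/2" e] by (intro exI[of _ "e/2"]) auto
next
  case (Suc n)
  obtain d where d: "d > 0" "d \<le> e" "G ` bx d \<subseteq> ibx e" using G_small[OF Suc.prems] by blast
  obtain d' where d': "d' > 0" "\<forall>z\<in>bx d'. \<forall>i\<le>n. (G ^^ i) z \<in> ibx d" using Suc.IH[OF d(1)] by blast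
  have "(G ^^ i) z \<in> ibx e" if z: "z \<in> bx d'" and i: "i \<le> Suc n" for z i
  proof (cases "i \<le> n")
    case True then show ?thesis using d'(2) z ibx_mono[OF d(2)] by blast
  next
    case False
    then have "i = Suc n" using i by simp
    moreover have "(G ^^ n) z \<in> bx d" using d'(2) z ibx_bx[OF order_refl] by blast
    ultimately show ?thesis using d(3) by auto
  qed
  then show ?case using d'(1) by blast
qed

lemma trajectory:
  assumes r: "r \<le> R" "\<And>z. z \<in> bx r ==> k z \<in> V & (\<exists>q>0. v q (k z) = k (G z) & (\<forall>t. 0 \<le> t & t \<le> q --> v t (k z) \<in> V))"
    and z: "z \<in> bx r" "\<And>i. i < n ==> (G ^^ i) z \<in> bx r"
  shows "\<exists>t\<ge>0. v t (k z) = k ((G ^^ n) z) & (\<forall>u. 0 \<le> u & u \<le> t --> v u (k z) \<in> V)"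
  using z(2)
proof (induction n)
  have zK: "k z \<in> K" using z(1) bx_mono[OF r(1)] B(2) kK by blast
  {
    case 0
    then show ?case using v0[OF zK] r(2)[OF z(1)] by (intro exI[of _ 0]) auto
  next
    case (Suc n)
    obtain t where t: "t \<ge> 0" "v t (k z) = k ((G ^^ n) z)" "\<forall>u. 0 \<le> u & u \<le> t --> v u (k z) \<in> V"
      using Suc by auto
    obtain q where q: "q > 0" "v q (k ((G ^^ n) z)) = k (G ((G ^^ n) z))"
      "\<forall>u. 0 \<le> u & u \<le> q --> v u (k ((G ^^ n) z)) \<in> V" using r(2)[of "(G ^^ n) z"] Suc.prems[of n] by auto
    have eq: "v u (k z) = v (u - t) (k ((G ^^ n) z))" for u using vadd[OF zK, of "u - t" t] t(2) by simp
    have "v (q + t) (k z) = k ((G ^^ Suc n) z)" using eq[of "q + t"] q(2) by simp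
    moreover have "v u (k z) \<in> V" if "0 \<le> u" "u \<le> q + t" for u
      using t(3) q(3) eq[of u] that by (cases "u \<le> t") auto
    ultimately show ?case using t(1) q(1) by (intro exI[of _ "q + t"]) auto
  }
qed

lemma k_small: assumes "open V" "p \<in> V" obtains r where "r > 0" "\<And>z. z \<in> bx r ==> k z \<in> V"
proof -
  have "open (B \<inter> k -` V)" by (rule continuous_open_preimage[OF k(2) B(1) assms(1)])
  moreover have "(0, 0) \<in> B \<inter> k -` V" using zero_bx B(2) k(4) assms(2) by auto
  ultimately obtain r where "r > 0" "bx r \<subseteq> B \<inter> k -` V" by (rule ibx_ball)
  then show thesis using that by blast
qed

end

lemma swap_bx [simp]: "prod.swap z \<in> bx r \<longleftrightarrow> z \<in> bx r" and swap_ibx [simp]: "prod.swap z \<in> ibx r \<longleftrightarrow> z \<in> ibx r"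
  by (auto simp: mem_bx mem_ibx)

text \<open>The chart of the reversed flow has its coordinates swapped, so that \<open>Gr\<close> is, up to the swap,
  the inverse of \<open>G\<close>.\<close>

locale hyp_pair = hyp K v p k B R \<kappa> \<nu> G + r: hyp K "rv v" p "k \<circ> prod.swap" "prod.swap ` B" R \<kappa> \<nu> Gr
  for K :: "'a::metric_space set" and v p k B R \<kappa> \<nu> G Gr +
  assumes inv: "z \<in> bx R ==> G z \<in> bx R ==> Gr (prod.swap (G z)) = prod.swap z"
begin

text \<open>Points entering near the stable set leave the box near a point all of whose backward iterates
  stay in the box, that is, near the unstable set.\<close>

lemma exit_limit:
  assumes s: "s = 1 \<or> s = -1" and r: "0 < r'" "r' \<le> r" "r < R" "G ` bx r' \<subseteq> bx r"
    and c: "\<And>n::nat. c n \<in> E s" "\<And>n. c n \<in> ibx r'" "\<And>d. d > 0 ==> eventually (%n. c n \<in> bx d) sequentially"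
  obtains m f q where "strict_mono (f :: nat => nat)" "(%n. (G ^^ m (f n)) (c (f n))) \<longlonglongrightarrow> q"
    "\<And>n i. i < m n ==> (G ^^ i) (c n) \<in> bx r'" "q \<in> bx r" "prod.swap q \<in> r.St" "s * snd q > 0"
proof -
  have sub: "ibx r' \<subseteq> bx r'" "bx r' \<subseteq> bx r" "bx r \<subseteq> bx R" "bx r \<subseteq> ibx R"
    using r by (auto intro!: bx_mono ibx_bx bx_ibx simp del: subset_iff)
  have ex: "\<exists>m. (G ^^ m) (c n) \<notin> ibx r'" for n
  proof (rule ccontr)
    assume "\<not> ?thesis"
    then have "(G ^^ m) (c n) \<in> bx R" for m using sub by blast
    then show False using E_escape[OF c(1) s] by blast
  qed
  \<comment> \<open>The first exit time from the smaller box. One step earlier the iterate is still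
    in it, so the exit point lies in \<open>bx r\<close>.\<close>
  define m where "m n = (LEAST m. (G ^^ m) (c n) \<notin> ibx r')" for n
  have m: "(G ^^ m n) (c n) \<notin> ibx r'" for n unfolding m_def by (rule LeastI_ex[OF ex])
  have bef: "(G ^^ i) (c n) \<in> ibx r'" if "i < m n" for i n
    using not_less_Least[OF that[unfolded m_def]] by blast
  have m0: "m n \<noteq> 0" for n using m[of n] c(2)[of n] by (metis funpow_0)
  have mq: "(G ^^ m n) (c n) \<in> bx r" for n
  proof -
    obtain i where i: "m n = Suc i" using m0 not0_implies_Suc by blast
    then have "i < m n" by simp
    then have "(G ^^ i) (c n) \<in> bx r'" using bef sub(1) by blast
    then show ?thesis using r(4) i by (simp add: image_subset_iff)
  qed
  have allq: "(G ^^ i) (c n) \<in> bx r" if "i \<le> m n" for i n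
    using mq[of n] bef[of i n] that sub(1,2) by (cases "i = m n") auto
  \<comment> \<open>The closer to the fixed point an orbit starts, the later it exits. Counting back
    from the exit, the limit point \<open>q\<close> thus inherits backward iterates of every
    order.\<close>
  have minf: "eventually (%n. j < m n) sequentially" for j
  proof -
    obtain d where d: "d > 0" "\<forall>z\<in>bx d. \<forall>i\<le>j. (G ^^ i) z \<in> ibx r'" using iterates_small[OF r(1)] by blast
    show ?thesis using c(3)[OF d(1)]
    proof eventually_elim
      case (elim n)
      then have "\<not> m n \<le> j" using d(2) m[of n] by blast
      then show ?case by simp
    qed
  qed
  have "compact (bx r - ibx r')" by (intro compact_diff compact_bx open_ibx)
  moreover have "\<forall>n. (G ^^ m n) (c n) \<in> bx r - ibx r'" using mq m by blast
  ultimately obtain q f where q: "q \<in> bx r - ibx r'" "strict_mono (f :: nat => nat)"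
    and "((%n. (G ^^ m n) (c n)) \<circ> f) \<longlonglongrightarrow> q" unfolding compact_def by meson
  then have lim: "(%n. (G ^^ m (f n)) (c (f n))) \<longlonglongrightarrow> q" by (simp add: o_def)
  define g where "g j n = (G ^^ (m (f n) - j)) (c (f n))" for j n
  have mf: "eventually (%n. j < m (f n)) sequentially" for j
    using eventually_subseq[OF q(2) minf] .
  have gr: "g j n \<in> bx r" for j n unfolding g_def by (rule allq) simp
  have gS: "G (g (Suc j) n) = g j n" if "j < m (f n)" for j n
  proof -
    have "m (f n) - j = Suc (m (f n) - Suc j)" using that by simp
    then show ?thesis by (simp add: g_def)
  qed
  have bk: "(Gr ^^ j) (prod.swap q) \<in> bx r & (%n. prod.swap (g j n)) \<longlonglongrightarrow> (Gr ^^ j) (prod.swap q)" for j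
  proof (induction j)
    case 0
    have "(%n. prod.swap (g 0 n)) \<longlonglongrightarrow> prod.swap q"
      unfolding g_def prod.swap_def using lim by (intro tendsto_intros) simp_all
    then show ?case using q(1) by simp
  next
    case (Suc j)
    have "(%n. Gr (prod.swap (g j n))) \<longlonglongrightarrow> Gr ((Gr ^^ j) (prod.swap q))"
    proof (rule continuous_on_tendsto_compose[OF r.G(1)])
      show "(%n. prod.swap (g j n)) \<longlonglongrightarrow> (Gr ^^ j) (prod.swap q)" using Suc by blast
      show "(Gr ^^ j) (prod.swap q) \<in> bx R" using Suc sub(3) by blast
      have "prod.swap (g j n) \<in> bx R" for n using gr[of j n] sub(3) by auto
      then show "eventually (%n. prod.swap (g j n) \<in> bx R) sequentially" by simp
    qed
    moreover have "eventually (%n. Gr (prod.swap (g j n)) = prod.swap (g (Suc j) n)) sequentially"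
      using mf[of j]
    proof eventually_elim
      case (elim n)
      show ?case using inv[of "g (Suc j) n"] gS[OF elim] gr[of "Suc j" n] gr[of j n] sub(3) by auto
    qed
    ultimately have "(%n. prod.swap (g (Suc j) n)) \<longlonglongrightarrow> Gr ((Gr ^^ j) (prod.swap q))"
      by (rule Lim_transform_eventually)
    then have l: "(%n. prod.swap (g (Suc j) n)) \<longlonglongrightarrow> (Gr ^^ Suc j) (prod.swap q)" by simp
    have "(Gr ^^ Suc j) (prod.swap q) \<in> bx r"
      by (rule closed_sequentially[OF closed_bx _ l]) (simp add: gr)
    then show ?case using l by blast
  qed
  have qS: "prod.swap q \<in> r.St"
  proof -
    have "(Gr ^^ n) (prod.swap q) \<in> bx R" for n using bk sub(3) by blast
    then have "prod.swap q \<notin> r.E 1" "prod.swap q \<notin> r.E (-1)"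
      using r.E_escape[of "prod.swap q" 1] r.E_escape[of "prod.swap q" "-1"] by auto
    then show ?thesis using q(1) sub(4) unfolding r.St_def by auto
  qed
  \<comment> \<open>The point before \<open>q\<close>. It lies on the unstable set and hence in the
    vertical cone, where \<open>G\<close> preserves the sign of the second coordinate; so if
    \<open>q\<close> were on the wrong side, it would lie in the cone \<open>Wc (- s)\<close>, which
    the exiting iterates avoid.\<close>
  define b where "b = prod.swap (Gr (prod.swap q))"
  have "Gr (prod.swap q) \<in> r.St" by (rule r.St_cone(3)[OF qS])
  then have bc: "\<bar>fst b\<bar> \<le> \<bar>snd b\<bar>" using r.St_cone(2) by (simp add: b_def)
  have bR: "b \<in> bx R" using bk[of 1] sub(3) by (auto simp: b_def)
  have Gb: "G b = q"
  proof -
    have "(%n. prod.swap (prod.swap (g 1 n))) \<longlonglongrightarrow> b"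
      unfolding b_def using bk[of 1] unfolding prod.swap_def by (intro tendsto_intros) simp_all
    then have "g 1 \<longlonglongrightarrow> b" by (simp only: swap_swap)
    moreover have "g 1 n \<in> bx R" for n using gr[of 1 n] sub(3) by blast
    ultimately have "(%n. G (g 1 n)) \<longlonglongrightarrow> G b"
      using bR by (intro continuous_on_tendsto_compose[OF G(1)]) auto
    moreover have "eventually (%n. G (g 1 n) = g 0 n) sequentially"
      using mf[of 0] by eventually_elim (use gS[of 0] in simp)
    ultimately have "g 0 \<longlonglongrightarrow> G b" by (rule Lim_transform_eventually)
    moreover have "g 0 \<longlonglongrightarrow> q" using lim unfolding g_def by simp
    ultimately show ?thesis using LIMSEQ_unique by blast
  qed
  have b0: "snd b \<noteq> 0"
  proof
    assume "snd b = 0"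
    then have "b = (0, 0)" using bc by (intro prod_eqI) auto
    then have "q = (0, 0)" using Gb G(3) by simp
    then show False using q(1) r(1) by (simp add: mem_ibx)
  qed
  have bq: "snd b * snd q > 0" using cone_sgn[OF bR bc b0] Gb by simp
  have "s * snd q > 0"
  proof (rule ccontr)
    assume N: "\<not> ?thesis"
    have s': "- s = 1 \<or> - s = -1" using s by auto
    have "\<bar>fst b\<bar> \<le> - s * snd b" using N bq bc s by (auto simp: zero_less_mult_iff)
    then have "q \<in> Wc (- s)" using Wc_G[OF bR _ b0 s'] Gb by simp
    then have "eventually (%n. (G ^^ m (f n)) (c (f n)) \<in> Wc (- s)) sequentially"
      using topological_tendstoD[OF lim open_Wc] by blast
    then obtain n where n: "(G ^^ m (f n)) (c (f n)) \<in> Wc (- s)" using eventually_happens by force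
    have "(G ^^ m (f n)) (c (f n)) \<in> E s \<union> Wc s"
      by (rule E_iterates[OF c(1) s]) (use bef sub in blast)
    then show False using n E_Wc_disj[OF _ n s] by (auto simp: Wc_def)
  qed
  moreover have "(G ^^ i) (c n) \<in> bx r'" if "i < m n" for n i using bef[OF that] sub(1) by blast
  ultimately show thesis using that[OF q(2) lim] q(1) qS by blast
qed

text \<open>Otherwise there are points of \<open>E s\<close> tending to the fixed point that fail to
  reach \<open>W\<close> inside \<open>V\<close>. By \<open>exit_limit\<close> they leave the box
  near a point \<open>q\<close> of the unstable set, on the side of \<open>u\<close>. This
  \<open>q\<close> lies on the separatrix behind \<open>y\<close>, and the flow carries whatever is
  near \<open>q\<close> on to \<open>y\<close>.\<close>

lemma sector_E:
  assumes s: "s = 1 \<or> s = -1" and r0: "r0 > 0"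
    and orb: "\<And>z z'. z \<in> r.St ==> z \<in> bx r0 ==> z' \<in> r.St ==> fst z * fst z' > 0 ==> \<bar>fst z'\<bar> \<le> \<bar>fst z\<bar> ==>
      \<exists>t\<ge>0. k (prod.swap z') = rv v t (k (prod.swap z))"
    and u: "u \<in> r.St" "u \<in> bx r0" "s * fst u > 0"
  shows "sector v p (k (prod.swap u)) (k ` E s)"
  unfolding sector_def
proof (intro ballI allI impI)
  fix y V W assume y: "y \<in> orb v (k (prod.swap u))"
    and A: "open V & open W & y \<in> W & p \<in> V & (\<forall>t\<le>0. v t y \<in> V)"
  define y0 where "y0 = k (prod.swap u)"
  have V: "open V" "p \<in> V" "\<And>t. t \<le> 0 ==> v t y \<in> V" and W: "open W" "y \<in> W" using A by auto
  obtain t0 where t0: "y = v t0 y0" using y by (auto simp: orb_def y0_def)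
  have "prod.swap u \<in> bx R" using r.St_cone(1)[OF u(1)] ibxR by auto
  then have y0K: "y0 \<in> K" unfolding y0_def using B(2) kK by blast
  have y0p: "y0 \<noteq> p" using r.St_nonzero[OF u(1)] u(3) by (auto simp: y0_def)
  have yK: "y \<in> K" using t0 inK[OF y0K] by simp
  \<comment> \<open>The box will be chosen off this arc of the separatrix, so that the point
    \<open>q\<close> where orbits leave the box comes before \<open>y\<close> and not after
    it.\<close>
  define C where "C = (%t. rv v t y0) ` {0..max 0 (- t0)}"
  have "compact C" unfolding C_def by (rule r.compact_arc[OF y0K])
  then have opC: "open (- C)" by (simp add: open_Compl compact_imp_closed)
  have pC: "p \<notin> C"
  proof
    assume "p \<in> C"
    then obtain t where "p = rv v t y0" by (auto simp: C_def)
    then have "y0 = p" using v_neg(2)[OF y0K, of t] pfix[of t] by (simp add: rv_def)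
    then show False using y0p by blast
  qed
  obtain r1 where r1: "r1 > 0" "\<And>z. z \<in> bx r1 ==> k z \<in> V \<inter> - C"
    by (rule k_small[of "V \<inter> - C"]) (use V opC pC in auto)
  obtain r2 where r2: "r2 > 0" "r2 \<le> R"
    "\<forall>z\<in>bx r2. \<exists>h>0. v h (k z) = k (G z) & (\<forall>t. 0 \<le> t & t \<le> h --> v t (k z) \<in> V)"
    using seg[OF V(1,2)] by blast
  define r where "r = min (min r1 r2) (min (R/2) \<bar>fst u\<bar>)"
  have u0: "fst u \<noteq> 0" using u(3) by auto
  have r: "r > 0" "r \<le> r1" "r \<le> r2" "r < R" "r \<le> \<bar>fst u\<bar>" using r1 r2 Rpos u0 by (auto simp: r_def)
  have rseg: "k z \<in> V & (\<exists>h>0. v h (k z) = k (G z) & (\<forall>t. 0 \<le> t & t \<le> h --> v t (k z) \<in> V))" if "z \<in> bx r" for z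
    using r1(2)[of z] r2(3) that bx_mono[OF r(2)] bx_mono[OF r(3)] by blast
  obtain r' where r': "r' > 0" "r' \<le> r" "G ` bx r' \<subseteq> ibx r" using G_small[OF r(1)] by blast
  have Gr': "G ` bx r' \<subseteq> bx r" using r'(3) ibx_bx[OF order_refl] by blast
  define good where "good c \<longleftrightarrow> (\<exists>t\<ge>0. v t (k c) \<in> W & (\<forall>u. 0 \<le> u & u \<le> t --> v u (k c) \<in> V))" for c
  have "\<exists>g>0. g \<le> R & (\<forall>c\<in>E s \<inter> ibx g. good c)"
  proof (rule ccontr)
    assume N: "\<not> ?thesis"
    have "\<exists>c. c \<in> E s & c \<in> ibx (min r' (inverse (real (Suc n)))) & \<not> good c" for n
    proof -
      have "min r' (inverse (real (Suc n))) > 0" "min r' (inverse (real (Suc n))) \<le> R" using r' r(4) by auto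
      then show ?thesis using N by blast
    qed
    then obtain c where c: "\<And>n. c n \<in> E s" "\<And>n. c n \<in> ibx (min r' (inverse (real (Suc n))))" "\<And>n. \<not> good (c n)"
      by metis
    have cr: "c n \<in> ibx r'" for n using c(2)[of n] by (simp add: mem_ibx)
    have c0: "eventually (%n. c n \<in> bx d) sequentially" if "d > 0" for d
    proof -
      have "eventually (%n. inverse (real (Suc n)) < d) sequentially"
        using order_tendstoD(2)[OF LIMSEQ_inverse_real_of_nat that] .
      then show ?thesis
      proof eventually_elim
        case (elim n)
        then show ?case using c(2)[of n] by (simp add: mem_ibx mem_bx)
      qed
    qed
    obtain m f q where f: "strict_mono (f :: nat => nat)" and lim: "(%n. (G ^^ m (f n)) (c (f n))) \<longlonglongrightarrow> q"
      and m: "\<And>n i. i < m n ==> (G ^^ i) (c n) \<in> bx r'"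
      and q: "q \<in> bx r" "prod.swap q \<in> r.St" "s * snd q > 0"
      by (rule exit_limit[OF s r'(1,2) r(4) Gr' c(1) cr c0]) auto
    have qB: "q \<in> B" using q(1) bx_mono[of r R] r(4) B(2) by auto
    have qK: "k q \<in> K" by (rule kK[OF qB])
    have "fst u * fst (prod.swap q) > 0" using u(3) q(3) s by (auto simp: zero_less_mult_iff)
    moreover have "\<bar>fst (prod.swap q)\<bar> \<le> \<bar>fst u\<bar>" using q(1) r(5) by (simp add: mem_bx)
    ultimately obtain t where t: "t \<ge> 0" "k q = rv v t y0" using orb[OF u(1,2) q(2)] by (auto simp: y0_def)
    have "k q \<notin> C" using r1(2)[of q] q(1) bx_mono[OF r(2)] by blast
    then have tt: "t > - t0" using t by (auto simp: C_def)
    define e where "e = t0 + t"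
    have e: "e \<ge> 0" using tt by (simp add: e_def)
    have vq: "v a (k q) = v (a - e) y" for a using t(2) t0 y0K by (simp add: rv_def vadd e_def)
    have inV: "v a (k q) \<in> V" if "0 \<le> a" "a \<le> e" for a using vq[of a] V(3)[of "a - e"] that by simp
    obtain d1 where d1: "d1 > 0" "\<And>z a. z \<in> K ==> dist z (k q) < d1 ==> 0 \<le> a ==> a \<le> e ==> v a z \<in> V"
      by (rule tube[OF qK V(1), of 0 e]) (use inV in auto)
    have "v e (k q) \<in> W" using vq[of e] W(2) v0[OF yK] by simp
    then obtain d2 where d2: "d2 > 0" "\<And>z. z \<in> K ==> dist z (k q) < d2 ==> v e z \<in> W"
      by (rule tube_point[OF qK W(1)]) blast
    define x where "x n = (G ^^ m (f n)) (c (f n))" for n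
    have tr: "\<exists>t\<ge>0. v t (k (c (f n))) = k (x n) & (\<forall>u. 0 \<le> u & u \<le> t --> v u (k (c (f n))) \<in> V)" for n
      unfolding x_def
    proof (rule trajectory[OF _ rseg])
      show "c (f n) \<in> bx r" using cr[of "f n"] ibx_bx[OF r'(2)] by blast
      show "(G ^^ i) (c (f n)) \<in> bx r" if "i < m (f n)" for i using m[OF that] bx_mono[OF r'(2)] by blast
    qed (use r(4) in simp)
    have "open (B \<inter> k -` ball (k q) (min d1 d2))" by (rule continuous_open_preimage[OF k(2) B(1) open_ball])
    moreover have "q \<in> B \<inter> k -` ball (k q) (min d1 d2)" using qB d1(1) d2(1) by simp
    ultimately have "eventually (%n. x n \<in> B \<inter> k -` ball (k q) (min d1 d2)) sequentially"
      using lim topological_tendstoD unfolding x_def by blast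
    then obtain n where "x n \<in> B \<inter> k -` ball (k q) (min d1 d2)" using eventually_happens by force
    then have xn: "k (x n) \<in> K" "dist (k (x n)) (k q) < d1" "dist (k (x n)) (k q) < d2"
      using kK by (auto simp: dist_commute)
    define z where "z = k (c (f n))"
    have "c (f n) \<in> B" using E_ibx c(1) ibxR B(2) by blast
    then have zK: "z \<in> K" unfolding z_def by (rule kK)
    obtain a where a: "a \<ge> 0" "v a z = k (x n)" "\<forall>u. 0 \<le> u & u \<le> a --> v u z \<in> V"
      using tr[of n] unfolding z_def by blast
    have eq: "v b z = v (b - a) (k (x n))" for b using vadd[OF zK, of "b - a" a] a(2) by simp
    have "v (e + a) z \<in> W" using eq[of "e + a"] d2(2)[OF xn(1,3)] by simp
    moreover have "v b z \<in> V" if "0 \<le> b" "b \<le> e + a" for b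
      using a(3) eq[of b] d1(2)[OF xn(1,2), of "b - a"] that by (cases "b \<le> a") auto
    ultimately have "good (c (f n))"
      unfolding good_def z_def[symmetric] using e a(1) by (intro exI[of _ "e + a"]) auto
    then show False using c(3) by blast
  qed
  then obtain g where g: "g > 0" "g \<le> R" "\<And>c. c \<in> E s ==> c \<in> ibx g ==> good c" by blast
  obtain N where N: "open N" "p \<in> N" "N \<inter> K = k ` ibx g" using kopen_nbhd[OF g(1,2)] by blast
  have "\<exists>t\<ge>0. v t z \<in> W & (\<forall>r. 0 \<le> r & r \<le> t --> v r z \<in> V)" if z: "z \<in> N \<inter> k ` E s" for z
  proof -
    obtain c where c: "c \<in> E s" "z = k c" using z by blast
    have cB: "c \<in> B" using E_ibx c(1) ibxR B(2) by blast
    have "z \<in> N \<inter> K" using z kK[OF cB] c(2) by simp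
    then obtain c' where c': "c' \<in> ibx g" "z = k c'" unfolding N(3) by blast
    have "c' \<in> B" by (rule subsetD[OF B(2) subsetD[OF ibx_bx[OF g(2)] c'(1)]])
    moreover have "k c = k c'" using c(2) c'(2) by simp
    ultimately have "c = c'" by (intro inj_onD[OF k(1) _ cB])
    then have "good c" using g(3)[OF c(1)] c'(1) by simp
    then show ?thesis unfolding good_def c(2) .
  qed
  then show "\<exists>W'. open W' & p \<in> W' &
      (\<forall>z\<in>W' \<inter> k ` E s. \<exists>t\<ge>0. v t z \<in> W & (\<forall>r. 0 \<le> r & r \<le> t --> v r z \<in> V))"
    using N(1,2) by (intro exI[of _ N]) blast
qed

text \<open>The points of \<open>St\<close> with first coordinates \<open>rs\<close> and
  \<open>- rs\<close> represent the two stable separatrices. The complement of the graph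
  \<open>St\<close> in the box consists of the two exit sets, and these are the sides required by
  \<open>sector_data\<close>.\<close>

theorem sectors: "sectors K v p"
proof -
  obtain rs where rs: "rs > 0" "rs < R"
    and fwd: "\<And>z t. z \<in> St ==> z \<in> bx rs ==> fst z \<noteq> 0 ==> t \<ge> 0 ==> \<exists>z'\<in>St. v t (k z) = k z' & fst z * fst z' > 0"
    and orbS: "\<And>z z'. z \<in> St ==> z \<in> bx rs ==> z' \<in> St ==> fst z * fst z' > 0 ==> \<bar>fst z'\<bar> \<le> \<bar>fst z\<bar> ==> \<exists>t\<ge>0. k z' = v t (k z)"
    by (rule St_curve) blast
  obtain ru where ru: "ru > 0" "ru < R"
    and orbU: "\<And>z z'. z \<in> r.St ==> z \<in> bx ru ==> z' \<in> r.St ==> fst z * fst z' > 0 ==> \<bar>fst z'\<bar> \<le> \<bar>fst z\<bar> ==>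
      \<exists>t\<ge>0. k (prod.swap z') = rv v t (k (prod.swap z))"
    by (rule r.St_curve[unfolded o_apply]) blast
  obtain a1 where z1: "(rs, a1) \<in> St" using St_exists[of rs] rs by auto
  obtain a2 where z2: "(- rs, a2) \<in> St" using St_exists[of "- rs"] rs by auto
  obtain b1 where u1: "(ru, b1) \<in> r.St" using r.St_exists[of ru] ru by auto
  obtain b2 where u2: "(- ru, b2) \<in> r.St" using r.St_exists[of "- ru"] ru by auto
  have zb: "(rs, a1) \<in> bx rs" "(- rs, a2) \<in> bx rs" "(ru, b1) \<in> bx ru" "(- ru, b2) \<in> bx ru"
    using St_cone(2)[OF z1] St_cone(2)[OF z2] r.St_cone(2)[OF u1] r.St_cone(2)[OF u2] rs ru by (auto simp: mem_bx)
  define x1 where "x1 = k (rs, a1)"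
  define x2 where "x2 = k (- rs, a2)"
  define y1 where "y1 = k (b1, ru)"
  define y2 where "y2 = k (b2, - ru)"
  have xw: "x1 \<in> wst K v p" "x2 \<in> wst K v p" unfolding x1_def x2_def by (rule St_wst[OF z1], rule St_wst[OF z2])
  then have xK: "x1 \<in> K" "x2 \<in> K" by (auto simp: wst_def)
  have xp: "x1 \<noteq> p" "x2 \<noteq> p" using St_nonzero[OF z1] St_nonzero[OF z2] rs by (auto simp: x1_def x2_def)
  obtain N where N: "open N" "p \<in> N" "N \<inter> K = k ` ibx rs" using kopen_nbhd[of rs] rs by auto
  have loc: "k z = p \<or> k z \<in> (%t. v t x1) ` {0..} \<or> k z \<in> (%t. v t x2) ` {0..}" if z: "z \<in> St" "z \<in> ibx rs" for z
  proof -
    have le: "\<bar>fst z\<bar> \<le> rs" using z(2) by (simp add: mem_ibx)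
    consider "fst z = 0" | "fst z > 0" | "fst z < 0" by linarith
    then show ?thesis
    proof cases
      case 1 then show ?thesis using St_nonzero[OF z(1)] by blast
    next
      case 2
      then obtain t where "t \<ge> 0" "k z = v t x1" using orbS[OF z1 zb(1) z(1)] le rs by (auto simp: x1_def)
      then show ?thesis by auto
    next
      case 3
      then obtain t where "t \<ge> 0" "k z = v t x2" using orbS[OF z2 zb(2) z(1)] le rs by (auto simp: x2_def mult_pos_neg)
      then show ?thesis by auto
    qed
  qed
  have wst: "wst K v p = {p} \<union> orb v x1 \<union> orb v x2"
  proof
    show "{p} \<union> orb v x1 \<union> orb v x2 \<subseteq> wst K v p"
      using wst_orb[OF xw(1)] wst_orb[OF xw(2)] wst_self[OF pK pfix] by blast
    show "wst K v p \<subseteq> {p} \<union> orb v x1 \<union> orb v x2"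
    proof
      fix x assume x: "x \<in> wst K v p"
      then have xK: "x \<in> K" and lim: "((%t. v t x) \<longlongrightarrow> p) at_top" by (auto simp: wst_def)
      obtain T where T: "\<And>t. t \<ge> T ==> v t x \<in> N"
        using topological_tendstoD[OF lim N(1,2)] by (auto simp: eventually_at_top_linorder)
      have st: "v t x \<in> k ` ibx rs" if "t \<ge> T" for t using T[OF that] inK[OF xK] N(3) by blast
      obtain z where z: "z \<in> ibx rs" "v T x = k z" using st[of T] by auto
      have sub: "ibx rs \<subseteq> ibx R" using rs by (intro ibx_mono) simp
      have "z \<in> St"
      proof (rule St_of_stay)
        show "v t (k z) \<in> k ` ibx R" if "t \<ge> 0" for t
          using st[of "t + T"] that z(2) vadd[OF xK, of t T] sub by auto
      qed (use z(1) sub in blast)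
      from loc[OF this z(1)] have "v T x \<in> {p} \<union> orb v x1 \<union> orb v x2" unfolding z(2)[symmetric] by (auto simp: orb_def)
      then consider "v T x = p" | "v T x \<in> orb v x1" | "v T x \<in> orb v x2" by blast
      then show "x \<in> {p} \<union> orb v x1 \<union> orb v x2"
      proof cases
        case 1
        then have "x = p" using v_neg(1)[OF xK, of T] pfix by metis
        then show ?thesis by simp
      next
        case 2
        then have "orb v x1 = orb v x" using orb_eq[OF \<open>x1 \<in> K\<close>] orb_v[OF xK] by blast
        then show ?thesis using orb_self[OF xK] by simp
      next
        case 3
        then have "orb v x2 = orb v x" using orb_eq[OF \<open>x2 \<in> K\<close>] orb_v[OF xK] by blast
        then show ?thesis using orb_self[OF xK] by simp
      qed
    qed
  qed
  have po: "p \<notin> orb v x1" "p \<notin> orb v x2" using wst_v_ne[OF xw(1) xp(1)] wst_v_ne[OF xw(2) xp(2)] by (auto simp: orb_def)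
  \<comment> \<open>Along a forward orbit in \<open>St\<close> the first coordinate keeps its sign.
    Applied in both time directions, this shows that the two chosen points lie on different
    orbits.\<close>
  have apart: False if t: "t \<ge> 0" and zw: "z \<in> St" "w \<in> St" "z \<in> bx rs" "w \<in> bx rs" "fst z * fst w < 0" and eq: "v t (k z) = k w" for z w t
  proof -
    have "fst z \<noteq> 0" using zw(5) by auto
    then obtain z' where z': "z' \<in> St" "v t (k z) = k z'" "fst z * fst z' > 0" using fwd[OF zw(1,3) _ t] by blast
    have "St \<subseteq> B" using St_cone(1) ibxR B(2) by blast
    then have "z' = w" using z' eq zw(2) by (intro inj_onD[OF k(1)]) auto
    then show False using z'(3) zw(5) by simp
  qed
  have dis: "orb v x1 \<inter> orb v x2 = {}"
  proof (rule ccontr)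
    assume "\<not> ?thesis"
    then obtain z where "z \<in> orb v x1" "z \<in> orb v x2" by blast
    then have "orb v x1 = orb v x2" using orb_eq xK by metis
    then have "x2 \<in> orb v x1" using orb_self[OF xK(2)] by simp
    then obtain t where t: "x2 = v t x1" by (auto simp: orb_def)
    show False
    proof (cases "t \<ge> 0")
      case True
      show False by (rule apart[OF True z1 z2 zb(1,2)]) (use t rs in \<open>auto simp: x1_def x2_def\<close>)
    next
      case False
      have "v (- t) x2 = x1" using t xK by simp
      then show False using apart[OF _ z2 z1 zb(2,1), of "- t"] False rs by (auto simp: x1_def x2_def)
    qed
  qed
  have "openin (top_of_set K) (k ` E s)" for s
    using E_ibx ibxR B(2) by (intro kopen open_E) blast
  moreover have "k ` E 1 \<inter> k ` E (-1) = {}"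
  proof -
    have "E 1 \<inter> E (-1) = {}" using E_disj[of _ 1] by auto
    moreover have "E s \<subseteq> B" for s using E_ibx ibxR B(2) by blast
    ultimately show ?thesis using inj_on_image_Int[OF k(1), of "E 1" "E (-1)"] by auto
  qed
  moreover have "N \<inter> K \<subseteq> insert p ((%t. v t x1) ` {0..}) \<union> insert p ((%t. v t x2) ` {0..}) \<union> (k ` E 1 \<union> k ` E (-1))"
  proof
    fix x assume "x \<in> N \<inter> K"
    then obtain z where z: "z \<in> ibx rs" "x = k z" unfolding N(3) by blast
    have "z \<in> ibx R" using z(1) ibx_mono[of rs R] rs by auto
    then have "z \<in> E 1 \<or> z \<in> E (-1) \<or> z \<in> St" by (auto simp: St_def)
    then show "x \<in> insert p ((%t. v t x1) ` {0..}) \<union> insert p ((%t. v t x2) ` {0..}) \<union> (k ` E 1 \<union> k ` E (-1))"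
      using loc[OF _ z(1)] z(2) by blast
  qed
  moreover have "sector v p y1 (k ` E 1)"
    using sector_E[OF _ ru(1) orbU u1 zb(3), of 1] ru by (simp add: y1_def)
  moreover have "sector v p y2 (k ` E (-1))"
    using sector_E[OF _ ru(1) orbU u2 zb(4), of "-1"] ru by (simp add: y2_def)
  moreover have "y1 \<in> wst K (rv v) p" "y2 \<in> wst K (rv v) p"
    using r.St_wst[OF u1] r.St_wst[OF u2] by (simp_all add: y1_def y2_def)
  moreover have "y1 \<noteq> p" "y2 \<noteq> p"
    using r.St_nonzero[OF u1] r.St_nonzero[OF u2] ru by (auto simp: y1_def y2_def)
  ultimately have "sector_data K v p N x1 x2 y1 y2 (k ` E 1) (k ` E (-1))"
    unfolding sector_data_def using N(1,2) xK wst po dis by blast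
  then show ?thesis unfolding sectors_def by blast
qed

end

section \<open>Saddles of differentiable flows\<close>

text \<open>The hypothesis says that \<open>G\<close> differs from the diagonal map with entries
  \<open>l\<close> and \<open>m\<close> by a map of Lipschitz constant \<open>h\<close> in the
  maximum norm. The cone conditions survive as long as \<open>h\<close> fits into the gaps between
  \<open>l\<close> and \<nu> and between \<kappa> and \<open>m\<close>.\<close>

lemma cones_of_estimate:
  assumes est: "\<And>z z'. z \<in> bx R ==> z' \<in> bx R ==>
      \<bar>fst (G z) - fst (G z') - l * (fst z - fst z')\<bar> \<le> h * max \<bar>fst z - fst z'\<bar> \<bar>snd z - snd z'\<bar> &
      \<bar>snd (G z) - snd (G z') - m * (snd z - snd z')\<bar> \<le> h * max \<bar>fst z - fst z'\<bar> \<bar>snd z - snd z'\<bar>"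
    and c: "0 \<le> l" "l + h \<le> \<nu>" "\<kappa> + h \<le> m" "0 < \<kappa>" "0 \<le> h" and R: "0 \<le> R" and G0: "G (0, 0) = (0, 0)"
  shows "cones R \<kappa> \<nu> G"
  unfolding cones_def
proof (intro conjI ballI impI)
  fix z z' assume zz: "z \<in> bx R" "z' \<in> bx R"
  note e = est[OF zz]
  { assume le: "\<bar>fst z - fst z'\<bar> \<le> \<bar>snd z - snd z'\<bar>"
    let ?y = "\<bar>snd z - snd z'\<bar>"
    have e': "\<bar>fst (G z) - fst (G z') - l * (fst z - fst z')\<bar> \<le> h * ?y"
      "\<bar>snd (G z) - snd (G z') - m * (snd z - snd z')\<bar> \<le> h * ?y" using e le by (simp_all add: max_def)
    have m: "m * ?y = \<bar>m * (snd z - snd z')\<bar>" "m * ?y \<ge> (\<kappa> + h) * ?y"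
      using c(3-5) mult_right_mono[OF c(3), of ?y] by (auto simp: abs_mult)
    show "\<kappa> * ?y \<le> \<bar>snd (G z) - snd (G z')\<bar>" using m e'(2) by (auto simp: algebra_simps)
    have "\<bar>l * (fst z - fst z')\<bar> \<le> l * ?y" using c(1) le by (simp add: abs_mult mult_left_mono)
    moreover have "(l + h) * ?y \<le> \<nu> * ?y" using c(2) by (rule mult_right_mono) simp
    ultimately show "\<bar>fst (G z) - fst (G z')\<bar> \<le> \<nu> * ?y" using e'(1) by (auto simp: algebra_simps) }
  { assume le: "\<bar>snd z - snd z'\<bar> \<le> \<bar>fst z - fst z'\<bar>"
    let ?x = "\<bar>fst z - fst z'\<bar>"
    have e': "\<bar>fst (G z) - fst (G z') - l * (fst z - fst z')\<bar> \<le> h * ?x" using e le by (simp add: max_def)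
    have "\<bar>l * (fst z - fst z')\<bar> = l * ?x" using c(1) by (simp add: abs_mult)
    moreover have "(l + h) * ?x \<le> \<nu> * ?x" using c(2) by (rule mult_right_mono) simp
    ultimately show "\<bar>fst (G z) - fst (G z')\<bar> \<le> \<nu> * ?x" using e' by (auto simp: algebra_simps) }
next
  fix z assume z: "z \<in> bx R" and le: "\<bar>fst z\<bar> \<le> \<bar>snd z\<bar> & snd z \<noteq> 0"
  have z0: "(0, 0) \<in> bx R" using R by (simp add: mem_bx)
  have e: "\<bar>snd (G z) - m * snd z\<bar> \<le> h * \<bar>snd z\<bar>" using est[OF z z0] G0 le by (simp add: max_def)
  have k: "(\<kappa> + h) * \<bar>snd z\<bar> \<le> m * \<bar>snd z\<bar>" "\<kappa> * \<bar>snd z\<bar> > 0" using c le by (auto intro: mult_right_mono)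
  show "snd z * snd (G z) > 0"
  proof (cases "snd z > 0")
    case True
    then have "snd (G z) > 0" using e k by (simp add: algebra_simps)
    then show ?thesis using True by simp
  next
    case False
    then have n: "snd z < 0" using le by simp
    then have "snd (G z) < 0" using e k by (simp add: algebra_simps)
    then show ?thesis using n by (simp add: mult_neg_neg)
  qed
qed

lemma continuous_chart_inv:
  assumes U: "openin M U" "homeomorphic_map (subtopology M U) (top_of_set (\<phi> ` U)) \<phi>"
  shows "continuous_map (top_of_set (\<phi> ` U)) M (inv_into U \<phi>)"
proof -
  have top_U: "topspace (subtopology M U) = U" using openin_subset[OF U(1)] by auto
  have inj: "inj_on \<phi> U" using homeomorphic_imp_injective_map[OF U(2)] unfolding top_U .
  obtain h where h: "homeomorphic_maps (subtopology M U) (top_of_set (\<phi> ` U)) \<phi> h"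
    using U(2) unfolding homeomorphic_map_maps by blast
  have "continuous_map (top_of_set (\<phi> ` U)) (subtopology M U) h"
    "\<forall>x\<in>topspace (subtopology M U). h (\<phi> x) = x" using h unfolding homeomorphic_maps_def by blast+
  then have ch: "continuous_map (top_of_set (\<phi> ` U)) M h" and hx: "\<forall>x\<in>U. h (\<phi> x) = x"
    unfolding top_U by (blast dest: continuous_map_into_fulltopology)+
  show ?thesis
  proof (rule continuous_map_eq[OF ch])
    fix z assume "z \<in> topspace (top_of_set (\<phi> ` U))"
    then have "z \<in> \<phi> ` U" by simp
    then show "h z = inv_into U \<phi> z" using hx inv_into_f_f[OF inj] by auto
  qed
qed

text \<open>The model flow \<open>w\<close> has at \<open>p\<close>, in the chart \<phi>, the
  eigenvectors \<open>e\<close> and \<open>f\<close> with rates \<open>l\<close> and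
  \<open>m\<close> for its time-one map, and \<open>g\<close> carries a neighbourhood of
  \<open>p\<close> into \<open>K\<close>. The assumption \<open>est\<close> is strict
  differentiability at \<open>p\<close>: it controls differences between any two nearby
  points.\<close>

locale sad = cflow K v for K :: "'a::metric_space set" and v +
  fixes M :: "'b topology" and w :: "real => 'b => 'b" and U :: "'b set" and \<phi> :: "'b => real^2"
    and p :: 'b and e f :: "real^2" and l m :: real and N :: "'b set" and g :: "'b => 'a"
    and L :: "real^2 => real^2"
  assumes flowM: "flow M w" and wp: "w t p = p"
    and U: "openin M U" "p \<in> U" "open (\<phi> ` U)" "homeomorphic_map (subtopology M U) (top_of_set (\<phi> ` U)) \<phi>"
    and basis: "e$1 * f$2 - e$2 * f$1 \<noteq> 0"
    and L: "linear L" "L e = l *\<^sub>R e" "L f = m *\<^sub>R f" and rates: "0 < l" "l < 1" "1 < m"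
    and est: "\<epsilon> > 0 ==> \<exists>\<delta>>0. ball (\<phi> p) \<delta> \<subseteq> \<phi> ` U &
      continuous_on (ball (\<phi> p) \<delta>) (%z. \<phi> (w 1 (inv_into U \<phi> z))) &
      (\<forall>z\<in>ball (\<phi> p) \<delta>. \<forall>z'\<in>ball (\<phi> p) \<delta>.
        norm (\<phi> (w 1 (inv_into U \<phi> z)) - \<phi> (w 1 (inv_into U \<phi> z')) - L (z - z')) \<le> \<epsilon> * norm (z - z'))"
    and N: "openin M N" "p \<in> N" "homeomorphic_map (subtopology M N) (top_of_set (g ` N)) g"
      "openin (top_of_set K) (g ` N)" "maps_orbits w N v g"
begin

definition T :: "real \<times> real => real^2" where
  "T z = \<phi> p + fst z *\<^sub>R e + snd z *\<^sub>R f"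

text \<open>\<open>P1\<close> and \<open>P2\<close> are Cramer's rule for the coordinates with
  respect to \<open>e\<close> and \<open>f\<close>.\<close>

definition P1 :: "real^2 => real" where
  "P1 z = (z$1 * f$2 - z$2 * f$1) / (e$1 * f$2 - e$2 * f$1)"

definition P2 :: "real^2 => real" where
  "P2 z = (e$1 * z$2 - e$2 * z$1) / (e$1 * f$2 - e$2 * f$1)"

definition Ti :: "real^2 => real \<times> real" where
  "Ti z = (P1 (z - \<phi> p), P2 (z - \<phi> p))"

definition \<Psi> where "\<Psi> z = inv_into U \<phi> (T z)"

definition B where "B = {z. T z \<in> \<phi> ` U & \<Psi> z \<in> N}"

definition k where "k z = g (\<Psi> z)"

definition G where "G z = Ti (\<phi> (w 1 (\<Psi> z)))"

lemma linear_P: "linear P1" "linear P2"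
  by (auto intro!: linearI simp: P1_def P2_def divide_inverse algebra_simps)

lemma P_ef: "P1 e = 1" "P1 f = 0" "P2 e = 0" "P2 f = 1"
  using basis by (auto simp: P1_def P2_def mult.commute)

lemma Ti_T [simp]: "Ti (T z) = z"
  by (cases z) (simp add: Ti_def T_def linear_add[OF linear_P(1)] linear_add[OF linear_P(2)]
      linear_scale[OF linear_P(1)] linear_scale[OF linear_P(2)] P_ef)

lemma T_Ti [simp]: "T (Ti z) = z"
proof -
  define x where "x = z - \<phi> p"
  have "P1 x *\<^sub>R e + P2 x *\<^sub>R f = x"
  proof -
    define d where "d = e$1 * f$2 - e$2 * f$1"
    have d: "d \<noteq> 0" using basis by (simp add: d_def)
    have A: "P1 x * e$i + P2 x * f$i = ((x$1 * f$2 - x$2 * f$1) * e$i + (e$1 * x$2 - e$2 * x$1) * f$i) / d" for i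
      by (simp add: P1_def P2_def d_def add_divide_distrib)
    have C: "(x$1 * f$2 - x$2 * f$1) * e$1 + (e$1 * x$2 - e$2 * x$1) * f$1 = x$1 * d"
      "(x$1 * f$2 - x$2 * f$1) * e$2 + (e$1 * x$2 - e$2 * x$1) * f$2 = x$2 * d" by (simp_all add: d_def algebra_simps)
    have "P1 x * e$1 + P2 x * f$1 = x$1" "P1 x * e$2 + P2 x * f$2 = x$2"
      unfolding A C using d by simp_all
    then show ?thesis by (simp add: vec_eq_iff forall_2)
  qed
  then show ?thesis by (simp add: T_def Ti_def x_def algebra_simps)
qed

lemma cont_T: "continuous_on S T" and cont_Ti: "continuous_on S' Ti"
  unfolding T_def Ti_def P1_def P2_def using basis by (auto intro!: continuous_intros)

lemma UM: "U \<subseteq> topspace M" and NM: "N \<subseteq> topspace M"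
  using U(1) N(1) openin_subset by auto

lemma top_U: "topspace (subtopology M U) = U" and top_N: "topspace (subtopology M N) = N"
  using UM NM by auto

lemma inj_\<phi>: "inj_on \<phi> U"
  using homeomorphic_imp_injective_map[OF U(4)] unfolding top_U .

lemma inv_\<phi>: "y \<in> U ==> inv_into U \<phi> (\<phi> y) = y" "z \<in> \<phi> ` U ==> \<phi> (inv_into U \<phi> z) = z"
  "z \<in> \<phi> ` U ==> inv_into U \<phi> z \<in> U"
  by (auto simp: inv_into_f_f[OF inj_\<phi>] f_inv_into_f inv_into_into)

lemma \<Psi>_T: "T z \<in> \<phi> ` U ==> \<phi> (\<Psi> z) = T z" "T z \<in> \<phi> ` U ==> \<Psi> z \<in> U"
  by (auto simp: \<Psi>_def inv_\<phi>)

lemma \<Psi>_Ti: "y \<in> U ==> \<Psi> (Ti (\<phi> y)) = y"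
  by (simp add: \<Psi>_def inv_\<phi>)

lemma cont_inv: "continuous_map (top_of_set (\<phi> ` U)) M (inv_into U \<phi>)"
  by (rule continuous_chart_inv[OF U(1,4)])

lemma open_D: "open {z. T z \<in> \<phi> ` U}"
  using open_vimage[OF U(3) cont_T] by (simp add: vimage_def)

lemma cont_\<Psi>: "continuous_map (top_of_set {z. T z \<in> \<phi> ` U}) M \<Psi>"
proof -
  have "continuous_map (top_of_set {z. T z \<in> \<phi> ` U}) (top_of_set (\<phi> ` U)) T"
    by (intro continuous_map_into_subtopology) (auto simp: cont_T)
  from continuous_map_compose[OF this cont_inv]
  have "continuous_map (top_of_set {z. T z \<in> \<phi> ` U}) M (inv_into U \<phi> \<circ> T)" .
  moreover have "\<Psi> = inv_into U \<phi> \<circ> T" by (rule ext) (simp add: \<Psi>_def)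
  ultimately show ?thesis by (simp only:)
qed

lemma pre_\<Psi>: assumes "openin M V" shows "open {z. T z \<in> \<phi> ` U & \<Psi> z \<in> V}"
proof -
  have "openin (top_of_set {z. T z \<in> \<phi> ` U}) {z \<in> topspace (top_of_set {z. T z \<in> \<phi> ` U}). \<Psi> z \<in> V}"
    by (rule openin_continuous_map_preimage[OF cont_\<Psi> assms])
  then show ?thesis using openin_open_trans[OF _ open_D] by simp
qed

lemma open_B: "open B" unfolding B_def by (rule pre_\<Psi>[OF N(1)])

lemma T0: "T (0, 0) = \<phi> p" and \<Psi>0: "\<Psi> (0, 0) = p"
  using U(2) by (auto simp: T_def \<Psi>_def inv_\<phi>)

lemma cont_k: "continuous_on B k"
proof -
  have sub: "B \<subseteq> {z. T z \<in> \<phi> ` U}" by (auto simp: B_def)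
  have "continuous_map (top_of_set B) M \<Psi>"
    by (rule continuous_map_from_subtopology_mono[OF cont_\<Psi> sub])
  then have "continuous_map (top_of_set B) (subtopology M N) \<Psi>"
    by (intro continuous_map_into_subtopology) (auto simp: B_def)
  from continuous_map_compose[OF this homeomorphic_imp_continuous_map[OF N(3)]]
  have "continuous_map (top_of_set B) (top_of_set (g ` N)) (g \<circ> \<Psi>)" .
  moreover have "k = g \<circ> \<Psi>" by (rule ext) (simp add: k_def)
  ultimately have "continuous_map (top_of_set B) (top_of_set (g ` N)) k" by (simp only:)
  from continuous_map_into_fulltopology[OF this] show ?thesis by simp
qed

lemma gK: "g ` N \<subseteq> K" by (rule openin_imp_subset[OF N(4)])

lemma inj_g: "inj_on g N"
  using homeomorphic_imp_injective_map[OF N(3)] unfolding top_N .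

lemma inj_k: "inj_on k B"
proof (rule inj_onI)
  fix z z' assume z: "z \<in> B" "z' \<in> B" "k z = k z'"
  then have "\<Psi> z = \<Psi> z'" using inj_onD[OF inj_g] by (auto simp: B_def k_def)
  then have "T z = T z'" using \<Psi>_T(1) z unfolding B_def by (metis (mono_tags, lifting) mem_Collect_eq)
  then show "z = z'" using Ti_T by metis
qed

lemma k_open: assumes "open S" "S \<subseteq> B" shows "openin (top_of_set K) (k ` S)"
proof -
  have "T ` S = Ti -` S"
  proof
    show "Ti -` S \<subseteq> T ` S" using T_Ti by (metis image_eqI subsetI vimageE)
  qed auto
  then have "open (T ` S)" using open_vimage[OF assms(1) cont_Ti] by simp
  then have "openin (top_of_set (\<phi> ` U)) (T ` S)" using assms(2) by (intro open_subset) (auto simp: B_def)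
  then have "openin (subtopology M U) {y \<in> topspace (subtopology M U). \<phi> y \<in> T ` S}"
    by (rule openin_continuous_map_preimage[OF homeomorphic_imp_continuous_map[OF U(4)]])
  then have "openin M {y \<in> U. \<phi> y \<in> T ` S}" using openin_trans_full U(1) unfolding top_U by blast
  moreover have "{y \<in> U. \<phi> y \<in> T ` S} = \<Psi> ` S"
  proof
    show "\<Psi> ` S \<subseteq> {y \<in> U. \<phi> y \<in> T ` S}"
    proof (rule image_subsetI)
      fix z assume z: "z \<in> S"
      then have "T z \<in> \<phi> ` U" using assms(2) by (auto simp: B_def)
      then show "\<Psi> z \<in> {y \<in> U. \<phi> y \<in> T ` S}" using \<Psi>_T[of z] z by simp
    qed
    show "{y \<in> U. \<phi> y \<in> T ` S} \<subseteq> \<Psi> ` S"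
    proof
      fix y assume "y \<in> {y \<in> U. \<phi> y \<in> T ` S}"
      then obtain z where "y \<in> U" "z \<in> S" "\<phi> y = T z" by blast
      then have "y = \<Psi> z" by (simp add: \<Psi>_def inv_\<phi>(1) flip: \<open>\<phi> y = T z\<close>)
      then show "y \<in> \<Psi> ` S" using \<open>z \<in> S\<close> by blast
    qed
  qed
  ultimately have "openin M (\<Psi> ` S)" by simp
  moreover have "\<Psi> ` S \<subseteq> N" using assms(2) by (auto simp: B_def)
  ultimately have "openin (subtopology M N) (\<Psi> ` S)" using openin_open_subtopology[OF N(1)] by blast
  then have "openin (top_of_set (g ` N)) (g ` \<Psi> ` S)"
    using homeomorphic_imp_open_map[OF N(3)] by (simp add: open_map_def)
  moreover have "g ` \<Psi> ` S = k ` S" by (auto simp: k_def)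
  ultimately show ?thesis using openin_trans N(4) by metis
qed

lemma pM: "p \<in> topspace M" using U UM by blast

lemma stays_near:
  assumes "openin M V" "p \<in> V"
  obtains r where "r > 0" "\<And>z t. z \<in> bx r ==> \<bar>t\<bar> \<le> 1 ==> T z \<in> \<phi> ` U & w t (\<Psi> z) \<in> V"
proof -
  let ?W = "{x \<in> topspace (prod_topology euclideanreal M). (%(t, x). w t x) x \<in> V}"
  have W: "openin (prod_topology euclideanreal M) ?W"
    by (rule openin_continuous_map_preimage[OF _ assms(1)]) (use flowM in \<open>auto simp: flow_def\<close>)
  have C: "compactin euclideanreal {-1..1}" by simp
  have "{-1..1} \<times> {p} \<subseteq> ?W" using wp assms(2) pM by auto
  then obtain I Q where Q: "{-1..1} \<subseteq> I" "openin M Q" "p \<in> Q" "I \<times> Q \<subseteq> ?W"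
    using tube_lemma_left[OF W C pM] by blast
  have "open {z. T z \<in> \<phi> ` U & \<Psi> z \<in> Q}" by (rule pre_\<Psi>[OF Q(2)])
  moreover have "(0, 0) \<in> {z. T z \<in> \<phi> ` U & \<Psi> z \<in> Q}" using Q(3) T0 \<Psi>0 U(2) by auto
  ultimately obtain r where r: "r > 0" "bx r \<subseteq> {z. T z \<in> \<phi> ` U & \<Psi> z \<in> Q}" by (rule ibx_ball)
  show thesis
  proof (rule that[OF r(1)])
    fix z t assume z: "z \<in> bx r" and t: "\<bar>t::real\<bar> \<le> 1"
    have "T z \<in> \<phi> ` U" "\<Psi> z \<in> Q" using r(2) z by auto
    moreover have "t \<in> I" by (rule subsetD[OF Q(1)]) (use t in auto)
    ultimately show "T z \<in> \<phi> ` U & w t (\<Psi> z) \<in> V" using Q(4) by auto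
  qed
qed

text \<open>The unit time segment of \<open>w\<close> is reparametrized to a segment of
  \<open>v\<close> of some length \<open>q 1\<close>, which is positive as \<open>q\<close>
  increases strictly. By the intermediate value theorem the change of time is onto, so no part of
  the segment escapes \<open>V\<close>.\<close>

lemma transport:
  assumes z: "z \<in> B" and st: "\<And>t. 0 \<le> t ==> t \<le> 1 ==> w t (\<Psi> z) \<in> N & g (w t (\<Psi> z)) \<in> V" and U1: "w 1 (\<Psi> z) \<in> U"
  shows "\<exists>a>0. v a (k z) = k (G z) & (\<forall>t. 0 \<le> t & t \<le> a --> v t (k z) \<in> V)"
proof -
  have "\<Psi> z \<in> N" using z by (simp add: B_def)
  then have "\<exists>q :: real => real. q 0 = 0 & continuous_on {0..1} q & strict_mono_on {0..1} q &
      (\<forall>t\<in>{0..1}. g (w t (\<Psi> z)) = v (q t) (g (\<Psi> z)))"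
    using N(5)[unfolded maps_orbits_def, rule_format, of 1 "\<Psi> z"] st by auto
  then obtain q where q: "q 0 = 0" "continuous_on {0..1} q" "strict_mono_on {0..1} q"
    "\<And>t. t \<in> {0..1} ==> g (w t (\<Psi> z)) = v (q t) (k z)" unfolding k_def by blast
  have "q 1 > 0" using strict_mono_onD[OF q(3), of 0 1] q(1) by simp
  moreover have "v (q 1) (k z) = k (G z)" using q(4)[of 1] \<Psi>_Ti[OF U1] by (simp add: k_def G_def)
  moreover have "v t (k z) \<in> V" if t: "0 \<le> t" "t \<le> q 1" for t
  proof -
    obtain s where "0 \<le> s" "s \<le> 1" "q s = t" using IVT'[of q 0 t 1] q(1,2) t by auto
    then show ?thesis using q(4)[of s] st[of s] by auto
  qed
  ultimately show ?thesis by blast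
qed

lemma G0: "G (0, 0) = (0, 0)"
proof -
  have "Ti (\<phi> p) = (0, 0)" using Ti_T[of "(0, 0)"] T0 by simp
  then show ?thesis by (simp add: G_def \<Psi>0 wp)
qed

lemma P_bound:
  obtains C where "C > 0" "\<And>x. \<bar>P1 x\<bar> \<le> C * norm x" "\<And>x. \<bar>P2 x\<bar> \<le> C * norm x"
proof -
  obtain C1 C2 where 1: "C1 > 0" "\<And>x. norm (P1 x) \<le> norm x * C1" and 2: "C2 > 0" "\<And>x. norm (P2 x) \<le> norm x * C2"
    using bounded_linear.pos_bounded linear_P linear_conv_bounded_linear by metis
  show thesis
  proof (rule that[of "max C1 C2"])
    show "\<bar>P1 x\<bar> \<le> max C1 C2 * norm x" for x
      using 1(2)[of x] mult_left_mono[of C1 "max C1 C2" "norm x"] by (simp add: mult.commute)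
    show "\<bar>P2 x\<bar> \<le> max C1 C2 * norm x" for x
      using 2(2)[of x] mult_left_mono[of C2 "max C1 C2" "norm x"] by (simp add: mult.commute)
  qed (use 1 in simp)
qed

end

context sad
begin

lemma G_estimate:
  assumes h: "h > 0"
  obtains r where "r > 0" "continuous_on (bx r) G"
    "\<And>z z'. z \<in> bx r ==> z' \<in> bx r ==>
      \<bar>fst (G z) - fst (G z') - l * (fst z - fst z')\<bar> \<le> h * max \<bar>fst z - fst z'\<bar> \<bar>snd z - snd z'\<bar> &
      \<bar>snd (G z) - snd (G z') - m * (snd z - snd z')\<bar> \<le> h * max \<bar>fst z - fst z'\<bar> \<bar>snd z - snd z'\<bar>"
proof -
  obtain C where C: "C > 0" "\<And>x. \<bar>P1 x\<bar> \<le> C * norm x" "\<And>x. \<bar>P2 x\<bar> \<le> C * norm x" by (rule P_bound) blast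
  define D where "D = norm e + norm f + 1"
  have D: "D > 0" by (simp add: D_def add_nonneg_pos)
  have Td: "T z - T z' = (fst z - fst z') *\<^sub>R e + (snd z - snd z') *\<^sub>R f" for z z' by (simp add: T_def algebra_simps)
  have TD: "norm (T z - T z') \<le> D * max \<bar>fst z - fst z'\<bar> \<bar>snd z - snd z'\<bar>" for z z'
  proof -
    let ?m = "max \<bar>fst z - fst z'\<bar> \<bar>snd z - snd z'\<bar>"
    have "norm (T z - T z') \<le> \<bar>fst z - fst z'\<bar> * norm e + \<bar>snd z - snd z'\<bar> * norm f"
      unfolding Td by (rule order_trans[OF norm_triangle_ineq]) simp
    also have "\<dots> \<le> ?m * norm e + ?m * norm f" by (intro add_mono mult_right_mono) auto
    also have "\<dots> \<le> D * ?m" by (simp add: D_def algebra_simps)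
    finally show ?thesis .
  qed
  define H where "H z = \<phi> (w 1 (inv_into U \<phi> z))" for z
  \<comment> \<open>\<open>D\<close> bounds the passage from eigenvector coordinates to the chart
    and \<open>C\<close> the passage back; dividing by both leaves the error \<open>h\<close> in the
    eigenvector coordinates.\<close>
  have "h / (C * D) > 0" using h C D by simp
  then obtain d where d: "d > 0" "continuous_on (ball (\<phi> p) d) H"
    "\<And>z z'. z \<in> ball (\<phi> p) d ==> z' \<in> ball (\<phi> p) d ==> norm (H z - H z' - L (z - z')) \<le> h / (C * D) * norm (z - z')"
    using est unfolding H_def by meson
  have "open (T -` ball (\<phi> p) d)" by (intro open_vimage cont_T) auto
  moreover have "(0, 0) \<in> T -` ball (\<phi> p) d" using d(1) T0 by simp
  ultimately obtain r where r: "r > 0" "bx r \<subseteq> T -` ball (\<phi> p) d" by (rule ibx_ball)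
  have GH: "G z = Ti (H (T z))" for z by (simp add: G_def H_def \<Psi>_def)
  show thesis
  proof (rule that[OF r(1)])
    show "continuous_on (bx r) G"
      unfolding GH
      by (intro continuous_on_compose2[OF cont_Ti[of UNIV]] continuous_on_compose2[OF d(2)] cont_T) (use r(2) in auto)
    fix z z' assume z: "z \<in> bx r" "z' \<in> bx r"
    let ?m = "max \<bar>fst z - fst z'\<bar> \<bar>snd z - snd z'\<bar>" and ?R = "H (T z) - H (T z') - L (T z - T z')"
    have "norm ?R \<le> h / (C * D) * norm (T z - T z')" by (rule d(3)) (use z r(2) in auto)
    also have "\<dots> \<le> h / (C * D) * (D * ?m)" using TD h C D by (intro mult_left_mono) auto
    finally have R: "C * norm ?R \<le> h * ?m" using C D by (simp add: field_simps)
    have LT: "L (T z - T z') = (l * (fst z - fst z')) *\<^sub>R e + (m * (snd z - snd z')) *\<^sub>R f"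
      unfolding Td linear_add[OF L(1)] linear_scale[OF L(1)] L(2,3) by (simp add: mult.commute)
    have "P1 ?R = fst (G z) - fst (G z') - l * (fst z - fst z')"
      unfolding LT GH Ti_def
      by (simp add: linear_diff[OF linear_P(1)] linear_add[OF linear_P(1)] linear_scale[OF linear_P(1)] P_ef)
    moreover have "P2 ?R = snd (G z) - snd (G z') - m * (snd z - snd z')"
      unfolding LT GH Ti_def
      by (simp add: linear_diff[OF linear_P(2)] linear_add[OF linear_P(2)] linear_scale[OF linear_P(2)] P_ef)
    ultimately show "\<bar>fst (G z) - fst (G z') - l * (fst z - fst z')\<bar> \<le> h * ?m &
        \<bar>snd (G z) - snd (G z') - m * (snd z - snd z')\<bar> \<le> h * ?m"
      using C(2,3)[of ?R] R by auto
  qed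
qed

text \<open>The size of the box is left free below \<open>R0\<close>, because the flow and its
  reverse will have to share one box.\<close>

lemma hyp_small:
  assumes \<kappa>: "1 < \<kappa>" "\<kappa> < m" and \<nu>: "l < \<nu>" "\<nu> < 1" and gp: "\<And>t. v t (g p) = g p"
  obtains R0 where "R0 > 0"
    "\<And>R. 0 < R ==> R \<le> R0 ==> hyp K v (g p) k B R \<kappa> \<nu> G &
      (\<forall>z\<in>bx R. T z \<in> \<phi> ` U & w 1 (\<Psi> z) \<in> U)"
proof -
  define h where "h = min (m - \<kappa>) (\<nu> - l)"
  have h: "h > 0" "l + h \<le> \<nu>" "\<kappa> + h \<le> m" using assms by (auto simp: h_def)
  obtain r1 where r1: "r1 > 0" "continuous_on (bx r1) G"
    "\<And>z z'. z \<in> bx r1 ==> z' \<in> bx r1 ==>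
      \<bar>fst (G z) - fst (G z') - l * (fst z - fst z')\<bar> \<le> h * max \<bar>fst z - fst z'\<bar> \<bar>snd z - snd z'\<bar> &
      \<bar>snd (G z) - snd (G z') - m * (snd z - snd z')\<bar> \<le> h * max \<bar>fst z - fst z'\<bar> \<bar>snd z - snd z'\<bar>"
    by (rule G_estimate[OF h(1)]) blast
  have near: "\<exists>r>0. \<forall>z\<in>bx r. z \<in> B & T z \<in> \<phi> ` U & w 1 (\<Psi> z) \<in> U & G z \<in> B &
      (\<exists>q>0. v q (k z) = k (G z) & (\<forall>t. 0 \<le> t & t \<le> q --> v t (k z) \<in> V))" if V: "open V" "g p \<in> V" for V
  proof -
    have "openin (top_of_set (g ` N)) (g ` N \<inter> V)" using V(1) by (rule openin_open_Int)
    then have "openin (subtopology M N) {y \<in> topspace (subtopology M N). g y \<in> g ` N \<inter> V}"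
      by (rule openin_continuous_map_preimage[OF homeomorphic_imp_continuous_map[OF N(3)]])
    then have "openin M {y \<in> N. g y \<in> g ` N \<inter> V}" using openin_trans_full N(1) unfolding top_N by blast
    then have "openin M ({y \<in> N. g y \<in> g ` N \<inter> V} \<inter> U)" using U(1) by (rule openin_Int)
    then obtain r where r: "r > 0" "\<And>z t. z \<in> bx r ==> \<bar>t\<bar> \<le> 1 ==>
        T z \<in> \<phi> ` U & w t (\<Psi> z) \<in> {y \<in> N. g y \<in> g ` N \<inter> V} \<inter> U"
      by (rule stays_near) (use N(2) U(2) V(2) in auto)
    have "z \<in> B & T z \<in> \<phi> ` U & w 1 (\<Psi> z) \<in> U & G z \<in> B &
      (\<exists>q>0. v q (k z) = k (G z) & (\<forall>t. 0 \<le> t & t \<le> q --> v t (k z) \<in> V))" if z: "z \<in> bx r" for z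
    proof -
      have zU: "T z \<in> \<phi> ` U" "\<Psi> z \<in> U" using r(2)[OF z, of 0] \<Psi>_T by auto
      have "w 0 (\<Psi> z) = \<Psi> z" using flowM zU(2) UM unfolding flow_def by blast
      then have zB: "z \<in> B" using r(2)[OF z, of 0] zU by (simp add: B_def)
      have w1: "w 1 (\<Psi> z) \<in> U" "w 1 (\<Psi> z) \<in> N" using r(2)[OF z, of 1] by auto
      have "T (G z) = \<phi> (w 1 (\<Psi> z))" by (simp add: G_def)
      then have "G z \<in> B" using w1 \<Psi>_Ti[OF w1(1)] by (simp add: B_def G_def)
      then show ?thesis using transport[OF zB _ w1(1), of V] zB zU(1) w1(1) r(2)[OF z] by auto
    qed
    then show ?thesis using r(1) by blast
  qed
  obtain r2 where r2: "r2 > 0" "\<And>z. z \<in> bx r2 ==> z \<in> B & T z \<in> \<phi> ` U & w 1 (\<Psi> z) \<in> U & G z \<in> B &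
      (\<exists>q>0. v q (k z) = k (G z) & (\<forall>t. 0 \<le> t & t \<le> q --> v t (k z) \<in> UNIV))"
    using near[OF open_UNIV UNIV_I] by meson
  show thesis
  proof (rule that[of "min r1 r2"])
    fix R assume R: "0 < R" "R \<le> min r1 r2"
    have sub: "bx R \<subseteq> bx r1" "bx R \<subseteq> bx r2" using R by (auto intro!: bx_mono simp del: subset_iff)
    have Z: "z \<in> B & T z \<in> \<phi> ` U & w 1 (\<Psi> z) \<in> U & G z \<in> B & (\<exists>q>0. v q (k z) = k (G z))" if "z \<in> bx R" for z
      using r2(2)[of z] sub(2) that by blast
    have "hyp K v (g p) k B R \<kappa> \<nu> G"
    proof unfold_locales
      show "g p \<in> K" using gK N(2) by blast
      show "v t (g p) = g p" for t by (rule gp)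
      show "cones R \<kappa> \<nu> G"
        by (rule cones_of_estimate[of R G l h m], erule r1(3)[OF subsetD[OF sub(1)] subsetD[OF sub(1)]], assumption)
          (use h rates(1) \<kappa>(1) R(1) G0 in linarith | rule G0)+
      show "k ` B \<subseteq> K" using gK by (auto simp: B_def k_def)
      show "continuous_on (bx R) G" by (rule continuous_on_subset[OF r1(2) sub(1)])
      show "\<exists>r>0. r \<le> R & (\<forall>z\<in>bx r. \<exists>q>0. v q (k z) = k (G z) & (\<forall>t. 0 \<le> t & t \<le> q --> v t (k z) \<in> V))"
        if V: "open V" "g p \<in> V" for V
      proof -
        obtain r where r: "r > 0" "\<And>z. z \<in> bx r ==> \<exists>q>0. v q (k z) = k (G z) & (\<forall>t. 0 \<le> t & t \<le> q --> v t (k z) \<in> V)"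
          using near[OF V] by meson
        have "bx (min r R) \<subseteq> bx r" by (rule bx_mono) simp
        then show ?thesis using r R(1) by (intro exI[of _ "min r R"]) auto
      qed
      show "bx R \<subseteq> B" "G ` bx R \<subseteq> B" using Z by blast+
      show "\<exists>q>0. v q (k z) = k (G z)" if "z \<in> bx R" for z using Z[OF that] by blast
      show "k (0, 0) = g p" by (simp add: k_def \<Psi>0)
      show "G (0, 0) = (0, 0)" by (rule G0)
      show "0 < \<nu>" using rates(1) \<nu>(1) by simp
    qed (rule R(1) \<kappa>(1) \<nu>(2) open_B inj_k cont_k k_open, assumption?)+
    then show "hyp K v (g p) k B R \<kappa> \<nu> G & (\<forall>z\<in>bx R. T z \<in> \<phi> ` U & w 1 (\<Psi> z) \<in> U)" using Z by blast
  qed (use r1 r2 in simp)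
qed

end

text \<open>A backward segment is a forward segment read from its other end \<open>y'\<close>, and
  the change of time is measured from that end as well.\<close>

lemma maps_orbits_rv:
  assumes v: "cflow K v" and w: "flow M w" and N: "N \<subseteq> topspace M" "g ` N \<subseteq> K" and mo: "maps_orbits w N v g"
  shows "maps_orbits (rv w) N (rv v) g"
  unfolding maps_orbits_def
proof (intro allI impI)
  interpret cflow K v by (rule v)
  fix y and T :: real assume T: "0 \<le> T" and st: "\<forall>t\<in>{0..T}. rv w t y \<in> N" and y: "y \<in> N"
  define y' where "y' = w (- T) y"
  have wadd: "\<And>s t. w (s + t) y = w s (w t y)" using w y N(1) unfolding flow_def by blast
  have y': "y' \<in> N" using st T by (auto simp: y'_def rv_def)
  have wy': "w t y' = rv w (T - t) y" for t using wadd[of t "- T"] by (simp add: y'_def rv_def)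
  have "\<forall>t\<in>{0..T}. w t y' \<in> N" using st by (auto simp: wy')
  then obtain q where q: "q 0 = 0" "continuous_on {0..T} q" "strict_mono_on {0..T} q"
    "\<And>t. t \<in> {0..T} ==> g (w t y') = v (q t) (g y')"
    using mo[unfolded maps_orbits_def, rule_format, OF T _ y'] by blast
  have w0: "w 0 y = y" using w y N(1) unfolding flow_def by blast
  have gy': "g y' \<in> K" using y' N(2) by blast
  have gy: "g y = v (q T) (g y')" using q(4)[of T] T w0 by (simp add: wy' rv_def)
  show "\<exists>q'. q' 0 = 0 & continuous_on {0..T} q' & strict_mono_on {0..T} q' &
      (\<forall>t\<in>{0..T}. g (rv w t y) = rv v (q' t) (g y))"
  proof (intro exI[of _ "%t. q T - q (T - t)"] conjI ballI)
    show "continuous_on {0..T} (%t. q T - q (T - t))"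
      by (intro continuous_intros continuous_on_compose2[OF q(2)]) auto
    show "strict_mono_on {0..T} (%t. q T - q (T - t))"
      using strict_mono_onD[OF q(3)] by (auto intro!: strict_mono_onI)
    fix t assume t: "t \<in> {0..T}"
    have "g (rv w t y) = v (q (T - t)) (g y')" using q(4)[of "T - t"] t by (simp add: wy')
    also have "\<dots> = rv v (q T - q (T - t)) (g y)" unfolding gy rv_def using vadd[OF gy'] by simp
    finally show "g (rv w t y) = rv v (q T - q (T - t)) (g y)" .
  qed simp
qed

lemma flow_rv: assumes "flow M w" shows "flow M (rv w)"
proof -
  have "continuous_map (prod_topology euclideanreal M) (prod_topology euclideanreal M) (%(t, x). (- t, x))"
    unfolding case_prod_unfold
    by (intro continuous_map_pairedI continuous_map_snd)
      (auto intro: continuous_map_minus continuous_map_fst)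
  then have "continuous_map (prod_topology euclideanreal M) M ((%(t, x). w t x) \<circ> (%(t, x). (- t, x)))"
    using assms by (intro continuous_map_compose) (auto simp: flow_def)
  moreover have "(%(t, x). w t x) \<circ> (%(t, x). (- t, x)) = (%(t, x). rv w t x)" by (auto simp: rv_def fun_eq_iff)
  moreover have "rv w (s + t) x = rv w s (rv w t x)" if "x \<in> topspace M" for s t x
    using assms that unfolding flow_def rv_def by (metis minus_add_distrib)
  ultimately show ?thesis using assms by (auto simp: flow_def rv_def)
qed

text \<open>The derivative in the space variable is continuous and hence close to \<open>L\<close>
  on a small ball; the mean value inequality turns this into a bound for differences. Time stays a
  parameter so that the lemma serves for \<open>1\<close> and for \<open>-1\<close>.\<close>

lemma C1_estimate:
  assumes C: "C1_flow M \<A> w" "(U, \<phi>) \<in> \<A>" "p \<in> U" and p: "w t p = p"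
    and L: "((%z. \<phi> (w t (inv_into U \<phi> z))) has_derivative L) (at (\<phi> p))" and c: "c > 0"
  shows "\<exists>d>0. ball (\<phi> p) d \<subseteq> \<phi> ` U &
      continuous_on (ball (\<phi> p) d) (%z. \<phi> (w t (inv_into U \<phi> z))) &
      (\<forall>z\<in>ball (\<phi> p) d. \<forall>z'\<in>ball (\<phi> p) d.
        norm (\<phi> (w t (inv_into U \<phi> z)) - \<phi> (w t (inv_into U \<phi> z')) - L (z - z')) \<le> c * norm (z - z'))"
proof -
  have at: "C1_surface_atlas M \<A>" and fl: "flow M w" using C(1) by (auto simp: C1_flow_def)
  have U: "openin M U" "open (\<phi> ` U)" "homeomorphic_map (subtopology M U) (top_of_set (\<phi> ` U)) \<phi>"
    using at C(2) unfolding C1_surface_atlas_def by auto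
  define D where "D = {(t, z). z \<in> \<phi> ` U & w t (inv_into U \<phi> z) \<in> U}"
  define F where "F = (%(t, z). \<phi> (w t (inv_into U \<phi> z)))"
  define H where "H z = \<phi> (w t (inv_into U \<phi> z))" for z
  have "C1_on D F" using C(1,2) unfolding C1_flow_def D_def F_def by blast
  then obtain f' where f': "\<And>x. x \<in> D ==> (F has_derivative blinfun_apply (f' x)) (at x)" "continuous_on D f'"
    unfolding C1_on_def by blast
  have inj: "inj_on \<phi> U" using homeomorphic_imp_injective_map[OF U(3)] openin_subset[OF U(1)] by (simp add: Int_absorb1)
  have "continuous_map M M (w t)"
  proof -
    have "continuous_map M (prod_topology euclideanreal M) (%x. (t, x))" by (intro continuous_map_pairedI) auto
    from continuous_map_compose[OF this, of M "%(t, x). w t x"] fl show ?thesis by (auto simp: flow_def o_def)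
  qed
  from continuous_map_compose[OF continuous_chart_inv[OF U(1,3)] this]
  have "openin (top_of_set (\<phi> ` U)) {z \<in> topspace (top_of_set (\<phi> ` U)). (w t \<circ> inv_into U \<phi>) z \<in> U}"
    by (rule openin_continuous_map_preimage[OF _ U(1)])
  then have "open {z \<in> \<phi> ` U. w t (inv_into U \<phi> z) \<in> U}" using openin_open_trans[OF _ U(2)] by simp
  moreover have "\<phi> p \<in> {z \<in> \<phi> ` U. w t (inv_into U \<phi> z) \<in> U}" using C(3) p inv_into_f_f[OF inj] by simp
  ultimately obtain d1 where d1: "d1 > 0" "ball (\<phi> p) d1 \<subseteq> {z \<in> \<phi> ` U. w t (inv_into U \<phi> z) \<in> U}"
    using open_contains_ball by blast
  have inD: "(t, z) \<in> D" if "z \<in> ball (\<phi> p) d1" for z using d1(2) that by (auto simp: D_def)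
  have p0: "(t, \<phi> p) \<in> D" using inD d1(1) by simp
  obtain d2 where d2: "d2 > 0" "\<And>x. x \<in> D ==> dist x (t, \<phi> p) < d2 ==> dist (f' x) (f' (t, \<phi> p)) < c"
    using f'(2) p0 c unfolding continuous_on_iff by blast
  define d where "d = min d1 d2"
  have d: "d > 0" "ball (\<phi> p) d \<subseteq> ball (\<phi> p) d1" using d1 d2 by (auto simp: d_def)
  define Dz where "Dz z = (%h. blinfun_apply (f' (t, z)) (0, h))" for z
  have der: "(H has_derivative Dz z) (at z)" if "z \<in> ball (\<phi> p) d" for z
  proof -
    have "((%z. (t, z)) has_derivative (%h. (0, h))) (at z)" by (auto intro!: derivative_eq_intros)
    moreover have "(F has_derivative blinfun_apply (f' (t, z))) (at (t, z))"
      using f'(1) inD d(2) that by blast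
    ultimately have "((%z. F (t, z)) has_derivative (%h. blinfun_apply (f' (t, z)) (0, h))) (at z)"
      by (rule has_derivative_compose)
    then show ?thesis by (simp add: F_def H_def[abs_def] Dz_def)
  qed
  have LD: "L = Dz (\<phi> p)"
    by (rule has_derivative_unique[of H]) (use L der d(1) in \<open>auto simp: H_def[abs_def]\<close>)
  have "norm (H z - H z' - L (z - z')) \<le> norm (z - z') * c" if z: "z \<in> ball (\<phi> p) d" "z' \<in> ball (\<phi> p) d" for z z'
    unfolding LD
  proof (rule differentiable_bound_linearization[where f = H and f' = Dz and ?x0.0 = "\<phi> p"
        and S = "ball (\<phi> p) d" and a = z' and b = z])
    show "z' + u *\<^sub>R (z - z') \<in> ball (\<phi> p) d" if "u \<in> {0..1}" for u
      using convexD_alt[OF convex_ball z(2,1), of u] that by (simp add: algebra_simps)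
    show "(H has_derivative Dz x) (at x within ball (\<phi> p) d)" if "x \<in> ball (\<phi> p) d" for x
      using der[OF that] has_derivative_at_withinI by blast
    show "onorm (Dz x - Dz (\<phi> p)) \<le> c" if x: "x \<in> ball (\<phi> p) d" for x
    proof (rule onorm_le)
      fix h
      have "dist (t, x) (t, \<phi> p) < d2" using x by (simp add: dist_Pair_Pair d_def dist_commute)
      then have n: "norm (f' (t, x) - f' (t, \<phi> p)) \<le> c"
        using d2(2)[OF inD] x d(2) by (simp add: dist_norm less_imp_le subset_iff)
      have "norm ((Dz x - Dz (\<phi> p)) h) = norm (blinfun_apply (f' (t, x) - f' (t, \<phi> p)) (0, h))"
        by (simp add: Dz_def blinfun.diff_left)
      also have "\<dots> \<le> norm (f' (t, x) - f' (t, \<phi> p)) * norm (0 :: real, h)" by (rule norm_blinfun)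
      also have "\<dots> \<le> c * norm h" using n by (simp add: norm_Pair mult_right_mono)
      finally show "norm ((Dz x - Dz (\<phi> p)) h) \<le> c * norm h" .
    qed
  qed (use d in simp)
  moreover have "continuous_on (ball (\<phi> p) d) H"
    using der has_derivative_continuous by (intro continuous_at_imp_continuous_on ballI) blast
  moreover have "ball (\<phi> p) d \<subseteq> \<phi> ` U" using d(2) d1(2) by blast
  ultimately show ?thesis using d(1) unfolding H_def by (intro exI[of _ d]) (auto simp: mult.commute)
qed

text \<open>For the reversed flow \<open>e\<close> and \<open>f\<close> exchange their roles. This
  swaps the coordinates, so that the two charts and the two time maps fit together as
  \<open>hyp_pair\<close> requires.\<close>

lemma sad_sectors:
  assumes 1: "sad K v M w U \<phi> p e f l m N g L" and 2: "sad K (rv v) M (rv w) U \<phi> p f e l' m' N g L'"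
    and gp: "\<And>t. v t (g p) = g p"
  shows "sectors K v (g p)"
proof -
  interpret a: sad K v M w U \<phi> p e f l m N g L by (rule 1)
  interpret b: sad K "rv v" M "rv w" U \<phi> p f e l' m' N g L' by (rule 2)
  \<comment> \<open>\<kappa> and \<nu> are midpoints between 1 and the weaker rates of the two
    directions, since both directions share one pair of constants.\<close>
  define \<kappa> where "\<kappa> = (1 + min m m') / 2"
  define \<nu> where "\<nu> = (1 + max l l') / 2"
  have r: "1 < \<kappa>" "\<kappa> < m" "\<kappa> < m'" "l < \<nu>" "l' < \<nu>" "\<nu> < 1"
    using a.rates b.rates by (auto simp: \<kappa>_def \<nu>_def min_def max_def)
  obtain R1 where R1: "R1 > 0" "\<And>R. 0 < R ==> R \<le> R1 ==> hyp K v (g p) a.k a.B R \<kappa> \<nu> a.G &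
      (\<forall>z\<in>bx R. a.T z \<in> \<phi> ` U & w 1 (a.\<Psi> z) \<in> U)" by (rule a.hyp_small[OF r(1,2,4,6) gp]) blast
  obtain R2 where R2: "R2 > 0" "\<And>R. 0 < R ==> R \<le> R2 ==> hyp K (rv v) (g p) b.k b.B R \<kappa> \<nu> b.G"
    by (rule b.hyp_small[OF r(1,3,5,6)]) (use gp in \<open>auto simp: rv_def\<close>)
  define R where "R = min R1 R2"
  have R: "R > 0" "R \<le> R1" "R \<le> R2" using R1 R2 by (auto simp: R_def)
  have T: "b.T z = a.T (prod.swap z)" for z by (simp add: a.T_def b.T_def)
  \<comment> \<open>Exchanging \<open>e\<close> and \<open>f\<close> changes the sign of both the
    numerators and the determinant.\<close>
  have P: "b.P1 x = a.P2 x" "b.P2 x = a.P1 x" for x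
    unfolding a.P1_def a.P2_def b.P1_def b.P2_def
    by (subst minus_divide_divide[symmetric], simp add: algebra_simps)+
  have Ti: "b.Ti z = prod.swap (a.Ti z)" for z by (simp add: a.Ti_def b.Ti_def P)
  have \<Psi>: "b.\<Psi> z = a.\<Psi> (prod.swap z)" for z by (simp add: a.\<Psi>_def b.\<Psi>_def T)
  have k: "b.k = a.k \<circ> prod.swap" by (rule ext) (simp add: a.k_def b.k_def \<Psi>)
  have B: "b.B = prod.swap ` a.B"
  proof
    show "prod.swap ` a.B \<subseteq> b.B" by (rule image_subsetI) (simp add: a.B_def b.B_def T \<Psi>)
    show "b.B \<subseteq> prod.swap ` a.B"
    proof
      fix z assume "z \<in> b.B"
      then have "prod.swap z \<in> a.B" by (simp add: a.B_def b.B_def T \<Psi>)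
      then show "z \<in> prod.swap ` a.B" by (metis image_eqI swap_swap)
    qed
  qed
  have Z: "a.T z \<in> \<phi> ` U" "w 1 (a.\<Psi> z) \<in> U" if "z \<in> bx R" for z using R1(2)[OF R(1,2)] that by blast+
  have inv: "b.G (prod.swap (a.G z)) = prod.swap z" if z: "z \<in> bx R" for z
  proof -
    have "a.\<Psi> z \<in> topspace M" using a.\<Psi>_T(2)[OF Z(1)[OF z]] a.UM by blast
    then have "w (- 1) (w 1 (a.\<Psi> z)) = a.\<Psi> z" using a.flowM unfolding flow_def by (metis ab_left_minus)
    then have "rv w 1 (b.\<Psi> (prod.swap (a.G z))) = a.\<Psi> z"
      unfolding \<Psi> swap_swap a.G_def a.\<Psi>_Ti[OF Z(2)[OF z]] by (simp add: rv_def)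
    then have "b.G (prod.swap (a.G z)) = prod.swap (a.Ti (a.T z))"
      unfolding b.G_def Ti using a.\<Psi>_T(1)[OF Z(1)[OF z]] by simp
    then show ?thesis by simp
  qed
  have "hyp_pair K v (g p) a.k a.B R \<kappa> \<nu> a.G b.G"
    unfolding hyp_pair_def hyp_pair_axioms_def
    using R1(2)[OF R(1,2)] R2(2)[OF R(1,3)] inv unfolding k B by blast
  then show ?thesis by (rule hyp_pair.sectors)
qed

theorem saddle_sectors:
  assumes v: "cflow K v" and s: "C1_saddle M \<A> w p"
    and N: "openin M N" "p \<in> N" "homeomorphic_map (subtopology M N) (top_of_set (g ` N)) g"
      "openin (top_of_set K) (g ` N)" "maps_orbits w N v g"
    and gp: "\<And>t. v t (g p) = g p"
  shows "sectors K v (g p)" "sectors K (rv v) (g p)"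
proof -
  have fl: "C1_flow M \<A> w" and wp: "\<And>t. w t p = p" using s by (auto simp: C1_saddle_def Sing_def)
  have fM: "flow M w" using fl by (simp add: C1_flow_def)
  obtain U \<phi> and L :: "real => real^2 => real^2" and a b e f where U: "(U, \<phi>) \<in> \<A>" "p \<in> U"
    and L: "\<And>t. ((%z. \<phi> (w t (inv_into U \<phi> z))) has_derivative L t) (at (\<phi> p))"
    and ab: "a < 0" "0 < b" "e \<noteq> 0" "f \<noteq> 0"
    and ef: "\<And>t. L t e = exp (t * a) *\<^sub>R e" "\<And>t. L t f = exp (t * b) *\<^sub>R f"
    using s unfolding C1_saddle_def by blast
  have at: "openin M U" "open (\<phi> ` U)" "homeomorphic_map (subtopology M U) (top_of_set (\<phi> ` U)) \<phi>"
    using fl U(1) unfolding C1_flow_def C1_surface_atlas_def by auto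
  have lin: "linear (L t)" for t using L has_derivative_linear by blast
  \<comment> \<open>Parallel eigenvectors would belong to the same eigenvalue, whereas
    \<open>exp a < 1 < exp b\<close>.\<close>
  have basis: "e$1 * f$2 - e$2 * f$1 \<noteq> 0"
  proof
    assume z: "e$1 * f$2 - e$2 * f$1 = 0"
    have "\<exists>c. f = c *\<^sub>R e"
    proof (cases "e$1 = 0")
      case True
      then have "e$2 \<noteq> 0" using ab(3) by (auto simp: vec_eq_iff forall_2)
      then show ?thesis using z True by (intro exI[of _ "f$2 / e$2"]) (auto simp: vec_eq_iff forall_2 field_simps)
    next
      case False
      then show ?thesis using z by (intro exI[of _ "f$1 / e$1"]) (auto simp: vec_eq_iff forall_2 field_simps)
    qed
    then obtain c where c: "f = c *\<^sub>R e" by blast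
    have "exp b *\<^sub>R f = L 1 f" using ef(2)[of 1] by simp
    also have "\<dots> = exp a *\<^sub>R f" using linear_scale[OF lin] ef(1)[of 1] by (simp add: c)
    finally have "exp a = exp b" using ab(4) by simp
    then show False using ab by simp
  qed
  then have basis': "f$1 * e$2 - f$2 * e$1 \<noteq> 0" by (simp add: mult.commute)
  have gK: "g ` N \<subseteq> K" by (rule openin_imp_subset[OF N(4)])
  note est = C1_estimate[OF fl U wp L]
  note est' = est[of _ "-1", folded rv_def[of w 1]]
  have wp': "rv w t p = p" for t by (simp add: rv_def wp)
  have 1: "sad K v M w U \<phi> p e f (exp a) (exp b) N g (L 1)"
    by (rule sad.intro[OF v], rule sad_axioms.intro)
      (rule fM wp at U(2) basis lin N | erule est | (use ef[of 1] ab(1,2) in simp))+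
  have 2: "sad K (rv v) M (rv w) U \<phi> p f e (exp (- b)) (exp (- a)) N g (L (- 1))"
    by (rule sad.intro[OF cflow.cflow_rv[OF v]], rule sad_axioms.intro)
      (rule flow_rv[OF fM] wp' at U(2) basis' lin N(1-4) maps_orbits_rv[OF v fM openin_subset[OF N(1)] gK N(5)]
        | erule est' | (use ef[of "-1"] ab(1,2) in simp))+
  show "sectors K v (g p)" by (rule sad_sectors[OF 1 2 gp])
  show "sectors K (rv v) (g p)"
    by (rule sad_sectors[OF 2]) (use 1 gp in \<open>simp_all add: rv_def[of v]\<close>)
qed

section \<open>Transfinite iteration and embedding\<close>

text \<open>All stages remain in the union of the finite ones once \<open>F\<close> maps this union
  into itself. Conversely, an infinite index type carries a well-order of type omega on a subset,
  and the iteration along it runs through the finite stages.\<close>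

lemma ord_iter_range:
  fixes A :: "'b set" and F :: "'b set => 'b set"
  assumes inf: "infinite (UNIV :: 'i set)"
    and F: "mono F" and L: "F (\<Union>n. (F ^^ n) A) \<subseteq> (\<Union>n. (F ^^ n) A)"
  shows "\<Union>{ord_iter r F A q | (r :: 'i rel) q. Well_order r & q \<in> Field r} = (\<Union>n. (F ^^ n) A)" (is "?X = ?L")
proof
  have "ord_iter r F A q \<subseteq> ?L" if r: "Well_order r" for r :: "'i rel" and q
  proof -
    have "wf (r - Id)" using r by (simp add: well_order_on_def)
    then show ?thesis
    proof (induction q)
      case (less i)
      have IH: "ord_iter r F A j \<subseteq> ?L" if "j \<in> underS r i" for j using less that by (auto simp: underS_def)
      consider "underS r i = {}" | j where "j \<in> Field r" "underS r i = under r j"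
        | "underS r i \<noteq> {}" "\<not> (\<exists>j\<in>Field r. underS r i = under r j)" by blast
      then show ?case
      proof cases
        case 1
        have "A = (F ^^ 0) A" by simp
        then show ?thesis unfolding ord_iter_zero[OF r 1] by blast
      next
        case (2 j)
        have "j \<in> underS r i" using r 2 by (auto simp: order_on_defs under_def refl_on_def)
        then have "F (ord_iter r F A j) \<subseteq> F ?L" by (intro monoD[OF F] IH)
        then show ?thesis unfolding ord_iter_succ[OF r 2] using L by blast
      next
        case 3
        then show ?thesis unfolding ord_iter_limit[OF r 3] using IH by blast
      qed
    qed
  qed
  then show "?X \<subseteq> ?L" by blast
  obtain f :: "nat => 'i" where f: "inj f" using infinite_countable_subset[OF inf] by blast
  define r where "r = dir_image natLeq f"
  have r: "Well_order r" unfolding r_def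
    by (rule Well_order_dir_image[OF natLeq_Well_order]) (use f inj_on_subset in blast)
  have rf: "r = {(f i, f j) | i j. i \<le> j}" by (auto simp: r_def dir_image_def natLeq_def)
  have Fd: "f n \<in> Field r" for n using rf by (force simp: Field_def)
  have "ord_iter r F A (f n) = (F ^^ n) A" for n
  proof (induction n)
    case 0
    have "underS r (f 0) = {}" by (auto simp: underS_def rf inj_eq[OF f])
    then show ?case using ord_iter_zero[OF r] by simp
  next
    case (Suc n)
    have "underS r (f (Suc n)) = under r (f n)"
      by (auto simp: underS_def under_def rf inj_eq[OF f])
    from ord_iter_succ[OF r Fd this, of F A] show ?case by (simp add: Suc)
  qed
  then show "?L \<subseteq> ?X" using r Fd by blast
qed

text \<open>Urysohn's construction: for each pair of sets of a countable base that some continuous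
  function separates, one such function is chosen. The zero function is added so that the family is
  nonempty and can be enumerated. Compactness makes the resulting continuous injection an
  embedding.\<close>

lemma compact_embedding:
  assumes S: "compact_space S" "Hausdorff_space S" "second_countable S"
  obtains \<iota> :: "'a => nat => real" where "homeomorphic_map S (top_of_set (\<iota> ` topspace S)) \<iota>"
proof -
  obtain \<B> where B0: "countable \<B> & (\<forall>V\<in>\<B>. openin S V) &
      (\<forall>U x. openin S U & x \<in> U --> (\<exists>V\<in>\<B>. x \<in> V & V \<subseteq> U))"
    using S(3)[unfolded second_countable_def] by (elim exE)
  then have B: "countable \<B>" "\<And>U x. openin S U ==> x \<in> U ==> \<exists>V\<in>\<B>. x \<in> V & V \<subseteq> U" by simp_all
  define sep where "sep U V f \<longleftrightarrow> continuous_map S euclideanreal f & (\<forall>x\<in>U. f x < 1/3) & (\<forall>x\<in>V. f x > 2/3)" for U V f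
  define f where "f = (%(U, V). if \<exists>g. sep U V g then SOME g. sep U V g else (%x. 0))"
  have fsep: "sep U V (f (U, V))" if "\<exists>g. sep U V g" for U V
    using someI_ex[OF that] that by (simp add: f_def)
  have fc: "continuous_map S euclideanreal (f z)" for z
  proof (cases "\<exists>g. sep (fst z) (snd z) g")
    case True
    then show ?thesis using fsep[of "fst z" "snd z"] by (simp add: sep_def)
  next
    case False
    then have "f z = (%x. 0)" by (simp only: f_def case_prod_unfold if_False)
    then show ?thesis by simp
  qed
  define G where "G = insert (%x. 0) (f ` (\<B> \<times> \<B>))"
  have G: "countable G" "G \<noteq> {}" using B(1) by (auto simp: G_def)
  define \<iota> where "\<iota> x n = from_nat_into G n x" for x n
  have "continuous_map S euclideanreal (from_nat_into G n)" for n
    using from_nat_into[OF G(2), of n] fc by (auto simp: G_def)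
  then have c: "continuous_map S euclidean \<iota>"
    unfolding euclidean_product_topology[symmetric] continuous_map_componentwise_UNIV by (simp add: \<iota>_def)
  have inj: "inj_on \<iota> (topspace S)"
  proof (rule inj_onI, rule ccontr)
    fix x y assume x: "x \<in> topspace S" and y: "y \<in> topspace S" and eq: "\<iota> x = \<iota> y" and ne: "x \<noteq> y"
    have ns: "normal_space S" using S compact_Hausdorff_or_regular_imp_normal_space by blast
    note cl = closedin_t1_singleton[OF Hausdorff_imp_t1_space[OF S(2)]]
    have "disjnt {x} {y}" using ne by simp
    then obtain g where g: "continuous_map S (top_of_set {0..1::real}) g" "g ` {x} \<subseteq> {0}" "g ` {y} \<subseteq> {1}"
      by (rule Urysohn_lemma[OF ns cl[OF x] cl[OF y] _ zero_le_one])
    have gc: "continuous_map S euclideanreal g" by (rule continuous_map_into_fulltopology[OF g(1)])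
    have op: "openin S {z \<in> topspace S. g z \<in> {..<1/3}}" "openin S {z \<in> topspace S. g z \<in> {2/3<..}}"
      by (rule openin_continuous_map_preimage[OF gc], simp)+
    have "x \<in> {z \<in> topspace S. g z \<in> {..<1/3}}" "y \<in> {z \<in> topspace S. g z \<in> {2/3<..}}" using x y g(2,3) by auto
    then obtain U V where U: "U \<in> \<B>" "x \<in> U" "U \<subseteq> {z \<in> topspace S. g z \<in> {..<1/3}}"
      and V: "V \<in> \<B>" "y \<in> V" "V \<subseteq> {z \<in> topspace S. g z \<in> {2/3<..}}"
      using B(2)[OF op(1)] B(2)[OF op(2)] by meson
    then have UV: "sep U V g" "f (U, V) \<in> G" using gc U V by (auto simp: sep_def G_def)
    then have "sep U V (f (U, V))" by (intro fsep) blast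
    then have "f (U, V) x \<noteq> f (U, V) y" using U(2) V(2) by (force simp: sep_def)
    moreover obtain n where "from_nat_into G n = f (U, V)" using from_nat_into_surj[OF G(1) UV(2)] by blast
    ultimately show False using fun_cong[OF eq, of n] by (simp add: \<iota>_def)
  qed
  have "homeomorphic_map S (top_of_set (\<iota> ` topspace S)) \<iota>"
  proof (rule continuous_imp_homeomorphic_map[OF _ S(1)])
    show "Hausdorff_space (top_of_set (\<iota> ` topspace S))" by (intro Hausdorff_space_subtopology) simp
    show "continuous_map S (top_of_set (\<iota> ` topspace S)) \<iota>" using c by (intro continuous_map_into_subtopology) auto
  qed (use inj in auto)
  then show thesis by (rule that)
qed

text \<open>This makes the index type of the transfinite iteration infinite, so that all finite
  stages occur. In a chart, a vertical segment going up from any point stays in the half plane, also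
  from its edge.\<close>

lemma surface_infinite:
  assumes S: "surface X" "x \<in> topspace X"
  shows "infinite (topspace X)"
proof
  assume fin: "finite (topspace X)"
  obtain U V where U: "openin X U" "x \<in> U" and V: "openin (top_of_set {z :: real^2. 0 \<le> z $ 2}) V"
    and "subtopology X U homeomorphic_space top_of_set V"
    using S unfolding surface_def by blast
  then obtain f where f: "homeomorphic_map (subtopology X U) (top_of_set V) f"
    unfolding homeomorphic_space by blast
  have top: "topspace (subtopology X U) = U" using openin_subset[OF U(1)] by auto
  have fV: "f ` U = V" using homeomorphic_imp_surjective_map[OF f] unfolding top by simp
  then have finV: "finite V" using fin openin_subset[OF U(1)] finite_subset by blast
  define z where "z = f x"
  have zV: "z \<in> V" using fV U(2) by (auto simp: z_def)
  obtain G where G: "open G" "V = {z. 0 \<le> z $ 2} \<inter> G" using V unfolding openin_open by blast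
  obtain e where e: "e > 0" "ball z e \<subseteq> G" using G zV open_contains_ball by blast
  define c where "c t = z + t *\<^sub>R axis 2 1" for t :: real
  have "c ` {0..<e} \<subseteq> V"
  proof (rule image_subsetI)
    fix t assume t: "t \<in> {0..<e}"
    have "c t \<in> ball z e" using t by (simp add: c_def dist_norm)
    moreover have "0 \<le> c t $ 2" using t zV G(2) by (simp add: c_def)
    ultimately show "c t \<in> V" using G(2) e(2) by blast
  qed
  then have "finite (c ` {0..<e})" using finV finite_subset by blast
  moreover have "inj_on c {0..<e}" by (auto simp: inj_on_def c_def axis_eq_0_iff)
  ultimately have "finite {0..<e}" using finite_imageD by blast
  then show False using e(1) infinite_Ico by blast
qed

section \<open>Flows on compact surfaces as flows on compact metric spaces\<close>

lemma (in cflow) olim_INT: "olim v x = (\<Inter>T. closure ((%t. v t x) ` {T..}))"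
proof
  show "olim v x \<subseteq> (\<Inter>T. closure ((%t. v t x) ` {T..}))"
  proof (intro subsetI INT_I)
    fix y T assume y: "y \<in> olim v x"
    have "\<exists>z\<in>(%t. v t x) ` {T..}. dist z y < e" if "e > 0" for e using olimD[OF y that, of T] by auto
    then show "y \<in> closure ((%t. v t x) ` {T..})" by (simp add: closure_approachable)
  qed
  show "(\<Inter>T. closure ((%t. v t x) ` {T..})) \<subseteq> olim v x"
  proof
    fix y assume y: "y \<in> (\<Inter>T. closure ((%t. v t x) ` {T..}))"
    show "y \<in> olim v x"
    proof (rule olimI)
      fix T e :: real assume e: "e > 0"
      have "y \<in> closure ((%t. v t x) ` {T..})" using y by blast
      then have "\<exists>z\<in>(%t. v t x) ` {T..}. dist z y < e" using e by (simp only: closure_approachable)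
      then show "\<exists>t\<ge>T. dist (v t x) y < e" by auto
    qed
  qed
qed

lemma omega_limit_rv: "omega_limit S (rv v) x = alpha_limit S v x"
proof -
  have "(%t. rv v t x) ` {T..} = (%t. v t x) ` {..- T}" for T
  proof -
    have "(%t. v t x) ` uminus ` {T..} = (%t. rv v t x) ` {T..}" by (simp only: image_image rv_def)
    then show ?thesis by simp
  qed
  then have "omega_limit S (rv v) x = (\<Inter>T. S closure_of ((%t. v t x) ` {..- T}))" by (simp add: omega_limit_def)
  also have "\<dots> = alpha_limit S v x"
  proof -
    have "range uminus = (UNIV :: real set)" by (rule surj_uminus)
    then have "(\<Inter>T. S closure_of ((%t. v t x) ` {..T})) = (\<Inter>T\<in>range uminus. S closure_of ((%t. v t x) ` {..T}))" by simp
    then show ?thesis by (simp only: alpha_limit_def image_image)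
  qed
  finally show ?thesis .
qed

text \<open>One operator serves both directions. The saddles are passed as a predicate, because the
  step of the reversed flow still refers to the saddles of \<open>v\<close>.\<close>

definition limit_step :: "'a topology => (real => 'a => 'a) => ('a => bool) => 'a set => 'a set" where
  "limit_step S v Q A = A \<union> \<Union>{Wu S v p | p x'. x' \<in> A & omega_limit S v x' = {p} & Q p}"

lemma limit_step_iff:
  "y \<in> limit_step S v Q A \<longleftrightarrow> y \<in> A \<or> (\<exists>z p. z \<in> A & omega_limit S v z = {p} & Q p & y \<in> Wu S v p)"
  by (auto simp: limit_step_def)

lemma ext_pos_step_eq: "ext_pos_step S v = limit_step S v (saddle S v)"
  by (simp add: ext_pos_step_def limit_step_def fun_eq_iff)

lemma ext_neg_step_eq: "ext_neg_step S v = limit_step S (rv v) (saddle S v)"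
  by (simp add: ext_neg_step_def limit_step_def fun_eq_iff Wu_def Ws_def omega_limit_rv
      omega_limit_rv[of _ "rv v", symmetric, simplified])

lemma neg_orbit_eq: "neg_orbit v x = pos_orbit (rv v) x"
proof -
  have "(%t. v t x) ` uminus ` {0..} = (%t. rv v t x) ` {0..}" by (simp only: image_image rv_def)
  then show ?thesis by (simp add: neg_orbit_def pos_orbit_def)
qed

text \<open>A step starts from a single point, which already belongs to some finite stage; so the
  union of the finite stages is closed under it.\<close>

lemma limit_step_iter:
  fixes A :: "'a set"
  assumes "infinite (UNIV :: 'a set)"
  shows "\<Union>{ord_iter r (limit_step S v Q) A q | (r :: 'a set rel) q. Well_order r & q \<in> Field r}
    = (\<Union>n. (limit_step S v Q ^^ n) A)"
proof (rule ord_iter_range)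
  show "infinite (UNIV :: 'a set set)" using assms by (metis finite_Pow_iff Pow_UNIV)
  show "mono (limit_step S v Q)" by (rule monoI) (auto simp: limit_step_def)
  show "limit_step S v Q (\<Union>n. (limit_step S v Q ^^ n) A) \<subseteq> (\<Union>n. (limit_step S v Q ^^ n) A)"
  proof
    fix y assume "y \<in> limit_step S v Q (\<Union>n. (limit_step S v Q ^^ n) A)"
    then obtain n where "y \<in> limit_step S v Q ((limit_step S v Q ^^ n) A)" by (auto simp: limit_step_def)
    then have "y \<in> (limit_step S v Q ^^ Suc n) A" by simp
    then show "y \<in> (\<Union>n. (limit_step S v Q ^^ n) A)" by blast
  qed
qed

locale embedded_flow =
  fixes S :: "'a topology" and v :: "real => 'a => 'a" and \<iota> :: "'a => nat => real"
  assumes flowS: "flow S v" and compS: "compact_space S"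
    and hom: "homeomorphic_map S (top_of_set (\<iota> ` topspace S)) \<iota>"
begin

definition K where "K = \<iota> ` topspace S"

definition \<kappa> where "\<kappa> = inv_into (topspace S) \<iota>"

definition u where "u t y = \<iota> (v t (\<kappa> y))"

lemma homK: "homeomorphic_map S (top_of_set K) \<iota>"
  using hom by (simp add: K_def)

lemma inj: "inj_on \<iota> (topspace S)"
  using homeomorphic_imp_injective_map[OF hom] .

lemma \<kappa>: "x \<in> topspace S ==> \<kappa> (\<iota> x) = x" "y \<in> K ==> \<iota> (\<kappa> y) = y" "y \<in> K ==> \<kappa> y \<in> topspace S"
  by (auto simp: \<kappa>_def K_def inv_into_f_f[OF inj])

lemma \<iota>K: "x \<in> topspace S ==> \<iota> x \<in> K"
  by (simp add: K_def)

lemma vin: "x \<in> topspace S ==> v t x \<in> topspace S"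
  using flowS continuous_map_image_subset_topspace[of "prod_topology euclideanreal S" S "%(t, x). v t x"]
  unfolding flow_def by fastforce

lemma u_\<iota>: "x \<in> topspace S ==> u t (\<iota> x) = \<iota> (v t x)"
  by (simp add: u_def \<kappa>)

lemma cont_\<kappa>: "continuous_map (top_of_set K) S \<kappa>"
proof -
  obtain h where h: "homeomorphic_maps S (top_of_set K) \<iota> h" using homK unfolding homeomorphic_map_maps by blast
  then have c: "continuous_map (top_of_set K) S h" and hx: "\<forall>x\<in>topspace S. h (\<iota> x) = x"
    unfolding homeomorphic_maps_def by blast+
  show ?thesis
  proof (rule continuous_map_eq[OF c])
    fix y assume "y \<in> topspace (top_of_set K)"
    then have "y \<in> K" by simp
    then show "h y = \<kappa> y" using hx \<kappa>(2,3) by metis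
  qed
qed

lemma cflow_u: "cflow K u"
proof
  have "compactin euclidean (\<iota> ` topspace S)"
    using compS continuous_map_into_fulltopology[OF homeomorphic_imp_continuous_map[OF hom]]
    by (intro image_compactin[of S]) (simp_all add: compact_space_def)
  then show "compact K" by (simp add: K_def)
  have "continuous_map (prod_topology euclideanreal (top_of_set K)) (prod_topology euclideanreal S) (%(t, y). (t, \<kappa> y))"
    using continuous_map_prod_top[of euclideanreal "top_of_set K" euclideanreal S "%t. t" \<kappa>] cont_\<kappa> by simp
  from continuous_map_compose[OF this, of S "%(t, x). v t x"]
  have "continuous_map (prod_topology euclideanreal (top_of_set K)) S ((%(t, x). v t x) \<circ> (%(t, y). (t, \<kappa> y)))"
    using flowS unfolding flow_def by blast
  from continuous_map_compose[OF this homeomorphic_imp_continuous_map[OF homK]]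
  have c: "continuous_map (prod_topology euclideanreal (top_of_set K)) (top_of_set K)
      (\<iota> \<circ> ((%(t, x). v t x) \<circ> (%(t, y). (t, \<kappa> y))))" .
  have "\<iota> \<circ> ((%(t, x). v t x) \<circ> (%(t, y). (t, \<kappa> y))) = (%(t, x). u t x)" by (auto simp: fun_eq_iff u_def)
  moreover have "prod_topology euclideanreal (top_of_set K) = top_of_set (UNIV \<times> K)"
    using prod_topology_subtopology_eu[of UNIV K] by (simp only: subtopology_UNIV)
  ultimately have "continuous_map (top_of_set (UNIV \<times> K)) (top_of_set K) (%(t, x). u t x)" using c by (simp only:)
  from continuous_map_into_fulltopology[OF this] show "continuous_on (UNIV \<times> K) (%(t, x). u t x)" by simp
  show "u t y \<in> K" if "y \<in> K" for y t using \<kappa>(3)[OF that] vin by (simp add: u_def \<iota>K)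
  show "u 0 y = y" if "y \<in> K" for y using \<kappa>(2,3)[OF that] flowS by (simp add: u_def flow_def)
  show "u s (u t y) = u (s + t) y" if "y \<in> K" for y s t
    using \<kappa>(3)[OF that] flowS vin by (simp add: u_def flow_def \<kappa>(1))
qed

lemma embedded_rv: "embedded_flow S (rv v) \<iota>"
  by unfold_locales (rule flow_rv[OF flowS] compS hom)+

lemma closure_\<iota>: assumes "A \<subseteq> topspace S" shows "\<iota> ` (S closure_of A) = closure (\<iota> ` A)"
proof -
  interpret c: cflow K u by (rule cflow_u)
  have "top_of_set K closure_of (\<iota> ` A) = K \<inter> closure (K \<inter> \<iota> ` A)"
    by (simp add: closure_of_subtopology)
  moreover have "\<iota> ` A \<subseteq> K" using assms by (auto simp: K_def)
  moreover from this have "closure (\<iota> ` A) \<subseteq> K" using c.closedK closure_minimal by blast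
  ultimately show ?thesis using homeomorphic_map_closure_of[OF homK assms] by (simp add: Int_absorb1)
qed

lemma omega_\<iota>: assumes x: "x \<in> topspace S" shows "\<iota> ` omega_limit S v x = olim u (\<iota> x)"
proof -
  interpret c: cflow K u by (rule cflow_u)
  have sub: "(%t. v t x) ` {T..} \<subseteq> topspace S" for T using vin[OF x] by auto
  have "\<iota> ` omega_limit S v x = (\<Inter>T. \<iota> ` (S closure_of ((%t. v t x) ` {T..})))"
    unfolding omega_limit_def
    by (rule image_INT[OF inj]) (auto simp: closure_of_subset_topspace)
  also have "\<dots> = (\<Inter>T. closure ((%t. u t (\<iota> x)) ` {T..}))"
    unfolding closure_\<iota>[OF sub] image_image u_\<iota>[OF x] ..
  finally show ?thesis using c.olim_INT by simp
qed

lemma omega_wst: assumes "x \<in> topspace S" "p \<in> topspace S"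
  shows "omega_limit S v x = {p} \<longleftrightarrow> \<iota> x \<in> wst K u (\<iota> p)"
proof -
  interpret c: cflow K u by (rule cflow_u)
  have sub: "omega_limit S v x \<subseteq> topspace S"
    unfolding omega_limit_def using closure_of_subset_topspace[of S] by blast
  have "omega_limit S v x = {p} \<longleftrightarrow> \<iota> ` omega_limit S v x = \<iota> ` {p}"
    using inj_on_image_eq_iff[OF inj sub, of "{p}"] assms(2) by simp
  then show ?thesis unfolding omega_\<iota>[OF assms(1)] using c.wst_olim[of "\<iota> x" "\<iota> p"] \<iota>K[OF assms(1)] by simp
qed

end

context embedded_flow
begin

interpretation c: cflow K u by (rule cflow_u)

interpretation r: embedded_flow S "rv v" \<iota> by (rule embedded_rv)

lemma r_eq: "r.u = rv u"
  by (simp add: r.u_def u_def rv_def fun_eq_iff)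

lemma Wu_wst: assumes "p \<in> topspace S" shows "\<iota> ` Wu S v p = wst K (rv u) (\<iota> p)"
proof -
  have *: "z \<in> Wu S v p \<longleftrightarrow> \<iota> z \<in> wst K (rv u) (\<iota> p)" if "z \<in> topspace S" for z
    using r.omega_wst[OF that assms] that unfolding r_eq Wu_def by (simp add: omega_limit_rv)
  show ?thesis
  proof
    show "\<iota> ` Wu S v p \<subseteq> wst K (rv u) (\<iota> p)" using * by (auto simp: Wu_def)
    show "wst K (rv u) (\<iota> p) \<subseteq> \<iota> ` Wu S v p"
    proof
      fix y assume y: "y \<in> wst K (rv u) (\<iota> p)"
      then have "y \<in> K" by (simp add: wst_def)
      then show "y \<in> \<iota> ` Wu S v p" using *[of "\<kappa> y"] y \<kappa>(2,3) by (metis image_eqI)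
    qed
  qed
qed

text \<open>The iteration starts from the positive half orbit and \<open>gplus\<close> from the
  whole orbit. All points of an orbit have the same limit set, so any step that starts on the orbit
  can be made from \<open>x\<close> instead.\<close>

lemma limit_iter_gplus:
  assumes x: "x \<in> topspace S" and P: "P = \<iota> ` {p \<in> topspace S. Q p}" and Q: "Collect Q \<subseteq> topspace S"
  defines "E \<equiv> (\<Union>n. (limit_step S v Q ^^ n) (pos_orbit v x))"
  shows "E \<subseteq> topspace S" "orb u (\<iota> x) \<union> \<iota> ` E = gplus K u P (\<iota> x)"
proof -
  have E: "y \<in> E" if a: "z \<in> E" "omega_limit S v z = {p}" "Q p" "y \<in> Wu S v p" for y z p
  proof -
    obtain n where "z \<in> (limit_step S v Q ^^ n) (pos_orbit v x)" using a(1) by (auto simp: E_def)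
    then have "y \<in> limit_step S v Q ((limit_step S v Q ^^ n) (pos_orbit v x))"
      unfolding limit_step_iff using a(2-4) by blast
    then have "y \<in> (limit_step S v Q ^^ Suc n) (pos_orbit v x)" by simp
    then show ?thesis unfolding E_def by blast
  qed
  have "(limit_step S v Q ^^ n) (pos_orbit v x) \<subseteq> topspace S &
      \<iota> ` (limit_step S v Q ^^ n) (pos_orbit v x) \<subseteq> gplus K u P (\<iota> x)" for n
  proof (induction n)
    case 0
    have "v t x \<in> topspace S & \<iota> (v t x) \<in> gplus K u P (\<iota> x)" for t
      using vin[OF x, of t] gplus.base[of u t "\<iota> x" K P] u_\<iota>[OF x] by simp
    then show ?case by (auto simp: pos_orbit_def)
  next
    case (Suc n)
    let ?A = "(limit_step S v Q ^^ n) (pos_orbit v x)"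
    have "y \<in> topspace S & \<iota> y \<in> gplus K u P (\<iota> x)"
      if y: "z \<in> ?A" "omega_limit S v z = {p}" "Q p" "y \<in> Wu S v p" for z p y
    proof -
      have z: "z \<in> topspace S" "\<iota> z \<in> gplus K u P (\<iota> x)" using Suc y(1) by auto
      have p: "p \<in> topspace S" using Q y(3) by blast
      have "\<iota> p \<in> P" "\<iota> z \<in> wst K u (\<iota> p)" "\<iota> y \<in> wst K (rv u) (\<iota> p)"
        using P p y omega_wst[OF z(1) p] Wu_wst[OF p] by auto
      then have "\<iota> y \<in> gplus K u P (\<iota> x)" by (rule gplus.step[OF z(2)])
      then show ?thesis using y(4) by (simp add: Wu_def)
    qed
    then have "y \<in> topspace S & \<iota> y \<in> gplus K u P (\<iota> x)" if "y \<in> limit_step S v Q ?A" for y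
      using that Suc unfolding limit_step_iff by blast
    then show ?case by auto
  qed
  then have sub: "E \<subseteq> topspace S" "\<iota> ` E \<subseteq> gplus K u P (\<iota> x)" unfolding E_def by blast+
  then show "E \<subseteq> topspace S" by blast
  have xE: "x \<in> E"
  proof -
    have "v 0 x = x" using flowS x by (simp add: flow_def)
    then have "x \<in> pos_orbit v x" unfolding pos_orbit_def by (intro image_eqI[of _ _ 0]) auto
    then have "x \<in> (limit_step S v Q ^^ 0) (pos_orbit v x)" by simp
    then show ?thesis unfolding E_def by blast
  qed
  have "y \<in> orb u (\<iota> x) \<union> \<iota> ` E" if "y \<in> gplus K u P (\<iota> x)" for y
    using that
  proof induction
    case (base t)
    then show ?case by (simp add: orb_def)
  next
    case (step x' p y)
    obtain p0 where p0: "p = \<iota> p0" "p0 \<in> topspace S" "Q p0" using step(2) P by blast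
    have "\<exists>z\<in>E. \<iota> z \<in> wst K u (\<iota> p0)"
    proof (cases "x' \<in> orb u (\<iota> x)")
      case True
      then have "olim u x' = olim u (\<iota> x)" using c.olim_orb_eq \<iota>K[OF x] by blast
      then have "\<iota> x \<in> wst K u (\<iota> p0)" using step(3) p0(1) c.wst_olim[of x'] c.wst_olim[of "\<iota> x"] \<iota>K[OF x] by simp
      then show ?thesis using xE by blast
    next
      case False
      then show ?thesis using step(3,5) p0(1) by auto
    qed
    then obtain z where z: "z \<in> E" "\<iota> z \<in> wst K u (\<iota> p0)" by blast
    have "omega_limit S v z = {p0}" using omega_wst[OF _ p0(2), of z] z sub(1) by blast
    moreover obtain y0 where "y = \<iota> y0" "y0 \<in> Wu S v p0" using step(4) Wu_wst[OF p0(2)] p0(1) by blast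
    ultimately show ?case using E[OF z(1) _ p0(3)] by blast
  qed
  then show "orb u (\<iota> x) \<union> \<iota> ` E = gplus K u P (\<iota> x)"
    using sub(2) gplus.base[of u _ "\<iota> x" K P] unfolding orb_def by blast
qed

end

context embedded_flow
begin

interpretation c: cflow K u by (rule cflow_u)

interpretation r: embedded_flow S "rv v" \<iota> by (rule embedded_rv)

definition P where "P = \<iota> ` {p \<in> topspace S. saddle S v p}"

definition C where "C x = S closure_of ext_orbit S v x"

lemma saddle_top: "Collect (saddle S v) \<subseteq> topspace S"
  by (auto simp: saddle_def Sing_def)

lemma ext_orbit_\<iota>:
  assumes x: "x \<in> topspace S" and inf: "infinite (UNIV :: 'a set)"
  shows "ext_orbit S v x \<subseteq> topspace S" "\<iota> ` ext_orbit S v x = eorb K u P (\<iota> x)"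
proof -
  define E where "E = (\<Union>n. (limit_step S v (saddle S v) ^^ n) (pos_orbit v x))"
  define E' where "E' = (\<Union>n. (limit_step S (rv v) (saddle S v) ^^ n) (pos_orbit (rv v) x))"
  have e: "ext_orbit S v x = E \<union> E'"
    unfolding ext_orbit_def ext_pos_orbit_def ext_neg_orbit_def ext_pos_step_eq ext_neg_step_eq neg_orbit_eq
      limit_step_iter[OF inf] E_def E'_def ..
  note 1 = limit_iter_gplus[OF x P_def saddle_top, folded E_def]
  note 2 = r.limit_iter_gplus[OF x P_def saddle_top, folded E'_def, unfolded r_eq orb_rv]
  show "ext_orbit S v x \<subseteq> topspace S" unfolding e using 1(1) 2(1) by blast
  have "v t x \<in> E \<union> E'" for t
  proof (cases "t \<ge> 0")
    case True
    then have "v t x \<in> (limit_step S v (saddle S v) ^^ 0) (pos_orbit v x)" by (auto simp: pos_orbit_def)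
    then show ?thesis unfolding E_def by blast
  next
    case False
    then have "v t x \<in> (limit_step S (rv v) (saddle S v) ^^ 0) (pos_orbit (rv v) x)"
      by (auto simp: pos_orbit_def rv_def intro!: image_eqI[of _ _ "- t"])
    then show ?thesis unfolding E'_def by blast
  qed
  then have "orb u (\<iota> x) \<subseteq> \<iota> ` (E \<union> E')" using u_\<iota>[OF x] by (auto simp: orb_def)
  then show "\<iota> ` ext_orbit S v x = eorb K u P (\<iota> x)"
    unfolding e eorb_def 1(2)[symmetric] 2(2)[symmetric] by blast
qed

lemma C_\<iota>:
  assumes "x \<in> topspace S" "infinite (UNIV :: 'a set)"
  shows "\<iota> ` C x = ecl K u P (\<iota> x)" "x \<in> C x" "C x \<subseteq> topspace S"
proof -
  note e = ext_orbit_\<iota>[OF assms]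
  show i: "\<iota> ` C x = ecl K u P (\<iota> x)" unfolding C_def closure_\<iota>[OF e(1)] e(2) ecl_def ..
  show CS: "C x \<subseteq> topspace S" unfolding C_def by (rule closure_of_subset_topspace)
  have "u 0 (\<iota> x) \<in> eorb K u P (\<iota> x)" unfolding eorb_def by (rule UnI1) (rule gplus.base)
  then have "\<iota> x \<in> eorb K u P (\<iota> x)" using c.v0[OF \<iota>K[OF assms(1)]] by simp
  then have "\<iota> x \<in> ecl K u P (\<iota> x)" unfolding ecl_def by (rule subsetD[OF closure_subset])
  then show "x \<in> C x" unfolding i[symmetric] using inj_on_image_mem_iff[OF inj assms(1) CS] by blast
qed

lemma extended_R_closed_iff:
  assumes inf: "infinite (UNIV :: 'a set)"
  shows "extended_R_closed S v \<longleftrightarrow> closed {(x, y). x \<in> K & y \<in> ecl K u P x}"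
proof -
  let ?D = "{(x, y). x \<in> topspace S & y \<in> C x}" and ?R = "{(x, y). x \<in> K & y \<in> ecl K u P x}"
  obtain h where "homeomorphic_maps S (top_of_set K) \<iota> h" using homK unfolding homeomorphic_map_maps by blast
  then have "homeomorphic_maps (prod_topology S S) (prod_topology (top_of_set K) (top_of_set K))
      (%(x, y). (\<iota> x, \<iota> y)) (%(x, y). (h x, h y))" by (simp only: homeomorphic_maps_prod simp_thms)
  then have hm: "homeomorphic_map (prod_topology S S) (top_of_set (K \<times> K)) (%(x, y). (\<iota> x, \<iota> y))"
    unfolding prod_topology_subtopology_eu homeomorphic_map_maps by blast
  have "extended_R_closed S v \<longleftrightarrow> closedin (prod_topology S S) ?D" by (simp add: extended_R_closed_def C_def)
  also have "\<dots> \<longleftrightarrow> ?D \<subseteq> topspace (prod_topology S S) & closedin (top_of_set (K \<times> K)) ((%(x, y). (\<iota> x, \<iota> y)) ` ?D)"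
    by (rule homeomorphic_map_closedness_eq[OF hm])
  finally have eq: "extended_R_closed S v \<longleftrightarrow> ?D \<subseteq> topspace (prod_topology S S) &
      closedin (top_of_set (K \<times> K)) ((%(x, y). (\<iota> x, \<iota> y)) ` ?D)" .
  have sub: "?D \<subseteq> topspace (prod_topology S S)" using C_\<iota>(3)[OF _ inf] by auto
  have img: "(%(x, y). (\<iota> x, \<iota> y)) ` ?D = ?R"
  proof -
    have "(a, b) \<in> (%(x, y). (\<iota> x, \<iota> y)) ` ?D \<longleftrightarrow> (\<exists>x\<in>topspace S. a = \<iota> x & b \<in> \<iota> ` C x)" for a b by auto
    moreover have "(\<exists>x\<in>topspace S. a = \<iota> x & b \<in> \<iota> ` C x) \<longleftrightarrow> (a, b) \<in> ?R" for a b
      using C_\<iota>(1)[OF _ inf] by (auto simp: K_def)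
    ultimately show ?thesis by (intro set_eqI) (simp only: split_paired_all)
  qed
  have "closedin (top_of_set (K \<times> K)) ?R \<longleftrightarrow> closed ?R"
  proof
    have cK: "closed (K \<times> K)" by (intro closed_Times c.closedK)
    show "closed ?R" if "closedin (top_of_set (K \<times> K)) ?R" using closedin_closed_trans[OF that cK] .
    have "ecl K u P x \<subseteq> K" if "x \<in> K" for x
      using C_\<iota>(1,3)[OF \<kappa>(3)[OF that] inf] \<kappa>(2)[OF that] by (auto simp: K_def)
    then have "?R \<subseteq> K \<times> K" by auto
    then show "closedin (top_of_set (K \<times> K)) ?R" if "closed ?R" using that by (intro closed_subset)
  qed
  then show ?thesis unfolding eq img using sub by blast
qed

lemma extended_pap_iff:
  assumes inf: "infinite (UNIV :: 'a set)"
  shows "extended_pap S v \<longleftrightarrow> (\<forall>x\<in>K. \<forall>y\<in>ecl K u P x. ecl K u P y = ecl K u P x)"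
proof -
  note Ci = C_\<iota>[OF _ inf]
  have "extended_pap S v \<longleftrightarrow> partition_on (topspace S) {C x | x. x \<in> topspace S}"
    by (simp add: extended_pap_def C_def)
  also have "\<dots> \<longleftrightarrow> disjoint {C x | x. x \<in> topspace S}"
  proof -
    have "\<Union>{C x | x. x \<in> topspace S} = topspace S" "{} \<notin> {C x | x. x \<in> topspace S}"
      using Ci(2,3) by blast+
    then show ?thesis by (simp add: partition_on_def)
  qed
  also have "\<dots> \<longleftrightarrow> (\<forall>x\<in>topspace S. \<forall>y\<in>C x. C y = C x)"
  proof
    assume d: "disjoint {C x | x. x \<in> topspace S}"
    show "\<forall>x\<in>topspace S. \<forall>y\<in>C x. C y = C x"
    proof (intro ballI)
      fix x y assume x: "x \<in> topspace S" and y: "y \<in> C x"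
      have yS: "y \<in> topspace S" using Ci(3)[OF x] y by blast
      then have "y \<in> C y \<inter> C x" using Ci(2) y by blast
      then show "C y = C x" using disjointD[OF d, of "C y" "C x"] x yS by blast
    qed
  next
    assume e: "\<forall>x\<in>topspace S. \<forall>y\<in>C x. C y = C x"
    show "disjoint {C x | x. x \<in> topspace S}"
    proof (rule disjointI)
      fix A B assume "A \<in> {C x | x. x \<in> topspace S}" "B \<in> {C x | x. x \<in> topspace S}" and ne: "A \<noteq> B"
      then obtain x y where "x \<in> topspace S" "A = C x" "y \<in> topspace S" "B = C y" by blast
      then have "z \<notin> A \<inter> B" for z using e ne by (metis IntE)
      then show "A \<inter> B = {}" by blast
    qed
  qed
  also have "\<dots> \<longleftrightarrow> (\<forall>x\<in>topspace S. \<forall>y\<in>C x. ecl K u P (\<iota> y) = ecl K u P (\<iota> x))"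
  proof (intro ball_cong refl)
    fix x y assume x: "x \<in> topspace S" and "y \<in> C x"
    then have y: "y \<in> topspace S" using Ci(3) by blast
    show "C y = C x \<longleftrightarrow> ecl K u P (\<iota> y) = ecl K u P (\<iota> x)"
      using inj_on_image_eq_iff[OF inj Ci(3)[OF y] Ci(3)[OF x]] by (simp only: Ci(1)[OF x] Ci(1)[OF y])
  qed
  also have "\<dots> \<longleftrightarrow> (\<forall>x\<in>topspace S. \<forall>y\<in>\<iota> ` C x. ecl K u P y = ecl K u P (\<iota> x))" by blast
  also have "\<dots> \<longleftrightarrow> (\<forall>x\<in>K. \<forall>y\<in>ecl K u P x. ecl K u P y = ecl K u P x)"
    by (simp add: K_def Ci(1) cong: ball_cong)
  finally show ?thesis .
qed

lemma pflow_u: assumes "finite (Sing S v)" shows "pflow K u P"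
proof
  have fix_iff: "(\<forall>t. u t (\<iota> x) = \<iota> x) \<longleftrightarrow> x \<in> Sing S v" if x: "x \<in> topspace S" for x
    unfolding u_\<iota>[OF x] Sing_def using inj_onD[OF inj _ vin[OF x] x] x by auto
  have "{p \<in> K. \<forall>t. u t p = p} = \<iota> ` Sing S v"
    using fix_iff by (auto simp: K_def Sing_def)
  then show "finite {p \<in> K. \<forall>t. u t p = p}" using assms by simp
  show "P \<subseteq> {p \<in> K. \<forall>t. u t p = p}"
    unfolding P_def using fix_iff by (auto simp: K_def saddle_def)
qed

lemma sfc_u: assumes "surface S" shows "sfc K u"
proof (unfold_locales)
  fix y assume "y \<in> K"
  then obtain x where x: "x \<in> topspace S" "y = \<iota> x" by (auto simp: K_def)
  obtain U V where U: "openin S U" "x \<in> U" and V: "openin (top_of_set {z :: real^2. 0 \<le> z $ 2}) V"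
    and "subtopology S U homeomorphic_space top_of_set V"
    using assms x(1) unfolding surface_def by blast
  moreover have "homeomorphic_map (subtopology S U) (top_of_set (\<iota> ` U)) \<iota>"
  proof -
    have "\<iota> ` (topspace S \<inter> U) = topspace (top_of_set K) \<inter> \<iota> ` U"
      using openin_subset[OF U(1)] by (auto simp: K_def)
    from homeomorphic_map_subtopologies[OF homK this] show ?thesis
      using openin_subset[OF U(1)] by (simp add: subtopology_subtopology K_def Int_absorb1 image_mono)
  qed
  then have "top_of_set (\<iota> ` U) homeomorphic_space subtopology S U"
    using homeomorphic_map_imp_homeomorphic_space homeomorphic_space_sym by blast
  ultimately have "top_of_set (\<iota> ` U) homeomorphic_space top_of_set V"
    using homeomorphic_space_trans by blast
  then obtain f g where "homeomorphic_maps (top_of_set (\<iota> ` U)) (top_of_set V) f g"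
    unfolding homeomorphic_space_def by blast
  then have "homeomorphism (\<iota> ` U) V f g"
    unfolding homeomorphic_maps_def continuous_map_subtopology_eu by (intro homeomorphismI) (auto simp: Pi_iff)
  moreover have "openin (top_of_set K) (\<iota> ` U)"
    using homeomorphic_imp_open_map[OF homK] U(1) by (simp add: open_map_def)
  ultimately show "\<exists>U V f g. openin (top_of_set K) U & y \<in> U &
      openin (top_of_set {z :: real^2. 0 \<le> z $ 2}) V & homeomorphism U V f g"
    using U(2) V x(2) by blast
qed

text \<open>The local equivalence is followed from the model surface into the embedded one, since
  the hyperbolic chart is built in the model and its boxes have to be carried over to
  \<open>K\<close>.\<close>

lemma sectors_u: assumes "p \<in> P" shows "sectors K u p" "sectors K (rv u) p"
proof -
  obtain x where x: "p = \<iota> x" "saddle S v x" using assms by (auto simp: P_def)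
  obtain M :: "(real^2) topology" and \<A> w q where s: "C1_saddle M \<A> w q" and "locally_flow_equivalent S v x M w q"
    using x(2) unfolding saddle_def by blast
  then obtain N N' h g where N: "openin S N" "x \<in> N" "openin M N'" "q \<in> N'"
    "homeomorphic_maps (subtopology S N) (subtopology M N') h g" "h x = q" and mo: "maps_orbits w N' v g"
    unfolding locally_flow_equivalent_def by blast
  have NS: "N \<subseteq> topspace S" "N' \<subseteq> topspace M" using N(1,3) openin_subset by auto
  have gx: "g q = x" using N(2,5,6) NS unfolding homeomorphic_maps_def by auto
  have hg: "homeomorphic_map (subtopology M N') (subtopology S N) g"
    using N(5) homeomorphic_maps_sym homeomorphic_map_maps by blast
  have gN: "g ` N' = N" using homeomorphic_imp_surjective_map[OF hg] NS by (simp add: Int_absorb1)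
  have "\<iota> ` (topspace S \<inter> N) = topspace (top_of_set K) \<inter> \<iota> ` N" using NS(1) by (auto simp: K_def)
  from homeomorphic_map_subtopologies[OF homK this]
  have "homeomorphic_map (subtopology S N) (top_of_set (\<iota> ` N)) \<iota>"
    using NS(1) by (simp add: subtopology_subtopology K_def Int_absorb1 image_mono)
  from homeomorphic_map_compose[OF hg this]
  have hm: "homeomorphic_map (subtopology M N') (top_of_set ((\<iota> \<circ> g) ` N')) (\<iota> \<circ> g)"
    unfolding image_comp[symmetric] gN .
  have op: "openin (top_of_set K) ((\<iota> \<circ> g) ` N')"
    unfolding image_comp[symmetric] gN using homeomorphic_imp_open_map[OF homK] N(1) by (simp add: open_map_def)
  have "maps_orbits w N' u (\<iota> \<circ> g)"
    unfolding maps_orbits_def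
  proof (intro allI impI)
    fix y and T :: real assume T: "0 \<le> T" "\<forall>t\<in>{0..T}. w t y \<in> N'" and y: "y \<in> N'"
    obtain r where r: "r 0 = 0 & continuous_on {0..T} r & strict_mono_on {0..T} r &
        (\<forall>t\<in>{0..T}. g (w t y) = v (r t) (g y))" using mo[unfolded maps_orbits_def] T y by meson
    have "g y \<in> topspace S" using gN y NS(1) by blast
    then show "\<exists>r. r 0 = 0 & continuous_on {0..T} r & strict_mono_on {0..T} r &
        (\<forall>t\<in>{0..T}. (\<iota> \<circ> g) (w t y) = u (r t) ((\<iota> \<circ> g) y))"
      using r by (intro exI[of _ r]) (simp add: u_\<iota>)
  qed
  moreover have "u t ((\<iota> \<circ> g) q) = (\<iota> \<circ> g) q" for t
    using x(2) by (simp add: gx u_\<iota> saddle_def Sing_def)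
  ultimately have "sectors K u ((\<iota> \<circ> g) q)" "sectors K (rv u) ((\<iota> \<circ> g) q)"
    using saddle_sectors[OF cflow_u s N(3,4) hm op] by blast+
  then show "sectors K u p" "sectors K (rv u) p" using x(1) gx by simp_all
qed

end

theorem proposition4p3:
  fixes S :: "'a topology" and v :: "real \<Rightarrow> 'a \<Rightarrow> 'a"
  assumes "surface S" and "compact_space S"
    and "flow S v"
    and "finite (Sing S v)"
  shows "extended_R_closed S v \<longleftrightarrow> extended_pap S v"
\<comment> \<open>A nonempty surface has infinitely many points, which makes the underlying type
  infinite as the iteration requires; for the empty one both sides hold trivially.\<close>
proof (cases "topspace S = {}")
  case True
  then have "extended_R_closed S v" "extended_pap S v"
    by (simp_all add: extended_R_closed_def extended_pap_def partition_on_empty)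
  then show ?thesis by blast
next
  case False
  then have "infinite (topspace S)" using surface_infinite[OF assms(1)] by blast
  then have inf: "infinite (UNIV :: 'a set)" by (rule infinite_super[OF subset_UNIV])
  have HS: "Hausdorff_space S" "second_countable S" using assms(1) by (auto simp: surface_def)
  obtain \<iota> :: "'a => nat => real" where hom: "homeomorphic_map S (top_of_set (\<iota> ` topspace S)) \<iota>"
    by (rule compact_embedding[OF assms(2) HS])
  interpret e: embedded_flow S v \<iota> by unfold_locales (rule assms(2,3) hom)+
  interpret pflow e.K e.u e.P by (rule e.pflow_u[OF assms(4)])
  interpret sfc e.K e.u by (rule e.sfc_u[OF assms(1)])
  interpret psurf e.K e.u e.P by unfold_locales
  show ?thesis
    unfolding e.extended_R_closed_iff[OF inf] e.extended_pap_iff[OF inf]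
  proof
    assume R: "closed {(x, y). x \<in> e.K & y \<in> ecl e.K e.u e.P x}"
    have "rflow e.K e.u e.P"
      by unfold_locales (rule R | erule e.sectors_u[THEN sectors_two_orbits])+
    then have "rgflow e.K e.u e.P"
      by (rule ecl_class_sectors) (rule sfc_axioms | erule e.sectors_u)+
    then show "\<forall>x\<in>e.K. \<forall>y\<in>ecl e.K e.u e.P x. ecl e.K e.u e.P y = ecl e.K e.u e.P x"
      using rgflow.ecl_class by blast
  next
    assume "\<forall>x\<in>e.K. \<forall>y\<in>ecl e.K e.u e.P x. ecl e.K e.u e.P y = ecl e.K e.u e.P x"
    then interpret ppap e.K e.u e.P by unfold_locales blast
    show "closed {(x, y). x \<in> e.K & y \<in> ecl e.K e.u e.P x}" by (rule pap_imp_closed)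
  qed
qed

end
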